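(* For any position $X$, any innocent strategy $F\in\mathcal S_X$, any closed-world play $U\in\mathcal W(X)$ and any state $\sigma\in\mathrm{Gl}(F)(U)$, $\sigma$ admits a $\mathrm{Gl}(F)$-maximal extension.
   Context: Base category. Let $\mathcal C$ be the category generated by the following graph modulo relations. Objects: $\star$; $[n]$ ($n\in\mathbb N$); for each $n$: $\mathrm{tick}_n,\mathrm{paral}_n,\mathrm{parar}_n,\nu_n,\mathrm{para}_n$; for $1\le i\le n$: $\iota^+_{n,i},\iota^-_{n,i}$; for $n,m$, $1\le i\le n$, $1\le j\le m$: $\tau_{n,i,m,j}$. Arrows: $d_1,\dots,d_n\colon\star\to[n]$; $s,t\colon[n]\to c$ for $c\in\{\mathrm{tick}_n,\mathrm{paral}_n,\mathrm{parar}_n,\iota^\pm_{n,i}\}$; $s\colon[n]\to\nu_n$, $t\colon[n+1]\to\nu_n$; $l\colon\mathrm{paral}_n\to\mathrm{para}_n$, $r\colon\mathrm{parar}_n\to\mathrm{para}_n$; $\epsilon\colon\iota^+_{n,i}\to\tau_{n,i,m,j}$, $\rho\colon\iota^-_{m,j}\to\tau_{n,i,m,j}$. Relations: $s\circ d_i=t\circ d_i$ ($1\le i\le n$) for each pair $s,t$ into a common object; $l\circ s=r\circ s$; $\epsilon\circ s\circ d_i=\rho\circ s\circ d_j$. $\widehat{\mathcal C}=[\mathcal C^{op},\mathbf{Set}]$, objects identified with representables. Positions: finite presheaves empty outside $\star$ and the $[n]$ (channels / players knowing $n$ channels). Moves (cospans in $\widehat{\mathcal C}$ with interface, up to isomorphism):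 basic moves $[n]\xrightarrow{s}c\xleftarrow{t}[n']$ for $c\in\{\mathrm{tick}_n,\mathrm{paral}_n,\mathrm{parar}_n,\nu_n,\iota^\pm_{n,i}\}$ ($n'=n+1$ for $\nu_n$, else $n$), interface $n\cdot\star$ via $[d_1,\dots,d_n]$; forking $[n]\xrightarrow{l\circ s}\mathrm{para}_n\leftarrow n|n$ with $n|n$ the pushout of $[n]\leftarrow n\cdot\star\to[n]$ (both $[d_1,\dots,d_n]$), right map induced by $l\circ t,r\circ t$, interface $n\cdot\star$; synchronisation $n\bowtie_{i,j}m\xrightarrow{s'}\tau_{n,i,m,j}\xleftarrow{t'}n\bowtie_{i,j}m$ with $n\bowtie_{i,j}m$ the pushout of $[n]\xleftarrow{d_i}\star\xrightarrow{d_j}[m]$, $s'$ induced by $\epsilon\circ s,\rho\circ s$, $t'$ by $\epsilon\circ t,\rho\circ t$, interface the channels. Closed-world moves: forking, synchronisation, tick, channel creation. Extended moves: push a move with interface $I$ out along a morphism $I\to Z$ to a position $Z$. A play is a mono $X_0\hookrightarrow U$ with $U$ the colimit of a finite or countable chain $X_0\to M_0\leftarrow X_1\to\cdots$ of extended moves; it is closed-world if all moves are extended closed-world moves. A view is a play $[n]\hookrightarrow V$ from a finite (possibly empty) chain of extended basic moves. $\mathcal E_X$: objects are plays $Y\hookrightarrow U$ with a morphism $Y\to X$; morphisms pairs $(h,k)$ commuting with inclusions and maps to $X$. $\mathcal V_X\subseteq\mathcal E_X$ full subcategory of views, with inclusion $i_X$; innocent strategies $\mathcal S_X=[\mathcal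 V_X^{op},\mathbf{Set}]$. $\mathcal W(X)$: closed-world plays $X\hookrightarrow U$ (with $Y=X$ mapped by the identity), morphisms $(\mathrm{id}_X,k)$; inclusion $j_X\colon\mathcal W(X)\to\mathcal E_X$. $\mathrm{Gl}\colon\mathcal S_X\to[\mathcal W(X)^{op},\mathbf{Set}]$ is right Kan extension along $i_X^{op}$ followed by restriction along $j_X$. For $G=\mathrm{Gl}(F)$ and $\sigma\in G(U)$, an extension of $\sigma$ is some $\sigma'\in G(U')$ together with $i\colon U\to U'$ such that $G(i)(\sigma')=\sigma$; it is strict if $U\to U'$ is not surjective; $\sigma$ is $G$-maximal if it has no strict extension. *)

theory Defs
  imports "HOL-Library.FuncSet" "HOL-Library.Extended_Nat" "HOL-Library.Infinite_Typeclass"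
begin

section \<open>Categories, functors, presheaves\<close>

text \<open>
  Arrows are only identified relative to a pair of objects, so composition takes the three objects
  as arguments: \<open>cmp C a b c g f\<close> is \<open>g \<circ> f\<close> for \<open>f : a \<rightarrow> b\<close> and \<open>g : b \<rightarrow> c\<close>.
\<close>

record ('o, 'm) cat =
  ob :: "'o set"
  hom :: "'o \<Rightarrow> 'o \<Rightarrow> 'm set"
  idn :: "'o \<Rightarrow> 'm"
  cmp :: "'o \<Rightarrow> 'o \<Rightarrow> 'o \<Rightarrow> 'm \<Rightarrow> 'm \<Rightarrow> 'm"

definition category :: "('o, 'm) cat \<Rightarrow> bool" where
  "category C \<longleftrightarrow>
     (\<forall>a\<in>ob C. idn C a \<in> hom C a a) \<and>
     (\<forall>a\<in>ob C. \<forall>b\<in>ob C. \<forall>c\<in>ob C. \<forall>f\<in>hom C a b. \<forall>g\<in>hom C b c. cmp C a b c g f \<in> hom C a c) \<and>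
     (\<forall>a\<in>ob C. \<forall>b\<in>ob C. \<forall>f\<in>hom C a b.
        cmp C a a b f (idn C a) = f \<and> cmp C a b b (idn C b) f = f) \<and>
     (\<forall>a\<in>ob C. \<forall>b\<in>ob C. \<forall>c\<in>ob C. \<forall>d\<in>ob C.
        \<forall>f\<in>hom C a b. \<forall>g\<in>hom C b c. \<forall>h\<in>hom C c d.
        cmp C a c d h (cmp C a b c g f) = cmp C a b d (cmp C b c d h g) f)"

record ('o1, 'm1, 'o2, 'm2) cfunctor =
  map_ob :: "'o1 \<Rightarrow> 'o2"
  map_arr :: "'o1 \<Rightarrow> 'o1 \<Rightarrow> 'm1 \<Rightarrow> 'm2"

definition is_functor ::
  "('o1, 'm1) cat \<Rightarrow> ('o2, 'm2) cat \<Rightarrow> ('o1, 'm1, 'o2, 'm2) cfunctor \<Rightarrow> bool" where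
  "is_functor A B i \<longleftrightarrow>
     (\<forall>a\<in>ob A. map_ob i a \<in> ob B) \<and>
     (\<forall>a\<in>ob A. \<forall>b\<in>ob A. \<forall>f\<in>hom A a b. map_arr i a b f \<in> hom B (map_ob i a) (map_ob i b)) \<and>
     (\<forall>a\<in>ob A. map_arr i a a (idn A a) = idn B (map_ob i a)) \<and>
     (\<forall>a\<in>ob A. \<forall>b\<in>ob A. \<forall>c\<in>ob A. \<forall>f\<in>hom A a b. \<forall>g\<in>hom A b c.
        map_arr i a c (cmp A a b c g f) =
        cmp B (map_ob i a) (map_ob i b) (map_ob i c) (map_arr i b c g) (map_arr i a b f))"

definition inclusion :: "('o, 'm, 'o, 'm) cfunctor" where
  "inclusion = \<lparr>map_ob = (\<lambda>a. a), map_arr = (\<lambda>a b f. f)\<rparr>"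

definition full_subcat :: "('o, 'm) cat \<Rightarrow> ('o \<Rightarrow> bool) \<Rightarrow> ('o, 'm) cat" where
  "full_subcat C S = C\<lparr>ob := {a \<in> ob C. S a}\<rparr>"

text \<open>For \<open>f : a \<rightarrow> b\<close>, \<open>far P a b f\<close> is the restriction map from \<open>fob P b\<close> to \<open>fob P a\<close>.\<close>

record ('o, 'm, 'a) presheaf =
  fob :: "'o \<Rightarrow> 'a set"
  far :: "'o \<Rightarrow> 'o \<Rightarrow> 'm \<Rightarrow> 'a \<Rightarrow> 'a"

definition presheaf :: "('o, 'm) cat \<Rightarrow> ('o, 'm, 'a) presheaf \<Rightarrow> bool" where
  "presheaf C P \<longleftrightarrow>
     (\<forall>a\<in>ob C. \<forall>b\<in>ob C. \<forall>f\<in>hom C a b. far P a b f \<in> fob P b \<rightarrow> fob P a) \<and>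
     (\<forall>a\<in>ob C. \<forall>x\<in>fob P a. far P a a (idn C a) x = x) \<and>
     (\<forall>a\<in>ob C. \<forall>b\<in>ob C. \<forall>c\<in>ob C. \<forall>f\<in>hom C a b. \<forall>g\<in>hom C b c. \<forall>x\<in>fob P c.
        far P a c (cmp C a b c g f) x = far P a b f (far P b c g x))"

text \<open>Components are extensional, so that equality of natural transformations is equality in HOL.\<close>

definition nat_trans ::
  "('o, 'm) cat \<Rightarrow> ('o, 'm, 'a) presheaf \<Rightarrow> ('o, 'm, 'b) presheaf \<Rightarrow> ('o \<Rightarrow> 'a \<Rightarrow> 'b) set" where
  "nat_trans C P Q =
     {\<eta> \<in> (\<Pi>\<^sub>E c\<in>ob C. fob P c \<rightarrow>\<^sub>E fob Q c).
        \<forall>a\<in>ob C. \<forall>b\<in>ob C. \<forall>f\<in>hom C a b. \<forall>x\<in>fob P b. \<eta> a (far P a b f x) = far Q a b f (\<eta> b x)}"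

definition nt_id :: "('o, 'm) cat \<Rightarrow> ('o, 'm, 'a) presheaf \<Rightarrow> 'o \<Rightarrow> 'a \<Rightarrow> 'a" where
  "nt_id C P = (\<lambda>c\<in>ob C. \<lambda>x\<in>fob P c. x)"

text \<open>\<open>nt_comp C P \<theta> \<eta>\<close> is \<open>\<theta> \<circ> \<eta>\<close> for \<open>\<eta>\<close> with domain \<open>P\<close>.\<close>

definition nt_comp ::
  "('o, 'm) cat \<Rightarrow> ('o, 'm, 'a) presheaf \<Rightarrow> ('o \<Rightarrow> 'b \<Rightarrow> 'c) \<Rightarrow> ('o \<Rightarrow> 'a \<Rightarrow> 'b) \<Rightarrow> 'o \<Rightarrow> 'a \<Rightarrow> 'c" where
  "nt_comp C P \<theta> \<eta> = (\<lambda>c\<in>ob C. \<lambda>x\<in>fob P c. \<theta> c (\<eta> c x))"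

definition nt_mono :: "('o, 'm) cat \<Rightarrow> ('o, 'm, 'a) presheaf \<Rightarrow> ('o \<Rightarrow> 'a \<Rightarrow> 'b) \<Rightarrow> bool" where
  "nt_mono C P \<eta> \<longleftrightarrow> (\<forall>c\<in>ob C. inj_on (\<eta> c) (fob P c))"

definition nt_surj ::
  "('o, 'm) cat \<Rightarrow> ('o, 'm, 'a) presheaf \<Rightarrow> ('o, 'm, 'b) presheaf \<Rightarrow> ('o \<Rightarrow> 'a \<Rightarrow> 'b) \<Rightarrow> bool" where
  "nt_surj C P Q \<eta> \<longleftrightarrow> (\<forall>c\<in>ob C. \<eta> c ` fob P c = fob Q c)"

definition psh_iso :: "('o, 'm) cat \<Rightarrow> ('o, 'm, 'a) presheaf \<Rightarrow> ('o, 'm, 'b) presheaf \<Rightarrow> bool" where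
  "psh_iso C P Q \<longleftrightarrow> (\<exists>\<eta>\<in>nat_trans C P Q. \<forall>c\<in>ob C. bij_betw (\<eta> c) (fob P c) (fob Q c))"

definition yoneda :: "('o, 'm) cat \<Rightarrow> 'o \<Rightarrow> ('o, 'm, 'm) presheaf" where
  "yoneda C c = \<lparr>fob = (\<lambda>a. hom C a c), far = (\<lambda>a b f g. cmp C a b c g f)\<rparr>"

definition yoneda_map :: "('o, 'm) cat \<Rightarrow> 'o \<Rightarrow> 'o \<Rightarrow> 'm \<Rightarrow> 'o \<Rightarrow> 'm \<Rightarrow> 'm" where
  "yoneda_map C c c' h = (\<lambda>a\<in>ob C. \<lambda>g\<in>hom C a c. cmp C a c c' h g)"

text \<open>
  Universal properties are tested against presheaves with elements in the type of the colimit.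
  All colimits needed below have countably many elements, so they exist, and are the usual
  colimits of presheaves, as soon as that type is infinite.
\<close>

definition is_pushout ::
  "('o, 'm) cat \<Rightarrow> ('o, 'm, 'i) presheaf \<Rightarrow> ('o, 'm, 'x) presheaf \<Rightarrow> ('o, 'm, 'y) presheaf \<Rightarrow>
   ('o \<Rightarrow> 'i \<Rightarrow> 'x) \<Rightarrow> ('o \<Rightarrow> 'i \<Rightarrow> 'y) \<Rightarrow>
   ('o, 'm, 'p) presheaf \<Rightarrow> ('o \<Rightarrow> 'x \<Rightarrow> 'p) \<Rightarrow> ('o \<Rightarrow> 'y \<Rightarrow> 'p) \<Rightarrow> bool" where
  "is_pushout C I A B f g P a b \<longleftrightarrow>
     presheaf C I \<and> presheaf C A \<and> presheaf C B \<and> presheaf C P \<and>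
     f \<in> nat_trans C I A \<and> g \<in> nat_trans C I B \<and>
     a \<in> nat_trans C A P \<and> b \<in> nat_trans C B P \<and>
     nt_comp C I a f = nt_comp C I b g \<and>
     (\<forall>(Q :: ('o, 'm, 'p) presheaf) a' b'.
        presheaf C Q \<and> a' \<in> nat_trans C A Q \<and> b' \<in> nat_trans C B Q \<and>
        nt_comp C I a' f = nt_comp C I b' g \<longrightarrow>
        (\<exists>!h. h \<in> nat_trans C P Q \<and> nt_comp C A h a = a' \<and> nt_comp C B h b = b'))"

definition restrict_along ::
  "('o1, 'm1, 'o2, 'm2) cfunctor \<Rightarrow> ('o2, 'm2, 'v) presheaf \<Rightarrow> ('o1, 'm1, 'v) presheaf" where
  "restrict_along i H =
     \<lparr>fob = (\<lambda>a. fob H (map_ob i a)),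
      far = (\<lambda>a b f. far H (map_ob i a) (map_ob i b) (map_arr i a b f))\<rparr>"

text \<open>
  The pointwise right Kan extension of a presheaf \<open>F\<close> on \<open>A\<close> along \<open>i\<^sup>o\<^sup>p\<close>, for \<open>i : A \<rightarrow> B\<close>:
  at \<open>b\<close>, the end of the powers of \<open>F a\<close> by \<open>hom B (i a) b\<close> over \<open>a\<close>, that is, the limit of \<open>F\<close>
  over the arrows \<open>f : i a \<rightarrow> b\<close>.
\<close>

definition right_kan_index ::
  "('o1, 'm1) cat \<Rightarrow> ('o2, 'm2) cat \<Rightarrow> ('o1, 'm1, 'o2, 'm2) cfunctor \<Rightarrow> 'o2 \<Rightarrow> ('o1 \<times> 'm2) set" where
  "right_kan_index A B i b = (SIGMA a:ob A. hom B (map_ob i a) b)"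

definition right_kan ::
  "('o1, 'm1) cat \<Rightarrow> ('o2, 'm2) cat \<Rightarrow> ('o1, 'm1, 'o2, 'm2) cfunctor \<Rightarrow>
   ('o1, 'm1, 'v) presheaf \<Rightarrow> ('o2, 'm2, 'o1 \<times> 'm2 \<Rightarrow> 'v) presheaf" where
  "right_kan A B i F =
     \<lparr>fob = (\<lambda>b. {\<sigma> \<in> (\<Pi>\<^sub>E p\<in>right_kan_index A B i b. fob F (fst p)).
         \<forall>a\<in>ob A. \<forall>a'\<in>ob A. \<forall>g\<in>hom A a a'. \<forall>f\<in>hom B (map_ob i a') b.
           \<sigma> (a, cmp B (map_ob i a) (map_ob i a') b f (map_arr i a a' g)) = far F a a' g (\<sigma> (a', f))}),
      far = (\<lambda>b b' k \<sigma>. \<lambda>(a, f) \<in> right_kan_index A B i b. \<sigma> (a, cmp B (map_ob i a) b b' k f))\<rparr>"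

definition right_kan_counit ::
  "('o1, 'm1) cat \<Rightarrow> ('o2, 'm2) cat \<Rightarrow> ('o1, 'm1, 'o2, 'm2) cfunctor \<Rightarrow>
   ('o1, 'm1, 'v) presheaf \<Rightarrow> 'o1 \<Rightarrow> ('o1 \<times> 'm2 \<Rightarrow> 'v) \<Rightarrow> 'v" where
  "right_kan_counit A B i F =
     (\<lambda>a\<in>ob A. \<lambda>\<sigma>\<in>fob (right_kan A B i F) (map_ob i a). \<sigma> (a, idn B (map_ob i a)))"

lemma nat_trans_in: "\<eta> \<in> nat_trans C P Q \<Longrightarrow> c \<in> ob C \<Longrightarrow> x \<in> fob P c \<Longrightarrow> \<eta> c x \<in> fob Q c"
  unfolding nat_trans_def by fastforce

lemma nat_trans_natural:
  "\<lbrakk>\<eta> \<in> nat_trans C P Q; a \<in> ob C; b \<in> ob C; f \<in> hom C a b; x \<in> fob P b\<rbrakk> \<Longrightarrow>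
     \<eta> a (far P a b f x) = far Q a b f (\<eta> b x)"
  unfolding nat_trans_def by blast

lemma nat_trans_eqI:
  assumes "\<eta> \<in> nat_trans C P Q" "\<theta> \<in> nat_trans C P Q'"
    and "\<And>c x. c \<in> ob C \<Longrightarrow> x \<in> fob P c \<Longrightarrow> \<eta> c x = \<theta> c x"
  shows "\<eta> = \<theta>"
proof (rule ext)+
  fix c x
  show "\<eta> c x = \<theta> c x"
  proof (cases "c \<in> ob C")
    case True
    then have "\<eta> c \<in> extensional (fob P c)" "\<theta> c \<in> extensional (fob P c)"
      using assms(1,2) unfolding nat_trans_def PiE_def by auto
    then show ?thesis
      using assms(3) True unfolding extensional_def by (cases "x \<in> fob P c") auto
  next
    case False
    then show ?thesis
      using assms(1,2) unfolding nat_trans_def PiE_def extensional_def by auto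
  qed
qed

lemma presheaf_far_in:
  "\<lbrakk>presheaf C P; a \<in> ob C; b \<in> ob C; f \<in> hom C a b; x \<in> fob P b\<rbrakk> \<Longrightarrow> far P a b f x \<in> fob P a"
  unfolding presheaf_def by blast

lemma nt_id_in: "presheaf C P \<Longrightarrow> nt_id C P \<in> nat_trans C P P"
  by (simp add: nat_trans_def nt_id_def presheaf_far_in)

lemma nt_comp_in:
  assumes "presheaf C P" "\<eta> \<in> nat_trans C P Q" "\<theta> \<in> nat_trans C Q R"
  shows "nt_comp C P \<theta> \<eta> \<in> nat_trans C P R"
  unfolding nat_trans_def[of C P R] nt_comp_def
  using nat_trans_in[OF assms(2)] nat_trans_in[OF assms(3)]
  by (simp add: presheaf_far_in[OF assms(1)] nat_trans_natural[OF assms(2)] nat_trans_natural[OF assms(3)])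

text \<open>
  The next three facts say that \<open>right_kan A B i F\<close>, with its counit, is a right Kan extension.
\<close>

lemma presheaf_right_kan:
  assumes B: "category B" and i: "is_functor A B i"
  shows "presheaf B (right_kan A B i F)"
proof -
  let ?i = "map_ob i"
  let ?R = "right_kan A B i F"
  have iob: "?i a \<in> ob B" if "a \<in> ob A" for a
    using i that unfolding is_functor_def by blast
  have iarr: "map_arr i a b g \<in> hom B (?i a) (?i b)" if "a \<in> ob A" "b \<in> ob A" "g \<in> hom A a b" for a b g
    using i that unfolding is_functor_def by blast
  have cmpB: "cmp B a b c g f \<in> hom B a c"
    if "a \<in> ob B" "b \<in> ob B" "c \<in> ob B" "f \<in> hom B a b" "g \<in> hom B b c" for a b c f g
    using B that unfolding category_def by blast
  have unitB: "cmp B a b b (idn B b) f = f"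
    if "a \<in> ob B" "b \<in> ob B" "f \<in> hom B a b" for a b f
    using B that unfolding category_def by blast
  have assB: "cmp B a c d h (cmp B a b c g f) = cmp B a b d (cmp B b c d h g) f"
    if "a \<in> ob B" "b \<in> ob B" "c \<in> ob B" "d \<in> ob B" "f \<in> hom B a b" "g \<in> hom B b c" "h \<in> hom B c d"
    for a b c d f g h
    using B that unfolding category_def by blast
  show ?thesis
    unfolding presheaf_def
  proof (intro conjI ballI funcsetI)
    fix b b' k \<sigma> assume b: "b \<in> ob B" "b' \<in> ob B" "k \<in> hom B b b'" and \<sigma>: "\<sigma> \<in> fob ?R b'"
    have nat: "\<sigma> (a, cmp B (?i a) (?i a') b' f (map_arr i a a' g)) = far F a a' g (\<sigma> (a', f))"
      if "a \<in> ob A" "a' \<in> ob A" "g \<in> hom A a a'" "f \<in> hom B (?i a') b'" for a a' g f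
      using \<sigma> that by (simp add: right_kan_def)
    have val: "\<sigma> (a, f) \<in> fob F a" if "a \<in> ob A" "f \<in> hom B (?i a) b'" for a f
      using \<sigma> that by (fastforce simp: right_kan_def right_kan_index_def)
    show "far ?R b b' k \<sigma> \<in> fob ?R b"
      using b by (auto simp: right_kan_def right_kan_index_def val cmpB iob iarr assB nat[symmetric])
  next
    fix b \<sigma> assume b: "b \<in> ob B" and \<sigma>: "\<sigma> \<in> fob ?R b"
    then have "\<sigma> \<in> extensional (right_kan_index A B i b)"
      by (simp add: right_kan_def PiE_def)
    then show "far ?R b b (idn B b) \<sigma> = \<sigma>"
      using b by (auto simp: right_kan_def right_kan_index_def unitB iob extensional_def fun_eq_iff)
  next
    fix b b' b'' k l \<sigma>
    assume "b \<in> ob B" "b' \<in> ob B" "b'' \<in> ob B" "k \<in> hom B b b'" "l \<in> hom B b' b''"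
    then show "far ?R b b'' (cmp B b b' b'' l k) \<sigma> = far ?R b b' k (far ?R b' b'' l \<sigma>)"
      by (auto simp: right_kan_def right_kan_index_def cmpB iob assB fun_eq_iff)
  qed
qed

lemma right_kan_counit_in:
  assumes B: "category B" and i: "is_functor A B i"
  shows "right_kan_counit A B i F \<in> nat_trans A (restrict_along i (right_kan A B i F)) F"
proof -
  let ?i = "map_ob i"
  let ?R = "right_kan A B i F"
  have iob: "?i a \<in> ob B" if "a \<in> ob A" for a
    using i that unfolding is_functor_def by blast
  have iarr: "map_arr i a b g \<in> hom B (?i a) (?i b)" if "a \<in> ob A" "b \<in> ob A" "g \<in> hom A a b" for a b g
    using i that unfolding is_functor_def by blast
  have idB: "idn B b \<in> hom B b b" if "b \<in> ob B" for b
    using B that unfolding category_def by blast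
  have unitB: "cmp B a a b f (idn B a) = f" "cmp B a b b (idn B b) f = f"
    if "a \<in> ob B" "b \<in> ob B" "f \<in> hom B a b" for a b f
    using B that unfolding category_def by blast+
  have val: "\<sigma> (a, f) \<in> fob F a" if "\<sigma> \<in> fob ?R b" "a \<in> ob A" "f \<in> hom B (?i a) b" for \<sigma> a b f
    using that by (fastforce simp: right_kan_def right_kan_index_def)
  have nat: "\<sigma> (a, map_arr i a a' g) = far F a a' g (\<sigma> (a', idn B (?i a')))"
    if "\<sigma> \<in> fob ?R (?i a')" "a \<in> ob A" "a' \<in> ob A" "g \<in> hom A a a'" for \<sigma> a a' g
  proof -
    have "\<sigma> (a, cmp B (?i a) (?i a') (?i a') (idn B (?i a')) (map_arr i a a' g))
        = far F a a' g (\<sigma> (a', idn B (?i a')))"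
      using that idB iob by (simp add: right_kan_def)
    then show ?thesis
      using that iob iarr unitB by simp
  qed
  have ap: "far ?R (?i a) (?i a') (map_arr i a a' g) \<sigma> (a, idn B (?i a)) = \<sigma> (a, map_arr i a a' g)"
    if "a \<in> ob A" "a' \<in> ob A" "g \<in> hom A a a'" for \<sigma> a a' g
    using that by (simp add: right_kan_def right_kan_index_def idB iob iarr unitB)
  show ?thesis
    by (simp add: nat_trans_def right_kan_counit_def restrict_along_def val idB iob iarr ap nat
        presheaf_far_in[OF presheaf_right_kan[OF B i]])
qed

lemma right_kan_universal:
  fixes F :: "('o1, 'm1, 'v) presheaf" and H :: "('o2, 'm2, 'w) presheaf"
  assumes B: "category B" and i: "is_functor A B i" and H: "presheaf B H"
    and \<alpha>: "\<alpha> \<in> nat_trans A (restrict_along i H) F"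
  shows "\<exists>!\<beta>. \<beta> \<in> nat_trans B H (right_kan A B i F) \<and>
     nt_comp A (restrict_along i H) (right_kan_counit A B i F) (\<lambda>a\<in>ob A. \<beta> (map_ob i a)) = \<alpha>"
    (is "\<exists>!\<beta>. ?P \<beta>")
proof -
  let ?i = "map_ob i"
  let ?R = "right_kan A B i F"
  have iob: "?i a \<in> ob B" if "a \<in> ob A" for a
    using i that unfolding is_functor_def by blast
  have iarr: "map_arr i a b g \<in> hom B (?i a) (?i b)" if "a \<in> ob A" "b \<in> ob A" "g \<in> hom A a b" for a b g
    using i that unfolding is_functor_def by blast
  have idB: "idn B b \<in> hom B b b" if "b \<in> ob B" for b
    using B that unfolding category_def by blast
  have cmpB: "cmp B a b c g f \<in> hom B a c"
    if "a \<in> ob B" "b \<in> ob B" "c \<in> ob B" "f \<in> hom B a b" "g \<in> hom B b c" for a b c f g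
    using B that unfolding category_def by blast
  have unitB: "cmp B a a b f (idn B a) = f" "cmp B a b b (idn B b) f = f"
    if "a \<in> ob B" "b \<in> ob B" "f \<in> hom B a b" for a b f
    using B that unfolding category_def by blast+
  have Hin: "far H a b f x \<in> fob H a" if "a \<in> ob B" "b \<in> ob B" "f \<in> hom B a b" "x \<in> fob H b" for a b f x
    using presheaf_far_in[OF H] that .
  have Hid: "far H a a (idn B a) x = x" if "a \<in> ob B" "x \<in> fob H a" for a x
    using H that unfolding presheaf_def by blast
  have Hcmp: "far H a c (cmp B a b c g f) x = far H a b f (far H b c g x)"
    if "a \<in> ob B" "b \<in> ob B" "c \<in> ob B" "f \<in> hom B a b" "g \<in> hom B b c" "x \<in> fob H c" for a b c f g x
    using H that unfolding presheaf_def by blast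
  have \<alpha>in: "\<alpha> a x \<in> fob F a" if "a \<in> ob A" "x \<in> fob H (?i a)" for a x
    using nat_trans_in[OF \<alpha>] that by (simp add: restrict_along_def)
  have \<alpha>nat: "\<alpha> a (far H (?i a) (?i b) (map_arr i a b g) x) = far F a b g (\<alpha> b x)"
    if "a \<in> ob A" "b \<in> ob A" "g \<in> hom A a b" "x \<in> fob H (?i b)" for a b g x
    using nat_trans_natural[OF \<alpha>] that by (simp add: restrict_along_def)
  define \<beta> where "\<beta> = (\<lambda>b\<in>ob B. \<lambda>x\<in>fob H b. \<lambda>(a, f)\<in>right_kan_index A B i b. \<alpha> a (far H (?i a) b f x))"
  have \<beta>ap: "\<beta> b x (a, f) = \<alpha> a (far H (?i a) b f x)"
    if "b \<in> ob B" "x \<in> fob H b" "a \<in> ob A" "f \<in> hom B (?i a) b" for a b f x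
    using that by (simp add: \<beta>_def right_kan_index_def)
  have \<beta>in: "\<beta> b x \<in> fob ?R b" if b: "b \<in> ob B" and x: "x \<in> fob H b" for b x
  proof -
    have "\<beta> b x \<in> (\<Pi>\<^sub>E p\<in>right_kan_index A B i b. fob F (fst p))"
      using b x by (auto simp: \<beta>_def right_kan_index_def intro!: \<alpha>in Hin iob)
    moreover have "\<beta> b x (a, cmp B (?i a) (?i a') b f (map_arr i a a' g)) = far F a a' g (\<beta> b x (a', f))"
      if "a \<in> ob A" "a' \<in> ob A" "g \<in> hom A a a'" "f \<in> hom B (?i a') b" for a a' g f
      using that b x by (simp add: \<beta>ap cmpB iob iarr Hcmp \<alpha>nat Hin)
    ultimately show ?thesis
      by (simp add: right_kan_def)
  qed
  have \<beta>nt: "\<beta> \<in> nat_trans B H ?R"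
  proof -
    have "\<beta> \<in> (\<Pi>\<^sub>E c\<in>ob B. fob H c \<rightarrow>\<^sub>E fob ?R c)"
    proof (intro PiE_I)
      show "\<beta> c x \<in> fob ?R c" if "c \<in> ob B" "x \<in> fob H c" for c x
        using \<beta>in that .
    qed (simp_all add: \<beta>_def)
    moreover have "\<beta> a (far H a b f x) = far ?R a b f (\<beta> b x)"
      if "a \<in> ob B" "b \<in> ob B" "f \<in> hom B a b" "x \<in> fob H b" for a b f x
    proof
      fix p
      show "\<beta> a (far H a b f x) p = far ?R a b f (\<beta> b x) p"
      proof (cases "p \<in> right_kan_index A B i a")
        case True
        then obtain c g where p: "p = (c, g)" "c \<in> ob A" "g \<in> hom B (?i c) a"
          by (auto simp: right_kan_index_def)
        then show ?thesis
          using that True by (simp add: \<beta>ap Hin right_kan_def cmpB iob Hcmp)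
      next
        case False
        then show ?thesis
          using that Hin by (simp add: \<beta>_def right_kan_def)
      qed
    qed
    ultimately show ?thesis
      unfolding nat_trans_def by blast
  qed
  have iff: "nt_comp A (restrict_along i H) (right_kan_counit A B i F) (\<lambda>a\<in>ob A. \<gamma> (?i a)) = \<alpha> \<longleftrightarrow>
      (\<forall>a\<in>ob A. \<forall>x\<in>fob H (?i a). \<gamma> (?i a) x (a, idn B (?i a)) = \<alpha> a x)" (is "?L = \<alpha> \<longleftrightarrow> ?r")
    if \<gamma>: "\<gamma> \<in> nat_trans B H ?R" for \<gamma>
  proof -
    have ap: "?L a x = \<gamma> (?i a) x (a, idn B (?i a))" if "a \<in> ob A" "x \<in> fob H (?i a)" for a x
      using that nat_trans_in[OF \<gamma> iob] by (simp add: nt_comp_def restrict_along_def right_kan_counit_def)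
    show ?thesis
    proof
      assume "?L = \<alpha>" then show ?r using ap by metis
    next
      assume r: ?r
      show "?L = \<alpha>"
      proof (rule ext)+
        fix a x
        consider "a \<notin> ob A" | "a \<in> ob A" "x \<notin> fob H (?i a)" | "a \<in> ob A" "x \<in> fob H (?i a)" by blast
        then show "?L a x = \<alpha> a x"
        proof cases
          case 1 then show ?thesis using \<alpha> by (auto simp: nt_comp_def nat_trans_def PiE_def extensional_def)
        next
          case 2
          then have "\<alpha> a \<in> extensional (fob H (?i a))"
            using \<alpha> by (auto simp: nat_trans_def PiE_def restrict_along_def)
          then show ?thesis using 2 by (auto simp: nt_comp_def restrict_along_def extensional_def)
        next
          case 3 then show ?thesis using r ap by simp
        qed
      qed
    qed
  qed
  show ?thesis
  proof (rule ex1I[of _ \<beta>])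
    show "?P \<beta>"
      using \<beta>nt iff[OF \<beta>nt] by (simp add: \<beta>ap iob idB Hid)
  next
    fix \<gamma> assume "?P \<gamma>"
    then have \<gamma>: "\<gamma> \<in> nat_trans B H ?R"
      and \<gamma>\<alpha>: "\<And>a x. a \<in> ob A \<Longrightarrow> x \<in> fob H (?i a) \<Longrightarrow> \<gamma> (?i a) x (a, idn B (?i a)) = \<alpha> a x"
      using iff by auto
    show "\<gamma> = \<beta>"
    proof (rule nat_trans_eqI[OF \<gamma> \<beta>nt])
      fix b x assume b: "b \<in> ob B" and x: "x \<in> fob H b"
      show "\<gamma> b x = \<beta> b x"
      proof (rule PiE_ext)
        show "\<gamma> b x \<in> (\<Pi>\<^sub>E p\<in>right_kan_index A B i b. fob F (fst p))"
          "\<beta> b x \<in> (\<Pi>\<^sub>E p\<in>right_kan_index A B i b. fob F (fst p))"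
          using nat_trans_in[OF \<gamma> b x] \<beta>in[OF b x] by (auto simp: right_kan_def)
        fix p assume "p \<in> right_kan_index A B i b"
        then obtain a f where p: "p = (a, f)" and a: "a \<in> ob A" and f: "f \<in> hom B (?i a) b"
          by (auto simp: right_kan_index_def)
        have "\<alpha> a (far H (?i a) b f x) = \<gamma> (?i a) (far H (?i a) b f x) (a, idn B (?i a))"
          using \<gamma>\<alpha> a Hin iob b f x by simp
        also have "\<dots> = far ?R (?i a) b f (\<gamma> b x) (a, idn B (?i a))"
          using nat_trans_natural[OF \<gamma> iob[OF a] b f x] by simp
        also have "\<dots> = \<gamma> b x (a, f)"
          using a f b by (simp add: right_kan_def right_kan_index_def idB iob unitB)
        finally show "\<gamma> b x p = \<beta> b x p"
          using p a b f x \<beta>ap by simp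
      qed
    qed
  qed
qed


section \<open>Categories presented by a graph and relations\<close>

text \<open>
  Paths are lists of edges in diagrammatic order; \<open>G e a b\<close> means that \<open>e\<close> is an edge from \<open>a\<close> to \<open>b\<close>.
\<close>

inductive path :: "'o set \<Rightarrow> ('e \<Rightarrow> 'o \<Rightarrow> 'o \<Rightarrow> bool) \<Rightarrow> 'o \<Rightarrow> 'e list \<Rightarrow> 'o \<Rightarrow> bool"
  for V G where
  path_Nil: "a \<in> V \<Longrightarrow> path V G a [] a"
| path_Cons: "\<lbrakk>a \<in> V; G e a b; path V G b p c\<rbrakk> \<Longrightarrow> path V G a (e # p) c"

inductive path_cong ::
  "'o set \<Rightarrow> ('e \<Rightarrow> 'o \<Rightarrow> 'o \<Rightarrow> bool) \<Rightarrow> ('e list \<Rightarrow> 'e list \<Rightarrow> bool) \<Rightarrow>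
   'o \<Rightarrow> 'o \<Rightarrow> 'e list \<Rightarrow> 'e list \<Rightarrow> bool"
  for V G R where
  cong_rel: "\<lbrakk>R p q; path V G a p b; path V G a q b\<rbrakk> \<Longrightarrow> path_cong V G R a b p q"
| cong_refl: "path V G a p b \<Longrightarrow> path_cong V G R a b p p"
| cong_sym: "path_cong V G R a b p q \<Longrightarrow> path_cong V G R a b q p"
| cong_trans: "\<lbrakk>path_cong V G R a b p q; path_cong V G R a b q r\<rbrakk> \<Longrightarrow> path_cong V G R a b p r"
| cong_append: "\<lbrakk>path_cong V G R a b p p'; path_cong V G R b c q q'\<rbrakk> \<Longrightarrow>
    path_cong V G R a c (p @ q) (p' @ q')"

definition presented_cat ::
  "'o set \<Rightarrow> ('e \<Rightarrow> 'o \<Rightarrow> 'o \<Rightarrow> bool) \<Rightarrow> ('e list \<Rightarrow> 'e list \<Rightarrow> bool) \<Rightarrow> ('o, 'e list set) cat" where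
  "presented_cat V G R =
     \<lparr>ob = V,
      hom = (\<lambda>a b. {p. path V G a p b} // {(p, q). path_cong V G R a b p q}),
      idn = (\<lambda>a. {q. path_cong V G R a a [] q}),
      cmp = (\<lambda>a b c g f. {r. \<exists>p\<in>f. \<exists>q\<in>g. path_cong V G R a c (p @ q) r})\<rparr>"

lemma path_append:
  "path V G a p b \<Longrightarrow> path V G b q c \<Longrightarrow> path V G a (p @ q) c"
  by (induction rule: path.induct) (auto intro: path.intros)

lemma path_cong_path:
  "path_cong V G R a b p q \<Longrightarrow> path V G a p b \<and> path V G a q b"
  by (induction rule: path_cong.induct) (auto intro: path_append)

lemma hom_presented_iff:
  "f \<in> hom (presented_cat V G R) a b \<longleftrightarrow> (\<exists>p. path V G a p b \<and> f = {q. path_cong V G R a b p q})"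
  by (auto simp: presented_cat_def quotient_def)

lemma cmp_presented:
  assumes "path V G a p b" "path V G b q c"
  shows "cmp (presented_cat V G R) a b c {q'. path_cong V G R b c q q'} {p'. path_cong V G R a b p p'}
       = {r. path_cong V G R a c (p @ q) r}"
proof -
  have "path_cong V G R a c (p @ q) r"
    if "path_cong V G R a b p p'" "path_cong V G R b c q q'" "path_cong V G R a c (p' @ q') r" for p' q' r
    using that by (blast intro: cong_append cong_trans)
  moreover have "path_cong V G R a b p p" "path_cong V G R b c q q"
    using assms by (auto intro: cong_refl)
  ultimately show ?thesis
    by (simp add: presented_cat_def) blast
qed

lemma category_presented_cat: "category (presented_cat V G R)"
proof -
  let ?C = "presented_cat V G R"
  have idn: "idn ?C a = {q. path_cong V G R a a [] q}" for a
    by (simp add: presented_cat_def)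
  have obV: "ob ?C = V"
    by (simp add: presented_cat_def)
  show ?thesis
    unfolding category_def
  proof (intro conjI ballI)
    fix a assume "a \<in> ob ?C"
    then show "idn ?C a \<in> hom ?C a a"
      using idn obV hom_presented_iff path_Nil by metis
  next
    fix a b c f g assume "f \<in> hom ?C a b" "g \<in> hom ?C b c"
    then show "cmp ?C a b c g f \<in> hom ?C a c"
      unfolding hom_presented_iff using cmp_presented path_append by metis
  next
    fix a b f assume "a \<in> ob ?C" "b \<in> ob ?C" "f \<in> hom ?C a b"
    then obtain p where p: "path V G a p b" "f = {q. path_cong V G R a b p q}"
      unfolding hom_presented_iff by blast
    have ab: "path V G a [] a" "path V G b [] b"
      using \<open>a \<in> ob ?C\<close> \<open>b \<in> ob ?C\<close> obV by (auto intro: path_Nil)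
    show "cmp ?C a a b f (idn ?C a) = f"
      using cmp_presented[OF ab(1) p(1)] p(2) idn by simp
    show "cmp ?C a b b (idn ?C b) f = f"
      using cmp_presented[OF p(1) ab(2)] p(2) idn by simp
  next
    fix a b c d f g h assume "f \<in> hom ?C a b" "g \<in> hom ?C b c" "h \<in> hom ?C c d"
    then obtain p q r where "path V G a p b" "f = {s. path_cong V G R a b p s}"
      "path V G b q c" "g = {s. path_cong V G R b c q s}"
      "path V G c r d" "h = {s. path_cong V G R c d r s}"
      unfolding hom_presented_iff by blast
    then show "cmp ?C a c d h (cmp ?C a b c g f) = cmp ?C a b d (cmp ?C b c d h g) f"
      by (simp add: cmp_presented path_append)
  qed
qed


section \<open>The base category\<close>

datatype cobj =
    Star
  | Player nat
  | Tick nat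
  | ParaL nat
  | ParaR nat
  | Nu nat
  | Para nat
  | IotaP nat nat
  | IotaN nat nat
  | Tau nat nat nat nat

fun valid_obj :: "cobj \<Rightarrow> bool" where
  "valid_obj (IotaP n i) \<longleftrightarrow> 1 \<le> i \<and> i \<le> n"
| "valid_obj (IotaN n i) \<longleftrightarrow> 1 \<le> i \<and> i \<le> n"
| "valid_obj (Tau n i m j) \<longleftrightarrow> 1 \<le> i \<and> i \<le> n \<and> 1 \<le> j \<and> j \<le> m"
| "valid_obj _ \<longleftrightarrow> True"

text \<open>
  \<open>basic c n n'\<close>: \<open>c\<close> is one of the objects that carry arrows \<open>s : [n] \<rightarrow> c\<close> and \<open>t : [n'] \<rightarrow> c\<close>.
\<close>

inductive basic :: "cobj \<Rightarrow> nat \<Rightarrow> nat \<Rightarrow> bool" where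
  "basic (Tick n) n n"
| "basic (ParaL n) n n"
| "basic (ParaR n) n n"
| "basic (Nu n) n (Suc n)"
| "\<lbrakk>1 \<le> i; i \<le> n\<rbrakk> \<Longrightarrow> basic (IotaP n i) n n"
| "\<lbrakk>1 \<le> i; i \<le> n\<rbrakk> \<Longrightarrow> basic (IotaN n i) n n"

datatype gen =
    GD nat nat
  | GS cobj
  | GT cobj
  | GL nat
  | GR nat
  | GEps nat nat nat nat
  | GRho nat nat nat nat

inductive gen_arr :: "gen \<Rightarrow> cobj \<Rightarrow> cobj \<Rightarrow> bool" where
  "\<lbrakk>1 \<le> i; i \<le> n\<rbrakk> \<Longrightarrow> gen_arr (GD n i) Star (Player n)"
| "basic c n n' \<Longrightarrow> gen_arr (GS c) (Player n) c"
| "basic c n n' \<Longrightarrow> gen_arr (GT c) (Player n') c"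
| "gen_arr (GL n) (ParaL n) (Para n)"
| "gen_arr (GR n) (ParaR n) (Para n)"
| "\<lbrakk>1 \<le> i; i \<le> n; 1 \<le> j; j \<le> m\<rbrakk> \<Longrightarrow> gen_arr (GEps n i m j) (IotaP n i) (Tau n i m j)"
| "\<lbrakk>1 \<le> i; i \<le> n; 1 \<le> j; j \<le> m\<rbrakk> \<Longrightarrow> gen_arr (GRho n i m j) (IotaN m j) (Tau n i m j)"

inductive gen_rel :: "gen list \<Rightarrow> gen list \<Rightarrow> bool" where
  "\<lbrakk>basic c n n'; 1 \<le> i; i \<le> n\<rbrakk> \<Longrightarrow> gen_rel [GD n i, GS c] [GD n' i, GT c]"
| "gen_rel [GS (ParaL n), GL n] [GS (ParaR n), GR n]"
| "\<lbrakk>1 \<le> i; i \<le> n; 1 \<le> j; j \<le> m\<rbrakk> \<Longrightarrow>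
     gen_rel [GD n i, GS (IotaP n i), GEps n i m j] [GD m j, GS (IotaN m j), GRho n i m j]"

definition CC :: "(cobj, gen list set) cat" where
  "CC = presented_cat {c. valid_obj c} gen_arr gen_rel"

text \<open>The arrow \<open>a \<rightarrow> b\<close> of \<open>CC\<close> represented by a path.\<close>

definition arw :: "cobj \<Rightarrow> cobj \<Rightarrow> gen list \<Rightarrow> gen list set" where
  "arw a b p = {q. path_cong {c. valid_obj c} gen_arr gen_rel a b p q}"

type_synonym 'a cpsh = "(cobj, gen list set, 'a) presheaf"
type_synonym ('a, 'b) cmap = "cobj \<Rightarrow> 'a \<Rightarrow> 'b"

abbreviation Yo :: "cobj \<Rightarrow> gen list set cpsh" where
  "Yo \<equiv> yoneda CC"

abbreviation Yo_map :: "cobj \<Rightarrow> cobj \<Rightarrow> gen list \<Rightarrow> (gen list set, gen list set) cmap" where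
  "Yo_map a b p \<equiv> yoneda_map CC a b (arw a b p)"

definition position :: "'a cpsh \<Rightarrow> bool" where
  "position P \<longleftrightarrow> presheaf CC P \<and> finite (SIGMA c:ob CC. fob P c) \<and>
     (\<forall>c\<in>ob CC. c \<noteq> Star \<and> (\<nexists>n. c = Player n) \<longrightarrow> fob P c = {})"


section \<open>Moves\<close>

text \<open>The coproduct of \<open>n\<close> copies of the representable \<open>\<star>\<close>.\<close>

definition stars :: "nat \<Rightarrow> (nat \<times> gen list set) cpsh" where
  "stars n = \<lparr>fob = (\<lambda>c. {1..n} \<times> hom CC c Star),
              far = (\<lambda>c c' f (i, g). (i, cmp CC c c' Star g f))\<rparr>"

text \<open>The cotuple \<open>[d\<^sub>1, \<dots>, d\<^sub>n]\<close> from \<open>stars n\<close> to \<open>[n']\<close>, for \<open>n \<le> n'\<close>.\<close>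

definition d_cotuple :: "nat \<Rightarrow> nat \<Rightarrow> (nat \<times> gen list set, gen list set) cmap" where
  "d_cotuple n n' = (\<lambda>c\<in>ob CC. \<lambda>(i, g)\<in>fob (stars n) c.
     cmp CC c Star (Player n') (arw Star (Player n') [GD n' i]) g)"

definition channels :: "'a cpsh \<Rightarrow> 'a cpsh" where
  "channels P = \<lparr>fob = (\<lambda>c. if c = Star then fob P c else {}), far = far P\<rparr>"

text \<open>
  Cospans \<open>ini \<rightarrow> mid \<leftarrow> fin\<close> with an interface \<open>ifc\<close> mapping to both feet.
\<close>

record ('i, 'x, 'm, 'z) icospan =
  ifc :: "'i cpsh"
  ini :: "'x cpsh"
  mid :: "'m cpsh"
  fin :: "'z cpsh"
  smap :: "('x, 'm) cmap"
  tmap :: "('z, 'm) cmap"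
  ifc_ini :: "('i, 'x) cmap"
  ifc_fin :: "('i, 'z) cmap"

definition basic_move ::
  "cobj \<Rightarrow> nat \<Rightarrow> nat \<Rightarrow> (nat \<times> gen list set, gen list set, gen list set, gen list set) icospan" where
  "basic_move c n n' =
     \<lparr>ifc = stars n, ini = Yo (Player n), mid = Yo c, fin = Yo (Player n'),
      smap = Yo_map (Player n) c [GS c], tmap = Yo_map (Player n') c [GT c],
      ifc_ini = d_cotuple n n, ifc_fin = d_cotuple n n'\<rparr>"

definition fork_move ::
  "nat \<Rightarrow> (nat \<times> gen list set, gen list set, gen list set, 'a) icospan \<Rightarrow> bool" where
  "fork_move n K \<longleftrightarrow>
     ifc K = stars n \<and> ini K = Yo (Player n) \<and> mid K = Yo (Para n) \<and>
     smap K = Yo_map (Player n) (Para n) [GS (ParaL n), GL n] \<and>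
     ifc_ini K = d_cotuple n n \<and>
     (\<exists>a b. is_pushout CC (stars n) (Yo (Player n)) (Yo (Player n))
              (d_cotuple n n) (d_cotuple n n) (fin K) a b \<and>
        ifc_fin K = nt_comp CC (stars n) a (d_cotuple n n) \<and>
        tmap K \<in> nat_trans CC (fin K) (mid K) \<and>
        nt_comp CC (Yo (Player n)) (tmap K) a = Yo_map (Player n) (Para n) [GT (ParaL n), GL n] \<and>
        nt_comp CC (Yo (Player n)) (tmap K) b = Yo_map (Player n) (Para n) [GT (ParaR n), GR n])"

definition sync_move ::
  "nat \<Rightarrow> nat \<Rightarrow> nat \<Rightarrow> nat \<Rightarrow> ('a, 'a, gen list set, 'a) icospan \<Rightarrow> bool" where
  "sync_move n i m j K \<longleftrightarrow>
     fin K = ini K \<and> mid K = Yo (Tau n i m j) \<and>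
     ifc K = channels (ini K) \<and>
     ifc_ini K = nt_id CC (channels (ini K)) \<and> ifc_fin K = nt_id CC (channels (ini K)) \<and>
     smap K \<in> nat_trans CC (ini K) (mid K) \<and> tmap K \<in> nat_trans CC (fin K) (mid K) \<and>
     (\<exists>a b. is_pushout CC (Yo Star) (Yo (Player n)) (Yo (Player m))
              (Yo_map Star (Player n) [GD n i]) (Yo_map Star (Player m) [GD m j]) (ini K) a b \<and>
        nt_comp CC (Yo (Player n)) (smap K) a =
          Yo_map (Player n) (Tau n i m j) [GS (IotaP n i), GEps n i m j] \<and>
        nt_comp CC (Yo (Player m)) (smap K) b =
          Yo_map (Player m) (Tau n i m j) [GS (IotaN m j), GRho n i m j] \<and>
        nt_comp CC (Yo (Player n)) (tmap K) a =
          Yo_map (Player n) (Tau n i m j) [GT (IotaP n i), GEps n i m j] \<and>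
        nt_comp CC (Yo (Player m)) (tmap K) b =
          Yo_map (Player m) (Tau n i m j) [GT (IotaN m j), GRho n i m j])"

text \<open>
  \<open>pushed_out K X s M t Y\<close>: the cospan \<open>X \<rightarrow> M \<leftarrow> Y\<close> arises from \<open>K\<close> by pushout along some map
  \<open>z\<close> from the interface to a position \<open>Z\<close>. Pushouts being determined up to isomorphism only,
  this makes extended moves closed under isomorphism of cospans.
\<close>

definition pushed_out ::
  "('i, 'x, 'm, 'z) icospan \<Rightarrow>
   'a cpsh \<Rightarrow> ('a, 'a) cmap \<Rightarrow> 'a cpsh \<Rightarrow> ('a, 'a) cmap \<Rightarrow> 'a cpsh \<Rightarrow> bool" where
  "pushed_out K X s M t Y \<longleftrightarrow>
     (\<exists>(Z :: 'a cpsh) z pX qX pM qM pY qY.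
        position Z \<and>
        is_pushout CC (ifc K) (ini K) Z (ifc_ini K) z X pX qX \<and>
        is_pushout CC (ifc K) (mid K) Z (nt_comp CC (ifc K) (smap K) (ifc_ini K)) z M pM qM \<and>
        is_pushout CC (ifc K) (fin K) Z (ifc_fin K) z Y pY qY \<and>
        s \<in> nat_trans CC X M \<and>
        nt_comp CC (ini K) s pX = nt_comp CC (ini K) pM (smap K) \<and> nt_comp CC Z s qX = qM \<and>
        t \<in> nat_trans CC Y M \<and>
        nt_comp CC (fin K) t pY = nt_comp CC (fin K) pM (tmap K) \<and> nt_comp CC Z t qY = qM)"

type_synonym 'a move_pred =
  "'a cpsh \<Rightarrow> ('a, 'a) cmap \<Rightarrow> 'a cpsh \<Rightarrow> ('a, 'a) cmap \<Rightarrow> 'a cpsh \<Rightarrow> bool"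

inductive ext_basic :: "'a move_pred" where
  "\<lbrakk>basic c n n'; pushed_out (basic_move c n n') X s M t Y\<rbrakk> \<Longrightarrow> ext_basic X s M t Y"

inductive ext_closed_world :: "'a move_pred" where
  fork: "\<lbrakk>fork_move n (K :: (_, _, _, 'a) icospan); pushed_out K X s M t Y\<rbrakk> \<Longrightarrow>
    ext_closed_world X s M t (Y :: 'a cpsh)"
| sync: "\<lbrakk>1 \<le> i; i \<le> n; 1 \<le> j; j \<le> m;
    sync_move n i m j (K :: ('a, 'a, _, 'a) icospan); pushed_out K X s M t Y\<rbrakk> \<Longrightarrow>
    ext_closed_world X s M t Y"
| tick: "pushed_out (basic_move (Tick n) n n) X s M t Y \<Longrightarrow> ext_closed_world X s M t Y"
| new_channel: "pushed_out (basic_move (Nu n) n (Suc n)) X s M t Y \<Longrightarrow> ext_closed_world X s M t Y"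

definition ext_move :: "'a move_pred" where
  "ext_move X s M t Y \<longleftrightarrow> ext_basic X s M t Y \<or> ext_closed_world X s M t Y"


section \<open>Plays and views\<close>

text \<open>
  A chain of length \<open>N\<close> (possibly \<open>\<infinity>\<close>) has positions \<open>Xs k\<close> for \<open>k \<le> N\<close> and moves
  \<open>Xs k \<rightarrow> Ms k \<leftarrow> Xs (Suc k)\<close> for \<open>k < N\<close>.
\<close>

definition chain_cocone ::
  "enat \<Rightarrow> (nat \<Rightarrow> 'a cpsh) \<Rightarrow> (nat \<Rightarrow> ('a, 'a) cmap) \<Rightarrow> (nat \<Rightarrow> 'a cpsh) \<Rightarrow> (nat \<Rightarrow> ('a, 'a) cmap) \<Rightarrow>
   'a cpsh \<Rightarrow> (nat \<Rightarrow> ('a, 'a) cmap) \<Rightarrow> (nat \<Rightarrow> ('a, 'a) cmap) \<Rightarrow> bool" where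
  "chain_cocone N Xs ss Ms ts U xs ms \<longleftrightarrow>
     presheaf CC U \<and>
     (\<forall>k. enat k \<le> N \<longrightarrow> xs k \<in> nat_trans CC (Xs k) U) \<and>
     (\<forall>k. enat k < N \<longrightarrow> ms k \<in> nat_trans CC (Ms k) U \<and>
        nt_comp CC (Xs k) (ms k) (ss k) = xs k \<and>
        nt_comp CC (Xs (Suc k)) (ms k) (ts k) = xs (Suc k))"

definition chain_colimit ::
  "enat \<Rightarrow> (nat \<Rightarrow> 'a cpsh) \<Rightarrow> (nat \<Rightarrow> ('a, 'a) cmap) \<Rightarrow> (nat \<Rightarrow> 'a cpsh) \<Rightarrow> (nat \<Rightarrow> ('a, 'a) cmap) \<Rightarrow>
   'a cpsh \<Rightarrow> (nat \<Rightarrow> ('a, 'a) cmap) \<Rightarrow> (nat \<Rightarrow> ('a, 'a) cmap) \<Rightarrow> bool" where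
  "chain_colimit N Xs ss Ms ts U xs ms \<longleftrightarrow>
     chain_cocone N Xs ss Ms ts U xs ms \<and>
     (\<forall>Q xs' ms'. chain_cocone N Xs ss Ms ts Q xs' ms' \<longrightarrow>
        (\<exists>!h. h \<in> nat_trans CC U Q \<and>
           (\<forall>k. enat k \<le> N \<longrightarrow> nt_comp CC (Xs k) h (xs k) = xs' k) \<and>
           (\<forall>k. enat k < N \<longrightarrow> nt_comp CC (Ms k) h (ms k) = ms' k)))"

definition chain_play ::
  "'a move_pred \<Rightarrow> enat \<Rightarrow> 'a cpsh \<Rightarrow> 'a cpsh \<Rightarrow> ('a, 'a) cmap \<Rightarrow> bool" where
  "chain_play mv N X U u \<longleftrightarrow>
     position X \<and> u \<in> nat_trans CC X U \<and> nt_mono CC X u \<and>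
     (\<exists>Xs ss Ms ts xs ms.
        Xs 0 = X \<and> xs 0 = u \<and>
        (\<forall>k. enat k < N \<longrightarrow> mv (Xs k) (ss k) (Ms k) (ts k) (Xs (Suc k))) \<and>
        chain_colimit N Xs ss Ms ts U xs ms)"

definition play :: "'a cpsh \<Rightarrow> 'a cpsh \<Rightarrow> ('a, 'a) cmap \<Rightarrow> bool" where
  "play X U u \<longleftrightarrow> (\<exists>N. chain_play ext_move N X U u)"

definition closed_world_play :: "'a cpsh \<Rightarrow> 'a cpsh \<Rightarrow> ('a, 'a) cmap \<Rightarrow> bool" where
  "closed_world_play X U u \<longleftrightarrow> (\<exists>N. chain_play ext_closed_world N X U u)"

definition view :: "'a cpsh \<Rightarrow> 'a cpsh \<Rightarrow> ('a, 'a) cmap \<Rightarrow> bool" where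
  "view X U u \<longleftrightarrow>
     (\<exists>n. psh_iso CC (Yo (Player n)) X) \<and> (\<exists>N. chain_play ext_basic (enat N) X U u)"


section \<open>Strategies and their global behaviour\<close>

text \<open>A play \<open>incl : base \<rightarrow> whole\<close> over \<open>X\<close>, with \<open>proj : base \<rightarrow> X\<close>.\<close>

record 'a eobj =
  base :: "'a cpsh"
  whole :: "'a cpsh"
  incl :: "('a, 'a) cmap"
  proj :: "('a, 'a) cmap"

type_synonym 'a earr = "('a, 'a) cmap \<times> ('a, 'a) cmap"

definition E_cat :: "'a cpsh \<Rightarrow> ('a eobj, 'a earr) cat" where
  "E_cat X =
     \<lparr>ob = {A. play (base A) (whole A) (incl A) \<and> proj A \<in> nat_trans CC (base A) X},
      hom = (\<lambda>A B. {(h, k). h \<in> nat_trans CC (base A) (base B) \<and> k \<in> nat_trans CC (whole A) (whole B) \<and>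
               nt_comp CC (base A) k (incl A) = nt_comp CC (base A) (incl B) h \<and>
               nt_comp CC (base A) (proj B) h = proj A}),
      idn = (\<lambda>A. (nt_id CC (base A), nt_id CC (whole A))),
      cmp = (\<lambda>A B C (h', k') (h, k). (nt_comp CC (base A) h' h, nt_comp CC (whole A) k' k))\<rparr>"

definition V_cat :: "'a cpsh \<Rightarrow> ('a eobj, 'a earr) cat" where
  "V_cat X = full_subcat (E_cat X) (\<lambda>A. view (base A) (whole A) (incl A))"

definition W_cat :: "'a cpsh \<Rightarrow> ('a eobj, 'a earr) cat" where
  "W_cat X = (E_cat X)
     \<lparr>ob := {A \<in> ob (E_cat X). base A = X \<and> proj A = nt_id CC X \<and>
               closed_world_play (base A) (whole A) (incl A)},
      hom := (\<lambda>A B. {(h, k) \<in> hom (E_cat X) A B. h = nt_id CC X})\<rparr>"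
lemma play_presheaf: "play X U u \<Longrightarrow> presheaf CC X \<and> presheaf CC U \<and> u \<in> nat_trans CC X U"
  unfolding play_def chain_play_def position_def chain_colimit_def chain_cocone_def by blast

lemma category_E_cat: "category (E_cat X)"
proof -
  have l1: "nt_comp CC P (nt_id CC Q) f = f"
    if f: "f \<in> nat_trans CC P Q" and P: "presheaf CC P" and Q: "presheaf CC Q"
    for P Q :: "'a cpsh" and f
    by (rule nat_trans_eqI[OF nt_comp_in[OF P f nt_id_in[OF Q]] f])
      (simp add: nt_comp_def nt_id_def nat_trans_in[OF f])
  have l2: "nt_comp CC P f (nt_id CC P) = f"
    if f: "f \<in> nat_trans CC P Q" and P: "presheaf CC P"
    for P Q :: "'a cpsh" and f
    by (rule nat_trans_eqI[OF nt_comp_in[OF P nt_id_in[OF P] f] f])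
      (simp add: nt_comp_def nt_id_def)
  have ass: "nt_comp CC P h (nt_comp CC P g f) = nt_comp CC P (nt_comp CC Q h g) f"
    if "f \<in> nat_trans CC P Q" for P Q :: "'a cpsh" and f g h :: "('a, 'a) cmap"
    using that by (auto simp: nt_comp_def nat_trans_in intro!: restrict_ext)
  show ?thesis
    unfolding category_def
  proof (intro conjI ballI)
    fix A B C f g assume "A \<in> ob (E_cat X)" "f \<in> hom (E_cat X) A B" "g \<in> hom (E_cat X) B C"
    then show "cmp (E_cat X) A B C g f \<in> hom (E_cat X) A C"
      using play_presheaf[of "base A" "whole A" "incl A"]
      by (auto simp: E_cat_def nt_comp_in) (metis ass)+
  qed (auto simp: E_cat_def dest!: play_presheaf intro: nt_id_in ass simp: l1 l2)
qed

lemma category_V_cat: "category (V_cat X)"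
  using category_E_cat[of X] unfolding V_cat_def full_subcat_def category_def by simp

lemma is_functor_V_cat: "is_functor (V_cat X) (E_cat X) inclusion"
  by (simp add: is_functor_def inclusion_def V_cat_def full_subcat_def)

text \<open>Innocent strategies over \<open>X\<close> with states in \<open>'v\<close>.\<close>

type_synonym ('a, 'v) strategy = "('a eobj, 'a earr, 'v) presheaf"

definition innocent_strategy :: "'a cpsh \<Rightarrow> ('a, 'v) strategy \<Rightarrow> bool" where
  "innocent_strategy X F \<longleftrightarrow> presheaf (V_cat X) F"

type_synonym ('a, 'v) state = "'a eobj \<times> 'a earr \<Rightarrow> 'v"

definition Gl :: "'a cpsh \<Rightarrow> ('a, 'v) strategy \<Rightarrow> ('a eobj, 'a earr, ('a, 'v) state) presheaf" where
  "Gl X F = restrict_along inclusion (right_kan (V_cat X) (E_cat X) inclusion F)"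

definition state_extension ::
  "'a cpsh \<Rightarrow> ('a eobj, 'a earr, 's) presheaf \<Rightarrow>
   'a eobj \<Rightarrow> 's \<Rightarrow> 'a eobj \<Rightarrow> 's \<Rightarrow> 'a earr \<Rightarrow> bool" where
  "state_extension X G U \<sigma> U' \<sigma>' i \<longleftrightarrow>
     U' \<in> ob (W_cat X) \<and> \<sigma>' \<in> fob G U' \<and> i \<in> hom (W_cat X) U U' \<and> far G U U' i \<sigma>' = \<sigma>"

definition strict_extension ::
  "'a cpsh \<Rightarrow> ('a eobj, 'a earr, 's) presheaf \<Rightarrow>
   'a eobj \<Rightarrow> 's \<Rightarrow> 'a eobj \<Rightarrow> 's \<Rightarrow> 'a earr \<Rightarrow> bool" where
  "strict_extension X G U \<sigma> U' \<sigma>' i \<longleftrightarrow>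
     state_extension X G U \<sigma> U' \<sigma>' i \<and> \<not> nt_surj CC (whole U) (whole U') (snd i)"

definition maximal_state ::
  "'a cpsh \<Rightarrow> ('a eobj, 'a earr, 's) presheaf \<Rightarrow> 'a eobj \<Rightarrow> 's \<Rightarrow> bool" where
  "maximal_state X G U \<sigma> \<longleftrightarrow> (\<nexists>U' \<sigma>' i. strict_extension X G U \<sigma> U' \<sigma>' i)"

end

theory Submission
  imports Defs "HOL-Library.Countable_Set"
begin

text \<open>
  A closed-world play on \<open>X\<close> can be described without reference to the order of its moves: every element
  is initial or created by exactly one move, every player makes at most one move, and every player is
  reached from \<open>X\<close> by finitely many moves. Conversely, any such configuration with countably many moves
  is a play, because its causal order is well-founded with finite branching and hence has a linear
  extension of order type at most \<open>\<omega>\<close>. As a consequence, plays are closed under unions of increasing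
  sequences, and an element of a play is determined by a word of restriction steps and
  player-to-move steps leading to it from an initial element. These words form a countable set, and a
  morphism of plays that is not surjective makes a new word meaningful.

  Given a state, build a sequence of extensions that at stage \<open>n\<close> makes the \<open>n\<close>-th word meaningful if
  some extension does. The states on the stages glue to a state on the union, since views are finite
  and so every view of the union factors through a stage. A strict extension of the union would make
  a new word meaningful, say the \<open>n\<close>-th, which would then have been made so at stage \<open>n\<close>.
\<close>

subsection \<open>Presheaves and pushouts\<close>

text \<open>The obstacle is that concatenation does not iterate: a stage may already be an infinite
  play, so stringing countably many stages together gives a chain of moves of order type beyond
  \<omega>, which is not a play. Configurations forget the order, and the moves of the union are put
  in order only once. The order fits into \<omega> because a move has finitely many source players,
  each created by at most one move. Words also take the place of Zorn's lemma: plays are countable,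
  so only countable unions are at hand, and names shared by all plays on \<open>X\<close> show that
  one countable sequence is enough. Morphisms of plays turn out to be monic, because a player makes
  at most one move; this lets the union be formed and lets a finite view lift to a stage. Since
  \<open>is_pushout\<close> and \<open>chain_colimit\<close> test only presheaves over the element
  type of the colimit, explicit colimits are built over sum and product types and then carried into
  that type, which is possible as they are countable and it is infinite.\<close>

definition mk_nt :: "('o, 'm) cat \<Rightarrow> ('o, 'm, 'a) presheaf \<Rightarrow> ('o \<Rightarrow> 'a \<Rightarrow> 'b) \<Rightarrow> 'o \<Rightarrow> 'a \<Rightarrow> 'b" where
  "mk_nt C P f = (\<lambda>c\<in>ob C. \<lambda>x\<in>fob P c. f c x)"

lemma mk_nt_app [simp]: "c \<in> ob C \<Longrightarrow> x \<in> fob P c \<Longrightarrow> mk_nt C P f c x = f c x"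
  by (simp add: mk_nt_def)

lemma mk_nt_in:
  assumes "presheaf C P"
    and "\<And>c x. c \<in> ob C \<Longrightarrow> x \<in> fob P c \<Longrightarrow> f c x \<in> fob Q c"
    and "\<And>a b h x. \<lbrakk>a \<in> ob C; b \<in> ob C; h \<in> hom C a b; x \<in> fob P b\<rbrakk> \<Longrightarrow>
      f a (far P a b h x) = far Q a b h (f b x)"
  shows "mk_nt C P f \<in> nat_trans C P Q"
  using assms(2,3) by (simp add: nat_trans_def mk_nt_def presheaf_far_in[OF assms(1)])

lemma nt_comp_app [simp]:
  "c \<in> ob C \<Longrightarrow> x \<in> fob P c \<Longrightarrow> nt_comp C P \<theta> \<eta> c x = \<theta> c (\<eta> c x)"
  by (simp add: nt_comp_def)

lemma nt_id_app [simp]: "c \<in> ob C \<Longrightarrow> x \<in> fob P c \<Longrightarrow> nt_id C P c x = x"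
  by (simp add: nt_id_def)

lemma nt_comp_eqI:
  assumes "\<And>c x. c \<in> ob C \<Longrightarrow> x \<in> fob P c \<Longrightarrow> \<theta> c (\<eta> c x) = \<theta>' c (\<eta>' c x)"
  shows "nt_comp C P \<theta> \<eta> = nt_comp C P \<theta>' \<eta>'"
  using assms by (auto simp: nt_comp_def intro!: restrict_ext)

lemma nt_comp_eqD:
  assumes "nt_comp C P \<theta> \<eta> = nt_comp C P \<theta>' \<eta>'" "c \<in> ob C" "x \<in> fob P c"
  shows "\<theta> c (\<eta> c x) = \<theta>' c (\<eta>' c x)"
  using assms nt_comp_app by metis

text \<open>\<open>nt_comp\<close> is extensional by construction and \<zeta> by hypothesis, so only
  values on \<open>P\<close> have to be compared.\<close>

lemma nt_comp_eq_ntI: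
  assumes "\<zeta> \<in> nat_trans C P Q"
    and "\<And>c x. c \<in> ob C \<Longrightarrow> x \<in> fob P c \<Longrightarrow> \<theta> c (\<eta> c x) = \<zeta> c x"
  shows "nt_comp C P \<theta> \<eta> = \<zeta>"
proof (rule ext)+
  fix c x
  have "c \<in> ob C \<Longrightarrow> \<zeta> c \<in> extensional (fob P c)" "c \<notin> ob C \<Longrightarrow> \<zeta> c = undefined"
    using assms(1) unfolding nat_trans_def PiE_def extensional_def by auto
  then show "nt_comp C P \<theta> \<eta> c x = \<zeta> c x"
    using assms(2) unfolding nt_comp_def extensional_def by auto
qed

lemma presheaf_far_id: "presheaf C P \<Longrightarrow> a \<in> ob C \<Longrightarrow> x \<in> fob P a \<Longrightarrow> far P a a (idn C a) x = x"
  unfolding presheaf_def by blast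

lemma presheaf_far_cmp:
  "\<lbrakk>presheaf C P; a \<in> ob C; b \<in> ob C; c \<in> ob C; f \<in> hom C a b; g \<in> hom C b c; x \<in> fob P c\<rbrakk> \<Longrightarrow>
     far P a c (cmp C a b c g f) x = far P a b f (far P b c g x)"
  unfolding presheaf_def by blast

lemma presheafI:
  assumes "\<And>a b f x. \<lbrakk>a \<in> ob C; b \<in> ob C; f \<in> hom C a b; x \<in> fob P b\<rbrakk> \<Longrightarrow> far P a b f x \<in> fob P a"
    and "\<And>a x. \<lbrakk>a \<in> ob C; x \<in> fob P a\<rbrakk> \<Longrightarrow> far P a a (idn C a) x = x"
    and "\<And>a b c f g x. \<lbrakk>a \<in> ob C; b \<in> ob C; c \<in> ob C; f \<in> hom C a b; g \<in> hom C b c; x \<in> fob P c\<rbrakk> \<Longrightarrow>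
       far P a c (cmp C a b c g f) x = far P a b f (far P b c g x)"
  shows "presheaf C P"
  using assms unfolding presheaf_def by blast

lemma nt_mono_inj: "nt_mono C P \<eta> \<Longrightarrow> c \<in> ob C \<Longrightarrow> x \<in> fob P c \<Longrightarrow> y \<in> fob P c \<Longrightarrow> \<eta> c x = \<eta> c y \<Longrightarrow> x = y"
  unfolding nt_mono_def inj_on_def by blast

lemma nt_monoI:
  "(\<And>c x y. \<lbrakk>c \<in> ob C; x \<in> fob P c; y \<in> fob P c; \<eta> c x = \<eta> c y\<rbrakk> \<Longrightarrow> x = y) \<Longrightarrow> nt_mono C P \<eta>"
  unfolding nt_mono_def inj_on_def by blast

section \<open>Subpresheaves, lifting along monos, and transport to another element type\<close>

definition sub_psh :: "('o, 'm, 'a) presheaf \<Rightarrow> ('o \<Rightarrow> 'a set) \<Rightarrow> ('o, 'm, 'a) presheaf" where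
  "sub_psh P S = \<lparr>fob = S, far = far P\<rparr>"

lemma sub_psh_simps [simp]: "fob (sub_psh P S) = S" "far (sub_psh P S) = far P"
  by (simp_all add: sub_psh_def)

lemma presheaf_sub_psh:
  assumes "presheaf C P" "\<And>c. c \<in> ob C \<Longrightarrow> S c \<subseteq> fob P c"
    and "\<And>a b f x. \<lbrakk>a \<in> ob C; b \<in> ob C; f \<in> hom C a b; x \<in> S b\<rbrakk> \<Longrightarrow> far P a b f x \<in> S a"
  shows "presheaf C (sub_psh P S)"
proof (rule presheafI, goal_cases)
  case (2 a x) then show ?case using presheaf_far_id[OF assms(1)] assms(2) by fastforce
next
  case (3 a b c f g x) then show ?case using presheaf_far_cmp[OF assms(1)] assms(2) by fastforce
qed (simp add: assms(3))

lemma sub_psh_incl: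
  assumes "presheaf C (sub_psh P S)" "\<And>c. c \<in> ob C \<Longrightarrow> S c \<subseteq> fob P c"
  shows "nt_id C (sub_psh P S) \<in> nat_trans C (sub_psh P S) P"
  using subsetD[OF assms(2)] presheaf_far_in[OF assms(1)] by (simp add: nat_trans_def nt_id_def)

text \<open>Membership in \<open>nat_trans\<close> depends on the codomain only through the values
  taken and their restrictions. Hence a map can be narrowed to a subpresheaf containing its image
  and widened again.\<close>

lemma nat_trans_codom:
  assumes \<eta>: "\<eta> \<in> nat_trans C P Q"
    and "\<And>c x. c \<in> ob C \<Longrightarrow> x \<in> fob P c \<Longrightarrow> \<eta> c x \<in> fob R c"
    and "\<And>a b f x. \<lbrakk>a \<in> ob C; b \<in> ob C; f \<in> hom C a b; x \<in> fob P b\<rbrakk> \<Longrightarrow>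
      far R a b f (\<eta> b x) = far Q a b f (\<eta> b x)"
  shows "\<eta> \<in> nat_trans C P R"
proof -
  have "\<eta> \<in> (\<Pi>\<^sub>E c\<in>ob C. fob P c \<rightarrow>\<^sub>E fob R c)"
  proof (intro PiE_I)
    show "\<eta> c x = undefined" if "c \<in> ob C" "x \<notin> fob P c" for c x
    proof -
      have "\<eta> c \<in> fob P c \<rightarrow>\<^sub>E fob Q c" using \<eta> that(1) unfolding nat_trans_def by blast
      then show ?thesis using that(2) by (rule PiE_arb)
    qed
    show "\<eta> c = undefined" if "c \<notin> ob C" for c
      using \<eta> that unfolding nat_trans_def by (blast dest: PiE_arb)
  qed (rule assms(2))
  then show ?thesis
    unfolding nat_trans_def using assms(3) nat_trans_natural[OF \<eta>] by simp
qed

text \<open>Preimages under the mono \<open>s\<close> are unique, so choosing them pointwise is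
  already natural: both sides of the naturality square agree after \<open>s\<close>.\<close>

lemma nat_trans_lift:
  assumes P: "presheaf C P" and X: "presheaf C X" and s: "s \<in> nat_trans C X M" and m: "nt_mono C X s"
    and k: "k \<in> nat_trans C P M"
    and im: "\<And>c x. c \<in> ob C \<Longrightarrow> x \<in> fob P c \<Longrightarrow> k c x \<in> s c ` fob X c"
  obtains k' where "k' \<in> nat_trans C P X"
    "\<And>c x. c \<in> ob C \<Longrightarrow> x \<in> fob P c \<Longrightarrow> s c (k' c x) = k c x"
proof
  define v where "v c x = inv_into (fob X c) (s c) (k c x)" for c x
  have v: "v c x \<in> fob X c" "s c (v c x) = k c x" if "c \<in> ob C" "x \<in> fob P c" for c x
    using im[OF that] by (simp_all add: v_def inv_into_into f_inv_into_f)
  show "mk_nt C P v \<in> nat_trans C P X"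
  proof (rule mk_nt_in[OF P v(1)])
    fix a b h x assume *: "a \<in> ob C" "b \<in> ob C" "h \<in> hom C a b" "x \<in> fob P b"
    show "v a (far P a b h x) = far X a b h (v b x)"
      by (rule nt_mono_inj[OF m *(1)])
        (use * v in \<open>simp_all add: presheaf_far_in[OF P] presheaf_far_in[OF X]
          nat_trans_natural[OF s] nat_trans_natural[OF k]\<close>)
  qed
  show "s c (mk_nt C P v c x) = k c x" if "c \<in> ob C" "x \<in> fob P c" for c x
    using v that by simp
qed

lemma countable_inj_infinite:
  assumes S: "countable S" and T: "infinite T"
  shows "\<exists>j. inj_on j S \<and> j ` S \<subseteq> T"
proof -
  obtain f :: "nat \<Rightarrow> _" where f: "inj f" "range f \<subseteq> T"
    using T unfolding infinite_iff_countable_subset by (elim exE conjE)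
  have "inj_on (f \<circ> to_nat_on S) S"
    by (rule comp_inj_on[OF inj_on_to_nat_on[OF S] inj_on_subset[OF f(1)]]) simp
  moreover have "(f \<circ> to_nat_on S) ` S \<subseteq> T" using f(2) by auto
  ultimately show ?thesis by (intro exI conjI)
qed

text \<open>Explicit colimits are first built over sum or product types, whereas the universal
  properties speak about one fixed type. Countable components and an infinite target type give the
  injections \<open>j\<close> along which all structure is carried over.\<close>

lemma presheaf_transport:
  fixes Q :: "('o, 'm, 'b) presheaf"
  assumes Q: "presheaf C Q" and cnt: "\<And>c. c \<in> ob C \<Longrightarrow> countable (fob Q c)"
  obtains Q' :: "('o, 'm, 'a::infinite) presheaf" and \<phi>
  where "presheaf C Q'" "\<phi> \<in> nat_trans C Q Q'" "nt_mono C Q \<phi>"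
    "\<And>c. c \<in> ob C \<Longrightarrow> \<phi> c ` fob Q c = fob Q' c"
proof -
  have "\<exists>j :: 'b \<Rightarrow> 'a. inj_on j (fob Q c)" if "c \<in> ob C" for c
    using countable_inj_infinite[OF cnt[OF that] infinite_UNIV] by blast
  then obtain j :: "'o \<Rightarrow> 'b \<Rightarrow> 'a" where j: "\<And>c. c \<in> ob C \<Longrightarrow> inj_on (j c) (fob Q c)" by metis
  define Q' where "Q' = \<lparr>fob = \<lambda>c. j c ` fob Q c, far = \<lambda>a b f y. j a (far Q a b f (inv_into (fob Q b) (j b) y))\<rparr>"
  have fo: "fob Q' c = j c ` fob Q c" for c by (simp add: Q'_def)
  have fa: "far Q' a b f (j b x) = j a (far Q a b f x)" if "b \<in> ob C" "x \<in> fob Q b" for a b f x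
    using that by (simp add: Q'_def inv_into_f_f[OF j])
  show thesis
  proof
    show "presheaf C Q'"
      by (rule presheafI) (auto simp: fo fa presheaf_far_in[OF Q] presheaf_far_id[OF Q] presheaf_far_cmp[OF Q])
    show "mk_nt C Q j \<in> nat_trans C Q Q'"
      by (rule mk_nt_in[OF Q]) (auto simp: fo fa)
    show "nt_mono C Q (mk_nt C Q j)"
      using j by (auto simp: nt_mono_def inj_on_def)
    show "mk_nt C Q j c ` fob Q c = fob Q' c" if "c \<in> ob C" for c
      using that by (auto simp: fo)
  qed
qed

section \<open>Pushouts along monos, computed elementwise\<close>

text \<open>The form a pushout takes when \<open>f\<close> is monic: \<open>B\<close> embeds, the
  part of \<open>A\<close> off the image of \<open>f\<close> is added freely, and the two pieces
  meet only through \<open>I\<close>. No test object occurs, so the restriction on element types is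
  avoided.\<close>

definition pushout_like ::
  "('o, 'm) cat \<Rightarrow> ('o, 'm, 'i) presheaf \<Rightarrow> ('o, 'm, 'x) presheaf \<Rightarrow> ('o, 'm, 'y) presheaf \<Rightarrow>
   ('o \<Rightarrow> 'i \<Rightarrow> 'x) \<Rightarrow> ('o \<Rightarrow> 'i \<Rightarrow> 'y) \<Rightarrow>
   ('o, 'm, 'p) presheaf \<Rightarrow> ('o \<Rightarrow> 'x \<Rightarrow> 'p) \<Rightarrow> ('o \<Rightarrow> 'y \<Rightarrow> 'p) \<Rightarrow> bool" where
  "pushout_like C I A B f g P a b \<longleftrightarrow>
     (\<forall>c\<in>ob C. fob P c = a c ` fob A c \<union> b c ` fob B c \<and>
        inj_on (b c) (fob B c) \<and> inj_on (a c) (fob A c - f c ` fob I c) \<and>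
        (\<forall>x\<in>fob A c. \<forall>y\<in>fob B c. a c x = b c y \<longrightarrow> (\<exists>i\<in>fob I c. x = f c i \<and> y = g c i)))"

lemma is_pushoutD:
  assumes "is_pushout C I A B f g P a b"
  shows "presheaf C I" "presheaf C A" "presheaf C B" "presheaf C P" "f \<in> nat_trans C I A"
    "g \<in> nat_trans C I B" "a \<in> nat_trans C A P" "b \<in> nat_trans C B P"
    "\<And>c i. c \<in> ob C \<Longrightarrow> i \<in> fob I c \<Longrightarrow> a c (f c i) = b c (g c i)"
proof -
  show "a c (f c i) = b c (g c i)" if "c \<in> ob C" "i \<in> fob I c" for c i
    by (rule nt_comp_eqD[OF _ that]) (use assms in \<open>simp add: is_pushout_def\<close>)
qed (use assms in \<open>simp_all add: is_pushout_def\<close>)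

text \<open>\<open>Q\<close> may have any element type here, in contrast to
  \<open>is_pushout\<close>; this is what later produces maps into representables out of pushouts
  over \<open>'a\<close>. The factorisation is forced because \<open>a\<close> and \<open>b\<close>
  cover \<open>P\<close>.\<close>

lemma pushout_like_factor:
  assumes psh: "presheaf C A" "presheaf C B" "presheaf C P" and g: "g \<in> nat_trans C I B"
    and a: "a \<in> nat_trans C A P" and b: "b \<in> nat_trans C B P"
    and sq: "\<And>c i. c \<in> ob C \<Longrightarrow> i \<in> fob I c \<Longrightarrow> a c (f c i) = b c (g c i)"
    and pl: "pushout_like C I A B f g P a b"
    and a': "a' \<in> nat_trans C A Q" and b': "b' \<in> nat_trans C B Q"
    and sq': "\<And>c i. c \<in> ob C \<Longrightarrow> i \<in> fob I c \<Longrightarrow> a' c (f c i) = b' c (g c i)"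
  shows "\<exists>!h. h \<in> nat_trans C P Q \<and> nt_comp C A h a = a' \<and> nt_comp C B h b = b'"
proof -
  have cov: "fob P c = a c ` fob A c \<union> b c ` fob B c" if "c \<in> ob C" for c
    using pl that unfolding pushout_like_def by blast
  have binj: "y = y'" if "c \<in> ob C" "y \<in> fob B c" "y' \<in> fob B c" "b c y = b c y'" for c y y'
    using pl that unfolding pushout_like_def inj_on_def by blast
  have ainj: "x = x'" if "c \<in> ob C" "x \<in> fob A c" "x' \<in> fob A c" "a c x = a c x'"
    "x \<notin> f c ` fob I c" "x' \<notin> f c ` fob I c" for c x x'
    using pl that unfolding pushout_like_def inj_on_def by blast
  have gl: "\<exists>i\<in>fob I c. x = f c i \<and> y = g c i" if "c \<in> ob C" "x \<in> fob A c" "y \<in> fob B c" "a c x = b c y" for c x y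
    using pl that unfolding pushout_like_def by blast
  have ab: "a' c x = b' c y" if "c \<in> ob C" "x \<in> fob A c" "y \<in> fob B c" "a c x = b c y" for c x y
    using gl[OF that] sq' that(1) by blast
  \<comment> \<open>If either element lies in the image of \<open>f\<close>, their common value is
    some \<open>b c y\<close> and both are compared with \<open>y\<close>; off that image
    \<open>a\<close> is injective.\<close>
  have aa: "a' c x = a' c x'" if *: "c \<in> ob C" "x \<in> fob A c" "x' \<in> fob A c" "a c x = a c x'" for c x x'
  proof -
    have "\<exists>y\<in>fob B c. a c z = b c y" if "z \<in> f c ` fob I c" for z
      using that sq *(1) nat_trans_in[OF g] by blast
    then show ?thesis using ainj[OF *] ab * by metis
  qed
  \<comment> \<open>Values reached from \<open>B\<close> are read off there, because
    \<open>b\<close> is injective; only the remaining ones go through \<open>A\<close>.\<close>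
  define h where "h c p = (if \<exists>y\<in>fob B c. p = b c y then b' c (SOME y. y \<in> fob B c \<and> p = b c y)
      else a' c (SOME x. x \<in> fob A c \<and> p = a c x))" for c p
  have hb: "h c (b c y) = b' c y" if "c \<in> ob C" "y \<in> fob B c" for c y
  proof -
    have "(SOME y'. y' \<in> fob B c \<and> b c y = b c y') = y"
      using binj that by (intro some_equality) auto
    then show ?thesis using that by (auto simp: h_def)
  qed
  have ha: "h c (a c x) = a' c x" if "c \<in> ob C" "x \<in> fob A c" for c x
  proof (cases "\<exists>y\<in>fob B c. a c x = b c y")
    case True then show ?thesis using hb ab that by metis
  next
    case False
    define x0 where "x0 = (SOME x'. x' \<in> fob A c \<and> a c x = a c x')"
    have "x0 \<in> fob A c \<and> a c x = a c x0"
      unfolding x0_def by (rule someI[of _ x]) (use that in simp)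
    moreover have "h c (a c x) = a' c x0" using False by (simp add: h_def x0_def)
    ultimately show ?thesis using aa[OF that(1), of x x0] that(2) by simp
  qed
  have h: "mk_nt C P h \<in> nat_trans C P Q"
  proof (rule mk_nt_in[OF psh(3)])
    show "h c p \<in> fob Q c" if "c \<in> ob C" "p \<in> fob P c" for c p
      using that(2) unfolding cov[OF that(1)]
      by (auto simp: ha hb that(1) nat_trans_in[OF a' that(1)] nat_trans_in[OF b' that(1)])
    fix c d k p assume *: "c \<in> ob C" "d \<in> ob C" "k \<in> hom C c d" "p \<in> fob P d"
    then consider x where "x \<in> fob A d" "p = a d x" | y where "y \<in> fob B d" "p = b d y"
      using cov by blast
    then show "h c (far P c d k p) = far Q c d k (h d p)"
    proof cases
      case 1
      then show ?thesis
        using * by (simp add: nat_trans_natural[OF a, symmetric] nat_trans_natural[OF a', symmetric] ha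
            presheaf_far_in[OF psh(1)])
    next
      case 2
      then show ?thesis
        using * by (simp add: nat_trans_natural[OF b, symmetric] nat_trans_natural[OF b', symmetric] hb
            presheaf_far_in[OF psh(2)])
    qed
  qed
  show "\<exists>!h. h \<in> nat_trans C P Q \<and> nt_comp C A h a = a' \<and> nt_comp C B h b = b'"
  proof (rule ex1I[of _ "mk_nt C P h"], intro conjI)
    show "mk_nt C P h \<in> nat_trans C P Q" by (rule h)
    show "nt_comp C A (mk_nt C P h) a = a'"
      by (rule nt_comp_eq_ntI[OF a']) (simp add: ha nat_trans_in[OF a])
    show "nt_comp C B (mk_nt C P h) b = b'"
      by (rule nt_comp_eq_ntI[OF b']) (simp add: hb nat_trans_in[OF b])
    fix k assume k: "k \<in> nat_trans C P Q \<and> nt_comp C A k a = a' \<and> nt_comp C B k b = b'"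
    have ka: "k c (a c x) = a' c x" if "c \<in> ob C" "x \<in> fob A c" for c x
      using k that nt_comp_app by metis
    have kb: "k c (b c x) = b' c x" if "c \<in> ob C" "x \<in> fob B c" for c x
      using k that nt_comp_app by metis
    show "k = mk_nt C P h"
    proof (rule nat_trans_eqI[OF conjunct1[OF k] h])
      show "k c p = mk_nt C P h c p" if "c \<in> ob C" "p \<in> fob P c" for c p
        using that cov[OF that(1)] ka kb ha hb by auto
    qed
  qed
qed

lemma pushout_criterion:
  fixes P :: "('o, 'm, 'p) presheaf"
  assumes psh: "presheaf C I" "presheaf C A" "presheaf C B" "presheaf C P"
    and f: "f \<in> nat_trans C I A" and g: "g \<in> nat_trans C I B"
    and a: "a \<in> nat_trans C A P" and b: "b \<in> nat_trans C B P"
    and sq: "\<And>c i. c \<in> ob C \<Longrightarrow> i \<in> fob I c \<Longrightarrow> a c (f c i) = b c (g c i)"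
    and pl: "pushout_like C I A B f g P a b"
  shows "is_pushout C I A B f g P a b"
  unfolding is_pushout_def
proof (intro conjI allI impI psh f g a b)
  show "nt_comp C I a f = nt_comp C I b g" by (rule nt_comp_eqI) (rule sq)
  fix Q :: "('o, 'm, 'p) presheaf" and a' b'
  assume "presheaf C Q \<and> a' \<in> nat_trans C A Q \<and> b' \<in> nat_trans C B Q \<and> nt_comp C I a' f = nt_comp C I b' g"
  then show "\<exists>!h. h \<in> nat_trans C P Q \<and> nt_comp C A h a = a' \<and> nt_comp C B h b = b'"
    by (intro pushout_like_factor[OF psh(2-4) g a b sq pl]) (auto dest: nt_comp_eqD)
qed

text \<open>The joint image is a cocone over the element type of \<open>P\<close>, hence an
  admissible test object. The induced map from \<open>P\<close> into it is the identity by
  uniqueness, so nothing lies outside the image.\<close>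

lemma pushout_jointly_surj:
  assumes po: "is_pushout C I A B f g P a b" and c: "c \<in> ob C"
  shows "fob P c = a c ` fob A c \<union> b c ` fob B c"
proof -
  note D = is_pushoutD[OF po]
  define S where "S c = a c ` fob A c \<union> b c ` fob B c" for c
  have Sub: "S c \<subseteq> fob P c" if "c \<in> ob C" for c
    using that nat_trans_in[OF D(7)] nat_trans_in[OF D(8)] by (auto simp: S_def)
  let ?Q = "sub_psh P S"
  have Q: "presheaf C ?Q"
    by (rule presheaf_sub_psh[OF D(4) Sub])
      (auto simp: S_def nat_trans_natural[OF D(7), symmetric] nat_trans_natural[OF D(8), symmetric]
        presheaf_far_in[OF D(2)] presheaf_far_in[OF D(3)])
  have a: "a \<in> nat_trans C A ?Q" and b: "b \<in> nat_trans C B ?Q"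
    by (rule nat_trans_codom[OF D(7)], simp_all add: S_def)
      (rule nat_trans_codom[OF D(8)], simp_all add: S_def)
  have sq: "nt_comp C I a f = nt_comp C I b g" using po unfolding is_pushout_def by blast
  obtain h where h: "h \<in> nat_trans C P ?Q" "nt_comp C A h a = a" "nt_comp C B h b = b"
    using po Q a b sq unfolding is_pushout_def by blast
  have h': "h \<in> nat_trans C P P"
    by (rule nat_trans_codom[OF h(1)]) (use nat_trans_in[OF h(1)] Sub in auto)
  have "nt_comp C A (nt_id C P) a = a" "nt_comp C B (nt_id C P) b = b"
    by (rule nt_comp_eq_ntI[OF D(7)], simp add: nat_trans_in[OF D(7)])
      (rule nt_comp_eq_ntI[OF D(8)], simp add: nat_trans_in[OF D(8)])
  then have "h = nt_id C P"
    using po h(2,3) h' nt_id_in[OF D(4)] D(4,7,8) sq unfolding is_pushout_def by blast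
  then have "fob P c \<subseteq> S c" using nat_trans_in[OF h(1) c] c by fastforce
  then show ?thesis using Sub[OF c] by (auto simp: S_def)
qed

text \<open>The carrier is \<open>B\<close> plus the part of \<open>A\<close> off the image of
  \<open>f\<close>. Restriction can lead from that part into the image, so elements are brought back
  to normal form after every restriction.\<close>

lemma pushout_exists:
  fixes A :: "('o, 'm, 'x) presheaf" and B :: "('o, 'm, 'y) presheaf"
  assumes psh: "presheaf C I" "presheaf C A" "presheaf C B"
    and f: "f \<in> nat_trans C I A" and g: "g \<in> nat_trans C I B" and mono: "nt_mono C I f"
    and cnt: "\<And>c. c \<in> ob C \<Longrightarrow> countable (fob A c)" "\<And>c. c \<in> ob C \<Longrightarrow> countable (fob B c)"
  obtains P :: "('o, 'm, 'p::infinite) presheaf" and a b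
  where "is_pushout C I A B f g P a b" "pushout_like C I A B f g P a b"
proof -
  \<comment> \<open>\<open>cl\<close> is the normal form: an element that comes from
    \<open>I\<close> is replaced by its counterpart in \<open>B\<close>, which is unique since
    \<open>f\<close> is monic.\<close>
  define cl :: "'o \<Rightarrow> 'x \<Rightarrow> 'x + 'y" where
    "cl c x = (if x \<in> f c ` fob I c then Inr (g c (inv_into (fob I c) (f c) x)) else Inl x)" for c x
  have clf: "cl c (f c i) = Inr (g c i)" if "c \<in> ob C" "i \<in> fob I c" for c i
    using that mono by (simp add: cl_def nt_mono_def inv_into_f_f)
  have cln: "cl c x = Inl x" if "x \<notin> f c ` fob I c" for c x
    using that by (simp add: cl_def)
  define Q :: "('o, 'm, 'x + 'y) presheaf" where
    "Q = \<lparr>fob = \<lambda>c. Inl ` (fob A c - f c ` fob I c) \<union> Inr ` fob B c,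
       far = \<lambda>c d h. case_sum (\<lambda>x. cl c (far A c d h x)) (\<lambda>y. Inr (far B c d h y))\<rparr>"
  have fo: "fob Q c = Inl ` (fob A c - f c ` fob I c) \<union> Inr ` fob B c" for c by (simp add: Q_def)
  have fr: "far Q c d h (Inr y) = Inr (far B c d h y)" "far Q c d h (Inl x) = cl c (far A c d h x)" for c d h x y
    by (simp_all add: Q_def)
  have clin: "cl c x \<in> fob Q c" if "c \<in> ob C" "x \<in> fob A c" for c x
    using that clf cln nat_trans_in[OF g] by (cases "x \<in> f c ` fob I c") (auto simp: fo)
  have clnat: "cl c (far A c d h x) = far Q c d h (cl d x)"
    if "c \<in> ob C" "d \<in> ob C" "h \<in> hom C c d" "x \<in> fob A d" for c d h x
  proof (cases "x \<in> f d ` fob I d")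
    case True
    then obtain i where i: "i \<in> fob I d" "x = f d i" by blast
    then show ?thesis
      using that by (simp add: nat_trans_natural[OF f, symmetric] clf presheaf_far_in[OF psh(1)] fr
          nat_trans_natural[OF g])
  next
    case False then show ?thesis by (simp add: cln fr)
  qed
  have Q: "presheaf C Q"
  proof (rule presheafI, goal_cases)
    case (1 a b h x)
    then show ?case using clin presheaf_far_in[OF psh(2)] presheaf_far_in[OF psh(3)]
      by (auto simp: fo[of b] fr) (auto simp: fo)
  next
    case (2 a x)
    then show ?case using presheaf_far_id[OF psh(2)] presheaf_far_id[OF psh(3)]
      by (auto simp: fo fr cln)
  next
    case (3 a b c h k x)
    then show ?case
      using presheaf_far_cmp[OF psh(2)] presheaf_far_cmp[OF psh(3)] presheaf_far_in[OF psh(2)]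
      by (auto simp: fo fr clnat)
  qed
  have a: "mk_nt C A cl \<in> nat_trans C A Q"
    by (rule mk_nt_in[OF psh(2)]) (auto simp: clin clnat)
  have b: "mk_nt C B (\<lambda>c. Inr) \<in> nat_trans C B Q"
    by (rule mk_nt_in[OF psh(3)]) (auto simp: fo fr)
  have cntQ: "countable (fob Q c)" if "c \<in> ob C" for c
    using cnt that by (simp add: fo)
  obtain P :: "('o, 'm, 'p) presheaf" and \<phi> where P: "presheaf C P" and \<phi>: "\<phi> \<in> nat_trans C Q P"
    and \<phi>i: "nt_mono C Q \<phi>" and \<phi>s: "\<And>c. c \<in> ob C \<Longrightarrow> \<phi> c ` fob Q c = fob P c"
    using presheaf_transport[OF Q cntQ] by metis
  let ?a = "nt_comp C A \<phi> (mk_nt C A cl)" and ?b = "nt_comp C B \<phi> (mk_nt C B (\<lambda>c. Inr))"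
  have a': "?a \<in> nat_trans C A P" by (rule nt_comp_in[OF psh(2) a \<phi>])
  have b': "?b \<in> nat_trans C B P" by (rule nt_comp_in[OF psh(3) b \<phi>])
  have inr: "Inr y \<in> fob Q c" if "y \<in> fob B c" for c y using that by (simp add: fo)
  have pl: "pushout_like C I A B f g P ?a ?b"
    unfolding pushout_like_def
  proof (intro ballI conjI impI)
    fix c assume c: "c \<in> ob C"
    have "fob Q c = cl c ` fob A c \<union> Inr ` fob B c"
      using clin[OF c] cln by (auto simp: fo) (metis Diff_iff image_eqI cln)
    then have "fob P c = \<phi> c ` (cl c ` fob A c \<union> Inr ` fob B c)" using \<phi>s[OF c] by metis
    then show "fob P c = ?a c ` fob A c \<union> ?b c ` fob B c"
      using c by (simp add: image_Un image_image cong: image_cong)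
    show "inj_on (?b c) (fob B c)"
      using c nt_mono_inj[OF \<phi>i c inr inr] by (auto simp: inj_on_def)
    show "inj_on (?a c) (fob A c - f c ` fob I c)"
    proof (rule inj_onI)
      fix x x' assume *: "x \<in> fob A c - f c ` fob I c" "x' \<in> fob A c - f c ` fob I c" "?a c x = ?a c x'"
      then have "cl c x = cl c x'" using nt_mono_inj[OF \<phi>i c clin clin] c by simp
      then show "x = x'" using * cln by auto
    qed
    fix x y assume *: "x \<in> fob A c" "y \<in> fob B c" "?a c x = ?b c y"
    then have "cl c x = Inr y" using nt_mono_inj[OF \<phi>i c clin[OF c] inr] c by simp
    then obtain i where "i \<in> fob I c" "x = f c i" using cln by fastforce
    then show "\<exists>i\<in>fob I c. x = f c i \<and> y = g c i" using \<open>cl c x = Inr y\<close> clf[OF c] by auto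
  qed
  show thesis
  proof (rule that[of P ?a ?b])
    show "is_pushout C I A B f g P ?a ?b"
      by (rule pushout_criterion[OF psh P f g a' b' _ pl])
        (simp add: nat_trans_in[OF f] nat_trans_in[OF g] clf)
  qed (rule pl)
qed

text \<open>The mediating map \<open>h\<close> to the explicit pushout commutes with the legs, so
  the injectivity and overlap conditions are reflected along it; joint surjectivity holds for every
  pushout.\<close>

lemma pushout_char:
  fixes P :: "('o, 'm, 'p::infinite) presheaf"
  assumes po: "is_pushout C I A B f g P a b" and mono: "nt_mono C I f"
    and cnt: "\<And>c. c \<in> ob C \<Longrightarrow> countable (fob A c)" "\<And>c. c \<in> ob C \<Longrightarrow> countable (fob B c)"
  shows "pushout_like C I A B f g P a b"
proof -
  note D = is_pushoutD[OF po]
  obtain P' :: "('o, 'm, 'p) presheaf" and a' b' where po': "is_pushout C I A B f g P' a' b'"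
    and pl: "pushout_like C I A B f g P' a' b'"
    using pushout_exists[OF D(1-3) D(5,6) mono cnt] by metis
  note D' = is_pushoutD[OF po']
  have "nt_comp C I a' f = nt_comp C I b' g" using po' unfolding is_pushout_def by blast
  then obtain h where h: "nt_comp C A h a = a'" "nt_comp C B h b = b'"
    using po D'(4,7,8) unfolding is_pushout_def by blast
  have ha: "h c (a c x) = a' c x" if "c \<in> ob C" "x \<in> fob A c" for c x
    using h(1) that nt_comp_app by metis
  have hb: "h c (b c x) = b' c x" if "c \<in> ob C" "x \<in> fob B c" for c x
    using h(2) that nt_comp_app by metis
  show ?thesis
    unfolding pushout_like_def
  proof (intro ballI conjI impI)
    fix c assume c: "c \<in> ob C"
    show "fob P c = a c ` fob A c \<union> b c ` fob B c" by (rule pushout_jointly_surj[OF po c])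
    have pl': "inj_on (b' c) (fob B c)" "inj_on (a' c) (fob A c - f c ` fob I c)"
      "\<forall>x\<in>fob A c. \<forall>y\<in>fob B c. a' c x = b' c y \<longrightarrow> (\<exists>i\<in>fob I c. x = f c i \<and> y = g c i)"
      using pl c unfolding pushout_like_def by blast+
    show "inj_on (b c) (fob B c)" using pl'(1) hb[OF c] unfolding inj_on_def by metis
    show "inj_on (a c) (fob A c - f c ` fob I c)" using pl'(2) ha[OF c] unfolding inj_on_def by (metis DiffD1)
    show "\<exists>i\<in>fob I c. x = f c i \<and> y = g c i" if "x \<in> fob A c" "y \<in> fob B c" "a c x = b c y" for x y
      using pl'(3) that ha[OF c that(1)] hb[OF c that(2)] by metis
  qed
qed

subsection \<open>Colimits of zigzags\<close>

definition zigzag ::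
  "enat \<Rightarrow> (nat \<Rightarrow> 'a cpsh) \<Rightarrow> (nat \<Rightarrow> ('a, 'a) cmap) \<Rightarrow> (nat \<Rightarrow> 'a cpsh) \<Rightarrow> (nat \<Rightarrow> ('a, 'a) cmap) \<Rightarrow> bool" where
  "zigzag N Xs ss Ms ts \<longleftrightarrow>
     (\<forall>k. enat k \<le> N \<longrightarrow> presheaf CC (Xs k)) \<and>
     (\<forall>k. enat k < N \<longrightarrow> presheaf CC (Ms k) \<and> ss k \<in> nat_trans CC (Xs k) (Ms k) \<and>
        nt_mono CC (Xs k) (ss k) \<and> ts k \<in> nat_trans CC (Xs (Suc k)) (Ms k))"

abbreviation fresh_elts ::
  "(nat \<Rightarrow> 'a cpsh) \<Rightarrow> (nat \<Rightarrow> ('a, 'a) cmap) \<Rightarrow> (nat \<Rightarrow> 'a cpsh) \<Rightarrow> nat \<Rightarrow> cobj \<Rightarrow> 'a set" where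
  "fresh_elts Xs ss Ms k c \<equiv> fob (Ms k) c - ss k c ` fob (Xs k) c"

text \<open>
  In a colimit of a zigzag whose forward maps are monic, each element either comes from the start or
  is born at exactly one stage; the birth map \<open>b\<close> records the stage, shifted by one, and the element.
\<close>

definition birth_map ::
  "enat \<Rightarrow> (nat \<Rightarrow> 'a cpsh) \<Rightarrow> (nat \<Rightarrow> ('a, 'a) cmap) \<Rightarrow> (nat \<Rightarrow> 'a cpsh) \<Rightarrow>
   (nat \<Rightarrow> ('a, 'a) cmap) \<Rightarrow> (nat \<Rightarrow> ('a, 'a) cmap) \<Rightarrow> (cobj \<Rightarrow> 'a \<Rightarrow> nat \<times> 'a) \<Rightarrow> bool" where
  "birth_map N Xs ss Ms xs ms b \<longleftrightarrow>
     (\<forall>c\<in>ob CC. (\<forall>x\<in>fob (Xs 0) c. b c (xs 0 c x) = (0, x)) \<and>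
        (\<forall>k y. enat k < N \<longrightarrow> y \<in> fresh_elts Xs ss Ms k c \<longrightarrow> b c (ms k c y) = (Suc k, y)))"

definition birth_cover ::
  "enat \<Rightarrow> (nat \<Rightarrow> 'a cpsh) \<Rightarrow> (nat \<Rightarrow> ('a, 'a) cmap) \<Rightarrow> (nat \<Rightarrow> 'a cpsh) \<Rightarrow>
   'a cpsh \<Rightarrow> (nat \<Rightarrow> ('a, 'a) cmap) \<Rightarrow> (nat \<Rightarrow> ('a, 'a) cmap) \<Rightarrow> bool" where
  "birth_cover N Xs ss Ms U xs ms \<longleftrightarrow>
     (\<forall>c\<in>ob CC. \<forall>e\<in>fob U c. (\<exists>x\<in>fob (Xs 0) c. e = xs 0 c x) \<or>
        (\<exists>k y. enat k < N \<and> y \<in> fresh_elts Xs ss Ms k c \<and> e = ms k c y))"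

lemma birth_mapD:
  assumes "birth_map N Xs ss Ms xs ms b" "c \<in> ob CC"
  shows "x \<in> fob (Xs 0) c \<Longrightarrow> b c (xs 0 c x) = (0, x)"
    "enat k < N \<Longrightarrow> y \<in> fresh_elts Xs ss Ms k c \<Longrightarrow> b c (ms k c y) = (Suc k, y)"
  using assms unfolding birth_map_def by blast+

lemma birth_coverE:
  assumes "birth_cover N Xs ss Ms U xs ms" "c \<in> ob CC" "e \<in> fob U c"
  obtains x where "x \<in> fob (Xs 0) c" "e = xs 0 c x"
  | k y where "enat k < N" "y \<in> fresh_elts Xs ss Ms k c" "e = ms k c y"
  using assms unfolding birth_cover_def by blast

lemma zigzagD:
  assumes "zigzag N Xs ss Ms ts"
  shows "enat k \<le> N \<Longrightarrow> presheaf CC (Xs k)"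
    "enat k < N \<Longrightarrow> presheaf CC (Ms k)" "enat k < N \<Longrightarrow> ss k \<in> nat_trans CC (Xs k) (Ms k)"
    "enat k < N \<Longrightarrow> nt_mono CC (Xs k) (ss k)" "enat k < N \<Longrightarrow> ts k \<in> nat_trans CC (Xs (Suc k)) (Ms k)"
  using assms unfolding zigzag_def by blast+

lemma chain_coconeD:
  assumes "chain_cocone N Xs ss Ms ts U xs ms"
  shows "presheaf CC U" "enat k \<le> N \<Longrightarrow> xs k \<in> nat_trans CC (Xs k) U"
    "enat k < N \<Longrightarrow> ms k \<in> nat_trans CC (Ms k) U"
    "\<lbrakk>enat k < N; c \<in> ob CC; x \<in> fob (Xs k) c\<rbrakk> \<Longrightarrow> ms k c (ss k c x) = xs k c x"
    "\<lbrakk>enat k < N; c \<in> ob CC; x \<in> fob (Xs (Suc k)) c\<rbrakk> \<Longrightarrow> ms k c (ts k c x) = xs (Suc k) c x"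
proof -
  show "ms k c (ss k c x) = xs k c x" if "enat k < N" "c \<in> ob CC" "x \<in> fob (Xs k) c"
  proof -
    have "nt_comp CC (Xs k) (ms k) (ss k) = xs k" using assms that(1) unfolding chain_cocone_def by blast
    then show ?thesis using nt_comp_app[OF that(2,3)] by metis
  qed
  show "ms k c (ts k c x) = xs (Suc k) c x" if "enat k < N" "c \<in> ob CC" "x \<in> fob (Xs (Suc k)) c"
  proof -
    have "nt_comp CC (Xs (Suc k)) (ms k) (ts k) = xs (Suc k)" using assms that(1) unfolding chain_cocone_def by blast
    then show ?thesis using nt_comp_app[OF that(2,3)] by metis
  qed
qed (use assms in \<open>simp_all add: chain_cocone_def\<close>)

lemma chain_coconeI:
  assumes "presheaf CC U" "\<And>k. enat k \<le> N \<Longrightarrow> xs k \<in> nat_trans CC (Xs k) U"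
    "\<And>k. enat k < N \<Longrightarrow> ms k \<in> nat_trans CC (Ms k) U"
    "\<And>k c x. \<lbrakk>enat k < N; c \<in> ob CC; x \<in> fob (Xs k) c\<rbrakk> \<Longrightarrow> ms k c (ss k c x) = xs k c x"
    "\<And>k c x. \<lbrakk>enat k < N; c \<in> ob CC; x \<in> fob (Xs (Suc k)) c\<rbrakk> \<Longrightarrow> ms k c (ts k c x) = xs (Suc k) c x"
  shows "chain_cocone N Xs ss Ms ts U xs ms"
  unfolding chain_cocone_def
proof (intro conjI allI impI)
  fix k assume k: "enat k < N"
  show "nt_comp CC (Xs k) (ms k) (ss k) = xs k"
    by (rule nt_comp_eq_ntI[OF assms(2)]) (use k assms(4) in auto)
  show "nt_comp CC (Xs (Suc k)) (ms k) (ts k) = xs (Suc k)"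
    by (rule nt_comp_eq_ntI[OF assms(2)]) (use k assms(5) in \<open>auto simp: Suc_ile_eq\<close>)
qed (use assms in auto)

text \<open>Birth records make the mediating map a definition by cases on \<open>b\<close>, and the
  cover leaves no freedom for a second one.\<close>

lemma chain_colimit_criterion:
  fixes U :: "'a cpsh"
  assumes zz: "zigzag N Xs ss Ms ts" and cc: "chain_cocone N Xs ss Ms ts U xs ms"
    and bm: "birth_map N Xs ss Ms xs ms b" and cov: "birth_cover N Xs ss Ms U xs ms"
  shows "chain_colimit N Xs ss Ms ts U xs ms"
  unfolding chain_colimit_def
proof (intro conjI allI impI cc)
  fix Q :: "'a cpsh" and xs' ms' assume cc': "chain_cocone N Xs ss Ms ts Q xs' ms'"
  note Z = zigzagD[OF zz] and K = chain_coconeD[OF cc] and K' = chain_coconeD[OF cc'] and B = birth_mapD[OF bm]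
  define H where "H c e = (case b c e of (0, x) \<Rightarrow> xs' 0 c x | (Suc k, y) \<Rightarrow> ms' k c y)" for c e
  have H0: "H c (xs 0 c x) = xs' 0 c x" if "c \<in> ob CC" "x \<in> fob (Xs 0) c" for c x
    using B(1)[OF that] by (simp add: H_def)
  have HS: "H c (ms k c y) = ms' k c y" if "c \<in> ob CC" "enat k < N" "y \<in> fresh_elts Xs ss Ms k c" for c k y
    using B(2)[OF that] by (simp add: H_def)
  \<comment> \<open>An element of a move is either old, and then settled at the preceding position,
    or fresh, and then settled by its birth record. The same split drives the other inductions along
    zigzags.\<close>
  have step: "H c (ms k c y) = ms' k c y"
    if "c \<in> ob CC" "enat k < N" "y \<in> fob (Ms k) c" "\<And>x. x \<in> fob (Xs k) c \<Longrightarrow> H c (xs k c x) = xs' k c x" for c k y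
  proof (cases "y \<in> ss k c ` fob (Xs k) c")
    case True
    then obtain x where "x \<in> fob (Xs k) c" "y = ss k c x" by blast
    then show ?thesis using that K(4) K'(4) by simp
  next
    case False then show ?thesis using HS that by blast
  qed
  have Hx: "H c (xs k c x) = xs' k c x" if "c \<in> ob CC" "enat k \<le> N" "x \<in> fob (Xs k) c" for c k x
    using that(2,3)
  proof (induction k arbitrary: x)
    case 0 then show ?case using H0 that(1) by simp
  next
    case (Suc k)
    then have k: "enat k < N" by (simp add: Suc_ile_eq)
    have "H c (ms k c (ts k c x)) = ms' k c (ts k c x)"
      by (rule step[OF that(1) k nat_trans_in[OF Z(5)[OF k] that(1) Suc.prems(2)] Suc.IH]) (use k in auto)
    then show ?case using K(5) K'(5) k that(1) Suc.prems(2) by simp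
  qed
  have Hm: "H c (ms k c y) = ms' k c y" if "c \<in> ob CC" "enat k < N" "y \<in> fob (Ms k) c" for c k y
    by (rule step[OF that Hx]) (use that in auto)
  have H: "mk_nt CC U H \<in> nat_trans CC U Q"
  proof (rule mk_nt_in[OF K(1)])
    show "H c e \<in> fob Q c" if c: "c \<in> ob CC" and e: "e \<in> fob U c" for c e
      using cov c e
    proof (cases rule: birth_coverE)
      case (1 x)
      then show ?thesis using nat_trans_in[OF K'(2)[of 0] c] by (simp add: H0 c zero_enat_def[symmetric])
    next
      case (2 k y)
      then show ?thesis using nat_trans_in[OF K'(3) c] by (simp add: Hm c)
    qed
    fix c d f e assume c: "c \<in> ob CC" and d: "d \<in> ob CC" and f: "f \<in> hom CC c d" and e: "e \<in> fob U d"
    have 0: "enat 0 \<le> N" by (simp add: zero_enat_def[symmetric])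
    show "H c (far U c d f e) = far Q c d f (H d e)"
      using cov d e
    proof (cases rule: birth_coverE)
      case (1 x)
      then show ?thesis
        using c d f 0 by (simp add: nat_trans_natural[OF K(2), symmetric] nat_trans_natural[OF K'(2), symmetric] H0
            presheaf_far_in[OF Z(1)])
    next
      case (2 k y)
      then show ?thesis
        using c d f by (simp add: nat_trans_natural[OF K(3), symmetric] nat_trans_natural[OF K'(3), symmetric] Hm
            presheaf_far_in[OF Z(2)])
    qed
  qed
  show "\<exists>!h. h \<in> nat_trans CC U Q \<and> (\<forall>k. enat k \<le> N \<longrightarrow> nt_comp CC (Xs k) h (xs k) = xs' k) \<and>
      (\<forall>k. enat k < N \<longrightarrow> nt_comp CC (Ms k) h (ms k) = ms' k)"
  proof (rule ex1I[of _ "mk_nt CC U H"], intro conjI allI impI H)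
    show "nt_comp CC (Xs k) (mk_nt CC U H) (xs k) = xs' k" if "enat k \<le> N" for k
      by (rule nt_comp_eq_ntI[OF K'(2)[OF that]]) (simp add: nat_trans_in[OF K(2)[OF that]] Hx that)
    show "nt_comp CC (Ms k) (mk_nt CC U H) (ms k) = ms' k" if "enat k < N" for k
      by (rule nt_comp_eq_ntI[OF K'(3)[OF that]]) (simp add: nat_trans_in[OF K(3)[OF that]] Hm that)
    fix h assume h: "h \<in> nat_trans CC U Q \<and> (\<forall>k. enat k \<le> N \<longrightarrow> nt_comp CC (Xs k) h (xs k) = xs' k) \<and>
      (\<forall>k. enat k < N \<longrightarrow> nt_comp CC (Ms k) h (ms k) = ms' k)"
    have hx: "h c (xs 0 c x) = xs' 0 c x" if "c \<in> ob CC" "x \<in> fob (Xs 0) c" for c x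
      using h nt_comp_app[OF that, of h "xs 0"] zero_enat_def by (metis zero_le)
    have hm: "h c (ms k c y) = ms' k c y" if "c \<in> ob CC" "y \<in> fob (Ms k) c" "enat k < N" for c k y
      using h nt_comp_app[OF that(1,2), of h "ms k"] that(3) by metis
    show "h = mk_nt CC U H"
    proof (rule nat_trans_eqI[OF conjunct1[OF h] H])
      fix c e assume c: "c \<in> ob CC" and e: "e \<in> fob U c"
      from cov c e show "h c e = mk_nt CC U H c e"
        by (cases rule: birth_coverE) (use c e in \<open>auto simp: hx hm H0 Hm\<close>)
    qed
  qed
qed

text \<open>As for pushouts, the joint image is a subpresheaf and a cocone, so the mediating map
  into it must be the identity.\<close>

lemma chain_colimit_surj:
  fixes U :: "'a cpsh"
  assumes cl: "chain_colimit N Xs ss Ms ts U xs ms"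
    and X: "\<And>k. enat k \<le> N \<Longrightarrow> presheaf CC (Xs k)" and M: "\<And>k. enat k < N \<Longrightarrow> presheaf CC (Ms k)"
    and c: "c \<in> ob CC" and e: "e \<in> fob U c"
  shows "(\<exists>k x. enat k \<le> N \<and> x \<in> fob (Xs k) c \<and> e = xs k c x) \<or> (\<exists>k y. enat k < N \<and> y \<in> fob (Ms k) c \<and> e = ms k c y)"
proof -
  have cc: "chain_cocone N Xs ss Ms ts U xs ms" using cl unfolding chain_colimit_def by blast
  note K = chain_coconeD[OF cc]
  define S where "S c = (\<Union>k\<in>{k. enat k \<le> N}. xs k c ` fob (Xs k) c) \<union> (\<Union>k\<in>{k. enat k < N}. ms k c ` fob (Ms k) c)" for c
  have Sub: "S c \<subseteq> fob U c" if "c \<in> ob CC" for c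
    using that nat_trans_in[OF K(2)] nat_trans_in[OF K(3)] by (auto simp: S_def)
  let ?Q = "sub_psh U S"
  have Q: "presheaf CC ?Q"
  proof (rule presheaf_sub_psh[OF K(1) Sub])
    fix a b f x assume *: "a \<in> ob CC" "b \<in> ob CC" "f \<in> hom CC a b" "x \<in> S b"
    then consider k y where "enat k \<le> N" "y \<in> fob (Xs k) b" "x = xs k b y"
      | k y where "enat k < N" "y \<in> fob (Ms k) b" "x = ms k b y"
      by (auto simp: S_def)
    then show "far U a b f x \<in> S a"
    proof cases
      case 1
      then show ?thesis
        using nat_trans_natural[OF K(2) *(1-3)] presheaf_far_in[OF X *(1-3)] unfolding S_def by force
    next
      case 2
      then show ?thesis
        using nat_trans_natural[OF K(3) *(1-3)] presheaf_far_in[OF M *(1-3)] unfolding S_def by force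
    qed
  qed
  have x: "xs k \<in> nat_trans CC (Xs k) ?Q" if "enat k \<le> N" for k
    by (rule nat_trans_codom[OF K(2)[OF that]]) (use that in \<open>auto simp: S_def\<close>)
  have m: "ms k \<in> nat_trans CC (Ms k) ?Q" if "enat k < N" for k
    by (rule nat_trans_codom[OF K(3)[OF that]]) (use that in \<open>auto simp: S_def\<close>)
  have "chain_cocone N Xs ss Ms ts ?Q xs ms"
    by (rule chain_coconeI[OF Q]) (simp_all add: x m K(4,5))
  then obtain h where h: "h \<in> nat_trans CC U ?Q" "\<forall>k. enat k \<le> N \<longrightarrow> nt_comp CC (Xs k) h (xs k) = xs k"
      "\<forall>k. enat k < N \<longrightarrow> nt_comp CC (Ms k) h (ms k) = ms k"
    using cl unfolding chain_colimit_def by blast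
  have h': "h \<in> nat_trans CC U U"
    by (rule nat_trans_codom[OF h(1)]) (use nat_trans_in[OF h(1)] Sub in auto)
  have "nt_comp CC (Xs k) (nt_id CC U) (xs k) = xs k" if "enat k \<le> N" for k
    by (rule nt_comp_eq_ntI[OF K(2)[OF that]]) (simp add: nat_trans_in[OF K(2)[OF that]])
  moreover have "nt_comp CC (Ms k) (nt_id CC U) (ms k) = ms k" if "enat k < N" for k
    by (rule nt_comp_eq_ntI[OF K(3)[OF that]]) (simp add: nat_trans_in[OF K(3)[OF that]])
  ultimately have "h = nt_id CC U"
    using cl h(2,3) h' nt_id_in[OF K(1)] cc unfolding chain_colimit_def by blast
  then have "e \<in> S c" using nat_trans_in[OF h(1) c e] c e by simp
  then show ?thesis by (auto simp: S_def)
qed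

text \<open>Elements are tagged by birth: 0 for the initial position, \<open>Suc k\<close> for the
  move with index \<open>k\<close>. The presheaf of tagged elements is then carried into
  \<open>'a\<close>.\<close>

lemma chain_colimit_exists:
  fixes Xs :: "nat \<Rightarrow> 'a::infinite cpsh"
  assumes zz: "zigzag N Xs ss Ms ts"
    and cX: "\<And>c. c \<in> ob CC \<Longrightarrow> countable (fob (Xs 0) c)"
    and cM: "\<And>k c. enat k < N \<Longrightarrow> c \<in> ob CC \<Longrightarrow> countable (fob (Ms k) c)"
  obtains U xs ms b where "chain_colimit N Xs ss Ms ts U xs ms"
    "birth_map N Xs ss Ms xs ms b" "birth_cover N Xs ss Ms U xs ms"
proof -
  note Z = zigzagD[OF zz]
  define step where "step k r c y = (if y \<in> ss k c ` fob (Xs k) c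
     then r c (inv_into (fob (Xs k) c) (ss k c) y) else (Suc k, y))"
    for k and r :: "cobj \<Rightarrow> 'a \<Rightarrow> nat \<times> 'a" and c y
  \<comment> \<open>\<open>rho k\<close> and \<open>mu k\<close> send an element of a position or of
    a move to its birth record, tracing it backwards until it is fresh or initial.\<close>
  define rho where "rho = rec_nat (\<lambda>c x. (0, x)) (\<lambda>k r c x. step k r c (ts k c x))"
  define mu where "mu k = step k (rho k)" for k
  have rho0: "rho 0 c x = (0, x)" for c x by (simp add: rho_def)
  have rhoS: "rho (Suc k) c x = mu k c (ts k c x)" for k c x by (simp add: rho_def mu_def)
  have mus: "mu k c (ss k c x) = rho k c x" if "c \<in> ob CC" "enat k < N" "x \<in> fob (Xs k) c" for k c x
    using Z(4)[OF that(2)] that by (simp add: mu_def step_def nt_mono_def inv_into_f_f)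
  have muf: "mu k c y = (Suc k, y)" if "y \<notin> ss k c ` fob (Xs k) c" for k c y
    using that by (simp add: mu_def step_def)
  \<comment> \<open>The restriction of an element born in a move is computed in that move and may be
    older than the element, hence the renormalisation by \<open>mu\<close>.\<close>
  define Q :: "(nat \<times> 'a) cpsh" where
    "Q = \<lparr>fob = \<lambda>c. Pair 0 ` fob (Xs 0) c \<union> (\<Union>k\<in>{k. enat k < N}. Pair (Suc k) ` fresh_elts Xs ss Ms k c),
      far = \<lambda>c d f (k, y). case k of 0 \<Rightarrow> (0, far (Xs 0) c d f y) | Suc j \<Rightarrow> mu j c (far (Ms j) c d f y)\<rparr>"
  have fo: "fob Q c = Pair 0 ` fob (Xs 0) c \<union> (\<Union>k\<in>{k. enat k < N}. Pair (Suc k) ` fresh_elts Xs ss Ms k c)" for c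
    by (simp add: Q_def)
  have fa: "far Q c d f (0, x) = (0, far (Xs 0) c d f x)" "far Q c d f (Suc k, y) = mu k c (far (Ms k) c d f y)"
    for c d f k x y by (simp_all add: Q_def)
  have N0: "enat 0 \<le> N" by (simp add: zero_enat_def[symmetric])
  have mu_step_in: "mu k c y \<in> fob Q c"
    if "c \<in> ob CC" "enat k < N" "y \<in> fob (Ms k) c" "\<And>x. x \<in> fob (Xs k) c \<Longrightarrow> rho k c x \<in> fob Q c" for k c y
  proof (cases "y \<in> ss k c ` fob (Xs k) c")
    case True then show ?thesis using that(4) mus[OF that(1,2)] by auto
  next
    case False then show ?thesis using that(2,3) by (auto simp: fo muf)
  qed
  have rho_in: "rho k c x \<in> fob Q c" if "c \<in> ob CC" "enat k \<le> N" "x \<in> fob (Xs k) c" for k c x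
    using that(2,3)
  proof (induction k arbitrary: x)
    case 0 then show ?case by (simp add: rho0 fo)
  next
    case (Suc k)
    then have k: "enat k < N" by (simp add: Suc_ile_eq)
    show ?case unfolding rhoS
      by (rule mu_step_in[OF that(1) k nat_trans_in[OF Z(5)[OF k] that(1) Suc.prems(2)] Suc.IH]) (use k in auto)
  qed
  have mu_in: "mu k c y \<in> fob Q c" if "c \<in> ob CC" "enat k < N" "y \<in> fob (Ms k) c" for k c y
    by (rule mu_step_in[OF that rho_in]) (use that in auto)
  have mu_step_nat: "mu k c (far (Ms k) c d f y) = far Q c d f (mu k d y)"
    if c: "c \<in> ob CC" "d \<in> ob CC" "f \<in> hom CC c d" and k: "enat k < N" and y: "y \<in> fob (Ms k) d"
      and IH: "\<And>x. x \<in> fob (Xs k) d \<Longrightarrow> rho k c (far (Xs k) c d f x) = far Q c d f (rho k d x)" for k c d f y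
  proof (cases "y \<in> ss k d ` fob (Xs k) d")
    case True
    then obtain x where x: "x \<in> fob (Xs k) d" "y = ss k d x" by blast
    have Xk: "presheaf CC (Xs k)" using Z(1) k by simp
    show ?thesis
      using x c k IH[OF x(1)]
      by (simp add: nat_trans_natural[OF Z(3)[OF k], symmetric] mus presheaf_far_in[OF Xk])
  next
    case False then show ?thesis by (simp add: muf fa)
  qed
  have rho_nat: "rho k c (far (Xs k) c d f x) = far Q c d f (rho k d x)"
    if c: "c \<in> ob CC" "d \<in> ob CC" "f \<in> hom CC c d" and k: "enat k \<le> N" "x \<in> fob (Xs k) d" for k c d f x
    using k
  proof (induction k arbitrary: x)
    case 0 then show ?case by (simp add: rho0 fa)
  next
    case (Suc k)
    then have k: "enat k < N" by (simp add: Suc_ile_eq)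
    have "mu k c (far (Ms k) c d f (ts k d x)) = far Q c d f (mu k d (ts k d x))"
      by (rule mu_step_nat[OF c k nat_trans_in[OF Z(5)[OF k] c(2) Suc.prems(2)] Suc.IH]) (use k in auto)
    then show ?case using c Suc.prems(2) by (simp add: rhoS nat_trans_natural[OF Z(5)[OF k]])
  qed
  have mu_nat: "mu k c (far (Ms k) c d f y) = far Q c d f (mu k d y)"
    if "c \<in> ob CC" "d \<in> ob CC" "f \<in> hom CC c d" "enat k < N" "y \<in> fob (Ms k) d" for k c d f y
    by (rule mu_step_nat[OF that rho_nat]) (use that in auto)
  have Q: "presheaf CC Q"
  proof (rule presheafI, goal_cases)
    case (1 a b f x)
    then show ?case
      using mu_in presheaf_far_in[OF Z(1)[OF N0]] presheaf_far_in[OF Z(2)]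
      by (auto simp: fo[of b] fa) (auto simp: fo)
  next
    case (2 a x)
    then show ?case
      using presheaf_far_id[OF Z(1)[OF N0]] presheaf_far_id[OF Z(2)] by (auto simp: fo fa muf)
  next
    case (3 a b c f g x)
    then show ?case
      using presheaf_far_cmp[OF Z(1)[OF N0]] presheaf_far_cmp[OF Z(2)] presheaf_far_in[OF Z(2)]
      by (auto simp: fo fa mu_nat)
  qed
  have "countable (fob Q c)" if "c \<in> ob CC" for c
    using that cX cM by (auto simp: fo)
  then obtain U :: "'a cpsh" and \<phi> where U: "presheaf CC U" and \<phi>: "\<phi> \<in> nat_trans CC Q U"
    and \<phi>i: "nt_mono CC Q \<phi>" and \<phi>s: "\<And>c. c \<in> ob CC \<Longrightarrow> \<phi> c ` fob Q c = fob U c"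
    using presheaf_transport[OF Q] by metis
  define xs where "xs k = mk_nt CC (Xs k) (\<lambda>c x. \<phi> c (rho k c x))" for k
  define ms where "ms k = mk_nt CC (Ms k) (\<lambda>c x. \<phi> c (mu k c x))" for k
  have cc: "chain_cocone N Xs ss Ms ts U xs ms"
  proof (rule chain_coconeI[OF U])
    show "xs k \<in> nat_trans CC (Xs k) U" if "enat k \<le> N" for k
      unfolding xs_def
      by (rule mk_nt_in[OF Z(1)[OF that]])
        (simp_all add: nat_trans_in[OF \<phi>] nat_trans_natural[OF \<phi>] rho_in rho_nat that)
    show "ms k \<in> nat_trans CC (Ms k) U" if "enat k < N" for k
      unfolding ms_def
      by (rule mk_nt_in[OF Z(2)[OF that]])
        (simp_all add: nat_trans_in[OF \<phi>] nat_trans_natural[OF \<phi>] mu_in mu_nat that)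
    show "ms k c (ss k c x) = xs k c x" if "enat k < N" "c \<in> ob CC" "x \<in> fob (Xs k) c" for k c x
      using that by (simp add: ms_def xs_def mus nat_trans_in[OF Z(3)])
    show "ms k c (ts k c x) = xs (Suc k) c x" if "enat k < N" "c \<in> ob CC" "x \<in> fob (Xs (Suc k)) c" for k c x
      using that by (simp add: ms_def xs_def rhoS nat_trans_in[OF Z(5)])
  qed
  define b where "b c = inv_into (fob Q c) (\<phi> c)" for c
  have bi: "b c (\<phi> c q) = q" if "c \<in> ob CC" "q \<in> fob Q c" for c q
    using that \<phi>i by (simp add: b_def nt_mono_def inv_into_f_f)
  have bm: "birth_map N Xs ss Ms xs ms b"
    unfolding birth_map_def
  proof (intro ballI conjI allI impI)
    fix c assume c: "c \<in> ob CC"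
    show "b c (xs 0 c x) = (0, x)" if "x \<in> fob (Xs 0) c" for x
      using rho_in[OF c N0 that] that c by (simp add: xs_def bi rho0)
    show "b c (ms k c y) = (Suc k, y)" if "enat k < N" "y \<in> fresh_elts Xs ss Ms k c" for k y
      using mu_in[OF c that(1), of y] that c muf[of y k c] bi[OF c, of "(Suc k, y)"] by (simp add: ms_def)
  qed
  have cov: "birth_cover N Xs ss Ms U xs ms"
    unfolding birth_cover_def
  proof (intro ballI)
    fix c e assume c: "c \<in> ob CC" and e: "e \<in> fob U c"
    then obtain q where q: "q \<in> fob Q c" "e = \<phi> c q" using \<phi>s by blast
    consider x where "x \<in> fob (Xs 0) c" "q = (0, x)"
      | k y where "enat k < N" "y \<in> fresh_elts Xs ss Ms k c" "q = (Suc k, y)"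
      using q(1) by (auto simp: fo)
    then show "(\<exists>x\<in>fob (Xs 0) c. e = xs 0 c x) \<or>
        (\<exists>k y. enat k < N \<and> y \<in> fresh_elts Xs ss Ms k c \<and> e = ms k c y)"
    proof cases
      case 1
      then show ?thesis using q c by (intro disjI1 bexI[of _ x]) (simp_all add: xs_def rho0)
    next
      case 2
      then show ?thesis using q c by (intro disjI2 exI[of _ k] exI[of _ y]) (simp add: ms_def muf)
    qed
  qed
  show thesis using that chain_colimit_criterion[OF zz cc bm cov] bm cov .
qed

text \<open>The birth map is pulled back along the comparison map \<open>h\<close> to the explicit
  colimit. The cover is proved inside \<open>U\<close>, by induction along the zigzag from joint
  surjectivity of the cocone.\<close>

lemma chain_colimit_birth:
  fixes U :: "'a::infinite cpsh"
  assumes zz: "zigzag N Xs ss Ms ts" and cl: "chain_colimit N Xs ss Ms ts U xs ms"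
    and cX: "\<And>c. c \<in> ob CC \<Longrightarrow> countable (fob (Xs 0) c)"
    and cM: "\<And>k c. enat k < N \<Longrightarrow> c \<in> ob CC \<Longrightarrow> countable (fob (Ms k) c)"
  obtains b where "birth_map N Xs ss Ms xs ms b" "birth_cover N Xs ss Ms U xs ms"
proof -
  note Z = zigzagD[OF zz]
  have cc: "chain_cocone N Xs ss Ms ts U xs ms" using cl unfolding chain_colimit_def by blast
  note K = chain_coconeD[OF cc]
  obtain U' :: "'a cpsh" and xs' ms' b where cl': "chain_colimit N Xs ss Ms ts U' xs' ms'"
    and bm: "birth_map N Xs ss Ms xs' ms' b"
    using chain_colimit_exists[OF zz cX cM] by metis
  have "chain_cocone N Xs ss Ms ts U' xs' ms'" using cl' unfolding chain_colimit_def by blast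
  then obtain h where h: "\<forall>k. enat k \<le> N \<longrightarrow> nt_comp CC (Xs k) h (xs k) = xs' k"
      "\<forall>k. enat k < N \<longrightarrow> nt_comp CC (Ms k) h (ms k) = ms' k"
    using cl unfolding chain_colimit_def by blast
  have hx: "h c (xs 0 c x) = xs' 0 c x" if "c \<in> ob CC" "x \<in> fob (Xs 0) c" for c x
    using h(1) nt_comp_app[OF that, of h "xs 0"] zero_enat_def by (metis zero_le)
  have hm: "h c (ms k c y) = ms' k c y" if "c \<in> ob CC" "y \<in> fob (Ms k) c" "enat k < N" for c k y
    using h(2) nt_comp_app[OF that(1,2), of h "ms k"] that(3) by metis
  have 1: "birth_map N Xs ss Ms xs ms (\<lambda>c e. b c (h c e))"
    using bm unfolding birth_map_def by (simp add: hx hm)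
  define G where "G c e \<longleftrightarrow> (\<exists>x\<in>fob (Xs 0) c. e = xs 0 c x) \<or>
      (\<exists>k y. enat k < N \<and> y \<in> fresh_elts Xs ss Ms k c \<and> e = ms k c y)" for c e
  have step: "G c (ms k c y)"
    if "c \<in> ob CC" "enat k < N" "y \<in> fob (Ms k) c" "\<And>x. x \<in> fob (Xs k) c \<Longrightarrow> G c (xs k c x)" for c k y
  proof (cases "y \<in> ss k c ` fob (Xs k) c")
    case True
    then obtain x where "x \<in> fob (Xs k) c" "y = ss k c x" by blast
    then show ?thesis using that K(4) by simp
  next
    case False then show ?thesis using that(2,3) unfolding G_def by blast
  qed
  have Gx: "G c (xs k c x)" if "c \<in> ob CC" "enat k \<le> N" "x \<in> fob (Xs k) c" for c k x
    using that(2,3)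
  proof (induction k arbitrary: x)
    case 0 then show ?case unfolding G_def by blast
  next
    case (Suc k)
    then have k: "enat k < N" by (simp add: Suc_ile_eq)
    have "G c (ms k c (ts k c x))"
      by (rule step[OF that(1) k nat_trans_in[OF Z(5)[OF k] that(1) Suc.prems(2)] Suc.IH]) (use k in auto)
    then show ?case using K(5) k that(1) Suc.prems(2) by simp
  qed
  have Gm: "G c (ms k c y)" if "c \<in> ob CC" "enat k < N" "y \<in> fob (Ms k) c" for c k y
    by (rule step[OF that Gx]) (use that in auto)
  have "G c e" if "c \<in> ob CC" "e \<in> fob U c" for c e
    using chain_colimit_surj[OF cl Z(1,2) that] Gx[OF that(1)] Gm[OF that(1)] by blast
  then have 2: "birth_cover N Xs ss Ms U xs ms"
    unfolding birth_cover_def G_def by blast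
  show thesis using that 1 2 .
qed

section \<open>When elements of a zigzag are born and how long they stay\<close>

context
  fixes N Xs ss Ms ts and U :: "'a cpsh" and xs ms b
  assumes zz: "zigzag N Xs ss Ms ts" and cc: "chain_cocone N Xs ss Ms ts U xs ms"
    and bm: "birth_map N Xs ss Ms xs ms b"
begin

lemma birth_stage_le:
  assumes "c \<in> ob CC" "enat k \<le> N" "x \<in> fob (Xs k) c"
  shows "fst (b c (xs k c x)) \<le> k"
  using assms(2,3)
proof (induction k arbitrary: x)
  case 0 then show ?case using birth_mapD(1)[OF bm assms(1)] by simp
next
  case (Suc k)
  then have k: "enat k < N" by (simp add: Suc_ile_eq)
  then have k': "enat k \<le> N" by simp
  have y: "ts k c x \<in> fob (Ms k) c" by (rule nat_trans_in[OF zigzagD(5)[OF zz k] assms(1) Suc.prems(2)])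
  have e: "xs (Suc k) c x = ms k c (ts k c x)" using chain_coconeD(5)[OF cc k assms(1) Suc.prems(2)] by simp
  show ?case
  proof (cases "ts k c x \<in> ss k c ` fob (Xs k) c")
    case True
    then obtain x' where "x' \<in> fob (Xs k) c" "ts k c x = ss k c x'" by blast
    then show ?thesis using Suc.IH[OF k'] chain_coconeD(4)[OF cc k assms(1)] e by (simp add: le_SucI)
  next
    case False
    then have "ts k c x \<in> fresh_elts Xs ss Ms k c" using y by blast
    then show ?thesis using birth_mapD(2)[OF bm assms(1) k] e by simp
  qed
qed

text \<open>Lifetimes have no gaps: something present at \<open>k\<close>, missing at
  \<open>Suc k\<close> and present again at \<open>l\<close> would be fresh in a later move,
  contradicting its birth at stage \<open>k\<close> or before. This is what forbids a second move by
  a player already consumed.\<close>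

lemma stage_elt_persists:
  assumes c: "c \<in> ob CC" and k: "k < l" "enat l \<le> N" and x: "x \<in> fob (Xs k) c" and x': "x' \<in> fob (Xs l) c"
    and eq: "xs k c x = xs l c x'"
  shows "\<exists>y\<in>fob (Xs (Suc k)) c. xs (Suc k) c y = xs k c x"
  using k x' eq
proof (induction l arbitrary: x')
  case (Suc l)
  then have l: "enat l < N" by (simp add: Suc_ile_eq)
  show ?case
  proof (cases "l = k")
    case True then show ?thesis using Suc.prems by auto
  next
    case False
    have y: "ts l c x' \<in> fob (Ms l) c" by (rule nat_trans_in[OF zigzagD(5)[OF zz l] c Suc.prems(3)])
    have e: "xs k c x = ms l c (ts l c x')" using chain_coconeD(5)[OF cc l c Suc.prems(3)] Suc.prems(4) by simp
    have kN: "enat k \<le> N" using Suc.prems(1) l by (meson enat_ord_simps(1) le_less_trans less_Suc_eq_le less_imp_le)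
    have "ts l c x' \<in> ss l c ` fob (Xs l) c"
    proof (rule ccontr)
      assume "ts l c x' \<notin> ss l c ` fob (Xs l) c"
      then have "ts l c x' \<in> fresh_elts Xs ss Ms l c" using y by blast
      then have "fst (b c (xs k c x)) = Suc l" using birth_mapD(2)[OF bm c l] e by simp
      then show False using birth_stage_le[OF c kN x] Suc.prems(1) by simp
    qed
    then obtain x'' where x'': "x'' \<in> fob (Xs l) c" "ts l c x' = ss l c x''" by blast
    have "xs k c x = xs l c x''" using e x'' chain_coconeD(4)[OF cc l c x''(1)] by simp
    then show ?thesis using Suc.IH[OF _ _ x''(1)] False Suc.prems(1) l by simp
  qed
qed simp

text \<open>Positions and moves are handled in one induction. In a move, old and fresh elements
  cannot be confused, since their birth stages are at most \<open>k\<close> and equal to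
  \<open>Suc k\<close>; fresh ones are told apart by the second component of \<open>b\<close>, old
  ones by induction.\<close>

lemma stage_inj:
  assumes tm: "\<And>k. enat k < N \<Longrightarrow> nt_mono CC (Xs (Suc k)) (ts k)" and c: "c \<in> ob CC"
  shows "enat k \<le> N \<Longrightarrow> inj_on (xs k c) (fob (Xs k) c)"
    and "enat k < N \<Longrightarrow> inj_on (ms k c) (fob (Ms k) c)"
proof -
  have step: "inj_on (ms k c) (fob (Ms k) c)" if k: "enat k < N" and IH: "inj_on (xs k c) (fob (Xs k) c)" for k
  proof (rule inj_onI)
    fix y y' assume y: "y \<in> fob (Ms k) c" and y': "y' \<in> fob (Ms k) c" and eq: "ms k c y = ms k c y'"
    have old: "ms k c (ss k c x) = xs k c x" "fst (b c (xs k c x)) \<le> k" if "x \<in> fob (Xs k) c" for x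
      using chain_coconeD(4)[OF cc k c that] birth_stage_le[OF c _ that] k by auto
    have new: "b c (ms k c z) = (Suc k, z)" if "z \<in> fob (Ms k) c" "z \<notin> ss k c ` fob (Xs k) c" for z
      using birth_mapD(2)[OF bm c k] that by blast
    show "y = y'"
    proof (cases "y \<in> ss k c ` fob (Xs k) c"; cases "y' \<in> ss k c ` fob (Xs k) c")
      assume "y \<in> ss k c ` fob (Xs k) c" "y' \<in> ss k c ` fob (Xs k) c"
      then obtain x x' where "x \<in> fob (Xs k) c" "y = ss k c x" "x' \<in> fob (Xs k) c" "y' = ss k c x'" by blast
      then show ?thesis using eq inj_onD[OF IH, of x x'] old(1)[of x] old(1)[of x'] by simp
    next
      assume *: "y \<in> ss k c ` fob (Xs k) c" "y' \<notin> ss k c ` fob (Xs k) c"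
      then obtain x where x: "x \<in> fob (Xs k) c" "y = ss k c x" by blast
      show ?thesis using new[OF y' *(2)] old[OF x(1)] eq x(2) by simp
    next
      assume *: "y \<notin> ss k c ` fob (Xs k) c" "y' \<in> ss k c ` fob (Xs k) c"
      then obtain x where x: "x \<in> fob (Xs k) c" "y' = ss k c x" by blast
      show ?thesis using new[OF y *(1)] old[OF x(1)] eq x(2) by simp
    next
      assume *: "y \<notin> ss k c ` fob (Xs k) c" "y' \<notin> ss k c ` fob (Xs k) c"
      have "y = snd (b c (ms k c y))" by (simp only: new[OF y *(1)] snd_conv)
      also have "\<dots> = y'" by (simp only: eq new[OF y' *(2)] snd_conv)
      finally show ?thesis .
    qed
  qed
  show xsi: "inj_on (xs k c) (fob (Xs k) c)" if "enat k \<le> N" for k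
    using that
  proof (induction k)
    case 0
    show ?case by (rule inj_on_inverseI[of _ "\<lambda>e. snd (b c e)"]) (simp add: birth_mapD(1)[OF bm c])
  next
    case (Suc k)
    then have k: "enat k < N" by (simp add: Suc_ile_eq)
    have m: "inj_on (ms k c) (fob (Ms k) c)" by (rule step[OF k Suc.IH]) (use k in simp)
    show ?case
    proof (rule inj_onI)
      fix x x' assume x: "x \<in> fob (Xs (Suc k)) c" "x' \<in> fob (Xs (Suc k)) c" "xs (Suc k) c x = xs (Suc k) c x'"
      have t: "ts k c x \<in> fob (Ms k) c" "ts k c x' \<in> fob (Ms k) c"
        using nat_trans_in[OF zigzagD(5)[OF zz k] c] x by blast+
      have "ts k c x = ts k c x'"
        by (rule inj_onD[OF m _ t])
          (simp only: chain_coconeD(5)[OF cc k c x(1)] chain_coconeD(5)[OF cc k c x(2)] x(3))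
      then show "x = x'" using nt_mono_inj[OF tm[OF k] c] x by blast
    qed
  qed
  show "inj_on (ms k c) (fob (Ms k) c)" if "enat k < N" for k
    by (rule step[OF that xsi]) (use that in simp)
qed

end

subsection \<open>The base category\<close>

instance cobj :: countable by countable_datatype
instance gen :: countable by countable_datatype

abbreviation cpath :: "cobj \<Rightarrow> gen list \<Rightarrow> cobj \<Rightarrow> bool" where
  "cpath \<equiv> path {c. valid_obj c} gen_arr"

abbreviation cpath_cong :: "cobj \<Rightarrow> cobj \<Rightarrow> gen list \<Rightarrow> gen list \<Rightarrow> bool" where
  "cpath_cong \<equiv> path_cong {c. valid_obj c} gen_arr gen_rel"

lemma ob_CC: "ob CC = {c. valid_obj c}"
  by (simp add: CC_def presented_cat_def)

lemma category_CC: "category CC"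
  unfolding CC_def by (rule category_presented_cat)

lemma hom_CC: "hom CC a b = arw a b ` {p. cpath a p b}"
  unfolding CC_def arw_def by (auto simp: hom_presented_iff)

lemma arw_in_hom: "cpath a p b \<Longrightarrow> arw a b p \<in> hom CC a b"
  by (auto simp: hom_CC)

lemma cmp_arw: "cpath a p b \<Longrightarrow> cpath b q c \<Longrightarrow> cmp CC a b c (arw b c q) (arw a b p) = arw a c (p @ q)"
  unfolding CC_def arw_def by (rule cmp_presented)

lemma idn_CC: "idn CC a = arw a a []"
  by (simp add: CC_def arw_def presented_cat_def)

lemma path_snoc_iff:
  "path V G a (p @ [e]) c \<longleftrightarrow> (\<exists>b. path V G a p b \<and> b \<in> V \<and> G e b c \<and> c \<in> V)"
proof (induction p arbitrary: a)
  case Nil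
  show ?case by (auto elim: path.cases intro: path.intros)
next
  case (Cons x p)
  have "path V G a (x # q) d \<longleftrightarrow> a \<in> V \<and> (\<exists>b. G x a b \<and> path V G b q d)" for q d
    by (auto elim: path.cases intro: path.intros)
  then show ?case using Cons by auto
qed

lemma path_target: "path V G a p b \<Longrightarrow> a \<in> V \<and> b \<in> V"
  by (induction rule: path.induct) auto

text \<open>Paths are taken apart at their last edge: in the graph at hand every object has finitely
  many incoming edges, all known explicitly, while a channel has infinitely many outgoing
  ones.\<close>

lemma path_last_cases:
  "path V G a p c \<longleftrightarrow> c \<in> V \<and> (p = [] \<and> a = c \<or> (\<exists>q e b. p = q @ [e] \<and> path V G a q b \<and> G e b c))"
proof (cases p rule: rev_cases)
  case Nil
  then show ?thesis by (auto elim: path.cases intro: path.intros)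
next
  case (snoc q e)
  then show ?thesis using path_target[of V G a q] by (auto simp: path_snoc_iff)
qed

lemma gen_arr_into:
  "gen_arr g b Star \<longleftrightarrow> False"
  "gen_arr g b (Player n) \<longleftrightarrow> b = Star \<and> (\<exists>i. 1 \<le> i \<and> i \<le> n \<and> g = GD n i)"
  "gen_arr g b (Tick n) \<longleftrightarrow> b = Player n \<and> (g = GS (Tick n) \<or> g = GT (Tick n))"
  "gen_arr g b (ParaL n) \<longleftrightarrow> b = Player n \<and> (g = GS (ParaL n) \<or> g = GT (ParaL n))"
  "gen_arr g b (ParaR n) \<longleftrightarrow> b = Player n \<and> (g = GS (ParaR n) \<or> g = GT (ParaR n))"
  "gen_arr g b (Nu n) \<longleftrightarrow> b = Player n \<and> g = GS (Nu n) \<or> b = Player (Suc n) \<and> g = GT (Nu n)"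
  "gen_arr g b (Para n) \<longleftrightarrow> b = ParaL n \<and> g = GL n \<or> b = ParaR n \<and> g = GR n"
  "gen_arr g b (IotaP n i) \<longleftrightarrow> 1 \<le> i \<and> i \<le> n \<and> b = Player n \<and> (g = GS (IotaP n i) \<or> g = GT (IotaP n i))"
  "gen_arr g b (IotaN n i) \<longleftrightarrow> 1 \<le> i \<and> i \<le> n \<and> b = Player n \<and> (g = GS (IotaN n i) \<or> g = GT (IotaN n i))"
  "gen_arr g b (Tau n i m j) \<longleftrightarrow> 1 \<le> i \<and> i \<le> n \<and> 1 \<le> j \<and> j \<le> m \<and>
     (b = IotaP n i \<and> g = GEps n i m j \<or> b = IotaN m j \<and> g = GRho n i m j)"
  by (auto elim!: gen_arr.cases basic.cases intro: gen_arr.intros basic.intros simp del: One_nat_def)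

lemma cpath_Star: "cpath a p Star \<longleftrightarrow> a = Star \<and> p = []"
  by (subst path_last_cases) (auto simp: gen_arr_into)

lemma cpath_Player: "cpath a p (Player n) \<longleftrightarrow>
    a = Player n \<and> p = [] \<or> a = Star \<and> (\<exists>i. 1 \<le> i \<and> i \<le> n \<and> p = [GD n i])"
  by (subst path_last_cases) (auto simp: gen_arr_into cpath_Star)

lemma cpath_Tick: "cpath a p (Tick n) \<longleftrightarrow> a = Tick n \<and> p = [] \<or>
    (\<exists>q. cpath a q (Player n) \<and> (p = q @ [GS (Tick n)] \<or> p = q @ [GT (Tick n)]))"
  by (subst path_last_cases) (auto simp: gen_arr_into)

lemma cpath_ParaL: "cpath a p (ParaL n) \<longleftrightarrow> a = ParaL n \<and> p = [] \<or>
    (\<exists>q. cpath a q (Player n) \<and> (p = q @ [GS (ParaL n)] \<or> p = q @ [GT (ParaL n)]))"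
  by (subst path_last_cases) (auto simp: gen_arr_into)

lemma cpath_ParaR: "cpath a p (ParaR n) \<longleftrightarrow> a = ParaR n \<and> p = [] \<or>
    (\<exists>q. cpath a q (Player n) \<and> (p = q @ [GS (ParaR n)] \<or> p = q @ [GT (ParaR n)]))"
  by (subst path_last_cases) (auto simp: gen_arr_into)

lemma cpath_Nu: "cpath a p (Nu n) \<longleftrightarrow> a = Nu n \<and> p = [] \<or>
    (\<exists>q. cpath a q (Player n) \<and> p = q @ [GS (Nu n)] \<or> cpath a q (Player (Suc n)) \<and> p = q @ [GT (Nu n)])"
  by (subst path_last_cases) (auto simp: gen_arr_into)

lemma cpath_IotaP: "cpath a p (IotaP n i) \<longleftrightarrow> 1 \<le> i \<and> i \<le> n \<and> (a = IotaP n i \<and> p = [] \<or>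
    (\<exists>q. cpath a q (Player n) \<and> (p = q @ [GS (IotaP n i)] \<or> p = q @ [GT (IotaP n i)])))"
  by (subst path_last_cases) (auto simp: gen_arr_into)

lemma cpath_IotaN: "cpath a p (IotaN n i) \<longleftrightarrow> 1 \<le> i \<and> i \<le> n \<and> (a = IotaN n i \<and> p = [] \<or>
    (\<exists>q. cpath a q (Player n) \<and> (p = q @ [GS (IotaN n i)] \<or> p = q @ [GT (IotaN n i)])))"
  by (subst path_last_cases) (auto simp: gen_arr_into)

lemma cpath_Para: "cpath a p (Para n) \<longleftrightarrow> a = Para n \<and> p = [] \<or>
    (\<exists>q. cpath a q (ParaL n) \<and> p = q @ [GL n] \<or> cpath a q (ParaR n) \<and> p = q @ [GR n])"
  by (subst path_last_cases) (auto simp: gen_arr_into)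

lemma cpath_Tau: "cpath a p (Tau n i m j) \<longleftrightarrow> 1 \<le> i \<and> i \<le> n \<and> 1 \<le> j \<and> j \<le> m \<and> (a = Tau n i m j \<and> p = [] \<or>
    (\<exists>q. cpath a q (IotaP n i) \<and> p = q @ [GEps n i m j] \<or> cpath a q (IotaN m j) \<and> p = q @ [GRho n i m j]))"
  by (subst path_last_cases) (auto simp: gen_arr_into)

lemmas cpath_into = cpath_Star cpath_Player cpath_Tick cpath_ParaL cpath_ParaR cpath_Nu cpath_IotaP
  cpath_IotaN cpath_Para cpath_Tau

text \<open>The graph has four levels: the channel, the players, the basic moves, and
  \<open>Para\<close> with \<open>Tau\<close>. Incoming edges are finite in number, so finiteness
  climbs level by level.\<close>

lemma finite_cpath: "finite {(a, p). cpath a p c}"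
proof -
  have step: "finite {(a, p). cpath a p c}"
    if "finite {(g, b). gen_arr g b c}" "\<And>g b. gen_arr g b c \<Longrightarrow> finite {(a, p). cpath a p b}" for c
  proof (rule finite_subset)
    show "{(a, p). cpath a p c} \<subseteq> {(c, [])} \<union>
        (\<Union>(g, b)\<in>{(g, b). gen_arr g b c}. (\<lambda>(a, q). (a, q @ [g])) ` {(a, q). cpath a q b})"
      by (subst path_last_cases) auto
    show "finite ({(c, [])} \<union>
        (\<Union>(g, b)\<in>{(g, b). gen_arr g b c}. (\<lambda>(a, q). (a, q @ [g])) ` {(a, q). cpath a q b}))"
      using that by auto
  qed
  have fin: "finite {(g, b). gen_arr g b c}" for c
  proof (rule finite_subset)
    show "{(g, b). gen_arr g b c} \<subseteq>
      (case c of Star \<Rightarrow> {} | Player n \<Rightarrow> (\<lambda>i. (GD n i, Star)) ` {..n}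
       | Nu n \<Rightarrow> {(GS c, Player n), (GT c, Player (Suc n))}
       | Tick n \<Rightarrow> {(GS c, Player n), (GT c, Player n)}
       | ParaL n \<Rightarrow> {(GS c, Player n), (GT c, Player n)}
       | ParaR n \<Rightarrow> {(GS c, Player n), (GT c, Player n)}
       | IotaP n i \<Rightarrow> {(GS c, Player n), (GT c, Player n)}
       | IotaN n i \<Rightarrow> {(GS c, Player n), (GT c, Player n)}
       | Para n \<Rightarrow> {(GL n, ParaL n), (GR n, ParaR n)}
       | Tau n i m j \<Rightarrow> {(GEps n i m j, IotaP n i), (GRho n i m j, IotaN m j)})"
      by (cases c) (auto simp: gen_arr_into)
  qed (auto split: cobj.split)
  have 0: "finite {(a, p). cpath a p Star}" by (rule step[OF fin]) (auto simp: gen_arr_into)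
  have 1: "finite {(a, p). cpath a p (Player n)}" for n
    by (rule step[OF fin]) (use 0 in \<open>auto simp: gen_arr_into\<close>)
  have 2: "finite {(a, p). cpath a p c}" if "\<And>n. c \<noteq> Para n" "\<And>n i m j. c \<noteq> Tau n i m j" for c
    by (rule step[OF fin]) (use 0 1 that in \<open>cases c; auto simp: gen_arr_into\<close>)
  show ?thesis
    by (rule step[OF fin]) (use 2 in \<open>cases c; auto simp: gen_arr_into\<close>)
qed

lemma finite_hom_into: "finite (SIGMA a:ob CC. hom CC a c)"
proof (rule finite_subset)
  show "(SIGMA a:ob CC. hom CC a c) \<subseteq> (\<lambda>(a, p). (a, arw a c p)) ` {(a, p). cpath a p c}"
    by (auto simp: hom_CC)
qed (simp add: finite_cpath)

lemma countable_hom: "countable (hom CC a b)"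
  by (simp add: hom_CC)

section \<open>Normal forms of paths and the word problem of the base category\<close>

text \<open>The number of channels shared by the source and the target player of \<open>c\<close>.
  It bounds the channels whose two paths into \<open>c\<close> coincide, which for
  \<open>Nu n\<close> leaves out the created one. The default 0 belongs to objects without edges
  \<open>GS\<close> and \<open>GT\<close>.\<close>

fun src_arity :: "cobj \<Rightarrow> nat" where
  "src_arity (Tick n) = n"
| "src_arity (ParaL n) = n"
| "src_arity (ParaR n) = n"
| "src_arity (Nu n) = n"
| "src_arity (IotaP n i) = n"
| "src_arity (IotaN n i) = n"
| "src_arity _ = 0"

text \<open>
  The relations are oriented from target to source, from the right to the left branch of a fork, and
  from receiver to sender.
\<close>

definition nf_snoc :: "gen list \<Rightarrow> gen \<Rightarrow> gen list" where
  "nf_snoc v g = (case g of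
       GT c \<Rightarrow> (case v of [GD n i] \<Rightarrow> if i \<le> src_arity c then [GD (src_arity c) i, GS c] else v @ [g] | _ \<Rightarrow> v @ [g])
     | GR k \<Rightarrow> (if v = [GS (ParaR k)] then [GS (ParaL k), GL k] else
         (case v of [x, y] \<Rightarrow> if y = GS (ParaR k) then [x, GS (ParaL k), GL k] else v @ [g] | _ \<Rightarrow> v @ [g]))
     | GRho n i m j \<Rightarrow> (if v = [GD m j, GS (IotaN m j)] then [GD n i, GS (IotaP n i), GEps n i m j] else v @ [g])
     | _ \<Rightarrow> v @ [g])"

abbreviation nf :: "gen list \<Rightarrow> gen list" where
  "nf \<equiv> foldl nf_snoc []"

lemma basic_arity: "basic c n n' \<Longrightarrow> src_arity c = n \<and> n \<le> n' \<and> valid_obj c"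
  by (auto elim: basic.cases)

lemma gen_arr_valid: "gen_arr g a b \<Longrightarrow> valid_obj a \<and> valid_obj b"
  by (auto elim!: gen_arr.cases dest: basic_arity)

lemma cpath_cong_suffix:
  "cpath_cong a b p q \<Longrightarrow> cpath b r c \<Longrightarrow> cpath_cong a c (p @ r) (q @ r)"
  by (rule cong_append) (auto intro: cong_refl)

lemma cpath_cong_prefix:
  "cpath_cong b c p q \<Longrightarrow> cpath a r b \<Longrightarrow> cpath_cong a c (r @ p) (r @ q)"
  by (rule cong_append) (auto intro: cong_refl)

text \<open>Soundness of one rewriting step: each case is a defining relation read from right to
  left, possibly behind a channel edge in the case of a fork.\<close>

lemma nf_snoc_cong:
  assumes v: "cpath z v a" and g: "gen_arr g a b"
  shows "cpath_cong z b (v @ [g]) (nf_snoc v g)"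
proof -
  have vg: "cpath z (v @ [g]) b" using v g gen_arr_valid[OF g] by (auto simp: path_snoc_iff)
  note refl = cong_refl[OF vg, of gen_rel]
  show ?thesis
    using g
  proof cases
    case (3 n n')
    show ?thesis
    proof (cases "\<exists>i. v = [GD n' i] \<and> i \<le> n")
      case True
      then obtain i where i: "v = [GD n' i]" "i \<le> n" by blast
      have i1: "1 \<le> i" "z = Star" using v i 3 by (auto simp: cpath_Player)
      have "cpath_cong z b [GD n i, GS b] [GD n' i, GT b]"
      proof (rule cong_rel)
        show "gen_rel [GD n i, GS b] [GD n' i, GT b]" using 3(3) i1(1) i(2) by (rule gen_rel.intros)
        show "cpath z [GD n' i, GT b] b" using vg i 3 by simp
        have "cpath z ([GD n i] @ [GS b]) b"
          unfolding path_snoc_iff using 3 i i1 gen_arr_valid[OF g]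
          by (intro exI[of _ "Player n"]) (auto simp: cpath_Player intro: gen_arr.intros)
        then show "cpath z [GD n i, GS b] b" by simp
      qed
      then show ?thesis using i 3 basic_arity[OF 3(3)] by (auto simp: nf_snoc_def intro: cong_sym)
    next
      case False
      then have "nf_snoc v g = v @ [g]"
        using v 3 basic_arity[OF 3(3)] by (auto simp: nf_snoc_def cpath_Player)
      then show ?thesis using refl by simp
    qed
  next
    case (5 k)
    have rel: "cpath_cong (Player k) (Para k) [GS (ParaR k), GR k] [GS (ParaL k), GL k]"
      by (rule cong_sym, rule cong_rel, rule gen_rel.intros)
        (simp_all add: cpath_into)
    consider "v = []" | "z = Player k" "v = [GS (ParaR k)]" | i where "z = Star" "1 \<le> i" "i \<le> k" "v = [GD k i, GS (ParaR k)]"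
      | "nf_snoc v g = v @ [g]"
      using v 5 by (auto simp: cpath_ParaR cpath_Player nf_snoc_def)
    then show ?thesis
    proof cases
      case 2 then show ?thesis using rel 5 by (simp add: nf_snoc_def)
    next
      case (3 i)
      have "cpath z [GD k i] (Player k)" using 3 by (simp add: cpath_Player)
      from cpath_cong_prefix[OF rel this] show ?thesis using 3 5 by (simp add: nf_snoc_def)
    qed (use refl 5 in \<open>simp_all add: nf_snoc_def\<close>)
  next
    case (7 i n j m)
    show ?thesis
    proof (cases "v = [GD m j, GS (IotaN m j)]")
      case True
      have z: "z = Star" using v True 7 by (simp add: cpath_into)
      have "cpath_cong z b [GD n i, GS (IotaP n i), GEps n i m j] [GD m j, GS (IotaN m j), GRho n i m j]"
        by (rule cong_rel, rule gen_rel.intros) (use 7 z in \<open>simp_all add: cpath_into\<close>)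
      then show ?thesis using True 7 by (auto simp: nf_snoc_def intro: cong_sym)
    next
      case False then show ?thesis using refl 7 by (simp add: nf_snoc_def)
    qed
  qed (use refl in \<open>simp_all add: nf_snoc_def\<close>)
qed

lemma nf_fold_cong: "cpath a p b \<Longrightarrow> cpath z v a \<Longrightarrow> cpath_cong z b (v @ p) (foldl nf_snoc v p)"
proof (induction arbitrary: v rule: path.induct)
  case (path_Nil a)
  then show ?case by (simp add: cong_refl)
next
  case (path_Cons a e b p c)
  have 1: "cpath_cong z b (v @ [e]) (nf_snoc v e)" by (rule nf_snoc_cong[OF path_Cons.prems path_Cons.hyps(2)])
  then have "cpath_cong z c (nf_snoc v e @ p) (foldl nf_snoc (nf_snoc v e) p)"
    using path_Cons.IH path_cong_path by metis
  moreover have "cpath_cong z c ((v @ [e]) @ p) (nf_snoc v e @ p)"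
    by (rule cpath_cong_suffix[OF 1 path_Cons.hyps(3)])
  ultimately show ?case using cong_trans by fastforce
qed

text \<open>Invariance of the normal form. The prefix \<open>v\<close> is needed twice: the fork
  relation also applies behind a channel edge, and a composite is normalised starting from the
  result of its first factor.\<close>

lemma cpath_cong_nf: "cpath_cong a b p q \<Longrightarrow> cpath z v a \<Longrightarrow> foldl nf_snoc v p = foldl nf_snoc v q"
proof (induction arbitrary: v rule: path_cong.induct)
  case (cong_rel p q a b)
  from cong_rel.hyps(1) show ?case
  proof cases
    case (1 c n n' i)
    have "a = Star" using cong_rel.hyps(2) 1 by (auto elim!: path.cases gen_arr.cases)
    then have "v = []" using cong_rel.prems by (simp add: cpath_Star)
    then show ?thesis using 1 basic_arity[OF 1(3)] by (simp add: nf_snoc_def)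
  next
    case (2 n)
    have "a = Player n" using cong_rel.hyps(2) 2 by (auto elim!: path.cases gen_arr.cases basic.cases)
    then have "v = [] \<or> (\<exists>i. v = [GD n i])" using cong_rel.prems by (auto simp: cpath_Player)
    then show ?thesis using 2 by (auto simp: nf_snoc_def)
  next
    case (3 i n j m)
    have "a = Star" using cong_rel.hyps(2) 3 by (auto elim!: path.cases gen_arr.cases)
    then have "v = []" using cong_rel.prems by (simp add: cpath_Star)
    then show ?thesis using 3 by (simp add: nf_snoc_def)
  qed
next
  case (cong_append a b p p' c q q')
  have "cpath z (foldl nf_snoc v p) b"
    using nf_fold_cong[OF _ cong_append.prems] cong_append.hyps(1) path_cong_path by metis
  then show ?case using cong_append.IH cong_append.prems by simp
qed auto

lemma arw_congI:
  assumes pq: "cpath_cong a b p q"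
  shows "arw a b p = arw a b q"
proof -
  have "cpath_cong a b p r \<longleftrightarrow> cpath_cong a b q r" for r
    using cong_trans[OF pq] cong_trans[OF cong_sym[OF pq]] by (rule iffI[rotated])
  then show ?thesis by (simp add: arw_def)
qed

text \<open>Solves the word problem: arrows are classes of paths, and from here on their equality is
  settled by evaluating \<open>nf\<close>.\<close>

lemma arw_eq_iff: "cpath a p b \<Longrightarrow> cpath a q b \<Longrightarrow> arw a b p = arw a b q \<longleftrightarrow> nf p = nf q"
proof
  assume p: "cpath a p b" and q: "cpath a q b"
  have a: "cpath a [] a" using path_target[OF p] by (simp add: path_Nil)
  {
    assume "arw a b p = arw a b q"
    then have "q \<in> arw a b p" using cong_refl[OF q] by (simp add: arw_def)
    then have "cpath_cong a b p q" by (simp add: arw_def)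
    then show "nf p = nf q" using cpath_cong_nf a by blast
  }
  assume "nf p = nf q"
  then have pq: "cpath_cong a b p q"
    using nf_fold_cong[OF p a] nf_fold_cong[OF q a] cong_sym cong_trans by (metis append_Nil)
  show "arw a b p = arw a b q"
    by (rule arw_congI[OF pq])
qed

lemma arw_nf: "cpath a p b \<Longrightarrow> arw a b (nf p) = arw a b p"
proof -
  assume p: "cpath a p b"
  then have a: "cpath a [] a" using path_target[OF p] by (simp add: path_Nil)
  have "cpath_cong a b p (nf p)" using nf_fold_cong[OF p a] by simp
  then show ?thesis by (rule arw_congI[symmetric])
qed

section \<open>The boundary of a closed-world move: source players, target players, created
  channels\<close>

text \<open>The objects whose representables are the middles of closed-world moves. The remaining
  move objects are only halves of a fork or of a synchronisation.\<close>

fun is_top :: "cobj \<Rightarrow> bool" where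
  "is_top (Tick n) \<longleftrightarrow> True"
| "is_top (Para n) \<longleftrightarrow> True"
| "is_top (Nu n) \<longleftrightarrow> True"
| "is_top (Tau n i m j) \<longleftrightarrow> valid_obj (Tau n i m j)"
| "is_top _ \<longleftrightarrow> False"

text \<open>One path for each player that makes the move, chosen in normal form;
  \<open>tgt_paths\<close> lists in the same way the players left behind.\<close>

fun src_paths :: "cobj \<Rightarrow> (nat \<times> gen list) set" where
  "src_paths (Tick n) = {(n, [GS (Tick n)])}"
| "src_paths (Nu n) = {(n, [GS (Nu n)])}"
| "src_paths (Para n) = {(n, [GS (ParaL n), GL n])}"
| "src_paths (Tau n i m j) = {(n, [GS (IotaP n i), GEps n i m j]), (m, [GS (IotaN m j), GRho n i m j])}"
| "src_paths _ = {}"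

fun tgt_paths :: "cobj \<Rightarrow> (nat \<times> gen list) set" where
  "tgt_paths (Tick n) = {(n, [GT (Tick n)])}"
| "tgt_paths (Nu n) = {(Suc n, [GT (Nu n)])}"
| "tgt_paths (Para n) = {(n, [GT (ParaL n), GL n]), (n, [GT (ParaR n), GR n])}"
| "tgt_paths (Tau n i m j) = {(n, [GT (IotaP n i), GEps n i m j]), (m, [GT (IotaN m j), GRho n i m j])}"
| "tgt_paths _ = {}"

text \<open>Channel creation is the only move with a channel unknown to its source players: the last
  channel of its target player.\<close>

fun new_paths :: "cobj \<Rightarrow> gen list set" where
  "new_paths (Nu n) = {[GD (Suc n) (Suc n), GT (Nu n)]}"
| "new_paths _ = {}"

definition srcs :: "cobj \<Rightarrow> nat \<Rightarrow> gen list set set" where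
  "srcs c n = arw (Player n) c ` {p. (n, p) \<in> src_paths c}"

definition tgts :: "cobj \<Rightarrow> nat \<Rightarrow> gen list set set" where
  "tgts c n = arw (Player n) c ` {p. (n, p) \<in> tgt_paths c}"

definition news :: "cobj \<Rightarrow> gen list set set" where
  "news c = arw Star c ` new_paths c"

lemma top_valid: "is_top c \<Longrightarrow> c \<in> ob CC"
  by (cases c) (auto simp: ob_CC)

lemma boundary_nf:
  "(n, p) \<in> src_paths c \<Longrightarrow> nf p = p" "(n, p) \<in> tgt_paths c \<Longrightarrow> nf p = p" "p \<in> new_paths c \<Longrightarrow> nf p = p"
  subgoal by (cases c) (auto simp: nf_snoc_def)
  subgoal by (cases c) (auto simp: nf_snoc_def)
  subgoal by (cases c) (auto simp: nf_snoc_def)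
  done

lemma boundary_cpath:
  assumes "is_top c"
  shows "(n, p) \<in> src_paths c \<Longrightarrow> cpath (Player n) p c"
    and "(n, p) \<in> tgt_paths c \<Longrightarrow> cpath (Player n) p c"
    and "p \<in> new_paths c \<Longrightarrow> cpath Star p c"
  subgoal using assms by (cases c) (simp_all add: cpath_into, safe, simp_all add: cpath_into)
  subgoal using assms by (cases c) (simp_all add: cpath_into, safe, simp_all add: cpath_into)
  subgoal using assms by (cases c) (simp_all add: cpath_into)
  done

lemma boundary_paths:
  assumes "is_top c"
  shows "(n, p) \<in> src_paths c \<Longrightarrow> cpath (Player n) p c \<and> nf p = p"
    and "(n, p) \<in> tgt_paths c \<Longrightarrow> cpath (Player n) p c \<and> nf p = p"
    and "p \<in> new_paths c \<Longrightarrow> cpath Star p c \<and> nf p = p"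
    and "src_paths c \<inter> tgt_paths c = {}"
  using boundary_nf boundary_cpath[OF assms] apply blast
  using boundary_nf boundary_cpath[OF assms] apply blast
  using boundary_nf boundary_cpath[OF assms] apply blast
  by (cases c) auto

lemma player_path_into_top:
  assumes "is_top c" "cpath (Player n) p c"
  shows "(n, nf p) \<in> src_paths c \<union> tgt_paths c"
  using assms by (cases c) (auto simp: cpath_into nf_snoc_def)

lemma channel_path_into_top:
  assumes "is_top c" "cpath Star p c"
  shows "(\<exists>(n, q)\<in>src_paths c. \<exists>i\<in>{1..n}. nf p = nf (GD n i # q)) \<or> nf p \<in> new_paths c"
  using assms by (cases c) (auto simp: cpath_into nf_snoc_def le_Suc_eq, (drule_tac x=i in bspec, simp, force split: if_splits)+)

lemma channel_path_via_tgt: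
  assumes "is_top c" "cpath Star p c"
  shows "\<exists>(n, q)\<in>tgt_paths c. \<exists>i\<in>{1..n}. nf p = nf (GD n i # q)"
  using assms by (cases c) (auto simp: cpath_into nf_snoc_def, (drule_tac x=i in bspec, simp, force split: if_splits)+)

lemma src_channel_not_new:
  assumes "is_top c" "(n, q) \<in> src_paths c"
  shows "nf (GD n i # q) \<notin> new_paths c"
  using assms by (cases c) (auto simp: nf_snoc_def)

lemma top_path_into_top:
  assumes "is_top c" "is_top d" "cpath d p c"
  shows "d = c \<and> p = []"
  using assms by (cases c; cases d) (auto simp: cpath_into)

lemma Player_valid [simp]: "Player n \<in> ob CC" and Star_valid [simp]: "Star \<in> ob CC"
  by (simp_all add: ob_CC)

lemma hom_Player_top:
  assumes c: "is_top c"
  shows "hom CC (Player n) c = srcs c n \<union> tgts c n" "srcs c n \<inter> tgts c n = {}"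
proof -
  show "hom CC (Player n) c = srcs c n \<union> tgts c n"
  proof
    show "hom CC (Player n) c \<subseteq> srcs c n \<union> tgts c n"
    proof
      fix f assume "f \<in> hom CC (Player n) c"
      then obtain p where p: "cpath (Player n) p c" "f = arw (Player n) c (nf p)"
        using arw_nf by (auto simp: hom_CC)
      then show "f \<in> srcs c n \<union> tgts c n"
        using player_path_into_top[OF c p(1)] by (auto simp: srcs_def tgts_def)
    qed
    show "srcs c n \<union> tgts c n \<subseteq> hom CC (Player n) c"
      using boundary_paths[OF c] by (auto simp: hom_CC srcs_def tgts_def)
  qed
  show "srcs c n \<inter> tgts c n = {}"
    using boundary_paths[OF c] arw_eq_iff by (auto simp: srcs_def tgts_def)
qed

text \<open>The channels of a move that its source players know. They exist before the move, so
  together with \<open>news\<close> they split its channels into old and created ones.\<close>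

definition olds :: "cobj \<Rightarrow> gen list set set" where
  "olds c = {cmp CC Star (Player n) c g (arw Star (Player n) [GD n i]) | n g i. g \<in> srcs c n \<and> 1 \<le> i \<and> i \<le> n}"

lemma olds_paths:
  assumes c: "is_top c"
  shows "olds c = {arw Star c (GD n i # q) | n q i. (n, q) \<in> src_paths c \<and> 1 \<le> i \<and> i \<le> n}"
proof -
  have D: "cpath Star [GD n i] (Player n)" if "1 \<le> i" "i \<le> n" for i n using that by (simp add: cpath_Player)
  have S: "olds c = {arw Star c (GD n i # q) | n q i. (n, q) \<in> src_paths c \<and> 1 \<le> i \<and> i \<le> n}"
    (is "_ = ?T")
  proof
    show "olds c \<subseteq> ?T"
    proof
      fix f assume "f \<in> olds c"
      then obtain n q i where f: "f = cmp CC Star (Player n) c (arw (Player n) c q) (arw Star (Player n) [GD n i])"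
        and q: "(n, q) \<in> src_paths c" and i: "1 \<le> i" "i \<le> n" by (auto simp: srcs_def olds_def)
      have "f = arw Star c (GD n i # q)"
        unfolding f using cmp_arw[OF D[OF i] conjunct1[OF boundary_paths(1)[OF c q]]] by simp
      then show "f \<in> ?T" using q i by blast
    qed
    show "?T \<subseteq> olds c"
    proof
      fix f assume "f \<in> ?T"
      then obtain n q i where f: "f = arw Star c (GD n i # q)"
        and q: "(n, q) \<in> src_paths c" and i: "1 \<le> i" "i \<le> n" by blast
      have "f = cmp CC Star (Player n) c (arw (Player n) c q) (arw Star (Player n) [GD n i])"
        unfolding f using cmp_arw[OF D[OF i] conjunct1[OF boundary_paths(1)[OF c q]]] by simp
      then show "f \<in> olds c" using q i unfolding srcs_def olds_def by blast
    qed
  qed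
  show ?thesis by (rule S)
qed

lemma hom_Star_top:
  assumes c: "is_top c"
  shows "hom CC Star c = olds c \<union> news c" and "olds c \<inter> news c = {}"
proof -
  have D: "cpath Star [GD n i] (Player n)" if "1 \<le> i" "i \<le> n" for i n using that by (simp add: cpath_Player)
  note S = olds_paths[OF c]
  have Dq: "cpath Star (GD n i # q) c" if "(n, q) \<in> src_paths c" "1 \<le> i" "i \<le> n" for n q i
    using path_append[OF D[OF that(2,3)] conjunct1[OF boundary_paths(1)[OF c that(1)]]] by simp
  have N: "cpath Star p c" "nf p = p" if "p \<in> new_paths c" for p using boundary_paths(3)[OF c that] by auto
  show "hom CC Star c = olds c \<union> news c"
  proof
    show "hom CC Star c \<subseteq> olds c \<union> news c"
    proof
      fix f assume "f \<in> hom CC Star c"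
      then obtain p where p: "cpath Star p c" "f = arw Star c p" by (auto simp: hom_CC)
      from channel_path_into_top[OF c p(1)] show "f \<in> olds c \<union> news c"
      proof
        assume "\<exists>(n, q)\<in>src_paths c. \<exists>i\<in>{1..n}. nf p = nf (GD n i # q)"
        then obtain n q i where q: "(n, q) \<in> src_paths c" "1 \<le> i" "i \<le> n" "nf p = nf (GD n i # q)" by auto
        then have "f = arw Star c (GD n i # q)" using arw_eq_iff[OF p(1) Dq] p(2) by blast
        then show ?thesis using q unfolding S by blast
      next
        assume "nf p \<in> new_paths c"
        then show ?thesis using arw_nf[OF p(1)] p(2) unfolding news_def by blast
      qed
    qed
    show "olds c \<union> news c \<subseteq> hom CC Star c"
      unfolding S news_def using Dq N(1) arw_in_hom by blast
  qed
  show "olds c \<inter> news c = {}"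
  proof (rule ccontr)
    assume "olds c \<inter> news c \<noteq> {}"
    then obtain n q i p where *: "(n, q) \<in> src_paths c" "1 \<le> i" "i \<le> n" "p \<in> new_paths c"
      "arw Star c (GD n i # q) = arw Star c p"
      unfolding S news_def by blast
    then have "nf (GD n i # q) = p" using arw_eq_iff[OF Dq N(1)] N(2) by metis
    then show False using src_channel_not_new[OF c *(1)] *(4) by metis
  qed
qed

text \<open>No move forgets a channel: each one is known to some target player. This yields
  surjectivity of the backward map on channels.\<close>

lemma hom_Star_via_tgts:
  assumes c: "is_top c"
  shows "hom CC Star c = {arw Star c (GD n i # q) | n q i. (n, q) \<in> tgt_paths c \<and> 1 \<le> i \<and> i \<le> n}"
proof -
  have Dq: "cpath Star (GD n i # q) c" if "(n, q) \<in> tgt_paths c" "1 \<le> i" "i \<le> n" for n q i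
    using path_append[of _ _ Star "[GD n i]" "Player n" q c] boundary_paths(2)[OF c that(1)] that(2,3)
    by (simp add: cpath_Player)
  show ?thesis
  proof
    show "hom CC Star c \<subseteq> {arw Star c (GD n i # q) | n q i. (n, q) \<in> tgt_paths c \<and> 1 \<le> i \<and> i \<le> n}"
    proof
      fix f assume "f \<in> hom CC Star c"
      then obtain p where p: "cpath Star p c" "f = arw Star c p" by (auto simp: hom_CC)
      obtain n q i where q: "(n, q) \<in> tgt_paths c" "1 \<le> i" "i \<le> n" "nf p = nf (GD n i # q)"
        using channel_path_via_tgt[OF c p(1)] by auto
      then have "f = arw Star c (GD n i # q)" using arw_eq_iff[OF p(1) Dq] p(2) by blast
      then show "f \<in> {arw Star c (GD n i # q) | n q i. (n, q) \<in> tgt_paths c \<and> 1 \<le> i \<and> i \<le> n}"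
        using q by blast
    qed
  qed (use Dq arw_in_hom in blast)
qed

lemma news_unique: "f \<in> news c \<Longrightarrow> g \<in> news c \<Longrightarrow> f = g"
  by (cases c) (auto simp: news_def)

lemma hom_top_top:
  assumes "is_top c" "is_top d"
  shows "hom CC d c = (if d = c then {idn CC c} else {})"
  using top_path_into_top[OF assms] top_valid[OF assms(1)]
  by (auto simp: hom_CC idn_CC ob_CC path_Nil)

lemma tgts_nonempty: "is_top c \<Longrightarrow> \<exists>n. tgts c n \<noteq> {}"
  by (cases c) (auto simp: tgts_def)

lemma srcs_nonempty: "is_top c \<Longrightarrow> \<exists>n. srcs c n \<noteq> {}"
  by (cases c) (auto simp: srcs_def)

text \<open>A move has at most two source players; this is where the finite branching of causality
  comes from.\<close>

lemma finite_srcs: "finite {(n, g). g \<in> srcs c n}"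
proof (rule finite_subset)
  show "{(n, g). g \<in> srcs c n} \<subseteq> (\<lambda>(n, p). (n, arw (Player n) c p)) ` src_paths c"
    by (auto simp: srcs_def)
  show "finite ((\<lambda>(n, p). (n, arw (Player n) c p)) ` src_paths c)" by (cases c) auto
qed

subsection \<open>The cospans of closed-world moves\<close>

lemma category_idn_in: "category C \<Longrightarrow> a \<in> ob C \<Longrightarrow> idn C a \<in> hom C a a"
  unfolding category_def by blast

lemma category_cmp_in:
  "\<lbrakk>category C; a \<in> ob C; b \<in> ob C; c \<in> ob C; f \<in> hom C a b; g \<in> hom C b c\<rbrakk> \<Longrightarrow> cmp C a b c g f \<in> hom C a c"
  unfolding category_def by blast

lemma category_unit:
  "\<lbrakk>category C; a \<in> ob C; b \<in> ob C; f \<in> hom C a b\<rbrakk> \<Longrightarrow> cmp C a a b f (idn C a) = f"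
  "\<lbrakk>category C; a \<in> ob C; b \<in> ob C; f \<in> hom C a b\<rbrakk> \<Longrightarrow> cmp C a b b (idn C b) f = f"
  unfolding category_def by blast+

lemma category_assoc:
  "\<lbrakk>category C; a \<in> ob C; b \<in> ob C; c \<in> ob C; d \<in> ob C; f \<in> hom C a b; g \<in> hom C b c; h \<in> hom C c d\<rbrakk> \<Longrightarrow>
     cmp C a c d h (cmp C a b c g f) = cmp C a b d (cmp C b c d h g) f"
  unfolding category_def by blast

lemma yoneda_simps [simp]: "fob (yoneda C c) a = hom C a c" "far (yoneda C c) a b f g = cmp C a b c g f"
  by (simp_all add: yoneda_def)

lemma presheaf_yoneda: "category C \<Longrightarrow> c \<in> ob C \<Longrightarrow> presheaf C (yoneda C c)"
  by (rule presheafI) (simp_all add: category_cmp_in category_unit category_assoc)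

lemma yoneda_map_in:
  assumes "category C" "c \<in> ob C" "c' \<in> ob C" "h \<in> hom C c c'"
  shows "yoneda_map C c c' h \<in> nat_trans C (yoneda C c) (yoneda C c')"
proof -
  have "yoneda_map C c c' h = mk_nt C (yoneda C c) (\<lambda>a g. cmp C a c c' h g)"
    by (simp add: yoneda_map_def mk_nt_def)
  then show ?thesis
    using assms by (auto intro!: mk_nt_in presheaf_yoneda simp: category_cmp_in category_assoc)
qed

lemma yoneda_nt:
  assumes C: "category C" and c: "c \<in> ob C" and \<eta>: "\<eta> \<in> nat_trans C (yoneda C c) P"
    and a: "a \<in> ob C" and g: "g \<in> hom C a c"
  shows "\<eta> a g = far P a c g (\<eta> c (idn C c))"
  using nat_trans_natural[OF \<eta> a c g, of "idn C c"] category_idn_in[OF C c] category_unit(2)[OF C a c g] by simp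

lemma yoneda_elt_in:
  assumes "category C" "c \<in> ob C" "presheaf C M" "m \<in> fob M c"
  shows "mk_nt C (yoneda C c) (\<lambda>a g. far M a c g m) \<in> nat_trans C (yoneda C c) M"
  using assms
  by (auto intro!: mk_nt_in presheaf_yoneda simp: presheaf_far_in presheaf_far_cmp)

lemma Yo_map_arw:
  assumes "cpath x q a" "cpath a p b"
  shows "Yo_map a b p x (arw x a q) = arw x b (q @ p)"
  using assms path_target[OF assms(1)] by (simp add: yoneda_map_def cmp_arw arw_in_hom ob_CC)

lemma Yo_map_in:
  assumes "cpath a p b"
  shows "Yo_map a b p \<in> nat_trans CC (Yo a) (Yo b)"
  using path_target[OF assms] by (auto intro!: yoneda_map_in category_CC arw_in_hom assms simp: ob_CC)

lemma presheaf_Yo: "c \<in> ob CC \<Longrightarrow> presheaf CC (Yo c)"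
  by (rule presheaf_yoneda[OF category_CC])

lemma hom_into_Player:
  "hom CC x (Player n) = (if x = Player n then {arw (Player n) (Player n) []}
     else if x = Star then {arw Star (Player n) [GD n i] | i. 1 \<le> i \<and> i \<le> n} else {})"
  by (auto simp: hom_CC cpath_Player)

lemma hom_into_Star: "hom CC x Star = (if x = Star then {arw Star Star []} else {})"
  by (auto simp: hom_CC cpath_Star)

lemma cpath_D: "1 \<le> i \<Longrightarrow> i \<le> n \<Longrightarrow> cpath Star [GD n i] (Player n)"
  by (simp add: cpath_Player)

lemma cpath_Nil: "c \<in> ob CC \<Longrightarrow> cpath c [] c"
  by (simp add: ob_CC path_Nil)

lemma arw_D_inj: "1 \<le> i \<Longrightarrow> i \<le> n \<Longrightarrow> 1 \<le> j \<Longrightarrow> j \<le> n \<Longrightarrow>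
    arw Star (Player n) [GD n i] = arw Star (Player n) [GD n j] \<longleftrightarrow> i = j"
  by (subst arw_eq_iff) (auto simp: cpath_Player nf_snoc_def)

text \<open>
  \<open>spans P \<eta> c S\<close>: the mono \<open>\<eta>\<close> identifies \<open>P\<close> with the subpresheaf of the representable \<open>c\<close>
  generated by the arrows from players given by the paths in \<open>S\<close>.
\<close>

definition spans :: "'p cpsh \<Rightarrow> ('p, gen list set) cmap \<Rightarrow> cobj \<Rightarrow> (nat \<times> gen list) set \<Rightarrow> bool" where
  "spans P \<eta> c S \<longleftrightarrow> presheaf CC P \<and> \<eta> \<in> nat_trans CC P (Yo c) \<and> nt_mono CC P \<eta> \<and>
     (\<forall>a\<in>ob CC. a \<noteq> Star \<longrightarrow> (\<forall>n. a \<noteq> Player n) \<longrightarrow> fob P a = {}) \<and>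
     (\<forall>k. \<eta> (Player k) ` fob P (Player k) = arw (Player k) c ` {p. (k, p) \<in> S}) \<and>
     \<eta> Star ` fob P Star = {arw Star c (GD n i # q) | n q i. (n, q) \<in> S \<and> 1 \<le> i \<and> i \<le> n}"

lemma spansD:
  assumes "spans P \<eta> c S"
  shows "presheaf CC P" "\<eta> \<in> nat_trans CC P (Yo c)" "nt_mono CC P \<eta>"
    "\<And>a. \<lbrakk>a \<in> ob CC; a \<noteq> Star; \<And>n. a \<noteq> Player n\<rbrakk> \<Longrightarrow> fob P a = {}"
    "\<And>k. \<eta> (Player k) ` fob P (Player k) = arw (Player k) c ` {p. (k, p) \<in> S}"
    "\<eta> Star ` fob P Star = {arw Star c (GD n i # q) | n q i. (n, q) \<in> S \<and> 1 \<le> i \<and> i \<le> n}"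
  using assms by (simp_all add: spans_def)

lemma Yo_map_Player:
  assumes p: "cpath (Player n) p c"
  shows "Yo_map (Player n) c p (Player n) (arw (Player n) (Player n) []) = arw (Player n) c p"
    and "1 \<le> i \<Longrightarrow> i \<le> n \<Longrightarrow> Yo_map (Player n) c p Star (arw Star (Player n) [GD n i]) = arw Star c (GD n i # p)"
  using Yo_map_arw[OF cpath_Nil p] Yo_map_arw[OF cpath_D p] by simp_all

text \<open>Says that a player embeds into \<open>c\<close> along \<open>p\<close>, put in terms of
  normal forms so that it can be checked by evaluation.\<close>

definition channel_sep :: "nat \<Rightarrow> gen list \<Rightarrow> bool" where
  "channel_sep n p \<longleftrightarrow> (\<forall>i j. 1 \<le> i \<longrightarrow> i \<le> n \<longrightarrow> 1 \<le> j \<longrightarrow> j \<le> n \<longrightarrow> nf (GD n i # p) = nf (GD n j # p) \<longrightarrow> i = j)"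

lemma cpath_D_Cons: "cpath (Player n) p c \<Longrightarrow> 1 \<le> i \<Longrightarrow> i \<le> n \<Longrightarrow> cpath Star (GD n i # p) c"
  using path_append[OF cpath_D] by fastforce

lemma channel_sepD:
  assumes "cpath (Player n) p c" "channel_sep n p" "1 \<le> i" "i \<le> n" "1 \<le> j" "j \<le> n"
    "arw Star c (GD n i # p) = arw Star c (GD n j # p)"
  shows "i = j"
  using assms(2-7) arw_eq_iff[OF cpath_D_Cons[OF assms(1,3,4)] cpath_D_Cons[OF assms(1,5,6)]]
  unfolding channel_sep_def by blast

lemma Yo_Player_cases:
  assumes "x \<in> fob (Yo (Player n)) a"
  obtains "a = Player n" "x = arw (Player n) (Player n) []"
  | i where "a = Star" "1 \<le> i" "i \<le> n" "x = arw Star (Player n) [GD n i]"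
  using assms by (auto simp: hom_into_Player split: if_splits)

lemma spans_single:
  assumes p: "cpath (Player n) p c" and sep: "channel_sep n p"
  shows "spans (Yo (Player n)) (Yo_map (Player n) c p) c {(n, p)}"
  unfolding spans_def
proof (intro conjI ballI allI impI presheaf_Yo Player_valid Yo_map_in[OF p] nt_monoI)
  fix a x y assume "x \<in> fob (Yo (Player n)) a" "y \<in> fob (Yo (Player n)) a"
    and eq: "Yo_map (Player n) c p a x = Yo_map (Player n) c p a y"
  then show "x = y"
    by (elim Yo_Player_cases) (use channel_sepD[OF p sep] in \<open>auto simp: Yo_map_Player[OF p]\<close>)
next
  fix k
  show "Yo_map (Player n) c p (Player k) ` fob (Yo (Player n)) (Player k) = arw (Player k) c ` {pa. (k, pa) \<in> {(n, p)}}"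
    using Yo_map_Player(1)[OF p] by (auto simp: hom_into_Player)
next
  show "Yo_map (Player n) c p Star ` fob (Yo (Player n)) Star =
      {arw Star c (GD n' i # q) | n' q i. (n', q) \<in> {(n, p)} \<and> 1 \<le> i \<and> i \<le> n'}"
    using Yo_map_Player(2)[OF p] by (auto simp: hom_into_Player image_iff)
qed (auto simp: hom_into_Player)

text \<open>The two representables cover the pushout and each embeds into \<open>c\<close>, so only
  mixed pairs can spoil injectivity: players must stay distinct, and channels may coincide only
  where \<open>I\<close> glues them. Both conditions are evaluations of \<open>nf\<close>.\<close>

lemma spans_pushout:
  assumes po: "is_pushout CC I (Yo (Player n)) (Yo (Player m)) f g P a b"
    and h: "h \<in> nat_trans CC P (Yo c)"
    and ha: "nt_comp CC (Yo (Player n)) h a = Yo_map (Player n) c p"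
    and hb: "nt_comp CC (Yo (Player m)) h b = Yo_map (Player m) c q"
    and p: "cpath (Player n) p c" "channel_sep n p" and q: "cpath (Player m) q c" "channel_sep m q"
    and cross1: "n = m \<Longrightarrow> nf p \<noteq> nf q"
    and cross2: "\<And>i j. \<lbrakk>1 \<le> i; i \<le> n; 1 \<le> j; j \<le> m; nf (GD n i # p) = nf (GD m j # q)\<rbrakk> \<Longrightarrow>
      \<exists>x\<in>fob I Star. f Star x = arw Star (Player n) [GD n i] \<and> g Star x = arw Star (Player m) [GD m j]"
  shows "spans P h c {(n, p), (m, q)}"
proof -
  note D = is_pushoutD[OF po]
  note cov = pushout_jointly_surj[OF po]
  have ha': "h x (a x y) = Yo_map (Player n) c p x y" if "x \<in> ob CC" "y \<in> fob (Yo (Player n)) x" for x y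
    using nt_comp_app[OF that, of h a] ha by simp
  have hb': "h x (b x y) = Yo_map (Player m) c q x y" if "x \<in> ob CC" "y \<in> fob (Yo (Player m)) x" for x y
    using nt_comp_app[OF that, of h b] hb by simp
  note S1 = spansD[OF spans_single[OF p]] and S2 = spansD[OF spans_single[OF q]]
  have cross: "a x y = b x z" if x: "x \<in> ob CC" and y: "y \<in> fob (Yo (Player n)) x" and z: "z \<in> fob (Yo (Player m)) x"
    and eq: "h x (a x y) = h x (b x z)" for x y z
    using y
  proof (cases rule: Yo_Player_cases)
    case 1
    then have "m = n" "z = arw (Player n) (Player n) []" using z by (auto simp: hom_into_Player split: if_splits)
    then have "arw (Player n) c p = arw (Player n) c q"
      using eq ha'[OF x y] hb'[OF x z] 1 Yo_map_Player(1)[OF p(1)] Yo_map_Player(1)[OF q(1)] by simp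
    then have "nf p = nf q" using arw_eq_iff[OF p(1), of q] q(1) \<open>m = n\<close> by blast
    then show ?thesis using cross1 \<open>m = n\<close> by blast
  next
    case (2 i)
    then obtain j where j: "1 \<le> j" "j \<le> m" "z = arw Star (Player m) [GD m j]"
      using z by (auto simp: hom_into_Player)
    have "arw Star c (GD n i # p) = arw Star c (GD m j # q)"
      using eq ha'[OF x y] hb'[OF x z] 2 j Yo_map_Player(2)[OF p(1)] Yo_map_Player(2)[OF q(1)] by simp
    then have "nf (GD n i # p) = nf (GD m j # q)"
      using arw_eq_iff[OF cpath_D_Cons[OF p(1) 2(2,3)] cpath_D_Cons[OF q(1) j(1,2)]] by blast
    then obtain w where "w \<in> fob I Star" "f Star w = y" "g Star w = z"
      using cross2[OF 2(2,3) j(1,2)] 2 j by metis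
    then show ?thesis using D(9)[OF x] 2(1) by metis
  qed
  have mono: "nt_mono CC P h"
  proof (rule nt_monoI)
    fix x y z assume x: "x \<in> ob CC" and y: "y \<in> fob P x" and z: "z \<in> fob P x" and eq: "h x y = h x z"
    consider y' z' where "y' \<in> fob (Yo (Player n)) x" "y = a x y'" "z' \<in> fob (Yo (Player n)) x" "z = a x z'"
      | y' z' where "y' \<in> fob (Yo (Player n)) x" "y = a x y'" "z' \<in> fob (Yo (Player m)) x" "z = b x z'"
      | y' z' where "y' \<in> fob (Yo (Player m)) x" "y = b x y'" "z' \<in> fob (Yo (Player n)) x" "z = a x z'"
      | y' z' where "y' \<in> fob (Yo (Player m)) x" "y = b x y'" "z' \<in> fob (Yo (Player m)) x" "z = b x z'"
      using y z unfolding cov[OF x] by (elim UnE imageE) blast+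
    then show "y = z"
    proof cases
      case 1
      then show ?thesis using eq ha'[OF x] nt_mono_inj[OF S1(3) x, of y' z'] by simp
    next
      case 2 then show ?thesis using cross[OF x] eq by blast
    next
      case 3 then show ?thesis using cross[OF x] eq by metis
    next
      case 4
      then show ?thesis using eq hb'[OF x] nt_mono_inj[OF S2(3) x, of y' z'] by simp
    qed
  qed
  have im: "h x ` fob P x = Yo_map (Player n) c p x ` fob (Yo (Player n)) x \<union> Yo_map (Player m) c q x ` fob (Yo (Player m)) x"
    if x: "x \<in> ob CC" for x
    unfolding cov[OF x] image_Un image_image using ha'[OF x] hb'[OF x] by (simp cong: image_cong)
  show ?thesis
    unfolding spans_def
  proof (intro conjI ballI allI impI D(4) h mono)
    fix x assume x: "x \<in> ob CC" "x \<noteq> Star" "\<forall>n. x \<noteq> Player n"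
    then show "fob P x = {}" using cov[OF x(1)] S1(4)[of x] S2(4)[of x] by simp
  next
    fix k
    show "h (Player k) ` fob P (Player k) = arw (Player k) c ` {pa. (k, pa) \<in> {(n, p), (m, q)}}"
      unfolding im[OF Player_valid] S1(5) S2(5) by blast
  next
    show "h Star ` fob P Star = {arw Star c (GD n' i # q') | n' q' i. (n', q') \<in> {(n, p), (m, q)} \<and> 1 \<le> i \<and> i \<le> n'}"
      unfolding im[OF Star_valid] S1(6) S2(6) by blast
  qed
qed

text \<open>What tick, channel creation, fork and synchronisation have in common, so that pushing
  out is analysed once. The interface consists of exactly the initial channels, and both feet sit
  inside the representable \<open>c\<close>, with the boundary paths as their players.\<close>

definition good_cospan :: "('i, 'x, gen list set, 'z) icospan \<Rightarrow> cobj \<Rightarrow> bool" where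
  "good_cospan K c \<longleftrightarrow> is_top c \<and> mid K = Yo c \<and>
     spans (ini K) (smap K) c (src_paths c) \<and> spans (fin K) (tmap K) c (tgt_paths c) \<and>
     presheaf CC (ifc K) \<and> ifc_ini K \<in> nat_trans CC (ifc K) (ini K) \<and> ifc_fin K \<in> nat_trans CC (ifc K) (fin K) \<and>
     nt_mono CC (ifc K) (ifc_ini K) \<and> (\<forall>a\<in>ob CC. a \<noteq> Star \<longrightarrow> fob (ifc K) a = {}) \<and>
     (\<forall>i\<in>fob (ifc K) Star. smap K Star (ifc_ini K Star i) = tmap K Star (ifc_fin K Star i)) \<and>
     ifc_ini K Star ` fob (ifc K) Star = fob (ini K) Star"

lemma stars_simps: "fob (stars n) c = {1..n} \<times> hom CC c Star"
    "far (stars n) c c' f (i, g) = (i, cmp CC c c' Star g f)"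
  by (simp_all add: stars_def)

lemma presheaf_stars: "presheaf CC (stars n)"
  by (rule presheafI) (auto simp: stars_simps category_cmp_in[OF category_CC] category_unit[OF category_CC]
      category_assoc[OF category_CC])

lemma arw_D_in: "1 \<le> i \<Longrightarrow> i \<le> n \<Longrightarrow> arw Star (Player n) [GD n i] \<in> hom CC Star (Player n)"
  by (rule arw_in_hom[OF cpath_D])

lemma d_cotuple_in: "n \<le> n' \<Longrightarrow> d_cotuple n n' \<in> nat_trans CC (stars n) (Yo (Player n'))"
proof -
  assume n: "n \<le> n'"
  have "d_cotuple n n' = mk_nt CC (stars n) (\<lambda>c (i, g). cmp CC c Star (Player n') (arw Star (Player n') [GD n' i]) g)"
    by (simp add: d_cotuple_def mk_nt_def)
  moreover have "mk_nt CC (stars n) (\<lambda>c (i, g). cmp CC c Star (Player n') (arw Star (Player n') [GD n' i]) g)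
      \<in> nat_trans CC (stars n) (Yo (Player n'))"
    by (rule mk_nt_in[OF presheaf_stars])
      (use n in \<open>auto simp: stars_simps category_assoc[OF category_CC] arw_D_in category_cmp_in[OF category_CC]\<close>)
  ultimately show ?thesis by simp
qed

lemma d_cotuple_app:
  assumes "1 \<le> i" "i \<le> n" "n \<le> n'"
  shows "d_cotuple n n' Star (i, arw Star Star []) = arw Star (Player n') [GD n' i]"
  using assms cmp_arw[OF cpath_Nil[OF Star_valid] cpath_D, of i n']
  by (simp add: d_cotuple_def stars_simps hom_into_Star)

lemma stars_elts: "c \<in> ob CC \<Longrightarrow> fob (stars n) c = (if c = Star then {(i, arw Star Star []) | i. 1 \<le> i \<and> i \<le> n} else {})"
  by (auto simp: stars_simps hom_into_Star)

lemma d_cotuple_mono: "nt_mono CC (stars n) (d_cotuple n n)"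
proof (rule nt_monoI)
  fix c x y assume "c \<in> ob CC" "x \<in> fob (stars n) c" "y \<in> fob (stars n) c" "d_cotuple n n c x = d_cotuple n n c y"
  then show "x = y"
    by (auto simp: stars_elts d_cotuple_app arw_D_inj split: if_splits)
qed

lemma d_cotuple_surj: "d_cotuple n n Star ` fob (stars n) Star = fob (Yo (Player n)) Star"
proof -
  have "d_cotuple n n Star ` fob (stars n) Star = {d_cotuple n n Star (i, arw Star Star []) | i. 1 \<le> i \<and> i \<le> n}"
    by (auto simp: stars_elts)
  also have "\<dots> = fob (Yo (Player n)) Star" by (force simp: hom_into_Player d_cotuple_app)
  finally show ?thesis .
qed

text \<open>Serves the three moves with a single source player, whose interface is the set of all
  its channels; among them only the final foot needs separate work.\<close>

lemma good_stars:
  assumes n: "is_top c" "src_paths c = {(n, p)}" "channel_sep n p" "cpath (Player n) p c"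
    and K: "mid K = Yo c" "ini K = Yo (Player n)" "smap K = Yo_map (Player n) c p" "ifc K = stars n"
      "ifc_ini K = d_cotuple n n"
    and fin: "spans (fin K) (tmap K) c (tgt_paths c)" "ifc_fin K \<in> nat_trans CC (ifc K) (fin K)"
    and eq: "\<And>i. 1 \<le> i \<Longrightarrow> i \<le> n \<Longrightarrow> tmap K Star (ifc_fin K Star (i, arw Star Star [])) = arw Star c (GD n i # p)"
  shows "good_cospan K c"
  unfolding good_cospan_def
proof (intro conjI n(1) K(1) fin)
  show "spans (ini K) (smap K) c (src_paths c)" unfolding K n(2) by (rule spans_single[OF n(4,3)])
  show "\<forall>i\<in>fob (ifc K) Star. smap K Star (ifc_ini K Star i) = tmap K Star (ifc_fin K Star i)"
    using eq Yo_map_Player(2)[OF n(4)] by (auto simp: K stars_elts d_cotuple_app)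
  show "ifc_ini K Star ` fob (ifc K) Star = fob (ini K) Star" unfolding K by (rule d_cotuple_surj)
qed (simp_all add: K presheaf_stars d_cotuple_in d_cotuple_mono stars_elts)

lemma good_tick: "good_cospan (basic_move (Tick n) n n) (Tick n)"
proof -
  have p: "cpath (Player n) [GS (Tick n)] (Tick n)" "cpath (Player n) [GT (Tick n)] (Tick n)"
    by (simp_all add: cpath_into)
  have sep: "channel_sep n [GS (Tick n)]" "channel_sep n [GT (Tick n)]"
    by (auto simp: channel_sep_def nf_snoc_def)
  show ?thesis
  proof (rule good_stars[of _ n "[GS (Tick n)]"])
    show "spans (fin (basic_move (Tick n) n n)) (tmap (basic_move (Tick n) n n)) (Tick n) (tgt_paths (Tick n))"
      using spans_single[OF p(2) sep(2)] by (simp add: basic_move_def)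
    show "tmap (basic_move (Tick n) n n) Star (ifc_fin (basic_move (Tick n) n n) Star (i, arw Star Star []))
        = arw Star (Tick n) (GD n i # [GS (Tick n)])" if i: "1 \<le> i" "i \<le> n" for i
      using i Yo_map_Player(2)[OF p(2) i] arw_eq_iff[OF cpath_D_Cons[OF p(1) i] cpath_D_Cons[OF p(2) i]]
      by (simp add: basic_move_def d_cotuple_app nf_snoc_def)
  qed (simp_all add: p sep basic_move_def d_cotuple_in)
qed

lemma good_nu: "good_cospan (basic_move (Nu n) n (Suc n)) (Nu n)"
proof -
  have p: "cpath (Player n) [GS (Nu n)] (Nu n)" "cpath (Player (Suc n)) [GT (Nu n)] (Nu n)"
    by (simp_all add: cpath_into)
  have sep: "channel_sep n [GS (Nu n)]" "channel_sep (Suc n) [GT (Nu n)]"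
    by (auto simp: channel_sep_def nf_snoc_def)
  show ?thesis
  proof (rule good_stars[of _ n "[GS (Nu n)]"])
    show "spans (fin (basic_move (Nu n) n (Suc n))) (tmap (basic_move (Nu n) n (Suc n))) (Nu n) (tgt_paths (Nu n))"
      using spans_single[OF p(2) sep(2)] by (simp add: basic_move_def)
    show "tmap (basic_move (Nu n) n (Suc n)) Star (ifc_fin (basic_move (Nu n) n (Suc n)) Star (i, arw Star Star []))
        = arw Star (Nu n) (GD n i # [GS (Nu n)])" if i: "1 \<le> i" "i \<le> n" for i
    proof -
      have i': "i \<le> Suc n" using i by simp
      show ?thesis
        using i Yo_map_Player(2)[OF p(2) i(1) i'] arw_eq_iff[OF cpath_D_Cons[OF p(1) i] cpath_D_Cons[OF p(2) i(1) i']]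
        by (simp add: basic_move_def d_cotuple_app nf_snoc_def)
    qed
  qed (simp_all add: p sep basic_move_def d_cotuple_in)
qed

lemma para_paths:
  "cpath (Player n) [GS (ParaL n), GL n] (Para n)" "cpath (Player n) [GT (ParaL n), GL n] (Para n)"
  "cpath (Player n) [GT (ParaR n), GR n] (Para n)"
  "channel_sep n [GS (ParaL n), GL n]" "channel_sep n [GT (ParaL n), GL n]" "channel_sep n [GT (ParaR n), GR n]"
  by (auto simp: cpath_into channel_sep_def nf_snoc_def)

lemma good_fork:
  assumes "fork_move n K"
  shows "good_cospan K (Para n)"
proof -
  obtain a b where K: "ifc K = stars n" "ini K = Yo (Player n)" "mid K = Yo (Para n)"
     "smap K = Yo_map (Player n) (Para n) [GS (ParaL n), GL n]" "ifc_ini K = d_cotuple n n"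
    and po: "is_pushout CC (stars n) (Yo (Player n)) (Yo (Player n)) (d_cotuple n n) (d_cotuple n n) (fin K) a b"
    and f: "ifc_fin K = nt_comp CC (stars n) a (d_cotuple n n)" and t: "tmap K \<in> nat_trans CC (fin K) (mid K)"
    and ta: "nt_comp CC (Yo (Player n)) (tmap K) a = Yo_map (Player n) (Para n) [GT (ParaL n), GL n]"
    and tb: "nt_comp CC (Yo (Player n)) (tmap K) b = Yo_map (Player n) (Para n) [GT (ParaR n), GR n]"
    using assms unfolding fork_move_def by blast
  note D = is_pushoutD[OF po]
  show ?thesis
  proof (rule good_stars[of _ n "[GS (ParaL n), GL n]"])
    have "spans (fin K) (tmap K) (Para n) {(n, [GT (ParaL n), GL n]), (n, [GT (ParaR n), GR n])}"
    proof (rule spans_pushout[OF po t[unfolded K] ta tb para_paths(2,5) para_paths(3,6)])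
      fix i j assume i: "1 \<le> i" "i \<le> n" and j: "1 \<le> j" "j \<le> n"
        and eq: "nf (GD n i # [GT (ParaL n), GL n]) = nf (GD n j # [GT (ParaR n), GR n])"
      then have "i = j" by (simp add: nf_snoc_def)
      then show "\<exists>x\<in>fob (stars n) Star. d_cotuple n n Star x = arw Star (Player n) [GD n i] \<and>
          d_cotuple n n Star x = arw Star (Player n) [GD n j]"
        using i by (intro bexI[of _ "(i, arw Star Star [])"]) (auto simp: stars_elts d_cotuple_app)
    qed (simp add: nf_snoc_def)
    then show "spans (fin K) (tmap K) (Para n) (tgt_paths (Para n))" by simp
    show "ifc_fin K \<in> nat_trans CC (ifc K) (fin K)"
      unfolding f K(1) by (rule nt_comp_in[OF D(1) D(5) D(7)])
    show "tmap K Star (ifc_fin K Star (i, arw Star Star [])) = arw Star (Para n) (GD n i # [GS (ParaL n), GL n])"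
      if i: "1 \<le> i" "i \<le> n" for i
    proof -
      have "tmap K Star (ifc_fin K Star (i, arw Star Star [])) = tmap K Star (a Star (arw Star (Player n) [GD n i]))"
        using i by (simp add: f stars_elts d_cotuple_app)
      also have "\<dots> = Yo_map (Player n) (Para n) [GT (ParaL n), GL n] Star (arw Star (Player n) [GD n i])"
        using arg_cong[OF ta, of "\<lambda>h. h Star (arw Star (Player n) [GD n i])"] arw_D_in[OF i] by simp
      also have "\<dots> = arw Star (Para n) (GD n i # [GT (ParaL n), GL n])"
        by (rule Yo_map_Player(2)[OF para_paths(2) i])
      also have "\<dots> = arw Star (Para n) (GD n i # [GS (ParaL n), GL n])"
        by (subst arw_eq_iff[OF cpath_D_Cons[OF para_paths(2) i] cpath_D_Cons[OF para_paths(1) i]])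
          (use i in \<open>simp add: nf_snoc_def\<close>)
      finally show ?thesis .
    qed
  qed (simp_all add: K para_paths)
qed

lemma tau_paths:
  assumes "1 \<le> i" "i \<le> n" "1 \<le> j" "j \<le> m"
  shows "cpath (Player n) [GS (IotaP n i), GEps n i m j] (Tau n i m j)"
    "cpath (Player m) [GS (IotaN m j), GRho n i m j] (Tau n i m j)"
    "cpath (Player n) [GT (IotaP n i), GEps n i m j] (Tau n i m j)"
    "cpath (Player m) [GT (IotaN m j), GRho n i m j] (Tau n i m j)"
    "channel_sep n [GS (IotaP n i), GEps n i m j]" "channel_sep m [GS (IotaN m j), GRho n i m j]"
    "channel_sep n [GT (IotaP n i), GEps n i m j]" "channel_sep m [GT (IotaN m j), GRho n i m j]"
  using assms by (auto simp: cpath_into channel_sep_def nf_snoc_def)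

lemma presheaf_channels: "presheaf CC P \<Longrightarrow> presheaf CC (channels P)"
  by (rule presheafI)
    (auto simp: channels_def hom_into_Star presheaf_far_id idn_CC[symmetric] presheaf_far_cmp split: if_splits)

lemma channels_incl: "presheaf CC P \<Longrightarrow> nt_id CC (channels P) \<in> nat_trans CC (channels P) P"
  using presheaf_far_in[OF presheaf_channels[of P]]
  by (auto simp: nat_trans_def nt_id_def channels_def split: if_splits)

text \<open>Both feet are the same glued position, embedded by different maps. On channels these
  maps agree, because the relation between \<open>s\<close> and \<open>t\<close> holds in each half;
  this makes the channels a common interface.\<close>

lemma good_sync:
  assumes ij: "1 \<le> i" "i \<le> n" "1 \<le> j" "j \<le> m" and sm: "sync_move n i m j K"
  shows "good_cospan K (Tau n i m j)"
proof -
  let ?c = "Tau n i m j"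
  obtain a b where K: "fin K = ini K" "mid K = Yo ?c" "ifc K = channels (ini K)"
     "ifc_ini K = nt_id CC (channels (ini K))" "ifc_fin K = nt_id CC (channels (ini K))"
    and st: "smap K \<in> nat_trans CC (ini K) (mid K)" "tmap K \<in> nat_trans CC (fin K) (mid K)"
    and po: "is_pushout CC (Yo Star) (Yo (Player n)) (Yo (Player m))
              (Yo_map Star (Player n) [GD n i]) (Yo_map Star (Player m) [GD m j]) (ini K) a b"
    and sa: "nt_comp CC (Yo (Player n)) (smap K) a = Yo_map (Player n) ?c [GS (IotaP n i), GEps n i m j]"
    and sb: "nt_comp CC (Yo (Player m)) (smap K) b = Yo_map (Player m) ?c [GS (IotaN m j), GRho n i m j]"
    and ta: "nt_comp CC (Yo (Player n)) (tmap K) a = Yo_map (Player n) ?c [GT (IotaP n i), GEps n i m j]"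
    and tb: "nt_comp CC (Yo (Player m)) (tmap K) b = Yo_map (Player m) ?c [GT (IotaN m j), GRho n i m j]"
    using sm unfolding sync_move_def by blast
  note D = is_pushoutD[OF po] and P = tau_paths[OF ij]
  \<comment> \<open>Channel \<open>i\<close> of the sender and channel \<open>j\<close> of the
    receiver are the only ones that coincide in \<open>Tau n i m j\<close>, and they are the ones
    glued.\<close>
  have glue: "\<exists>x\<in>fob (Yo Star) Star. Yo_map Star (Player n) [GD n i] Star x = arw Star (Player n) [GD n i] \<and>
      Yo_map Star (Player m) [GD m j] Star x = arw Star (Player m) [GD m j]"
    using Yo_map_arw[OF cpath_Nil cpath_D, of i n] Yo_map_arw[OF cpath_Nil cpath_D, of j m] ij
    by (intro bexI[of _ "arw Star Star []"]) (auto simp: hom_into_Star)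
  have S: "spans (ini K) (smap K) ?c {(n, [GS (IotaP n i), GEps n i m j]), (m, [GS (IotaN m j), GRho n i m j])}"
  proof (rule spans_pushout[OF po st(1)[unfolded K(2)] sa sb P(1,5) P(2,6)])
    fix i' j'
    assume "1 \<le> i'" "i' \<le> n" "1 \<le> j'" "j' \<le> m"
      "nf (GD n i' # [GS (IotaP n i), GEps n i m j]) = nf (GD m j' # [GS (IotaN m j), GRho n i m j])"
    then have "i' = i" "j' = j" by (auto simp: nf_snoc_def split: if_splits)
    then show "\<exists>x\<in>fob (Yo Star) Star. Yo_map Star (Player n) [GD n i] Star x = arw Star (Player n) [GD n i'] \<and>
      Yo_map Star (Player m) [GD m j] Star x = arw Star (Player m) [GD m j']"
      using glue by simp
  qed (simp add: nf_snoc_def)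
  have T: "spans (ini K) (tmap K) ?c {(n, [GT (IotaP n i), GEps n i m j]), (m, [GT (IotaN m j), GRho n i m j])}"
  proof (rule spans_pushout[OF po st(2)[unfolded K(1,2)] ta tb P(3,7) P(4,8)])
    fix i' j'
    assume "1 \<le> i'" "i' \<le> n" "1 \<le> j'" "j' \<le> m"
      "nf (GD n i' # [GT (IotaP n i), GEps n i m j]) = nf (GD m j' # [GT (IotaN m j), GRho n i m j])"
    then have "i' = i" "j' = j" by (auto simp: nf_snoc_def split: if_splits)
    then show "\<exists>x\<in>fob (Yo Star) Star. Yo_map Star (Player n) [GD n i] Star x = arw Star (Player n) [GD n i'] \<and>
      Yo_map Star (Player m) [GD m j] Star x = arw Star (Player m) [GD m j']"
      using glue by simp
  qed (simp add: nf_snoc_def)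
  have eq: "smap K Star x = tmap K Star x" if x: "x \<in> fob (ini K) Star" for x
  proof -
    have *: "h Star (e Star (arw Star (Player k) [GD k l])) = arw Star ?c (GD k l # p)"
      if "nt_comp CC (Yo (Player k)) h e = Yo_map (Player k) ?c p" "cpath (Player k) p ?c" "1 \<le> l" "l \<le> k" for h e k l p
      using arg_cong[OF that(1), of "\<lambda>h. h Star (arw Star (Player k) [GD k l])"] arw_D_in[OF that(3,4)]
        Yo_map_Player(2)[OF that(2-4)] by simp
    from x consider l where "1 \<le> l" "l \<le> n" "x = a Star (arw Star (Player n) [GD n l])"
      | l where "1 \<le> l" "l \<le> m" "x = b Star (arw Star (Player m) [GD m l])"
      unfolding pushout_jointly_surj[OF po Star_valid] by (auto simp: hom_into_Player)
    then show ?thesis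
    proof cases
      case (1 l)
      have "arw Star ?c (GD n l # [GS (IotaP n i), GEps n i m j]) = arw Star ?c (GD n l # [GT (IotaP n i), GEps n i m j])"
        by (subst arw_eq_iff[OF cpath_D_Cons[OF P(1) 1(1,2)] cpath_D_Cons[OF P(3) 1(1,2)]])
          (use 1 in \<open>simp add: nf_snoc_def\<close>)
      then show ?thesis using *[OF sa P(1) 1(1,2)] *[OF ta P(3) 1(1,2)] 1(3) by simp
    next
      case (2 l)
      have "arw Star ?c (GD m l # [GS (IotaN m j), GRho n i m j]) = arw Star ?c (GD m l # [GT (IotaN m j), GRho n i m j])"
        by (subst arw_eq_iff[OF cpath_D_Cons[OF P(2) 2(1,2)] cpath_D_Cons[OF P(4) 2(1,2)]])
          (use 2 in \<open>simp add: nf_snoc_def\<close>)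
      then show ?thesis using *[OF sb P(2) 2(1,2)] *[OF tb P(4) 2(1,2)] 2(3) by simp
    qed
  qed
  have ch: "fob (channels (ini K)) x = (if x = Star then fob (ini K) Star else {})" for x
    by (simp add: channels_def)
  show ?thesis
    unfolding good_cospan_def
  proof (intro conjI)
    show "is_top ?c" using ij by simp
    show "spans (ini K) (smap K) ?c (src_paths ?c)" using S by simp
    show "spans (fin K) (tmap K) ?c (tgt_paths ?c)" using T K(1) by simp
    show "nt_mono CC (ifc K) (ifc_ini K)" by (rule nt_monoI) (simp add: K)
  qed (auto simp: K ch eq presheaf_channels[OF D(4)] channels_incl[OF D(4)])
qed

subsection \<open>Extended closed-world moves\<close>

lemma pushout_likeD:
  assumes "pushout_like C I A B f g P a b" "c \<in> ob C"
  shows "fob P c = a c ` fob A c \<union> b c ` fob B c"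
    "\<lbrakk>y \<in> fob B c; y' \<in> fob B c; b c y = b c y'\<rbrakk> \<Longrightarrow> y = y'"
    "\<lbrakk>x \<in> fob A c; x' \<in> fob A c; a c x = a c x'; x \<notin> f c ` fob I c; x' \<notin> f c ` fob I c\<rbrakk> \<Longrightarrow> x = x'"
    "\<lbrakk>x \<in> fob A c; y \<in> fob B c; a c x = b c y\<rbrakk> \<Longrightarrow> \<exists>i\<in>fob I c. x = f c i \<and> y = g c i"
  using assms unfolding pushout_like_def inj_on_def by blast+

text \<open>Both pushouts share \<open>I\<close> and \<open>B\<close>, and elements of
  \<open>A\<close> off the image of \<open>f\<close> stay off the image of \<open>f'\<close> because
  \<theta> is injective. So the two pieces of the elementwise form are never mixed.\<close>

lemma pushout_like_map_inj:
  assumes c: "c \<in> ob C" and pl: "pushout_like C I A B f g P a b" and pl': "pushout_like C I A' B f' g P' a' b'"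
    and sq: "\<And>i. i \<in> fob I c \<Longrightarrow> a c (f c i) = b c (g c i)" and g: "\<And>i. i \<in> fob I c \<Longrightarrow> g c i \<in> fob B c"
    and f: "\<And>i. i \<in> fob I c \<Longrightarrow> f c i \<in> fob A c"
    and \<theta>: "inj_on (\<theta> c) (fob A c)" and \<theta>in: "\<And>x. x \<in> fob A c \<Longrightarrow> \<theta> c x \<in> fob A' c"
    and f': "\<And>i. i \<in> fob I c \<Longrightarrow> f' c i = \<theta> c (f c i)"
    and sa: "\<And>x. x \<in> fob A c \<Longrightarrow> s c (a c x) = a' c (\<theta> c x)" and sb: "\<And>y. y \<in> fob B c \<Longrightarrow> s c (b c y) = b' c y"
  shows "inj_on (s c) (fob P c)"
proof (rule inj_onI)
  fix p p' assume p: "p \<in> fob P c" and p': "p' \<in> fob P c" and eq: "s c p = s c p'"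
  note L = pushout_likeD[OF pl c] and L' = pushout_likeD[OF pl' c]
  have dec: "(\<exists>y\<in>fob B c. q = b c y) \<or> (\<exists>x\<in>fob A c. x \<notin> f c ` fob I c \<and> q = a c x)" if q: "q \<in> fob P c" for q
  proof (cases "q \<in> b c ` fob B c")
    case False
    then obtain x where x: "x \<in> fob A c" "q = a c x" using q unfolding L(1) by blast
    then have "x \<notin> f c ` fob I c" using False sq g by auto
    then show ?thesis using x by blast
  qed blast
  have ab: "False" if x: "x \<in> fob A c" "x \<notin> f c ` fob I c" and y: "y \<in> fob B c" "a' c (\<theta> c x) = b' c y" for x y
  proof -
    obtain i where "i \<in> fob I c" "\<theta> c x = f' c i" using L'(4)[OF \<theta>in[OF x(1)] y] by blast
    then show False using inj_onD[OF \<theta> _ x(1) f] f' x(2) by auto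
  qed
  from dec[OF p] dec[OF p'] show "p = p'"
  proof (elim disjE bexE conjE)
    fix y y' assume *: "y \<in> fob B c" "p = b c y" "y' \<in> fob B c" "p' = b c y'"
    then show ?thesis using eq sb[OF *(1)] sb[OF *(3)] L'(2)[OF *(1,3)] by simp
  next
    fix y x assume *: "y \<in> fob B c" "p = b c y" "x \<in> fob A c" "p' = a c x" "x \<notin> f c ` fob I c"
    then show ?thesis using ab[OF *(3,5,1)] eq sa[OF *(3)] sb[OF *(1)] by simp
  next
    fix x y assume *: "y \<in> fob B c" "p' = b c y" "x \<in> fob A c" "p = a c x" "x \<notin> f c ` fob I c"
    then show ?thesis using ab[OF *(3,5,1)] eq sa[OF *(3)] sb[OF *(1)] by simp
  next
    fix x x' assume *: "x \<in> fob A c" "x \<notin> f c ` fob I c" "p = a c x" "x' \<in> fob A c" "x' \<notin> f c ` fob I c" "p' = a c x'"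
    have **: "\<theta> c w \<notin> f' c ` fob I c" if "w \<in> fob A c" "w \<notin> f c ` fob I c" for w
      using that inj_onD[OF \<theta> _ that(1) f] f' by auto
    have "a' c (\<theta> c x) = a' c (\<theta> c x')" using eq * sa[OF *(1)] sa[OF *(4)] by simp
    then have "\<theta> c x = \<theta> c x'" by (rule L'(3)[OF \<theta>in[OF *(1)] \<theta>in[OF *(4)] _ **[OF *(1,2)] **[OF *(4,5)]])
    then show ?thesis using inj_onD[OF \<theta> _ *(1,4)] * by blast
  qed
qed

text \<open>A subobject of a pushout is recognised as a pushout by its image: the legs are lifted
  through the mono \<open>s\<close>, and the elementwise form is inherited from \<open>P'\<close>.
  In this way both feet of a move are recovered from its middle.\<close>

lemma pushout_foot:
  assumes psh: "presheaf C I" "presheaf C A" "presheaf C B" "presheaf C P"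
    and f: "f \<in> nat_trans C I A" and g: "g \<in> nat_trans C I B"
    and \<theta>: "\<theta> \<in> nat_trans C A A'" "nt_mono C A \<theta>"
    and s: "s \<in> nat_trans C P P'" "nt_mono C P s"
    and a': "a' \<in> nat_trans C A' P'" and b': "b' \<in> nat_trans C B P'"
    and pl: "pushout_like C I A' B f' g P' a' b'"
    and f': "\<And>c i. c \<in> ob C \<Longrightarrow> i \<in> fob I c \<Longrightarrow> f' c i = \<theta> c (f c i)"
    and sq: "\<And>c i. c \<in> ob C \<Longrightarrow> i \<in> fob I c \<Longrightarrow> a' c (f' c i) = b' c (g c i)"
    and im: "\<And>c. c \<in> ob C \<Longrightarrow> s c ` fob P c = a' c ` \<theta> c ` fob A c \<union> b' c ` fob B c"
  shows "\<exists>a b. is_pushout C I A B f g P a b \<and> nt_comp C A s a = nt_comp C A a' \<theta> \<and> nt_comp C B s b = b'"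
proof -
  obtain a where a: "a \<in> nat_trans C A P"
    and sa: "\<And>c x. c \<in> ob C \<Longrightarrow> x \<in> fob A c \<Longrightarrow> s c (a c x) = nt_comp C A a' \<theta> c x"
    by (rule nat_trans_lift[OF psh(2) psh(4) s nt_comp_in[OF psh(2) \<theta>(1) a']]) (use im in auto)
  then have sa: "\<And>c x. c \<in> ob C \<Longrightarrow> x \<in> fob A c \<Longrightarrow> s c (a c x) = a' c (\<theta> c x)" by simp
  obtain b where b: "b \<in> nat_trans C B P" and sb: "\<And>c x. c \<in> ob C \<Longrightarrow> x \<in> fob B c \<Longrightarrow> s c (b c x) = b' c x"
    by (rule nat_trans_lift[OF psh(3) psh(4) s b']) (use im in auto)
  have sinj: "p = p'" if "c \<in> ob C" "p \<in> fob P c" "p' \<in> fob P c" "s c p = s c p'" for c p p'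
    using nt_mono_inj[OF s(2)] that by blast
  have \<theta>inj: "p = p'" if "c \<in> ob C" "p \<in> fob A c" "p' \<in> fob A c" "\<theta> c p = \<theta> c p'" for c p p'
    using nt_mono_inj[OF \<theta>(2)] that by blast
  have sq1: "a c (f c i) = b c (g c i)" if "c \<in> ob C" "i \<in> fob I c" for c i
    by (rule sinj[OF that(1) nat_trans_in[OF a that(1) nat_trans_in[OF f that]] nat_trans_in[OF b that(1) nat_trans_in[OF g that]]])
      (simp add: sa[OF that(1) nat_trans_in[OF f that]] sb[OF that(1) nat_trans_in[OF g that]] f'[OF that, symmetric] sq[OF that])
  have "pushout_like C I A B f g P a b"
    unfolding pushout_like_def
  proof (intro ballI conjI impI)
    fix c assume c: "c \<in> ob C"
    note L = pushout_likeD[OF pl c]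
    show "fob P c = a c ` fob A c \<union> b c ` fob B c"
    proof
      show "a c ` fob A c \<union> b c ` fob B c \<subseteq> fob P c" using nat_trans_in[OF a c] nat_trans_in[OF b c] by blast
      show "fob P c \<subseteq> a c ` fob A c \<union> b c ` fob B c"
      proof
        fix p assume p: "p \<in> fob P c"
        then have "s c p \<in> a' c ` \<theta> c ` fob A c \<union> b' c ` fob B c" using im[OF c] by blast
        then consider x where "x \<in> fob A c" "s c p = s c (a c x)" | y where "y \<in> fob B c" "s c p = s c (b c y)"
          using sa[OF c] sb[OF c] by auto
        then show "p \<in> a c ` fob A c \<union> b c ` fob B c"
          by cases (use sinj[OF c p] nat_trans_in[OF a c] nat_trans_in[OF b c] in blast)+
      qed
    qed
    show "inj_on (b c) (fob B c)"
    proof (rule inj_onI)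
      fix y y' assume *: "y \<in> fob B c" "y' \<in> fob B c" "b c y = b c y'"
      then show "y = y'" using L(2)[OF *(1,2)] sb[OF c *(1)] sb[OF c *(2)] by simp
    qed
    show "inj_on (a c) (fob A c - f c ` fob I c)"
    proof (rule inj_onI)
      fix x x' assume *: "x \<in> fob A c - f c ` fob I c" "x' \<in> fob A c - f c ` fob I c" "a c x = a c x'"
      have **: "\<theta> c w \<notin> f' c ` fob I c" if "w \<in> fob A c - f c ` fob I c" for w
        using that f'[OF c] \<theta>inj[OF c _ nat_trans_in[OF f c]] by auto
      have xx: "x \<in> fob A c" "x' \<in> fob A c" using * by auto
      have "a' c (\<theta> c x) = a' c (\<theta> c x')" using sa[OF c xx(1)] sa[OF c xx(2)] *(3) by simp
      then have "\<theta> c x = \<theta> c x'"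
        by (rule L(3)[OF nat_trans_in[OF \<theta>(1) c xx(1)] nat_trans_in[OF \<theta>(1) c xx(2)] _ **[OF *(1)] **[OF *(2)]])
      then show "x = x'" using \<theta>inj[OF c xx] by blast
    qed
    fix x y assume *: "x \<in> fob A c" "y \<in> fob B c" "a c x = b c y"
    have "a' c (\<theta> c x) = b' c y" using sa[OF c *(1)] sb[OF c *(2)] *(3) by simp
    then obtain i where i: "i \<in> fob I c" "\<theta> c x = f' c i" "y = g c i"
      using L(4)[OF nat_trans_in[OF \<theta>(1) c *(1)] *(2)] by blast
    then have "x = f c i" using \<theta>inj[OF c *(1) nat_trans_in[OF f c i(1)]] f'[OF c i(1)] by simp
    then show "\<exists>i\<in>fob I c. x = f c i \<and> y = g c i" using i by blast
  qed
  then have "is_pushout C I A B f g P a b"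
    by (intro pushout_criterion[OF psh f g a b]) (simp_all add: sq1)
  moreover have "nt_comp C A s a = nt_comp C A a' \<theta>" by (rule nt_comp_eqI) (rule sa)
  moreover have "nt_comp C B s b = b'" by (rule nt_comp_eq_ntI[OF b']) (rule sb)
  ultimately show ?thesis by blast
qed

text \<open>
  The shape of an extended closed-world move \<open>X \<rightarrow> M \<leftarrow> Y\<close>, generated by the element \<open>m\<close> of type \<open>c\<close>.
\<close>

definition cw_step :: "cobj \<Rightarrow> 'a \<Rightarrow> 'a move_pred" where
  "cw_step c m X s M t Y \<longleftrightarrow>
     (is_top c \<and> m \<in> fob M c \<and> presheaf CC X \<and> presheaf CC M \<and> presheaf CC Y \<and>
      s \<in> nat_trans CC X M \<and> nt_mono CC X s \<and> t \<in> nat_trans CC Y M \<and> nt_mono CC Y t) \<and>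
     (\<forall>a\<in>ob CC. a \<noteq> Star \<longrightarrow> inj_on (\<lambda>g. far M a c g m) (hom CC a c)) \<and>
     (\<forall>a\<in>ob CC. a \<noteq> Star \<longrightarrow> (\<forall>n. a \<noteq> Player n) \<longrightarrow>
        fob X a = {} \<and> fob Y a = {} \<and> fob M a = (\<lambda>g. far M a c g m) ` hom CC a c) \<and>
     (\<forall>n. fob M (Player n) = s (Player n) ` fob X (Player n) \<union> (\<lambda>g. far M (Player n) c g m) ` tgts c n \<and>
        s (Player n) ` fob X (Player n) \<inter> (\<lambda>g. far M (Player n) c g m) ` tgts c n = {} \<and>
        (\<lambda>g. far M (Player n) c g m) ` srcs c n \<subseteq> s (Player n) ` fob X (Player n) \<and>
        t (Player n) ` fob Y (Player n) = fob M (Player n) - (\<lambda>g. far M (Player n) c g m) ` srcs c n) \<and>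
     (fob M Star = s Star ` fob X Star \<union> (\<lambda>g. far M Star c g m) ` news c \<and>
      s Star ` fob X Star \<inter> (\<lambda>g. far M Star c g m) ` news c = {} \<and> t Star ` fob Y Star = fob M Star)"

lemma cw_stepD:
  assumes "cw_step c m X s M t Y"
  shows "is_top c" "m \<in> fob M c" "presheaf CC X" "presheaf CC M" "presheaf CC Y"
    "s \<in> nat_trans CC X M" "nt_mono CC X s" "t \<in> nat_trans CC Y M" "nt_mono CC Y t"
    "\<And>a. a \<in> ob CC \<Longrightarrow> a \<noteq> Star \<Longrightarrow> inj_on (\<lambda>g. far M a c g m) (hom CC a c)"
    "\<And>a. \<lbrakk>a \<in> ob CC; a \<noteq> Star; \<And>n. a \<noteq> Player n\<rbrakk> \<Longrightarrow> fob X a = {}"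
    "\<And>a. \<lbrakk>a \<in> ob CC; a \<noteq> Star; \<And>n. a \<noteq> Player n\<rbrakk> \<Longrightarrow> fob Y a = {}"
    "\<And>a. \<lbrakk>a \<in> ob CC; a \<noteq> Star; \<And>n. a \<noteq> Player n\<rbrakk> \<Longrightarrow> fob M a = (\<lambda>g. far M a c g m) ` hom CC a c"
    "\<And>n. fob M (Player n) = s (Player n) ` fob X (Player n) \<union> (\<lambda>g. far M (Player n) c g m) ` tgts c n"
    "\<And>n. s (Player n) ` fob X (Player n) \<inter> (\<lambda>g. far M (Player n) c g m) ` tgts c n = {}"
    "\<And>n. (\<lambda>g. far M (Player n) c g m) ` srcs c n \<subseteq> s (Player n) ` fob X (Player n)"
    "\<And>n. t (Player n) ` fob Y (Player n) = fob M (Player n) - (\<lambda>g. far M (Player n) c g m) ` srcs c n"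
    "fob M Star = s Star ` fob X Star \<union> (\<lambda>g. far M Star c g m) ` news c"
    "s Star ` fob X Star \<inter> (\<lambda>g. far M Star c g m) ` news c = {}"
    "t Star ` fob Y Star = fob M Star"
  using assms by (simp_all add: cw_step_def)

lemma good_cospanD:
  assumes "good_cospan K c"
  shows "is_top c" "mid K = Yo c" "spans (ini K) (smap K) c (src_paths c)" "spans (fin K) (tmap K) c (tgt_paths c)"
    "presheaf CC (ifc K)" "ifc_ini K \<in> nat_trans CC (ifc K) (ini K)" "ifc_fin K \<in> nat_trans CC (ifc K) (fin K)"
    "nt_mono CC (ifc K) (ifc_ini K)" "\<And>a. a \<in> ob CC \<Longrightarrow> a \<noteq> Star \<Longrightarrow> fob (ifc K) a = {}"
    "\<And>a i. a \<in> ob CC \<Longrightarrow> i \<in> fob (ifc K) a \<Longrightarrow> smap K a (ifc_ini K a i) = tmap K a (ifc_fin K a i)"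
    "ifc_ini K Star ` fob (ifc K) Star = fob (ini K) Star"
proof -
  fix a i assume "a \<in> ob CC" "i \<in> fob (ifc K) a"
  then show "smap K a (ifc_ini K a i) = tmap K a (ifc_fin K a i)"
    using assms unfolding good_cospan_def by (cases "a = Star") auto
qed (use assms in \<open>auto simp: good_cospan_def\<close>)

lemma good_cospan_images:
  assumes "good_cospan K c"
  shows "smap K Star ` fob (ini K) Star = olds c" "tmap K Star ` fob (fin K) Star = hom CC Star c"
    "smap K (Player n) ` fob (ini K) (Player n) = srcs c n" "tmap K (Player n) ` fob (fin K) (Player n) = tgts c n"
  using spansD(5,6)[OF good_cospanD(3)[OF assms]] spansD(5,6)[OF good_cospanD(4)[OF assms]]
    olds_paths[OF good_cospanD(1)[OF assms]] hom_Star_via_tgts[OF good_cospanD(1)[OF assms]]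
  by (simp_all add: srcs_def tgts_def)

lemma position_finite:
  assumes "position P" "a \<in> ob CC"
  shows "finite (fob P a)"
proof (rule finite_subset)
  show "fob P a \<subseteq> snd ` (SIGMA c:ob CC. fob P c)" using assms(2) by force
  show "finite (snd ` (SIGMA c:ob CC. fob P c))" using assms(1) by (simp add: position_def)
qed

lemma position_empty: "position P \<Longrightarrow> a \<in> ob CC \<Longrightarrow> a \<noteq> Star \<Longrightarrow> (\<And>n. a \<noteq> Player n) \<Longrightarrow> fob P a = {}"
  unfolding position_def by blast

lemma spans_countable: "spans P \<eta> c S \<Longrightarrow> a \<in> ob CC \<Longrightarrow> countable (fob P a)"
  using spansD(2,3)[of P \<eta> c S] nat_trans_in[of \<eta> CC P "Yo c" a]
  by (intro countable_image_inj_on[of "\<eta> a"] countable_subset[OF _ countable_hom[of a c]])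
    (auto simp: nt_mono_def)

text \<open>All three pushouts are taken along the same map into the same position \<open>Z\<close>,
  so their elementwise forms compare \<open>X\<close>, \<open>M\<close> and \<open>Y\<close>
  directly. Away from channels the interface is empty, hence the representable and \<open>Z\<close>
  stay disjoint there.\<close>

lemma pushed_out_cw_step:
  fixes M :: "'a::infinite cpsh"
  assumes gk: "good_cospan K c" and po: "pushed_out K X s M t Y"
  shows "\<exists>m. cw_step c m X s M t Y"
proof -
  note G = good_cospanD[OF gk] and GI = good_cospan_images[OF gk]
  note SI = spansD[OF G(3)] and ST = spansD[OF G(4)]
  have c: "c \<in> ob CC" by (rule top_valid[OF G(1)])
  let ?J = "nt_comp CC (ifc K) (smap K) (ifc_ini K)"
  obtain Z :: "'a cpsh" and z pX qX pM qM pY qY where Z: "position Z"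
    and poX: "is_pushout CC (ifc K) (ini K) Z (ifc_ini K) z X pX qX"
    and poM: "is_pushout CC (ifc K) (Yo c) Z ?J z M pM qM"
    and poY: "is_pushout CC (ifc K) (fin K) Z (ifc_fin K) z Y pY qY"
    and s: "s \<in> nat_trans CC X M" and sp: "nt_comp CC (ini K) s pX = nt_comp CC (ini K) pM (smap K)"
    and sq: "nt_comp CC Z s qX = qM"
    and t: "t \<in> nat_trans CC Y M" and tp: "nt_comp CC (fin K) t pY = nt_comp CC (fin K) pM (tmap K)"
    and tq: "nt_comp CC Z t qY = qM"
    using po unfolding pushed_out_def G(2) by blast
  note DX = is_pushoutD[OF poX] and DM = is_pushoutD[OF poM] and DY = is_pushoutD[OF poY]
  have Jm: "nt_mono CC (ifc K) ?J"
  proof (rule nt_monoI)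
    fix a x y assume a: "a \<in> ob CC" and x: "x \<in> fob (ifc K) a" and y: "y \<in> fob (ifc K) a" and eq: "?J a x = ?J a y"
    then have "ifc_ini K a x = ifc_ini K a y"
      using nt_mono_inj[OF SI(3) a nat_trans_in[OF G(6) a x] nat_trans_in[OF G(6) a y]] by simp
    then show "x = y" using nt_mono_inj[OF G(8) a x y] by blast
  qed
  have fm: "nt_mono CC (ifc K) (ifc_fin K)"
  proof (rule nt_monoI)
    fix a x y assume a: "a \<in> ob CC" and x: "x \<in> fob (ifc K) a" and y: "y \<in> fob (ifc K) a"
      and eq: "ifc_fin K a x = ifc_fin K a y"
    then have "?J a x = ?J a y" using G(10)[OF a x] G(10)[OF a y] by simp
    then show "x = y" using nt_mono_inj[OF Jm a x y] by blast
  qed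
  have cZ: "countable (fob Z a)" if "a \<in> ob CC" for a
    using position_finite[OF Z that] by (rule countable_finite)
  have plX: "pushout_like CC (ifc K) (ini K) Z (ifc_ini K) z X pX qX"
    by (rule pushout_char[OF poX G(8) spans_countable[OF G(3)] cZ])
  have plM: "pushout_like CC (ifc K) (Yo c) Z ?J z M pM qM"
    by (rule pushout_char[OF poM Jm _ cZ]) (simp_all add: countable_hom)
  have plY: "pushout_like CC (ifc K) (fin K) Z (ifc_fin K) z Y pY qY"
    by (rule pushout_char[OF poY fm spans_countable[OF G(4)] cZ])
  have sp': "s a (pX a x) = pM a (smap K a x)" if "a \<in> ob CC" "x \<in> fob (ini K) a" for a x
    by (rule nt_comp_eqD[OF sp that])
  have tp': "t a (pY a x) = pM a (tmap K a x)" if "a \<in> ob CC" "x \<in> fob (fin K) a" for a x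
    by (rule nt_comp_eqD[OF tp that])
  have sq': "s a (qX a x) = qM a x" if "a \<in> ob CC" "x \<in> fob Z a" for a x
    using nt_comp_app[OF that, of s qX] sq by simp
  have tq': "t a (qY a x) = qM a x" if "a \<in> ob CC" "x \<in> fob Z a" for a x
    using nt_comp_app[OF that, of t qY] tq by simp
  have imX: "s a ` fob X a = pM a ` smap K a ` fob (ini K) a \<union> qM a ` fob Z a" if a: "a \<in> ob CC" for a
    unfolding pushout_likeD(1)[OF plX a] image_Un image_image using sp'[OF a] sq'[OF a] by (simp cong: image_cong)
  have imY: "t a ` fob Y a = pM a ` tmap K a ` fob (fin K) a \<union> qM a ` fob Z a" if a: "a \<in> ob CC" for a
    unfolding pushout_likeD(1)[OF plY a] image_Un image_image using tp'[OF a] tq'[OF a] by (simp cong: image_cong)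
  have imM: "fob M a = pM a ` hom CC a c \<union> qM a ` fob Z a" if a: "a \<in> ob CC" for a
    using pushout_likeD(1)[OF plM a] by simp
  have sm: "nt_mono CC X s"
    unfolding nt_mono_def
  proof
    fix a assume a: "a \<in> ob CC"
    show "inj_on (s a) (fob X a)"
      by (rule pushout_like_map_inj[OF a plX plM DX(9)[OF a] nat_trans_in[OF DX(6) a] nat_trans_in[OF DX(5) a],
            of "smap K"])
        (use a SI(3) nat_trans_in[OF SI(2) a] sp' sq' in \<open>auto simp: nt_mono_def\<close>)
  qed
  have tm: "nt_mono CC Y t"
    unfolding nt_mono_def
  proof
    fix a assume a: "a \<in> ob CC"
    show "inj_on (t a) (fob Y a)"
      by (rule pushout_like_map_inj[OF a plY plM DY(9)[OF a] nat_trans_in[OF DY(6) a] nat_trans_in[OF DY(5) a],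
            of "tmap K"])
        (use a ST(3) nat_trans_in[OF ST(2) a] tp' tq' G(10) in \<open>auto simp: nt_mono_def\<close>)
  qed
  \<comment> \<open>The generator of the move is the image of the identity; the image of the
    representable consists of its restrictions.\<close>
  define m where "m = pM c (idn CC c)"
  have m: "m \<in> fob M c"
    unfolding m_def by (rule nat_trans_in[OF DM(7) c]) (simp add: category_idn_in[OF category_CC c])
  have dot: "pM a g = far M a c g m" if "a \<in> ob CC" "g \<in> hom CC a c" for a g
    unfolding m_def by (rule yoneda_nt[OF category_CC c DM(7) that])
  have dots: "pM a ` G = (\<lambda>g. far M a c g m) ` G" if "a \<in> ob CC" "G \<subseteq> hom CC a c" for a G
    using dot that by (intro image_cong) auto
  have JStar: "?J Star ` fob (ifc K) Star = olds c"
  proof -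
    have "?J Star ` fob (ifc K) Star = smap K Star ` ifc_ini K Star ` fob (ifc K) Star"
      unfolding image_image by (rule image_cong) auto
    then show ?thesis using G(11) GI(1) by simp
  qed
  have pinj: "inj_on (pM a) (hom CC a c)" if a: "a \<in> ob CC" "a \<noteq> Star" for a
    using pushout_likeD(3)[OF plM a(1)] G(9)[OF a] by (intro inj_onI) auto
  have pq: "pM a g \<noteq> qM a w" if a: "a \<in> ob CC" "a \<noteq> Star" and "g \<in> hom CC a c" "w \<in> fob Z a" for a g w
    using pushout_likeD(4)[OF plM a(1)] G(9)[OF a] that(3,4) by auto
  have pq0: "pM Star g \<noteq> qM Star w" if gn: "g \<in> news c" and w: "w \<in> fob Z Star" for g w
  proof
    have gh: "g \<in> hom CC Star c" using gn hom_Star_top(1)[OF G(1)] by blast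
    assume eq: "pM Star g = qM Star w"
    have "\<exists>i\<in>fob (ifc K) Star. g = ?J Star i \<and> w = z Star i"
      by (rule pushout_likeD(4)[OF plM Star_valid _ w eq]) (simp add: gh)
    then have "g \<in> olds c" using JStar by blast
    then show False using gn hom_Star_top(2)[OF G(1)] by blast
  qed
  \<comment> \<open>Every old channel comes from the interface, hence already lies in
    \<open>Z\<close>.\<close>
  have oldq: "pM Star ` olds c \<subseteq> qM Star ` fob Z Star"
    using DM(9)[OF Star_valid] nat_trans_in[OF DM(6) Star_valid] unfolding JStar[symmetric] by auto
  show ?thesis
    unfolding cw_step_def
  proof (intro exI[of _ m] conjI ballI allI impI G(1) m DX(4) DM(4) DY(4) s sm t tm)
    fix a assume a: "a \<in> ob CC" "a \<noteq> Star"
    show "inj_on (\<lambda>g. far M a c g m) (hom CC a c)"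
      using pinj[OF a] dot[OF a(1)] by (simp add: inj_on_def)
    assume np: "\<forall>n. a \<noteq> Player n"
    have Ze: "fob Z a = {}" using position_empty[OF Z a] np by blast
    show "fob X a = {}" using pushout_likeD(1)[OF plX a(1)] Ze SI(4)[OF a] np by simp
    show "fob Y a = {}" using pushout_likeD(1)[OF plY a(1)] Ze ST(4)[OF a] np by simp
    show "fob M a = (\<lambda>g. far M a c g m) ` hom CC a c"
      using imM[OF a(1)] Ze dots[OF a(1) order_refl] by simp
  next
    fix n
    let ?a = "Player n"
    note H = hom_Player_top[OF G(1), of n]
    have ds: "(\<lambda>g. far M ?a c g m) ` srcs c n = pM ?a ` srcs c n"
      "(\<lambda>g. far M ?a c g m) ` tgts c n = pM ?a ` tgts c n"
      using dots[of ?a] H(1) by auto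
    have sd: "pM ?a ` srcs c n \<inter> pM ?a ` tgts c n = {}"
      using H pinj[of ?a] unfolding inj_on_def by auto
    have qd: "pM ?a ` (srcs c n \<union> tgts c n) \<inter> qM ?a ` fob Z ?a = {}"
      using pq[of ?a] H(1) by auto
    note iX = imX[OF Player_valid[of n], unfolded GI] and iY = imY[OF Player_valid[of n], unfolded GI]
      and iM = imM[OF Player_valid[of n], unfolded H(1)]
    show "fob M ?a = s ?a ` fob X ?a \<union> (\<lambda>g. far M ?a c g m) ` tgts c n"
      unfolding ds iX iM by blast
    show "s ?a ` fob X ?a \<inter> (\<lambda>g. far M ?a c g m) ` tgts c n = {}"
      unfolding ds iX using sd qd by blast
    show "(\<lambda>g. far M ?a c g m) ` srcs c n \<subseteq> s ?a ` fob X ?a"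
      unfolding ds iX by blast
    show "t ?a ` fob Y ?a = fob M ?a - (\<lambda>g. far M ?a c g m) ` srcs c n"
      unfolding ds iY iM using sd qd by blast
  next
    note H = hom_Star_top[OF G(1)]
    have ds: "(\<lambda>g. far M Star c g m) ` news c = pM Star ` news c"
      using dots[of Star "news c"] H(1) by auto
    note iX = imX[OF Star_valid, unfolded GI] and iY = imY[OF Star_valid, unfolded GI]
      and iM = imM[OF Star_valid]
    show "fob M Star = s Star ` fob X Star \<union> (\<lambda>g. far M Star c g m) ` news c"
      unfolding ds iX iM H(1) by blast
    have sX: "s Star ` fob X Star = qM Star ` fob Z Star" unfolding iX using oldq by blast
    show "s Star ` fob X Star \<inter> (\<lambda>g. far M Star c g m) ` news c = {}"
      unfolding ds sX by (intro equalityI subsetI) (auto dest!: pq0 dest: sym)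
    show "t Star ` fob Y Star = fob M Star" unfolding iY iM by blast
  qed
qed

lemma ext_closed_world_cw_step:
  fixes M :: "'a::infinite cpsh"
  assumes "ext_closed_world X s M t Y"
  shows "\<exists>c m. cw_step c m X s M t Y"
  using assms
proof cases
  case (fork n K) then show ?thesis using pushed_out_cw_step[OF good_fork] by blast
next
  case (sync i n j m K) then show ?thesis using pushed_out_cw_step[OF good_sync] by blast
next
  case (tick n) then show ?thesis using pushed_out_cw_step[OF good_tick] by blast
next
  case (new_channel n) then show ?thesis using pushed_out_cw_step[OF good_nu] by blast
qed

text \<open>An old channel is a restriction of a source player, and source players lie in
  \<open>X\<close>.\<close>

lemma cw_step_old_channels:
  assumes st: "cw_step c m X s M t Y"
  shows "(\<lambda>g. far M Star c g m) ` olds c \<subseteq> s Star ` fob X Star"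
proof
  note S = cw_stepD[OF st]
  have c: "c \<in> ob CC" by (rule top_valid[OF S(1)])
  fix e assume "e \<in> (\<lambda>g. far M Star c g m) ` olds c"
  then obtain n g i where g: "g \<in> srcs c n" and i: "1 \<le> i" "i \<le> n"
    and e: "e = far M Star c (cmp CC Star (Player n) c g (arw Star (Player n) [GD n i])) m"
    unfolding olds_def by blast
  have gh: "g \<in> hom CC (Player n) c" using g hom_Player_top(1)[OF S(1)] by blast
  obtain x where x: "x \<in> fob X (Player n)" "far M (Player n) c g m = s (Player n) x"
    using S(16) g by blast
  have "e = far M Star (Player n) (arw Star (Player n) [GD n i]) (s (Player n) x)"
    unfolding e presheaf_far_cmp[OF S(4) Star_valid Player_valid c arw_D_in[OF i] gh S(2)] x(2) ..
  also have "\<dots> = s Star (far X Star (Player n) (arw Star (Player n) [GD n i]) x)"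
    using nat_trans_natural[OF S(6) Star_valid Player_valid arw_D_in[OF i] x(1)] by simp
  finally show "e \<in> s Star ` fob X Star"
    using presheaf_far_in[OF S(3) Star_valid Player_valid arw_D_in[OF i] x(1)] by blast
qed

text \<open>The context is rebuilt inside \<open>M\<close>: \<open>Z\<close> consists of what the
  move leaves alone. The middle is then a pushout by the elementwise criterion, and both feet follow
  from it through their images.\<close>

lemma cw_step_pushed_out:
  fixes K :: "('i, 'x, gen list set, 'z) icospan" and M :: "'a cpsh"
  assumes gk: "good_cospan K c" and st: "cw_step c m X s M t Y" and X: "position X"
  shows "pushed_out K X s M t Y"
proof -
  note G = good_cospanD[OF gk] and GI = good_cospan_images[OF gk] and S = cw_stepD[OF st]
  note SI = spansD[OF G(3)] and ST = spansD[OF G(4)]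
  have c: "c \<in> ob CC" by (rule top_valid[OF G(1)])
  note HP = hom_Player_top[OF G(1)] and HS = hom_Star_top[OF G(1)]
  let ?J = "nt_comp CC (ifc K) (smap K) (ifc_ini K)"
  let ?d = "\<lambda>a g. far M a c g m"
  \<comment> \<open>All channels of \<open>X\<close> belong to the context, but the source players
    do not: they are supplied by the cospan.\<close>
  define z where "z a = (case a of Star \<Rightarrow> s Star ` fob X Star
     | Player n \<Rightarrow> s (Player n) ` fob X (Player n) - ?d (Player n) ` srcs c n | _ \<Rightarrow> {})" for a
  have z0: "z Star = s Star ` fob X Star" and zP: "z (Player n) = s (Player n) ` fob X (Player n) - ?d (Player n) ` srcs c n"
    and zN: "\<lbrakk>a \<noteq> Star; \<And>n. a \<noteq> Player n\<rbrakk> \<Longrightarrow> z a = {}" for n a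
    by (simp_all add: z_def split: cobj.split)
  have zX: "z a \<subseteq> s a ` fob X a" for a by (cases a) (auto simp: z_def)
  have zM: "z a \<subseteq> fob M a" if "a \<in> ob CC" for a
    using zX[of a] nat_trans_in[OF S(6) that] by blast
  let ?Z = "sub_psh M z"
  have clos: "far M a b f x \<in> z a" if a: "a \<in> ob CC" and b: "b \<in> ob CC" and f: "f \<in> hom CC a b" and x: "x \<in> z b" for a b f x
  proof -
    consider "b = Star" | n where "b = Player n" using x zN by blast
    then show ?thesis
    proof cases
      case 1
      then have "a = Star" "f = idn CC Star" using f by (auto simp: hom_into_Star idn_CC split: if_splits)
      then show ?thesis using 1 x presheaf_far_id[OF S(4) b] zM[OF b] by auto
    next
      case (2 n)
      show ?thesis
      proof (cases "a = Player n")
        case True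
        then have "f = idn CC b" using f 2 by (simp add: hom_into_Player idn_CC)
        then show ?thesis using 2 True x presheaf_far_id[OF S(4) b] zM[OF b] by auto
      next
        case False
        then have a0: "a = Star" using f 2 by (auto simp: hom_into_Player split: if_splits)
        obtain y where y: "y \<in> fob X b" "x = s b y" using zX x by blast
        then have "far M a b f x = s a (far X a b f y)" using nat_trans_natural[OF S(6) a b f y(1)] by simp
        then show ?thesis using presheaf_far_in[OF S(3) a b f y(1)] a0 z0 by simp
      qed
    qed
  qed
  have Zp: "presheaf CC ?Z" by (rule presheaf_sub_psh[OF S(4) zM clos])
  have Z: "position ?Z"
    unfolding position_def
  proof (intro conjI ballI impI Zp)
    show "finite (SIGMA c:ob CC. fob ?Z c)"
    proof (rule finite_subset)
      show "(SIGMA c:ob CC. fob ?Z c) \<subseteq> (\<lambda>(a, x). (a, s a x)) ` (SIGMA c:ob CC. fob X c)"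
        using zX by force
      show "finite ((\<lambda>(a, x). (a, s a x)) ` (SIGMA c:ob CC. fob X c))"
        using X by (simp add: position_def)
    qed
  qed (simp add: zN)
  let ?pM = "mk_nt CC (Yo c) ?d" and ?qM = "nt_id CC ?Z"
  have pM: "?pM \<in> nat_trans CC (Yo c) M" by (rule yoneda_elt_in[OF category_CC c S(4) S(2)])
  have qM: "?qM \<in> nat_trans CC ?Z M" by (rule sub_psh_incl[OF Zp zM])
  have J: "?J \<in> nat_trans CC (ifc K) (Yo c)" by (rule nt_comp_in[OF G(5) G(6) SI(2)])
  have JStar: "?J Star ` fob (ifc K) Star = olds c"
  proof -
    have "?J Star ` fob (ifc K) Star = smap K Star ` ifc_ini K Star ` fob (ifc K) Star"
      unfolding image_image by (rule image_cong) auto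
    then show ?thesis using G(11) GI(1) by simp
  qed
  have Jh: "?J a i \<in> hom CC a c" if "a \<in> ob CC" "i \<in> fob (ifc K) a" for a i
    using nat_trans_in[OF J that] by simp
  have dJ: "?d a (?J a i) \<in> z a" if a: "a \<in> ob CC" and i: "i \<in> fob (ifc K) a" for a i
  proof -
    have a0: "a = Star" using G(9)[OF a] i by blast
    then have "?J a i \<in> olds c" using JStar i by blast
    then show ?thesis using cw_step_old_channels[OF st] a0 z0 by blast
  qed
  \<comment> \<open>The interface enters the context by way of the representable, since its elements
    become old channels of the move.\<close>
  define zeta where "zeta = nt_comp CC (ifc K) ?pM ?J"
  have zeta_app: "zeta a i = ?d a (?J a i)" if "a \<in> ob CC" "i \<in> fob (ifc K) a" for a i
    using that Jh[OF that] by (simp add: zeta_def)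
  have zeta: "zeta \<in> nat_trans CC (ifc K) ?Z"
    by (rule nat_trans_codom[OF nt_comp_in[OF G(5) J pM, folded zeta_def]]) (use dJ zeta_app in auto)
  have dinj: "g = h" if "a \<in> ob CC" "a \<noteq> Star" "g \<in> hom CC a c" "h \<in> hom CC a c" "?d a g = ?d a h" for a g h
    using inj_onD[OF S(10)[OF that(1,2)] that(5,3,4)] .
  have plM: "pushout_like CC (ifc K) (Yo c) ?Z ?J zeta M ?pM ?qM"
    unfolding pushout_like_def
  proof (intro ballI conjI impI)
    fix a assume a: "a \<in> ob CC"
    have p: "?pM a ` fob (Yo c) a = ?d a ` hom CC a c" using a by (auto simp: image_iff)
    have q: "?qM a ` fob ?Z a = z a" using a by (auto simp: image_iff)
    have "fob M a = ?d a ` hom CC a c \<union> z a"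
    proof -
      consider "a = Star" | n where "a = Player n" | "a \<noteq> Star" "\<And>n. a \<noteq> Player n" by blast
      then show ?thesis
      proof cases
        case 1
        then show ?thesis using cw_step_old_channels[OF st] S(18) HS(1) z0 by auto
      next
        case (2 n)
        then show ?thesis using S(14)[of n] S(16)[of n] HP(1)[of n] zP[of n] by auto
      next
        case 3 then show ?thesis using S(13)[OF a] zN[of a] by auto
      qed
    qed
    then show "fob M a = ?pM a ` fob (Yo c) a \<union> ?qM a ` fob ?Z a" unfolding p q .
    show "inj_on (?qM a) (fob ?Z a)" using a by (simp add: inj_on_def)
    show "inj_on (?pM a) (fob (Yo c) a - ?J a ` fob (ifc K) a)"
    proof (cases "a = Star")
      case True
      have "fob (Yo c) a - ?J a ` fob (ifc K) a \<subseteq> news c" unfolding True JStar using HS(1) by auto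
      then show ?thesis using news_unique by (intro inj_onI) blast
    next
      case False
      show ?thesis
      proof (rule inj_onI)
        fix x y assume "x \<in> fob (Yo c) a - ?J a ` fob (ifc K) a" "y \<in> fob (Yo c) a - ?J a ` fob (ifc K) a" "?pM a x = ?pM a y"
        then show "x = y" using dinj[OF a False, of x y] a by simp
      qed
    qed
    fix g y assume g: "g \<in> fob (Yo c) a" and y: "y \<in> fob ?Z a" and eq: "?pM a g = ?qM a y"
    have gh: "g \<in> hom CC a c" and eq': "?d a g = y" and yz: "y \<in> z a" using g y eq a by simp_all
    have "g \<in> ?J a ` fob (ifc K) a"
    proof -
      consider "a = Star" | n where "a = Player n" | "a \<noteq> Star" "\<And>n. a \<noteq> Player n" by blast
      then show ?thesis
      proof cases
        case 1
        then have "g \<notin> news c" using S(19) eq' yz z0 by auto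
        then show ?thesis using gh HS(1) 1 unfolding 1 JStar by auto
      next
        case (2 n)
        then have "g \<notin> tgts c n" using S(15)[of n] eq' yz zP[of n] by auto
        then have "g \<in> srcs c n" using gh 2 HP(1)[of n] by auto
        then show ?thesis using eq' yz zP[of n] 2 by auto
      next
        case 3 then show ?thesis using zN[of a] yz by auto
      qed
    qed
    then show "\<exists>i\<in>fob (ifc K) a. g = ?J a i \<and> y = zeta a i" using eq' zeta_app[OF a] by auto
  qed
  have sqM: "?pM a (?J a i) = ?qM a (zeta a i)" if "a \<in> ob CC" "i \<in> fob (ifc K) a" for a i
    using that Jh[OF that] dJ[OF that] zeta_app[OF that] by simp
  have poM: "is_pushout CC (ifc K) (Yo c) ?Z ?J zeta M ?pM ?qM"
    by (rule pushout_criterion[OF G(5) presheaf_Yo[OF c] Zp S(4) J zeta pM qM sqM plM])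
  have pim: "?pM a ` H = ?d a ` H" if "a \<in> ob CC" "H \<subseteq> hom CC a c" for a H
    using that by (intro image_cong) auto
  have qim: "?qM a ` fob ?Z a = z a" if "a \<in> ob CC" for a using that by (auto simp: image_iff)
  have imX: "s a ` fob X a = ?pM a ` smap K a ` fob (ini K) a \<union> ?qM a ` fob ?Z a" if a: "a \<in> ob CC" for a
  proof -
    have h: "smap K a ` fob (ini K) a \<subseteq> hom CC a c" using nat_trans_in[OF SI(2) a] by auto
    consider "a = Star" | n where "a = Player n" | "a \<noteq> Star" "\<And>n. a \<noteq> Player n" by blast
    then show ?thesis
    proof cases
      case 1
      then show ?thesis unfolding qim[OF a] pim[OF a h] using cw_step_old_channels[OF st] GI(1) z0 by auto
    next
      case (2 n)
      then show ?thesis unfolding qim[OF a] pim[OF a h] using GI(3)[of n] zP[of n] S(16)[of n] by auto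
    next
      case 3
      then show ?thesis unfolding qim[OF a] pim[OF a h] using S(11)[OF a] SI(4)[OF a] zN[of a] by auto
    qed
  qed
  have imY: "t a ` fob Y a = ?pM a ` tmap K a ` fob (fin K) a \<union> ?qM a ` fob ?Z a" if a: "a \<in> ob CC" for a
  proof -
    have h: "tmap K a ` fob (fin K) a \<subseteq> hom CC a c" using nat_trans_in[OF ST(2) a] by auto
    consider "a = Star" | n where "a = Player n" | "a \<noteq> Star" "\<And>n. a \<noteq> Player n" by blast
    then show ?thesis
    proof cases
      case 1
      then show ?thesis unfolding qim[OF a] pim[OF a h]
        using cw_step_old_channels[OF st] GI(2) z0 S(18,20) HS(1) by auto
    next
      case (2 n)
      have "?d (Player n) ` srcs c n \<inter> ?d (Player n) ` tgts c n = {}"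
        using S(15,16)[of n] by blast
      then show ?thesis unfolding qim[OF a] pim[OF a h] unfolding 2
        using GI(4)[of n] zP[of n] S(14)[of n] S(17)[of n] by auto
    next
      case 3
      then show ?thesis unfolding qim[OF a] pim[OF a h] using S(12)[OF a] ST(4)[OF a] zN[of a] by auto
    qed
  qed
  obtain pX qX where X1: "is_pushout CC (ifc K) (ini K) ?Z (ifc_ini K) zeta X pX qX"
    "nt_comp CC (ini K) s pX = nt_comp CC (ini K) ?pM (smap K)" "nt_comp CC ?Z s qX = ?qM"
    using pushout_foot[OF G(5) SI(1) Zp S(3) G(6) zeta SI(2,3) S(6,7) pM qM plM _ sqM imX] by auto
  obtain pY qY where Y1: "is_pushout CC (ifc K) (fin K) ?Z (ifc_fin K) zeta Y pY qY"
    "nt_comp CC (fin K) t pY = nt_comp CC (fin K) ?pM (tmap K)" "nt_comp CC ?Z t qY = ?qM"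
    using pushout_foot[OF G(5) ST(1) Zp S(5) G(7) zeta ST(2,3) S(8,9) pM qM plM _ sqM imY] G(10) by auto
  show ?thesis
    unfolding pushed_out_def
    by (intro exI[of _ ?Z] exI[of _ zeta] exI[of _ pX] exI[of _ qX] exI[of _ ?pM] exI[of _ ?qM]
        exI[of _ pY] exI[of _ qY] conjI Z X1 Y1 S(6) S(8)) (simp add: G(2) poM)
qed

section \<open>Realising the cospans of fork and synchronisation over the given element type\<close>

text \<open>The final position of a fork is a pushout that has to be realised over
  \<open>'a\<close>. Its map into the representable lives over another element type and is therefore
  obtained from \<open>pushout_like_factor\<close>.\<close>

lemma fork_exists: "\<exists>K :: (nat \<times> gen list set, gen list set, gen list set, 'a::infinite) icospan. fork_move n K"
proof -
  let ?D = "d_cotuple n n" and ?P = "Yo (Player n)" and ?c = "Para n"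
  have D: "?D \<in> nat_trans CC (stars n) ?P" by (simp add: d_cotuple_in)
  have c: "countable (fob ?P a)" for a by (simp add: countable_hom)
  obtain F :: "'a cpsh" and a b where po: "is_pushout CC (stars n) ?P ?P ?D ?D F a b"
    and pl: "pushout_like CC (stars n) ?P ?P ?D ?D F a b"
    by (rule pushout_exists[OF presheaf_stars presheaf_Yo presheaf_Yo D D d_cotuple_mono c c]) auto
  note E = is_pushoutD[OF po]
  have eq: "Yo_map (Player n) ?c [GT (ParaL n), GL n] x (?D x i) = Yo_map (Player n) ?c [GT (ParaR n), GR n] x (?D x i)"
    if x: "x \<in> ob CC" and i: "i \<in> fob (stars n) x" for x i
  proof -
    obtain k where k: "x = Star" "i = (k, arw Star Star [])" "1 \<le> k" "k \<le> n"
      using x i by (auto simp: stars_elts split: if_splits)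
    show ?thesis
      using k arw_eq_iff[OF cpath_D_Cons[OF para_paths(2) k(3,4)] cpath_D_Cons[OF para_paths(3) k(3,4)]]
      by (simp add: d_cotuple_app Yo_map_Player[OF para_paths(2)] Yo_map_Player[OF para_paths(3)] nf_snoc_def)
  qed
  obtain h where "h \<in> nat_trans CC F (Yo ?c)"
    "nt_comp CC ?P h a = Yo_map (Player n) ?c [GT (ParaL n), GL n]"
    "nt_comp CC ?P h b = Yo_map (Player n) ?c [GT (ParaR n), GR n]"
    using pushout_like_factor[OF E(2-4) D E(7,8) E(9) pl Yo_map_in[OF para_paths(2)] Yo_map_in[OF para_paths(3)] eq]
    by blast
  then show ?thesis
    using po
    by (intro exI[of _ "\<lparr>ifc = stars n, ini = ?P, mid = Yo ?c, fin = F,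
      smap = Yo_map (Player n) ?c [GS (ParaL n), GL n], tmap = h, ifc_ini = ?D, ifc_fin = nt_comp CC (stars n) a ?D\<rparr>"])
      (auto simp: fork_move_def)
qed

lemma sync_exists:
  assumes ij: "1 \<le> i" "i \<le> n" "1 \<le> j" "j \<le> m"
  shows "\<exists>K :: ('a::infinite, 'a, gen list set, 'a) icospan. sync_move n i m j K"
proof -
  let ?f = "Yo_map Star (Player n) [GD n i]" and ?g = "Yo_map Star (Player m) [GD m j]" and ?c = "Tau n i m j"
  note P = tau_paths[OF ij]
  have f: "?f \<in> nat_trans CC (Yo Star) (Yo (Player n))" by (rule Yo_map_in[OF cpath_D[OF ij(1,2)]])
  have g: "?g \<in> nat_trans CC (Yo Star) (Yo (Player m))" by (rule Yo_map_in[OF cpath_D[OF ij(3,4)]])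
  have fm: "nt_mono CC (Yo Star) ?f" by (rule nt_monoI) (auto simp: hom_into_Star split: if_splits)
  have c: "countable (fob (Yo x) a)" for x a by (simp add: countable_hom)
  obtain F :: "'a cpsh" and a b where po: "is_pushout CC (Yo Star) (Yo (Player n)) (Yo (Player m)) ?f ?g F a b"
    and pl: "pushout_like CC (Yo Star) (Yo (Player n)) (Yo (Player m)) ?f ?g F a b"
    by (rule pushout_exists[OF presheaf_Yo presheaf_Yo presheaf_Yo f g fm c c]) auto
  note E = is_pushoutD[OF po]
  have fg: "?f Star (arw Star Star []) = arw Star (Player n) [GD n i]" "?g Star (arw Star Star []) = arw Star (Player m) [GD m j]"
    using Yo_map_arw[OF cpath_Nil[OF Star_valid] cpath_D, of i n] Yo_map_arw[OF cpath_Nil[OF Star_valid] cpath_D, of j m] ij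
    by simp_all
  have eq: "Yo_map (Player n) ?c p x (?f x e) = Yo_map (Player m) ?c q x (?g x e)"
    if x: "x \<in> ob CC" and e: "e \<in> fob (Yo Star) x" and p: "cpath (Player n) p ?c" and q: "cpath (Player m) q ?c"
      and n: "nf (GD n i # p) = nf (GD m j # q)" for x e p q
  proof -
    have xe: "x = Star" "e = arw Star Star []" using e by (auto simp: hom_into_Star split: if_splits)
    show ?thesis
      unfolding xe fg Yo_map_Player(2)[OF p ij(1,2)] Yo_map_Player(2)[OF q ij(3,4)]
      using arw_eq_iff[OF cpath_D_Cons[OF p ij(1,2)] cpath_D_Cons[OF q ij(3,4)]] n by blast
  qed
  have n1: "nf (GD n i # [GS (IotaP n i), GEps n i m j]) = nf (GD m j # [GS (IotaN m j), GRho n i m j])"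
    and n2: "nf (GD n i # [GT (IotaP n i), GEps n i m j]) = nf (GD m j # [GT (IotaN m j), GRho n i m j])"
    using ij by (simp_all add: nf_snoc_def)
  obtain s where s: "s \<in> nat_trans CC F (Yo ?c)"
    "nt_comp CC (Yo (Player n)) s a = Yo_map (Player n) ?c [GS (IotaP n i), GEps n i m j]"
    "nt_comp CC (Yo (Player m)) s b = Yo_map (Player m) ?c [GS (IotaN m j), GRho n i m j]"
    using pushout_like_factor[OF E(2-4) g E(7,8) E(9) pl Yo_map_in[OF P(1)] Yo_map_in[OF P(2)] eq[OF _ _ P(1,2) n1]]
    by blast
  obtain t where t: "t \<in> nat_trans CC F (Yo ?c)"
    "nt_comp CC (Yo (Player n)) t a = Yo_map (Player n) ?c [GT (IotaP n i), GEps n i m j]"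
    "nt_comp CC (Yo (Player m)) t b = Yo_map (Player m) ?c [GT (IotaN m j), GRho n i m j]"
    using pushout_like_factor[OF E(2-4) g E(7,8) E(9) pl Yo_map_in[OF P(3)] Yo_map_in[OF P(4)] eq[OF _ _ P(3,4) n2]]
    by blast
  show ?thesis
    using po s t
    by (intro exI[of _ "\<lparr>ifc = channels F, ini = F, mid = Yo ?c, fin = F, smap = s, tmap = t,
       ifc_ini = nt_id CC (channels F), ifc_fin = nt_id CC (channels F)\<rparr>"]) (auto simp: sync_move_def)
qed

lemma cw_step_ext_closed_world:
  fixes M :: "'a::infinite cpsh"
  assumes st: "cw_step c m X s M t Y" and X: "position X"
  shows "ext_closed_world X s M t Y"
proof (cases c)
  case (Tick n)
  then show ?thesis using cw_step_pushed_out[OF good_tick _ X] st by (blast intro: ext_closed_world.tick)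
next
  case (Nu n)
  then show ?thesis using cw_step_pushed_out[OF good_nu _ X] st by (blast intro: ext_closed_world.new_channel)
next
  case (Para n)
  obtain K :: "(nat \<times> gen list set, gen list set, gen list set, 'a) icospan" where K: "fork_move n K"
    using fork_exists by blast
  show ?thesis using cw_step_pushed_out[OF good_fork[OF K] _ X] st Para K by (blast intro: ext_closed_world.fork)
next
  case (Tau n i k j)
  then have ij: "1 \<le> i" "i \<le> n" "1 \<le> j" "j \<le> k" using cw_stepD(1)[OF st] by simp_all
  obtain K :: "('a, 'a, gen list set, 'a) icospan" where K: "sync_move n i k j K"
    using sync_exists[OF ij] by blast
  show ?thesis
    using cw_step_pushed_out[OF good_sync[OF ij K] _ X] st Tau K ij by (blast intro: ext_closed_world.sync)
qed (use cw_stepD(1)[OF st] in simp_all)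

subsection \<open>Plays as configurations\<close>

text \<open>The restrictions of a move of type \<open>c\<close> that did not exist before it was played.\<close>

definition fresh_arrows :: "cobj \<Rightarrow> cobj \<Rightarrow> gen list set set" where
  "fresh_arrows c a = (case a of Star \<Rightarrow> news c | Player n \<Rightarrow> tgts c n | _ \<Rightarrow> hom CC a c)"

lemma fresh_arrows_simps [simp]:
  "fresh_arrows c Star = news c" "fresh_arrows c (Player n) = tgts c n"
  by (simp_all add: fresh_arrows_def)

lemma fresh_arrows_other: "a \<noteq> Star \<Longrightarrow> (\<And>n. a \<noteq> Player n) \<Longrightarrow> fresh_arrows c a = hom CC a c"
  by (cases a) (auto simp: fresh_arrows_def)

lemma fresh_arrows_hom: "is_top c \<Longrightarrow> fresh_arrows c a \<subseteq> hom CC a c"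
  using hom_Star_top(1)[of c] hom_Player_top(1)[of c] by (cases a) (auto simp: fresh_arrows_def)

lemma obj_cases:
  obtains "a = Star" | n where "a = Player n" | "a \<noteq> Star" "\<And>n. a \<noteq> Player n"
  by blast

lemma cw_step_fresh:
  assumes st: "cw_step c m X s M t Y" and a: "a \<in> ob CC"
  shows "fob M a - s a ` fob X a = (\<lambda>g. far M a c g m) ` fresh_arrows c a"
    and "inj_on (\<lambda>g. far M a c g m) (fresh_arrows c a)"
proof -
  note S = cw_stepD[OF st]
  show "fob M a - s a ` fob X a = (\<lambda>g. far M a c g m) ` fresh_arrows c a"
  proof (cases rule: obj_cases[of a])
    case 1 then show ?thesis using S(18,19) by auto
  next
    case (2 n) then show ?thesis using S(14,15)[of n] by auto
  next
    case 3 then show ?thesis using S(11,13)[OF a] by (simp add: fresh_arrows_other)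
  qed
  show "inj_on (\<lambda>g. far M a c g m) (fresh_arrows c a)"
  proof (cases "a = Star")
    case True then show ?thesis using news_unique by (auto intro!: inj_onI)
  next
    case False
    show ?thesis by (rule inj_on_subset[OF S(10)[OF a False] fresh_arrows_hom[OF S(1)]])
  qed
qed

text \<open>Causal well-foundedness in inductive form: a derivation records a finite history of the
  player, and inductions on it replace inductions along a chain of moves.\<close>

inductive reach :: "'a cpsh \<Rightarrow> 'a cpsh \<Rightarrow> ('a, 'a) cmap \<Rightarrow> nat \<Rightarrow> 'a \<Rightarrow> bool"
  for X U u where
  reach_init: "x \<in> fob X (Player n) \<Longrightarrow> reach X U u n (u (Player n) x)"
| reach_tgt: "\<lbrakk>is_top c; m \<in> fob U c; \<And>n' g'. g' \<in> srcs c n' \<Longrightarrow> reach X U u n' (far U (Player n') c g' m); g \<in> tgts c n\<rbrakk>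
    \<Longrightarrow> reach X U u n (far U (Player n) c g m)"

text \<open>
  An intrinsic description of closed-world plays, independent of any order in which the moves are
  played: every element is initial or created by exactly one move, every player makes at most one
  move, and every player is reached from the initial ones by finitely many moves.
\<close>

definition cw_conf :: "'a cpsh \<Rightarrow> 'a cpsh \<Rightarrow> ('a, 'a) cmap \<Rightarrow> bool" where
  "cw_conf X U u \<longleftrightarrow> (position X \<and> presheaf CC U \<and> u \<in> nat_trans CC X U \<and> nt_mono CC X u) \<and>
     (\<forall>a\<in>ob CC. countable (fob U a)) \<and>
     (\<forall>a\<in>ob CC. \<forall>e\<in>fob U a. e \<in> u a ` fob X a \<or>
        (\<exists>c m g. is_top c \<and> m \<in> fob U c \<and> g \<in> fresh_arrows c a \<and> e = far U a c g m)) \<and>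
     (\<forall>a\<in>ob CC. \<forall>c m g. is_top c \<longrightarrow> m \<in> fob U c \<longrightarrow> g \<in> fresh_arrows c a \<longrightarrow> far U a c g m \<notin> u a ` fob X a) \<and>
     (\<forall>a\<in>ob CC. \<forall>c m g c' m' g'. is_top c \<longrightarrow> m \<in> fob U c \<longrightarrow> g \<in> fresh_arrows c a \<longrightarrow>
        is_top c' \<longrightarrow> m' \<in> fob U c' \<longrightarrow> g' \<in> fresh_arrows c' a \<longrightarrow> far U a c g m = far U a c' g' m' \<longrightarrow>
        c = c' \<and> m = m' \<and> g = g') \<and>
     (\<forall>n c m g c' m' g'. is_top c \<longrightarrow> m \<in> fob U c \<longrightarrow> g \<in> srcs c n \<longrightarrow>
        is_top c' \<longrightarrow> m' \<in> fob U c' \<longrightarrow> g' \<in> srcs c' n \<longrightarrow> far U (Player n) c g m = far U (Player n) c' g' m' \<longrightarrow>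
        c = c' \<and> m = m' \<and> g = g') \<and>
     (\<forall>n. \<forall>e\<in>fob U (Player n). reach X U u n e)"

lemma cw_confD:
  assumes "cw_conf X U u"
  shows "position X" "presheaf CC U" "u \<in> nat_trans CC X U" "nt_mono CC X u"
    "\<And>a. a \<in> ob CC \<Longrightarrow> countable (fob U a)"
    "\<And>a e. a \<in> ob CC \<Longrightarrow> e \<in> fob U a \<Longrightarrow> e \<in> u a ` fob X a \<or>
        (\<exists>c m g. is_top c \<and> m \<in> fob U c \<and> g \<in> fresh_arrows c a \<and> e = far U a c g m)"
    "\<And>a c m g. \<lbrakk>a \<in> ob CC; is_top c; m \<in> fob U c; g \<in> fresh_arrows c a\<rbrakk> \<Longrightarrow> far U a c g m \<notin> u a ` fob X a"
    "\<And>a c m g c' m' g'. \<lbrakk>a \<in> ob CC; is_top c; m \<in> fob U c; g \<in> fresh_arrows c a;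
        is_top c'; m' \<in> fob U c'; g' \<in> fresh_arrows c' a; far U a c g m = far U a c' g' m'\<rbrakk> \<Longrightarrow>
        c = c' \<and> m = m' \<and> g = g'"
    "\<And>n c m g c' m' g'. \<lbrakk>is_top c; m \<in> fob U c; g \<in> srcs c n;
        is_top c'; m' \<in> fob U c'; g' \<in> srcs c' n; far U (Player n) c g m = far U (Player n) c' g' m'\<rbrakk> \<Longrightarrow>
        c = c' \<and> m = m' \<and> g = g'"
    "\<And>n e. e \<in> fob U (Player n) \<Longrightarrow> reach X U u n e"
  using assms unfolding cw_conf_def by meson+

text \<open>Moves of \<open>U\<close> correspond to indices of the chain: the generator of the
  \<open>k\<close>-th step is its only element of a top type, and all that is fresh there is a
  restriction of it. Uniqueness of creation then comes from the birth map, uniqueness of a player's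
  move from the persistence of elements.\<close>

lemma closed_world_play_cw_conf:
  fixes U :: "'a::infinite cpsh"
  assumes "closed_world_play X U u"
  shows "cw_conf X U u"
proof -
  obtain N Xs ss Ms ts xs ms where X: "position X" and u: "u \<in> nat_trans CC X U" and um: "nt_mono CC X u"
    and X0: "Xs 0 = X" and x0: "xs 0 = u"
    and mv: "\<And>k. enat k < N \<Longrightarrow> ext_closed_world (Xs k) (ss k) (Ms k) (ts k) (Xs (Suc k))"
    and cl: "chain_colimit N Xs ss Ms ts U xs ms"
    using assms unfolding closed_world_play_def chain_play_def by blast
  have "\<exists>c m. cw_step c m (Xs k) (ss k) (Ms k) (ts k) (Xs (Suc k))" if "enat k < N" for k
    by (rule ext_closed_world_cw_step[OF mv[OF that]])
  then obtain cs mk where st: "\<And>k. enat k < N \<Longrightarrow> cw_step (cs k) (mk k) (Xs k) (ss k) (Ms k) (ts k) (Xs (Suc k))"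
    by metis
  note S = cw_stepD[OF st]
  have Xp: "presheaf CC (Xs k)" if "enat k \<le> N" for k
  proof (cases k)
    case 0 then show ?thesis using X X0 by (simp add: position_def)
  next
    case (Suc j) then show ?thesis using S(5)[of j] that by (simp add: Suc_ile_eq)
  qed
  have zz: "zigzag N Xs ss Ms ts"
    unfolding zigzag_def using Xp S(4,6,7,8) by blast
  have cX: "countable (fob (Xs k) a)" if "enat k \<le> N" "a \<in> ob CC" for k a
    using that(1)
  proof (induction k)
    case 0 then show ?case using position_finite[OF X that(2)] X0 by (simp add: countable_finite)
  next
    case (Suc k)
    then have k: "enat k < N" by (simp add: Suc_ile_eq)
    have "fob (Ms k) a \<subseteq> ss k a ` fob (Xs k) a \<union> (\<lambda>g. far (Ms k) a (cs k) g (mk k)) ` hom CC a (cs k)"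
      using cw_step_fresh(1)[OF st[OF k] that(2)] fresh_arrows_hom[OF S(1)[OF k], of a] by blast
    moreover have "countable (fob (Xs k) a)" using Suc.IH k by simp
    ultimately have "countable (fob (Ms k) a)"
      by (elim countable_subset) (simp add: countable_hom)
    then have "countable (ts k a ` fob (Xs (Suc k)) a)"
      using nat_trans_in[OF S(8)[OF k] that(2)] by (auto intro: countable_subset)
    then show ?case
      by (rule countable_image_inj_on) (use S(9)[OF k] that(2) in \<open>simp add: nt_mono_def\<close>)
  qed
  have cM: "countable (fob (Ms k) a)" if k: "enat k < N" and a: "a \<in> ob CC" for k a
  proof -
    have "fob (Ms k) a \<subseteq> ss k a ` fob (Xs k) a \<union> (\<lambda>g. far (Ms k) a (cs k) g (mk k)) ` hom CC a (cs k)"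
      using cw_step_fresh(1)[OF st[OF k] a] fresh_arrows_hom[OF S(1)[OF k], of a] by blast
    moreover have "countable (fob (Xs k) a)" using cX a k by simp
    ultimately show ?thesis by (elim countable_subset) (simp add: countable_hom)
  qed
  have N0: "enat 0 \<le> N" by (simp add: zero_enat_def[symmetric])
  obtain b where bm: "birth_map N Xs ss Ms xs ms b" and cov: "birth_cover N Xs ss Ms U xs ms"
    by (rule chain_colimit_birth[OF zz cl cX[OF N0] cM]) auto
  have cc: "chain_cocone N Xs ss Ms ts U xs ms" using cl unfolding chain_colimit_def by blast
  note K = chain_coconeD[OF cc] and B = birth_mapD[OF bm]
  define mh where "mh k = ms k (cs k) (mk k)" for k
  have co: "cs k \<in> ob CC" if "enat k < N" for k by (rule top_valid[OF S(1)[OF that]])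
  have mh: "mh k \<in> fob U (cs k)" if "enat k < N" for k
    unfolding mh_def by (rule nat_trans_in[OF K(3)[OF that] co[OF that] S(2)[OF that]])
  have mhg: "far U a (cs k) g (mh k) = ms k a (far (Ms k) a (cs k) g (mk k))"
    if "enat k < N" "a \<in> ob CC" "g \<in> hom CC a (cs k)" for k a g
    unfolding mh_def using nat_trans_natural[OF K(3)[OF that(1)] that(2) co[OF that(1)] that(3) S(2)[OF that(1)]] by simp
  have fh: "g \<in> hom CC a (cs k)" if "enat k < N" "g \<in> fresh_arrows (cs k) a" for k a g
    using fresh_arrows_hom[OF S(1)[OF that(1)]] that(2) by blast
  have fr: "far (Ms k) a (cs k) g (mk k) \<in> fresh_elts Xs ss Ms k a"
    if "enat k < N" "a \<in> ob CC" "g \<in> fresh_arrows (cs k) a" for k a g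
    using cw_step_fresh(1)[OF st[OF that(1)] that(2)] that(3) by blast
  have bg: "b a (far U a (cs k) g (mh k)) = (Suc k, far (Ms k) a (cs k) g (mk k))"
    if "enat k < N" "a \<in> ob CC" "g \<in> fresh_arrows (cs k) a" for k a g
    unfolding mhg[OF that(1,2) fh[OF that(1,3)]] by (rule B(2)[OF that(2,1) fr[OF that]])
  have cover: "e \<in> u a ` fob X a \<or> (\<exists>k g. enat k < N \<and> g \<in> fresh_arrows (cs k) a \<and> e = far U a (cs k) g (mh k))"
    if a: "a \<in> ob CC" and e: "e \<in> fob U a" for a e
    using cov a e
  proof (cases rule: birth_coverE)
    case (1 x) then show ?thesis using X0 x0 by blast
  next
    case (2 k y)
    then obtain g where "g \<in> fresh_arrows (cs k) a" "y = far (Ms k) a (cs k) g (mk k)"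
      using cw_step_fresh(1)[OF st[OF 2(1)] a] by blast
    then show ?thesis using 2 mhg[OF 2(1) a fh[OF 2(1)]] by metis
  qed
  \<comment> \<open>The position \<open>X\<close> has no elements of top type, and the only arrows
    between top objects are identities, so an element of top type is one of the generators.\<close>
  have move: "\<exists>k. enat k < N \<and> c = cs k \<and> m = mh k" if c: "is_top c" and m: "m \<in> fob U c" for c m
  proof -
    have "fob X c = {}" by (rule position_empty[OF X top_valid[OF c]]) (use c in auto)
    then obtain k g where k: "enat k < N" "g \<in> fresh_arrows (cs k) c" "m = far U c (cs k) g (mh k)"
      using cover[OF top_valid[OF c] m] by blast
    have "g \<in> hom CC c (cs k)" by (rule fh[OF k(1,2)])
    then have "c = cs k" "g = idn CC (cs k)"
      using hom_top_top[OF S(1)[OF k(1)] c] by (auto split: if_splits)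
    then show ?thesis using k presheaf_far_id[OF K(1) co[OF k(1)] mh[OF k(1)]] by auto
  qed
  note inj = stage_inj[OF zz cc bm S(9)]
  have src: "\<exists>x\<in>fob (Xs k) (Player n). far (Ms k) (Player n) (cs k) g (mk k) = ss k (Player n) x \<and>
      far U (Player n) (cs k) g (mh k) = xs k (Player n) x"
    if k: "enat k < N" and g: "g \<in> srcs (cs k) n" for k n g
  proof -
    have gh: "g \<in> hom CC (Player n) (cs k)" using g hom_Player_top(1)[OF S(1)[OF k]] by blast
    obtain x where x: "x \<in> fob (Xs k) (Player n)" "far (Ms k) (Player n) (cs k) g (mk k) = ss k (Player n) x"
      using S(16)[OF k, of n] g by blast
    then show ?thesis using mhg[OF k Player_valid gh] K(4)[OF k Player_valid x(1)] by auto
  qed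
  \<comment> \<open>A move removes its source players: one used again at \<open>l\<close> would have
    persisted to \<open>Suc k\<close>, although the backward map of move \<open>k\<close> misses
    it.\<close>
  have src_lt: "False" if kl: "k < l" "enat l < N" and g: "g \<in> srcs (cs k) n" and g': "g' \<in> srcs (cs l) n"
    and eq: "far U (Player n) (cs k) g (mh k) = far U (Player n) (cs l) g' (mh l)" for k l g g' n
  proof -
    have k: "enat k < N" using kl by (meson enat_ord_simps(2) less_trans)
    obtain x where x: "x \<in> fob (Xs k) (Player n)" "far (Ms k) (Player n) (cs k) g (mk k) = ss k (Player n) x"
      "far U (Player n) (cs k) g (mh k) = xs k (Player n) x" using src[OF k g] by blast
    obtain x' where x': "x' \<in> fob (Xs l) (Player n)" "far U (Player n) (cs l) g' (mh l) = xs l (Player n) x'"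
      using src[OF kl(2) g'] by blast
    have lN: "enat l \<le> N" using kl(2) by simp
    obtain y where y: "y \<in> fob (Xs (Suc k)) (Player n)" "xs (Suc k) (Player n) y = xs k (Player n) x"
      using stage_elt_persists[OF zz cc bm Player_valid kl(1) lN x(1) x'(1)] eq x(3) x'(2) by auto
    have "ts k (Player n) y = ss k (Player n) x"
      by (rule inj_onD[OF inj(2)[OF _ Player_valid k] _ nat_trans_in[OF S(8)[OF k] Player_valid y(1)]
          nat_trans_in[OF S(6)[OF k] Player_valid x(1)]])
        (simp_all add: K(4)[OF k Player_valid x(1)] K(5)[OF k Player_valid y(1)] y(2))
    then have "far (Ms k) (Player n) (cs k) g (mk k) \<in> ts k (Player n) ` fob (Xs (Suc k)) (Player n)"
      using x(2) y(1) by (metis image_eqI)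
    then show False using S(17)[OF k, of n] g by blast
  qed
  have reach_move: "reach X U u n (far U (Player n) (cs k) g (mh k))"
    if k: "enat k < N" and g: "g \<in> tgts (cs k) n" and IH: "\<And>n x. x \<in> fob (Xs k) (Player n) \<Longrightarrow> reach X U u n (xs k (Player n) x)"
    for k n g
  proof (rule reach_tgt[OF S(1)[OF k] mh[OF k] _ g])
    fix n' g' assume "g' \<in> srcs (cs k) n'"
    from src[OF k this] show "reach X U u n' (far U (Player n') (cs k) g' (mh k))" using IH by auto
  qed
  have reach_pos: "reach X U u n (xs k (Player n) x)" if "enat k \<le> N" "x \<in> fob (Xs k) (Player n)" for k n x
    using that
  proof (induction k arbitrary: n x)
    case 0 then show ?case using X0 x0 by (auto intro: reach_init)
  next
    case (Suc k)
    then have k: "enat k < N" and k': "enat k \<le> N" by (simp_all add: Suc_ile_eq)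
    note IH = Suc.IH[OF k']
    have "ts k (Player n) x \<in> fob (Ms k) (Player n)" by (rule nat_trans_in[OF S(8)[OF k] Player_valid Suc.prems(2)])
    then consider x' where "x' \<in> fob (Xs k) (Player n)" "ts k (Player n) x = ss k (Player n) x'"
      | g where "g \<in> tgts (cs k) n" "ts k (Player n) x = far (Ms k) (Player n) (cs k) g (mk k)"
      unfolding S(14)[OF k, of n] by blast
    then show ?case
    proof cases
      case 1
      then have "xs (Suc k) (Player n) x = xs k (Player n) x'"
        using K(4)[OF k Player_valid 1(1)] K(5)[OF k Player_valid Suc.prems(2)] by simp
      then show ?thesis using IH[OF 1(1)] by simp
    next
      case 2
      then have "g \<in> hom CC (Player n) (cs k)" using hom_Player_top(1)[OF S(1)[OF k]] by blast
      then have "xs (Suc k) (Player n) x = far U (Player n) (cs k) g (mh k)"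
        using 2 mhg[OF k Player_valid] K(5)[OF k Player_valid Suc.prems(2)] by simp
      then show ?thesis using reach_move[OF k 2(1) IH] by simp
    qed
  qed
  show ?thesis
    unfolding cw_conf_def
  proof (intro conjI ballI allI impI X K(1) u um)
    fix a assume a: "a \<in> ob CC"
    have "fob U a \<subseteq> u a ` fob X a \<union> (\<Union>k. (\<lambda>g. far U a (cs k) g (mh k)) ` hom CC a (cs k))"
    proof
      fix e assume "e \<in> fob U a"
      from cover[OF a this] show "e \<in> u a ` fob X a \<union> (\<Union>k. (\<lambda>g. far U a (cs k) g (mh k)) ` hom CC a (cs k))"
      proof (elim disjE exE conjE)
        fix k g assume *: "enat k < N" "g \<in> fresh_arrows (cs k) a" "e = far U a (cs k) g (mh k)"
        then show ?thesis using fh[OF *(1,2)] by blast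
      qed blast
    qed
    moreover have "countable (fob X a)" using position_finite[OF X a] by (rule countable_finite)
    ultimately show "countable (fob U a)"
      by (elim countable_subset) (simp add: countable_hom)
  next
    fix a e assume "a \<in> ob CC" "e \<in> fob U a"
    from cover[OF this]
    show "e \<in> u a ` fob X a \<or> (\<exists>c m g. is_top c \<and> m \<in> fob U c \<and> g \<in> fresh_arrows c a \<and> e = far U a c g m)"
    proof (elim disjE exE conjE)
      fix k g assume *: "enat k < N" "g \<in> fresh_arrows (cs k) a" "e = far U a (cs k) g (mh k)"
      then show ?thesis using S(1)[OF *(1)] mh[OF *(1)] by blast
    qed blast
  next
    fix a c m g assume a: "a \<in> ob CC" and c: "is_top c" "m \<in> fob U c" and g: "g \<in> fresh_arrows c a"
    obtain k where k: "enat k < N" "c = cs k" "m = mh k" using move[OF c] by blast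
    show "far U a c g m \<notin> u a ` fob X a"
    proof
      assume "far U a c g m \<in> u a ` fob X a"
      then obtain x where "x \<in> fob (Xs 0) a" "far U a c g m = xs 0 a x" using X0 x0 by blast
      then show False using B(1)[OF a, of x] bg[OF k(1) a, of g] g k(2,3) by simp
    qed
  next
    fix a c m g c' m' g'
    assume a: "a \<in> ob CC" and c: "is_top c" "m \<in> fob U c" and g: "g \<in> fresh_arrows c a"
      and c': "is_top c'" "m' \<in> fob U c'" and g': "g' \<in> fresh_arrows c' a" and eq: "far U a c g m = far U a c' g' m'"
    obtain k where k: "enat k < N" "c = cs k" "m = mh k" using move[OF c] by blast
    obtain l where l: "enat l < N" "c' = cs l" "m' = mh l" using move[OF c'] by blast
    have "(Suc k, far (Ms k) a (cs k) g (mk k)) = b a (far U a c g m)"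
      using bg[OF k(1) a, of g] g k by simp
    also have "\<dots> = (Suc l, far (Ms l) a (cs l) g' (mk l))"
      unfolding eq using bg[OF l(1) a, of g'] g' l by simp
    finally have kl: "k = l" and gg: "far (Ms k) a (cs k) g (mk k) = far (Ms k) a (cs k) g' (mk k)" by auto
    have "g = g'"
      by (rule inj_onD[OF cw_step_fresh(2)[OF st[OF k(1)] a] gg]) (use g g' k l kl in auto)
    then show "c = c'" "m = m'" "g = g'" using k l kl by auto
  next
    fix n c m g c' m' g'
    assume c: "is_top c" "m \<in> fob U c" and g: "g \<in> srcs c n"
      and c': "is_top c'" "m' \<in> fob U c'" and g': "g' \<in> srcs c' n"
      and eq: "far U (Player n) c g m = far U (Player n) c' g' m'"
    obtain k where k: "enat k < N" "c = cs k" "m = mh k" using move[OF c] by blast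
    obtain l where l: "enat l < N" "c' = cs l" "m' = mh l" using move[OF c'] by blast
    have kl: "k = l"
    proof (rule ccontr)
      assume "k \<noteq> l"
      then consider "k < l" | "l < k" by linarith
      then show False
      proof cases
        case 1 show False by (rule src_lt[OF 1 l(1)]) (use g g' eq k l in auto)
      next
        case 2 show False by (rule src_lt[OF 2 k(1)]) (use g g' eq k l in auto)
      qed
    qed
    have gh: "g \<in> hom CC (Player n) (cs k)" "g' \<in> hom CC (Player n) (cs k)"
      using g g' k l kl hom_Player_top(1)[OF S(1)[OF k(1)]] by auto
    have in_M: "far (Ms k) (Player n) (cs k) h (mk k) \<in> fob (Ms k) (Player n)" if "h \<in> hom CC (Player n) (cs k)" for h
      by (rule presheaf_far_in[OF S(4)[OF k(1)] Player_valid co[OF k(1)] that S(2)[OF k(1)]])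
    have gg: "far (Ms k) (Player n) (cs k) g (mk k) = far (Ms k) (Player n) (cs k) g' (mk k)"
      by (rule inj_onD[OF inj(2)[OF _ Player_valid k(1)] _ in_M[OF gh(1)] in_M[OF gh(2)]])
        (use eq k l kl mhg[OF k(1) Player_valid gh(1)] mhg[OF k(1) Player_valid gh(2)] in auto)
    have "g = g'" by (rule inj_onD[OF S(10)[OF k(1) Player_valid] gg gh]) simp
    then show "c = c'" "m = m'" "g = g'" using k l kl by auto
  next
    fix n e assume "e \<in> fob U (Player n)"
    from cover[OF Player_valid this] show "reach X U u n e"
    proof (elim disjE exE conjE)
      assume "e \<in> u (Player n) ` fob X (Player n)" then show ?thesis by (auto intro: reach_init)
    next
      fix k g assume *: "enat k < N" "g \<in> fresh_arrows (cs k) (Player n)" "e = far U (Player n) (cs k) g (mh k)"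
      then show ?thesis using reach_move[OF *(1) _ reach_pos] by simp
    qed
  qed
qed

section \<open>Putting the moves of a configuration in order\<close>

text \<open>Well-founded recursion codes \<open>x\<close> by a pair. The first component separates
  the elements of \<open>S\<close>; the second exceeds the sum of the codes of all predecessors,
  which are finite in number. A pair code is at least its second component, so codes increase along
  \<open>R\<close>.\<close>

lemma wf_countable_linear_extension:
  assumes wf: "wf R" and fin: "\<And>x. finite {y. (y, x) \<in> R}" and cnt: "countable S"
  obtains e :: "'m \<Rightarrow> nat" where "inj_on e S" "\<And>x y. (y, x) \<in> R \<Longrightarrow> e y < e x"
proof -
  define e :: "'m \<Rightarrow> nat" where
    "e = wfrec R (\<lambda>f x. prod_encode (to_nat_on S x, Suc (sum f {y. (y, x) \<in> R})))"
  have e: "e x = prod_encode (to_nat_on S x, Suc (sum e {y. (y, x) \<in> R}))" for x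
  proof -
    have "e x = prod_encode (to_nat_on S x, Suc (sum (cut e R x) {y. (y, x) \<in> R}))"
      by (rule def_wfrec[OF _ wf]) (simp add: e_def)
    also have "sum (cut e R x) {y. (y, x) \<in> R} = sum e {y. (y, x) \<in> R}"
      by (rule sum.cong) (simp_all add: cut_apply)
    finally show ?thesis .
  qed
  show thesis
  proof
    show "inj_on e S"
    proof (rule inj_onI)
      fix x y assume "x \<in> S" "y \<in> S" "e x = e y"
      then show "x = y" using e[of x] e[of y] cnt by simp
    qed
    fix x y assume yx: "(y, x) \<in> R"
    have "e y \<le> sum e {y. (y, x) \<in> R}" by (rule member_le_sum) (use yx fin in auto)
    also have "\<dots> < Suc (sum e {y. (y, x) \<in> R})" by simp
    also have "\<dots> \<le> e x" by (simp only: e[of x] le_prod_encode_2)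
    finally show "e y < e x" .
  qed
qed

text \<open>Listing the finite or infinite image of \<open>e\<close> in increasing order turns a
  coding by numbers into a sequence of length at most \<omega>.\<close>

lemma enumerate_enat:
  fixes e :: "'m \<Rightarrow> nat"
  assumes inj: "inj_on e S"
  shows "\<exists>N \<mu>. bij_betw \<mu> {k. enat k < N} S \<and> (\<forall>i k. i < k \<longrightarrow> enat k < N \<longrightarrow> e (\<mu> i) < e (\<mu> k))"
proof -
  have main: ?thesis if h: "bij_betw h {k. enat k < N} (e ` S)" "\<And>i k. i < k \<Longrightarrow> enat k < N \<Longrightarrow> h i < h k" for h N
  proof -
    let ?v = "inv_into S e"
    have v: "bij_betw ?v (e ` S) S" using inj by (simp add: bij_betw_inv_into inj_on_imp_bij_betw)
    have 1: "bij_betw (?v \<circ> h) {k. enat k < N} S" by (rule bij_betw_trans[OF h(1) v])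
    have ev: "e ((?v \<circ> h) k) = h k" if "enat k < N" for k
      using bij_betw_apply[OF h(1), of k] that by (simp add: f_inv_into_f)
    have "e ((?v \<circ> h) i) < e ((?v \<circ> h) k)" if "i < k" "enat k < N" for i k
    proof -
      have "enat i < N" using that by (meson enat_ord_simps(2) less_trans)
      then show ?thesis using ev h(2)[OF that] that(2) by simp
    qed
    then show ?thesis using 1 by blast
  qed
  show ?thesis
  proof (cases "finite (e ` S)")
    case True
    obtain h where h: "bij_betw h {..<card (e ` S)} (e ` S)" "strict_mono_on {..<card (e ` S)} h"
      using ex_bij_betw_strict_mono_card[OF True] by blast
    have "{k. enat k < enat (card (e ` S))} = {..<card (e ` S)}" by auto
    then show ?thesis using h by (intro main[of h "enat (card (e ` S))"]) (auto simp: strict_mono_on_def)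
  next
    case False
    then show ?thesis
      by (intro main[of "enumerate (e ` S)" \<infinity>]) (auto simp: bij_enumerate enumerate_mono)
  qed
qed

text \<open>Moves are played in an order that extends causality. Positions and moves are realised
  inside \<open>U\<close>, so that the cocone consists essentially of inclusions and the colimit
  property is a matter of births alone.\<close>

lemma cw_conf_closed_world_play:
  fixes U :: "'a::infinite cpsh"
  assumes conf: "cw_conf X U u"
  shows "closed_world_play X U u"
proof -
  note A = cw_confD[OF conf]
  have Xp: "presheaf CC X" using A(1) by (simp add: position_def)
  define MV where "MV = {(c, m). is_top c \<and> m \<in> fob U c}"
  \<comment> \<open>Immediate causality: the second move is made by a player that the first one
    created.\<close>
  define R where "R = {((c', m'), (c, m)). is_top c \<and> m \<in> fob U c \<and> is_top c' \<and> m' \<in> fob U c' \<and>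
     (\<exists>n g g'. g \<in> srcs c n \<and> g' \<in> tgts c' n \<and> far U (Player n) c g m = far U (Player n) c' g' m')}"
  \<comment> \<open>Accessibility passes along \<open>reach\<close>: the creator of a player is
    unique, and the causes of that creator made its source players, to which the induction
    hypothesis applies.\<close>
  have tgt_acc: "\<forall>c m g. is_top c \<longrightarrow> m \<in> fob U c \<longrightarrow> g \<in> tgts c n \<longrightarrow> e = far U (Player n) c g m \<longrightarrow> (c, m) \<in> Wellfounded.acc R"
    if "reach X U u n e" for n e
    using that
  proof induction
    case (reach_init x n)
    have "far U (Player n) c g m \<notin> u (Player n) ` fob X (Player n)" if "is_top c" "m \<in> fob U c" "g \<in> tgts c n" for c m g
      using A(7)[of "Player n" c m g] that by simp
    then show ?case using reach_init by (metis image_eqI)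
  next
    case (reach_tgt c m g n)
    show ?case
    proof (intro allI impI)
      fix c1 m1 g1 assume "is_top c1" "m1 \<in> fob U c1" "g1 \<in> tgts c1 n" "far U (Player n) c g m = far U (Player n) c1 g1 m1"
      then have eq: "c1 = c" "m1 = m" using A(8)[of "Player n" c m g c1 m1 g1] reach_tgt.hyps by simp_all
      show "(c1, m1) \<in> Wellfounded.acc R"
        unfolding eq
      proof (rule acc.intros)
        fix p assume "(p, (c, m)) \<in> R"
        then obtain c' m' n' h h' where p: "p = (c', m')" "is_top c'" "m' \<in> fob U c'" "h \<in> srcs c n'" "h' \<in> tgts c' n'"
          "far U (Player n') c h m = far U (Player n') c' h' m'"
          by (auto simp: R_def)
        then show "p \<in> Wellfounded.acc R" using reach_tgt.IH by blast
      qed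
    qed
  qed
  have far_in: "far U a c g m \<in> fob U a" if "a \<in> ob CC" "is_top c" "m \<in> fob U c" "g \<in> hom CC a c" for a c g m
    by (rule presheaf_far_in[OF A(2) that(1) top_valid[OF that(2)] that(4,3)])
  have "wf R"
  proof (rule acc_wfI, rule allI)
    fix p show "p \<in> Wellfounded.acc R"
    proof (cases "p \<in> MV")
      case True
      then obtain c m where p: "p = (c, m)" "is_top c" "m \<in> fob U c" by (auto simp: MV_def)
      obtain n g where g: "g \<in> tgts c n" using tgts_nonempty[OF p(2)] by blast
      have gh: "g \<in> hom CC (Player n) c" using g hom_Player_top(1)[OF p(2)] by blast
      have "(c, m) \<in> Wellfounded.acc R"
        by (rule tgt_acc[OF A(10)[OF far_in[OF Player_valid p(2,3) gh]], rule_format, OF p(2,3) g refl])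
      then show ?thesis using p(1) by simp
    next
      case False
      show ?thesis by (rule acc.intros) (use False in \<open>auto simp: R_def MV_def\<close>)
    qed
  qed
  moreover have "finite {q. (q, p) \<in> R}" for p
  proof -
    obtain c m where p: "p = (c, m)" by force
    let ?P = "\<lambda>n g q. case q of (c', m') \<Rightarrow> is_top c' \<and> m' \<in> fob U c' \<and>
       (\<exists>g'. g' \<in> tgts c' n \<and> far U (Player n) c g m = far U (Player n) c' g' m')"
    \<comment> \<open>A source player has at most one creator, so predecessors are indexed by the
      finitely many sources.\<close>
    have uni: "q = q'" if "?P n g q" "?P n g q'" for n g q q'
      using that A(8)[of "Player n" "fst q" "snd q" _ "fst q'" "snd q'"] by (cases q; cases q') auto
    have "{q. (q, p) \<in> R} \<subseteq> (\<lambda>(n, g). THE q. ?P n g q) ` {(n, g). g \<in> srcs c n}"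
    proof
      fix q assume "q \<in> {q. (q, p) \<in> R}"
      then obtain n g where g: "g \<in> srcs c n" "?P n g q" by (auto simp: R_def p)
      then have "(THE q. ?P n g q) = q" using uni by (intro the_equality) blast+
      then show "q \<in> (\<lambda>(n, g). THE q. ?P n g q) ` {(n, g). g \<in> srcs c n}" using g(1) by force
    qed
    then show ?thesis using finite_srcs[of c] by (rule finite_subset[OF _ finite_imageI])
  qed
  moreover have "countable MV"
  proof -
    have "MV = (SIGMA c:{c. is_top c}. fob U c)" by (auto simp: MV_def)
    then show ?thesis using A(5) top_valid by (auto intro!: countable_SIGMA)
  qed
  ultimately obtain e :: "cobj \<times> 'a \<Rightarrow> nat" where e: "inj_on e MV" "\<And>x y. (y, x) \<in> R \<Longrightarrow> e y < e x"
    using wf_countable_linear_extension[of R MV] by metis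
  obtain N \<mu> where \<mu>: "bij_betw \<mu> {k. enat k < N} MV" and \<mu>e: "\<And>i k. i < k \<Longrightarrow> enat k < N \<Longrightarrow> e (\<mu> i) < e (\<mu> k)"
    using enumerate_enat[OF e(1)] by metis
  define cs where "cs k = fst (\<mu> k)" for k
  define mk where "mk k = snd (\<mu> k)" for k
  have \<mu>k: "is_top (cs k)" "mk k \<in> fob U (cs k)" if "enat k < N" for k
    using bij_betw_apply[OF \<mu>, of k] that by (auto simp: MV_def cs_def mk_def)
  have \<mu>s: "\<exists>k. enat k < N \<and> c = cs k \<and> m = mk k" if "is_top c" "m \<in> fob U c" for c m
  proof -
    have "(c, m) \<in> \<mu> ` {k. enat k < N}" using \<mu> that by (auto simp: bij_betw_def MV_def)
    then obtain k where "enat k < N" "\<mu> k = (c, m)" by auto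
    then show ?thesis by (intro exI[of _ k]) (simp add: cs_def mk_def)
  qed
  have \<mu>i: "k = l" if "enat k < N" "enat l < N" "cs k = cs l" "mk k = mk l" for k l
    using bij_betw_imp_inj_on[OF \<mu>] that unfolding inj_on_def cs_def mk_def by (simp add: prod_eq_iff)
  have \<mu>R: "i < k" if "enat i < N" "enat k < N" "g \<in> srcs (cs k) n" "g' \<in> tgts (cs i) n"
    "far U (Player n) (cs k) g (mk k) = far U (Player n) (cs i) g' (mk i)" for i k g g' n
  proof (rule ccontr)
    assume "\<not> i < k"
    have "((cs i, mk i), (cs k, mk k)) \<in> R" using that \<mu>k unfolding R_def by blast
    then have "e (\<mu> i) < e (\<mu> k)" using e(2) by (simp add: cs_def mk_def)
    moreover have "e (\<mu> k) \<le> e (\<mu> i)" using \<mu>e[of k i] that(1) \<open>\<not> i < k\<close> by (cases "i = k") auto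
    ultimately show False by simp
  qed
  have co: "cs k \<in> ob CC" if "enat k < N" for k using top_valid \<mu>k(1)[OF that] by blast
  let ?d = "\<lambda>k a g. far U a (cs k) g (mk k)"
  have dU: "?d k a g \<in> fob U a" if "enat k < N" "a \<in> ob CC" "g \<in> hom CC a (cs k)" for k a g
    using far_in[OF that(2) \<mu>k[OF that(1)] that(3)] .
  have ltN: "enat i < N" if "i < k" "enat k \<le> N" for i k
    using that by (meson enat_ord_simps(2) order_less_le_trans)
  have tU: "g \<in> hom CC (Player n) (cs k)" if "enat k < N" "g \<in> srcs (cs k) n \<union> tgts (cs k) n" for k n g
    using hom_Player_top(1)[OF \<mu>k(1)[OF that(1)]] that(2) by blast
  \<comment> \<open>\<open>born\<close> only grows; a position subtracts from it the players that
    have moved, while channels are never lost.\<close>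
  define born where "born k a = u a ` fob X a \<union> (\<Union>i<k. ?d i a ` fresh_arrows (cs i) a)" for k a
  define used where "used k n = (\<Union>i<k. ?d i (Player n) ` srcs (cs i) n)" for k n
  define pos where "pos k a = (case a of Star \<Rightarrow> born k Star | Player n \<Rightarrow> born k (Player n) - used k n | _ \<Rightarrow> {})" for k a
  have pos0: "pos k Star = born k Star" and posP: "pos k (Player n) = born k (Player n) - used k n" for k n
    by (simp_all add: pos_def)
  have posN: "pos k a = {}" if "a \<noteq> Star" "\<And>n. a \<noteq> Player n" for k a
    using that by (auto simp: pos_def split: cobj.split)
  have posB: "pos k a \<subseteq> born k a" for k a by (cases a) (auto simp: pos_def)
  have born_mono: "born i a \<subseteq> born k a" if "i \<le> k" for i k a
    unfolding born_def using that by (intro Un_mono UN_mono) auto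
  have bornU: "born k a \<subseteq> fob U a" if "enat k \<le> N" "a \<in> ob CC" for k a
    using nat_trans_in[OF A(3) that(2)] dU[OF ltN[OF _ that(1)] that(2)] fresh_arrows_hom[OF \<mu>k(1)[OF ltN[OF _ that(1)]], of _ a]
    unfolding born_def by blast
  have posU: "pos k a \<subseteq> fob U a" if "enat k \<le> N" "a \<in> ob CC" for k a
    using posB bornU[OF that] by blast
  \<comment> \<open>The sources of a move are available at its turn: their creators have smaller
    index by the choice of order, and no earlier move shares a source with it.\<close>
  have enabled: "?d k (Player n) g \<in> pos k (Player n)" if k: "enat k < N" and g: "g \<in> srcs (cs k) n" for k n g
  proof -
    have "?d k (Player n) g \<in> fob U (Player n)" using dU[OF k Player_valid] tU[OF k] g by blast
    from A(6)[OF Player_valid this] have "?d k (Player n) g \<in> born k (Player n)"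
    proof (elim disjE exE conjE)
      fix c m g' assume *: "is_top c" "m \<in> fob U c" "g' \<in> fresh_arrows c (Player n)" "?d k (Player n) g = far U (Player n) c g' m"
      obtain i where i: "enat i < N" "c = cs i" "m = mk i" using \<mu>s[OF *(1,2)] by blast
      have "i < k" using \<mu>R[OF i(1) k g] * i by simp
      then show ?thesis using * i unfolding born_def by auto
    qed (simp add: born_def)
    moreover have "?d k (Player n) g \<notin> used k n"
    proof
      assume "?d k (Player n) g \<in> used k n"
      then obtain i g' where i: "i < k" "g' \<in> srcs (cs i) n" "?d k (Player n) g = ?d i (Player n) g'"
        by (auto simp: used_def)
      have iN: "enat i < N" using ltN[OF i(1)] k by simp
      have "cs k = cs i \<and> mk k = mk i \<and> g = g'" by (rule A(9)[OF \<mu>k[OF k] g \<mu>k[OF iN] i(2,3)])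
      then show False using \<mu>i[OF k iN] i(1) by simp
    qed
    ultimately show ?thesis unfolding posP by blast
  qed
  \<comment> \<open>Strong induction over stages: a channel of a created player is new, or it
    belongs to a source of the creating move, and that source was born earlier.\<close>
  have closP: "far U Star (Player n) f x \<in> born k Star"
    if "enat k \<le> N" "f \<in> hom CC Star (Player n)" "x \<in> born k (Player n)" for k n f x
    using that
  proof (induction k arbitrary: n f x rule: less_induct)
    case (less k)
    from less.prems(3) consider y where "y \<in> fob X (Player n)" "x = u (Player n) y"
      | i g where "i < k" "g \<in> tgts (cs i) n" "x = ?d i (Player n) g"
      by (auto simp: born_def)
    then show ?case
    proof cases
      case 1
      have "far U Star (Player n) f x = u Star (far X Star (Player n) f y)"
        using nat_trans_natural[OF A(3) Star_valid Player_valid less.prems(2) 1(1)] 1(2) by simp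
      moreover have "far X Star (Player n) f y \<in> fob X Star"
        by (rule presheaf_far_in[OF Xp Star_valid Player_valid less.prems(2) 1(1)])
      ultimately show ?thesis unfolding born_def by simp
    next
      case 2
      have i: "enat i < N" by (rule ltN[OF 2(1) less.prems(1)])
      let ?h = "cmp CC Star (Player n) (cs i) g f"
      have gh: "g \<in> hom CC (Player n) (cs i)" using tU[OF i] 2(2) by blast
      have h: "?h \<in> hom CC Star (cs i)"
        by (rule category_cmp_in[OF category_CC Star_valid Player_valid co[OF i] less.prems(2) gh])
      have x: "far U Star (Player n) f x = ?d i Star ?h"
        unfolding 2(3) using presheaf_far_cmp[OF A(2) Star_valid Player_valid co[OF i] less.prems(2) gh \<mu>k(2)[OF i]] by simp
      from h consider "?h \<in> news (cs i)" | "?h \<in> olds (cs i)" using hom_Star_top(1)[OF \<mu>k(1)[OF i]] by blast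
      then show ?thesis
      proof cases
        case 1 then show ?thesis unfolding x born_def using 2(1) by auto
      next
        case 2
        then obtain n' g' j where g': "g' \<in> srcs (cs i) n'" and j: "1 \<le> j" "j \<le> n'"
          and hh: "?h = cmp CC Star (Player n') (cs i) g' (arw Star (Player n') [GD n' j])"
          unfolding olds_def by blast
        have gh': "g' \<in> hom CC (Player n') (cs i)" using tU[OF i] g' by blast
        have "?d i Star ?h = far U Star (Player n') (arw Star (Player n') [GD n' j]) (?d i (Player n') g')"
          unfolding hh by (rule presheaf_far_cmp[OF A(2) Star_valid Player_valid co[OF i] arw_D_in[OF j] gh' \<mu>k(2)[OF i]])
        moreover have "?d i (Player n') g' \<in> born i (Player n')" using enabled[OF i g'] posB by blast
        ultimately have "?d i Star ?h \<in> born i Star"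
          using less.IH[OF \<open>i < k\<close> _ arw_D_in[OF j]] i by simp
        then show ?thesis using x born_mono[of i k Star] \<open>i < k\<close> by auto
      qed
    qed
  qed
  have pos_clos: "far U a b f x \<in> pos k a" if k: "enat k \<le> N" and a: "a \<in> ob CC" and b: "b \<in> ob CC"
    and f: "f \<in> hom CC a b" and x: "x \<in> pos k b" for k a b f x
  proof (cases rule: obj_cases[of b])
    case 1
    then have "a = Star" "f = idn CC Star" using f by (auto simp: hom_into_Star idn_CC split: if_splits)
    then show ?thesis using 1 x presheaf_far_id[OF A(2) b] posU[OF k b] by auto
  next
    case (2 n)
    show ?thesis
    proof (cases "a = Player n")
      case True
      then have "f = idn CC b" using f 2 by (simp add: hom_into_Player idn_CC)
      then show ?thesis using 2 True x presheaf_far_id[OF A(2) b] posU[OF k b] by auto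
    next
      case False
      then have a0: "a = Star" using f 2 by (auto simp: hom_into_Player split: if_splits)
      then show ?thesis using closP[OF k, of f n x] f x 2 posB[of k b] pos0 by auto
    qed
  next
    case 3 then show ?thesis using x posN[of b k] by simp
  qed
  define md where "md k a = pos k a \<union> ?d k a ` hom CC a (cs k)" for k a
  have mdU: "md k a \<subseteq> fob U a" if "enat k < N" "a \<in> ob CC" for k a
    using posU[OF _ that(2), of k] dU[OF that] that(1) unfolding md_def by auto
  have md_clos: "far U a b f x \<in> md k a" if k: "enat k < N" and a: "a \<in> ob CC" and b: "b \<in> ob CC"
    and f: "f \<in> hom CC a b" and x: "x \<in> md k b" for k a b f x
  proof -
    from x consider "x \<in> pos k b" | g where "g \<in> hom CC b (cs k)" "x = ?d k b g" unfolding md_def by blast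
    then show ?thesis
    proof cases
      case 1 then show ?thesis using pos_clos[OF _ a b f] k by (auto simp: md_def)
    next
      case 2
      have "far U a b f x = ?d k a (cmp CC a b (cs k) g f)"
        using presheaf_far_cmp[OF A(2) a b co[OF k] f 2(1) \<mu>k(2)[OF k]] 2(2) by simp
      then show ?thesis
        using category_cmp_in[OF category_CC a b co[OF k] f 2(1)] unfolding md_def by simp
    qed
  qed
  \<comment> \<open>Stage 0 is \<open>X\<close> itself and not its image in \<open>U\<close>, as
    \<open>chain_play\<close> demands; hence the separate case, and the map \<open>u\<close> in
    \<open>xs\<close>.\<close>
  define Xs where "Xs k = (if k = 0 then X else sub_psh U (pos k))" for k
  define xs where "xs k = (if k = 0 then u else nt_id CC (sub_psh U (pos k)))" for k
  define Ms where "Ms k = sub_psh U (md k)" for k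
  define ms where "ms k = nt_id CC (sub_psh U (md k))" for k
  have pos_psh: "presheaf CC (sub_psh U (pos k))" if "enat k \<le> N" for k
    by (rule presheaf_sub_psh[OF A(2) posU[OF that] pos_clos[OF that]])
  have Ms_psh: "presheaf CC (Ms k)" if "enat k < N" for k
    unfolding Ms_def by (rule presheaf_sub_psh[OF A(2) mdU[OF that] md_clos[OF that]])
  have Xs_psh: "presheaf CC (Xs k)" if "enat k \<le> N" for k
    using pos_psh[OF that] Xp by (simp add: Xs_def)
  have xs_nt: "xs k \<in> nat_trans CC (Xs k) U" if "enat k \<le> N" for k
    using sub_psh_incl[OF pos_psh[OF that] posU[OF that]] A(3) by (simp add: Xs_def xs_def)
  have xs_mono: "nt_mono CC (Xs k) (xs k)" for k
    using A(4) by (auto simp: Xs_def xs_def nt_mono_def inj_on_def)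
  have u_im: "pos 0 a = u a ` fob X a" if "a \<in> ob CC" for a
    using position_empty[OF A(1) that] by (cases rule: obj_cases[of a]) (auto simp: pos0 posP posN born_def used_def)
  have xs_im: "xs k a ` fob (Xs k) a = pos k a" if "a \<in> ob CC" for k a
    using u_im[OF that] that by (cases "k = 0") (auto simp: Xs_def xs_def image_iff)
  have ms_nt: "ms k \<in> nat_trans CC (Ms k) U" if "enat k < N" for k
    unfolding ms_def Ms_def by (rule sub_psh_incl[OF Ms_psh[OF that, unfolded Ms_def] mdU[OF that]])
  have Ms_fob: "fob (Ms k) = md k" and Ms_far: "far (Ms k) = far U" for k by (simp_all add: Ms_def)
  have fresh_new: "?d k a g \<notin> born k a" if k: "enat k < N" and a: "a \<in> ob CC" and g: "g \<in> fresh_arrows (cs k) a" for k a g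
  proof
    assume "?d k a g \<in> born k a"
    then consider "?d k a g \<in> u a ` fob X a" | i g' where "i < k" "g' \<in> fresh_arrows (cs i) a" "?d k a g = ?d i a g'"
      by (auto simp: born_def)
    then show False
    proof cases
      case 1 then show False using A(7)[OF a \<mu>k[OF k] g] by blast
    next
      case 2
      have i: "enat i < N" using ltN[OF 2(1)] k by simp
      have "cs k = cs i \<and> mk k = mk i \<and> g = g'" by (rule A(8)[OF a \<mu>k[OF k] g \<mu>k[OF i] 2(2,3)])
      then show False using \<mu>i[OF k i] 2(1) by simp
    qed
  qed
  have md0: "md k Star = born (Suc k) Star" if k: "enat k < N" for k
  proof -
    have "?d k Star ` olds (cs k) \<subseteq> born k Star"
    proof
      fix y assume "y \<in> ?d k Star ` olds (cs k)"
      then obtain n' g' j where g': "g' \<in> srcs (cs k) n'" and j: "1 \<le> j" "j \<le> n'"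
        and y: "y = ?d k Star (cmp CC Star (Player n') (cs k) g' (arw Star (Player n') [GD n' j]))"
        unfolding olds_def by blast
      have gh': "g' \<in> hom CC (Player n') (cs k)" using tU[OF k] g' by blast
      have "y = far U Star (Player n') (arw Star (Player n') [GD n' j]) (?d k (Player n') g')"
        unfolding y by (rule presheaf_far_cmp[OF A(2) Star_valid Player_valid co[OF k] arw_D_in[OF j] gh' \<mu>k(2)[OF k]])
      moreover have "?d k (Player n') g' \<in> born k (Player n')" using enabled[OF k g'] posB by blast
      ultimately show "y \<in> born k Star" using closP[OF less_imp_le[OF k] arw_D_in[OF j]] by blast
    qed
    then show ?thesis
      unfolding md_def pos0 hom_Star_top(1)[OF \<mu>k(1)[OF k]] by (auto simp: born_def lessThan_Suc)
  qed
  have mdP: "md k (Player n) = pos k (Player n) \<union> ?d k (Player n) ` tgts (cs k) n" if k: "enat k < N" for k n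
    using enabled[OF k] unfolding md_def hom_Player_top(1)[OF \<mu>k(1)[OF k]] by auto
  \<comment> \<open>Apart from stage 0 every map is an inclusion into \<open>U\<close>, so
    \<open>xs k\<close> and \<open>xs (Suc k)\<close> also serve as the two legs of the
    \<open>k\<close>-th move.\<close>
  have st: "cw_step (cs k) (mk k) (Xs k) (xs k) (Ms k) (xs (Suc k)) (Xs (Suc k))" if k: "enat k < N" for k
  proof -
    have k1: "enat k \<le> N" and k2: "enat (Suc k) \<le> N" using k by (simp_all add: Suc_ile_eq)
    have pos_md: "pos (Suc k) a \<subseteq> md k a" if a: "a \<in> ob CC" for a
    proof (cases rule: obj_cases[of a])
      case 1 then show ?thesis using md0[OF k] pos0 by simp
    next
      case (2 n) then show ?thesis unfolding 2 mdP[OF k] posP by (auto simp: born_def used_def lessThan_Suc)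
    next
      case 3 then show ?thesis using posN[of a] by simp
    qed
    have id: "?d k (cs k) (idn CC (cs k)) = mk k" by (rule presheaf_far_id[OF A(2) co[OF k] \<mu>k(2)[OF k]])
    have mkM: "mk k \<in> fob (Ms k) (cs k)"
      unfolding Ms_fob md_def using id category_idn_in[OF category_CC co[OF k]] by (metis UnI2 image_eqI)
    have s1: "xs k \<in> nat_trans CC (Xs k) (Ms k)"
    proof (rule nat_trans_codom[OF xs_nt[OF k1]])
      fix a x assume "a \<in> ob CC" "x \<in> fob (Xs k) a"
      then show "xs k a x \<in> fob (Ms k) a" using xs_im[of a k] unfolding Ms_fob md_def by blast
    qed (simp add: Ms_far)
    have t1: "xs (Suc k) \<in> nat_trans CC (Xs (Suc k)) (Ms k)"
    proof (rule nat_trans_codom[OF xs_nt[OF k2]])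
      fix a x assume a: "a \<in> ob CC" "x \<in> fob (Xs (Suc k)) a"
      then show "xs (Suc k) a x \<in> fob (Ms k) a" using xs_im[OF a(1), of "Suc k"] pos_md[OF a(1)] unfolding Ms_fob by blast
    qed (simp add: Ms_far)
    \<comment> \<open>A player created by move \<open>k\<close> cannot have been used by move
      \<open>k\<close> or an earlier one, since a creator precedes every user.\<close>
    have st_ne: "?d k (Player n) g \<noteq> ?d i (Player n) g'"
      if "i \<le> k" "g \<in> tgts (cs k) n" "g' \<in> srcs (cs i) n" for i n g g'
    proof
      assume eq: "?d k (Player n) g = ?d i (Player n) g'"
      have iN: "enat i < N" using that(1) k by (meson enat_ord_simps(1) order_le_less_trans)
      have "k < i" by (rule \<mu>R[OF k iN that(3,2)]) (simp add: eq)
      then show False using that(1) by simp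
    qed
    show ?thesis
      unfolding cw_step_def xs_im[OF Player_valid] xs_im[OF Star_valid]
    proof (intro conjI ballI allI impI \<mu>k(1)[OF k] mkM Xs_psh[OF k1] Xs_psh[OF k2] Ms_psh[OF k] s1 t1 xs_mono)
      fix a assume a: "a \<in> ob CC" "a \<noteq> Star"
      show "inj_on (\<lambda>g. far (Ms k) a (cs k) g (mk k)) (hom CC a (cs k))"
        unfolding Ms_far
      proof (cases rule: obj_cases[of a])
        case (2 n)
        note H = hom_Player_top(1)[OF \<mu>k(1)[OF k], of n]
        show "inj_on (?d k a) (hom CC a (cs k))"
          unfolding 2
        proof (rule inj_onI)
          fix g g' assume g: "g \<in> hom CC (Player n) (cs k)" "g' \<in> hom CC (Player n) (cs k)"
            and eq: "?d k (Player n) g = ?d k (Player n) g'"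
          consider "g \<in> srcs (cs k) n" "g' \<in> srcs (cs k) n" | "g \<in> tgts (cs k) n" "g' \<in> tgts (cs k) n"
            | "g \<in> tgts (cs k) n" "g' \<in> srcs (cs k) n" | "g' \<in> tgts (cs k) n" "g \<in> srcs (cs k) n"
            using g H by blast
          then show "g = g'"
          proof cases
            case 1 then show ?thesis using A(9)[OF \<mu>k[OF k] 1(1) \<mu>k[OF k] 1(2) eq] by blast
          next
            case 2
            then show ?thesis using A(8)[OF Player_valid \<mu>k[OF k] _ \<mu>k[OF k] _ eq] by simp
          next
            case 3 then show ?thesis using st_ne[of k g n g'] eq by simp
          next
            case 4 then show ?thesis using st_ne[of k g' n g] eq by simp
          qed
        qed
      next
        case 3
        show "inj_on (?d k a) (hom CC a (cs k))"
        proof (rule inj_onI)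
          fix g g' assume "g \<in> hom CC a (cs k)" "g' \<in> hom CC a (cs k)" and eq: "?d k a g = ?d k a g'"
          then show "g = g'" using A(8)[OF a(1) \<mu>k[OF k] _ \<mu>k[OF k] _ eq] fresh_arrows_other[OF 3] by blast
        qed
      qed (use a in simp)
      assume np: "\<forall>n. a \<noteq> Player n"
      have pe: "pos l a = {}" for l using posN a(2) np by blast
      then show "fob (Xs k) a = {}" "fob (Xs (Suc k)) a = {}" using xs_im[OF a(1)] by (metis image_is_empty)+
      show "fob (Ms k) a = (\<lambda>g. far (Ms k) a (cs k) g (mk k)) ` hom CC a (cs k)"
        unfolding Ms_fob Ms_far md_def pe by simp
    next
      fix n
      show "fob (Ms k) (Player n) = pos k (Player n) \<union> (\<lambda>g. far (Ms k) (Player n) (cs k) g (mk k)) ` tgts (cs k) n"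
        unfolding Ms_fob Ms_far by (rule mdP[OF k])
      show "pos k (Player n) \<inter> (\<lambda>g. far (Ms k) (Player n) (cs k) g (mk k)) ` tgts (cs k) n = {}"
        unfolding Ms_far using fresh_new[OF k Player_valid, of _ n] posB by auto
      show "(\<lambda>g. far (Ms k) (Player n) (cs k) g (mk k)) ` srcs (cs k) n \<subseteq> pos k (Player n)"
        unfolding Ms_far using enabled[OF k] by blast
      have "?d k (Player n) ` tgts (cs k) n \<inter> used (Suc k) n = {}"
        using st_ne unfolding used_def by (auto simp: less_Suc_eq_le)
      moreover have "born (Suc k) (Player n) = born k (Player n) \<union> ?d k (Player n) ` tgts (cs k) n"
        by (auto simp: born_def lessThan_Suc)
      moreover have "used (Suc k) n = used k n \<union> ?d k (Player n) ` srcs (cs k) n"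
        by (auto simp: used_def lessThan_Suc)
      ultimately show "pos (Suc k) (Player n) = fob (Ms k) (Player n) - (\<lambda>g. far (Ms k) (Player n) (cs k) g (mk k)) ` srcs (cs k) n"
        unfolding Ms_fob Ms_far mdP[OF k] posP by blast
    next
      have b: "born (Suc k) Star = born k Star \<union> ?d k Star ` news (cs k)" by (auto simp: born_def lessThan_Suc)
      show "fob (Ms k) Star = pos k Star \<union> (\<lambda>g. far (Ms k) Star (cs k) g (mk k)) ` news (cs k)"
        unfolding Ms_fob Ms_far md0[OF k] pos0 by (rule b)
      show "pos k Star \<inter> (\<lambda>g. far (Ms k) Star (cs k) g (mk k)) ` news (cs k) = {}"
        unfolding Ms_far pos0 using fresh_new[OF k Star_valid] by auto
      show "pos (Suc k) Star = fob (Ms k) Star"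
        unfolding Ms_fob md0[OF k] pos0 ..
    qed
  qed
  have Xpos: "position (Xs k)" if k: "enat k \<le> N" for k
  proof (cases "k = 0")
    case True then show ?thesis using A(1) by (simp add: Xs_def)
  next
    case False
    \<comment> \<open>Each of the first \<open>k\<close> moves contributes only restrictions of one
      element, and representables are finite.\<close>
    have "(SIGMA a:ob CC. pos k a) \<subseteq> (\<lambda>(a, x). (a, u a x)) ` (SIGMA a:ob CC. fob X a) \<union>
        (\<Union>i<k. (\<lambda>(a, g). (a, ?d i a g)) ` (SIGMA a:ob CC. hom CC a (cs i)))"
    proof
      fix p assume "p \<in> (SIGMA a:ob CC. pos k a)"
      then obtain a x where p: "p = (a, x)" "a \<in> ob CC" "x \<in> born k a" using posB by blast
      then consider y where "y \<in> fob X a" "x = u a y" | i g where "i < k" "g \<in> hom CC a (cs i)" "x = ?d i a g"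
        using fresh_arrows_hom[OF \<mu>k(1)[OF ltN[OF _ k]]] unfolding born_def by blast
      then show "p \<in> (\<lambda>(a, x). (a, u a x)) ` (SIGMA a:ob CC. fob X a) \<union>
        (\<Union>i<k. (\<lambda>(a, g). (a, ?d i a g)) ` (SIGMA a:ob CC. hom CC a (cs i)))"
        by cases (use p in force)+
    qed
    then have "finite (SIGMA a:ob CC. pos k a)"
      by (rule finite_subset) (use A(1) finite_hom_into in \<open>auto simp: position_def\<close>)
    then show ?thesis using False Xs_psh[OF k] posN by (auto simp: position_def Xs_def)
  qed
  have zz: "zigzag N Xs xs Ms (\<lambda>k. xs (Suc k))"
    unfolding zigzag_def using Xs_psh Ms_psh cw_stepD(6,8)[OF st] xs_mono by blast
  have cc: "chain_cocone N Xs xs Ms (\<lambda>k. xs (Suc k)) U xs ms"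
  proof (rule chain_coconeI[OF A(2) xs_nt ms_nt])
    show "ms k c (xs k c x) = xs k c x" if "enat k < N" "c \<in> ob CC" "x \<in> fob (Xs k) c" for k c x
      using nat_trans_in[OF cw_stepD(6)[OF st[OF that(1)]] that(2,3)] that(2) by (simp add: ms_def Ms_def)
    show "ms k c (xs (Suc k) c x) = xs (Suc k) c x" if "enat k < N" "c \<in> ob CC" "x \<in> fob (Xs (Suc k)) c" for k c x
      using nat_trans_in[OF cw_stepD(8)[OF st[OF that(1)]] that(2,3)] that(2) by (simp add: ms_def Ms_def)
  qed auto
  have fr: "fresh_elts Xs xs Ms k a = ?d k a ` fresh_arrows (cs k) a" if "enat k < N" "a \<in> ob CC" for k a
    using cw_step_fresh(1)[OF st[OF that(1)] that(2)] unfolding Ms_far .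
  have ms_app: "ms k a y = y" if "enat k < N" "a \<in> ob CC" "y \<in> fob (Ms k) a" for k a y
    using that by (simp add: ms_def Ms_def)
  \<comment> \<open>The record with tag 0 carries an element of \<open>X\<close> rather than of
    \<open>U\<close>, so \<open>u\<close> has to be inverted there.\<close>
  define b where "b a x = (if x \<in> u a ` fob X a then (0, inv_into (fob X a) (u a) x)
      else (Suc (THE k. enat k < N \<and> x \<in> ?d k a ` fresh_arrows (cs k) a), x))" for a x
  have bm: "birth_map N Xs xs Ms xs ms b"
    unfolding birth_map_def
  proof (intro ballI conjI allI impI)
    fix a assume a: "a \<in> ob CC"
    show "b a (xs 0 a x) = (0, x)" if "x \<in> fob (Xs 0) a" for x
      using that A(4) a by (auto simp: b_def xs_def Xs_def nt_mono_def inv_into_f_f)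
    fix k y assume k: "enat k < N" and y: "y \<in> fresh_elts Xs xs Ms k a"
    then obtain g where g: "g \<in> fresh_arrows (cs k) a" "y = ?d k a g" using fr[OF k a] by blast
    have ny: "y \<notin> u a ` fob X a" using A(7)[OF a \<mu>k[OF k] g(1)] g(2) by simp
    have "(THE k. enat k < N \<and> y \<in> ?d k a ` fresh_arrows (cs k) a) = k"
    proof (rule the_equality)
      show "enat k < N \<and> y \<in> ?d k a ` fresh_arrows (cs k) a" using k g by blast
      fix l assume l: "enat l < N \<and> y \<in> ?d l a ` fresh_arrows (cs l) a"
      then obtain h where h: "h \<in> fresh_arrows (cs l) a" "?d l a h = ?d k a g" using g(2) by auto
      have "cs l = cs k \<and> mk l = mk k \<and> h = g" by (rule A(8)[OF a \<mu>k[OF conjunct1[OF l]] h(1) \<mu>k[OF k] g(1) h(2)])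
      then show "l = k" using \<mu>i k l by blast
    qed
    then show "b a (ms k a y) = (Suc k, y)" using ny ms_app[OF k a] y by (simp add: b_def)
  qed
  have cov: "birth_cover N Xs xs Ms U xs ms"
    unfolding birth_cover_def
  proof (intro ballI)
    fix a x assume a: "a \<in> ob CC" and x: "x \<in> fob U a"
    from A(6)[OF a x] show "(\<exists>y\<in>fob (Xs 0) a. x = xs 0 a y) \<or> (\<exists>k y. enat k < N \<and> y \<in> fresh_elts Xs xs Ms k a \<and> x = ms k a y)"
    proof (elim disjE exE conjE)
      assume "x \<in> u a ` fob X a" then show ?thesis by (auto simp: Xs_def xs_def)
    next
      fix c m g assume *: "is_top c" "m \<in> fob U c" "g \<in> fresh_arrows c a" "x = far U a c g m"
      obtain k where k: "enat k < N" "c = cs k" "m = mk k" using \<mu>s[OF *(1,2)] by blast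
      then have xf: "x \<in> fresh_elts Xs xs Ms k a" using fr[OF k(1) a] * by blast
      then show ?thesis using k(1) ms_app[OF k(1) a, of x] by (intro disjI2 exI[of _ k] exI[of _ x]) simp
    qed
  qed
  have "chain_play ext_closed_world N X U u"
    unfolding chain_play_def
  proof (intro conjI A(1,3,4) exI)
    show "Xs 0 = X" "xs 0 = u" by (simp_all add: Xs_def xs_def)
    show "\<forall>k. enat k < N \<longrightarrow> ext_closed_world (Xs k) (xs k) (Ms k) (xs (Suc k)) (Xs (Suc k))"
      using cw_step_ext_closed_world[OF st Xpos] by simp
    show "chain_colimit N Xs xs Ms (\<lambda>k. xs (Suc k)) U xs ms"
      by (rule chain_colimit_criterion[OF zz cc bm cov])
  qed
  then show ?thesis unfolding closed_world_play_def by blast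
qed

subsection \<open>Morphisms of plays\<close>

lemma reach_map:
  assumes k: "k \<in> nat_trans CC U U'" and ku: "\<And>a x. a \<in> ob CC \<Longrightarrow> x \<in> fob X a \<Longrightarrow> k a (u a x) = u' a x"
    and r: "reach X U u n e"
  shows "reach X U' u' n (k (Player n) e)"
  using r
proof induction
  case (reach_init x n)
  then show ?case using ku[OF Player_valid reach_init] reach.reach_init[of x X n U' u'] by simp
next
  case (reach_tgt c m g n)
  have c: "c \<in> ob CC" by (rule top_valid[OF reach_tgt.hyps(1)])
  have nat: "k (Player n') (far U (Player n') c h m) = far U' (Player n') c h (k c m)" if "h \<in> hom CC (Player n') c" for n' h
    by (rule nat_trans_natural[OF k Player_valid c that reach_tgt.hyps(2)])
  note H = hom_Player_top(1)[OF reach_tgt.hyps(1)]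
  have "reach X U' u' n (far U' (Player n) c g (k c m))"
  proof (rule reach.reach_tgt[OF reach_tgt.hyps(1) nat_trans_in[OF k c reach_tgt.hyps(2)] _ reach_tgt.hyps(4)])
    fix n' g' assume g': "g' \<in> srcs c n'"
    then have "g' \<in> hom CC (Player n') c" using H by blast
    from nat[OF this] reach_tgt.IH[OF g'] show "reach X U' u' n' (far U' (Player n') c g' (k c m))" by simp
  qed
  moreover have "g \<in> hom CC (Player n) c" using H reach_tgt.hyps(4) by blast
  ultimately show ?case using nat by simp
qed

text \<open>The map sends initial elements to initial ones and fresh ones to fresh ones, so a
  collision is a collision of creating moves. Colliding moves have colliding sources; by induction
  on \<open>reach\<close> these coincide, and a player makes at most one move.\<close>

lemma cw_conf_morphism_mono:
  assumes conf: "cw_conf X U u" and conf': "cw_conf X U' u'" and k: "k \<in> nat_trans CC U U'"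
    and ku: "\<And>a x. a \<in> ob CC \<Longrightarrow> x \<in> fob X a \<Longrightarrow> k a (u a x) = u' a x"
  shows "nt_mono CC U k"
proof -
  note A = cw_confD[OF conf] and A' = cw_confD[OF conf']
  have nat: "k a (far U a c g m) = far U' a c g (k c m)" if "a \<in> ob CC" "is_top c" "m \<in> fob U c" "g \<in> hom CC a c" for a c g m
    by (rule nat_trans_natural[OF k that(1) top_valid[OF that(2)] that(4,3)])
  have fh: "g \<in> hom CC a c" if "is_top c" "g \<in> fresh_arrows c a" for a c g
    using fresh_arrows_hom[OF that(1)] that(2) by blast
  have far_in: "far U a c g m \<in> fob U a" if "a \<in> ob CC" "is_top c" "m \<in> fob U c" "g \<in> hom CC a c" for a c g m
    by (rule presheaf_far_in[OF A(2) that(1) top_valid[OF that(2)] that(4,3)])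
  have kin: "k c m \<in> fob U' c" if "is_top c" "m \<in> fob U c" for c m
    by (rule nat_trans_in[OF k top_valid[OF that(1)] that(2)])
  have move_inj: "m = m'" if c: "is_top c" and m: "m \<in> fob U c" and m': "m' \<in> fob U c" and eq: "k c m = k c m'"
    and IH: "\<And>n g e'. \<lbrakk>g \<in> srcs c n; e' \<in> fob U (Player n); k (Player n) (far U (Player n) c g m) = k (Player n) e'\<rbrakk>
        \<Longrightarrow> far U (Player n) c g m = e'" for c m m'
  proof -
    obtain n g where g: "g \<in> srcs c n" using srcs_nonempty[OF c] by blast
    then have gh: "g \<in> hom CC (Player n) c" using hom_Player_top(1)[OF c] by blast
    have "far U (Player n) c g m = far U (Player n) c g m'"
      by (rule IH[OF g far_in[OF Player_valid c m' gh]])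
        (simp only: nat[OF Player_valid c m gh] nat[OF Player_valid c m' gh] eq)
    then show ?thesis using A(9)[OF c m g c m' g] by blast
  qed
  \<comment> \<open>Reduces a collision of arbitrary elements to one of moves. \<open>IH\<close> is
    left open because players need the induction on \<open>reach\<close>, while the other elements
    use its outcome.\<close>
  have gen: "e = e'" if a: "a \<in> ob CC" and e: "e \<in> fob U a" and e': "e' \<in> fob U a" and eq: "k a e = k a e'"
    and IH: "\<And>c m m' g. \<lbrakk>is_top c; m \<in> fob U c; m' \<in> fob U c; g \<in> fresh_arrows c a; e = far U a c g m; k c m = k c m'\<rbrakk>
      \<Longrightarrow> m = m'" for a e e'
  proof -
    have new: "k a (far U a c g m) \<notin> u' a ` fob X a" if "is_top c" "m \<in> fob U c" "g \<in> fresh_arrows c a" for c m g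
      unfolding nat[OF a that(1,2) fh[OF that(1,3)]] by (rule A'(7)[OF a that(1) kin[OF that(1,2)] that(3)])
    have old: "k a y \<in> u' a ` fob X a" if y: "y \<in> u a ` fob X a" for y
      using y ku[OF a] by auto
    from A(6)[OF a e] A(6)[OF a e'] show ?thesis
    proof (elim disjE exE conjE)
      assume "e \<in> u a ` fob X a" "e' \<in> u a ` fob X a"
      then obtain x x' where x: "x \<in> fob X a" "e = u a x" "x' \<in> fob X a" "e' = u a x'" by blast
      then have "u' a x = u' a x'" using eq ku[OF a x(1)] ku[OF a x(3)] by simp
      then show ?thesis using nt_mono_inj[OF A'(4) a x(1,3)] x by simp
    next
      fix c m g assume *: "is_top c" "m \<in> fob U c" "g \<in> fresh_arrows c a" and "e \<in> u a ` fob X a" "e' = far U a c g m"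
      then show ?thesis using new[OF *] old[of e] eq by simp
    next
      fix c m g assume *: "is_top c" "m \<in> fob U c" "g \<in> fresh_arrows c a" and "e' \<in> u a ` fob X a" "e = far U a c g m"
      then show ?thesis using new[OF *] old[of e'] eq by simp
    next
      fix c m g c' m' g'
      assume c: "is_top c" "m \<in> fob U c" "g \<in> fresh_arrows c a" and ee: "e = far U a c g m"
        and c': "is_top c'" "m' \<in> fob U c'" "g' \<in> fresh_arrows c' a" and ee': "e' = far U a c' g' m'"
      have "far U' a c g (k c m) = far U' a c' g' (k c' m')"
        using eq unfolding ee ee' nat[OF a c(1,2) fh[OF c(1,3)]] nat[OF a c'(1,2) fh[OF c'(1,3)]] .
      then have q: "c = c'" "k c m = k c' m'" "g = g'"
        using A'(8)[OF a c(1) kin[OF c(1,2)] c(3) c'(1) kin[OF c'(1,2)] c'(3)] by blast+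
      then have "m = m'" using IH[OF c(1,2) _ c(3) ee] c'(2) by blast
      then show ?thesis using ee ee' q by simp
    qed
  qed
  \<comment> \<open>The second element is quantified inside the claim, since only the history of
    \<open>e\<close> is taken apart.\<close>
  have player: "\<forall>e'\<in>fob U (Player n). k (Player n) e = k (Player n) e' \<longrightarrow> e = e'" if "reach X U u n e" for n e
    using that
  proof induction
    case (reach_init x n)
    show ?case
    proof (intro ballI impI)
      fix e' assume e': "e' \<in> fob U (Player n)" and eq: "k (Player n) (u (Player n) x) = k (Player n) e'"
      show "u (Player n) x = e'"
      proof (rule gen[OF Player_valid nat_trans_in[OF A(3) Player_valid reach_init] e' eq])
        fix c m m' g assume "is_top c" "m \<in> fob U c" "g \<in> fresh_arrows c (Player n)" "u (Player n) x = far U (Player n) c g m"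
        then show "m = m'" using A(7)[OF Player_valid, of c m g n] reach_init by (metis image_eqI)
      qed
    qed
  next
    case (reach_tgt c m g n)
    have gh: "g \<in> hom CC (Player n) c" using hom_Player_top(1)[OF reach_tgt.hyps(1)] reach_tgt.hyps(4) by blast
    show ?case
    proof (intro ballI impI)
      fix e' assume e': "e' \<in> fob U (Player n)" and eq: "k (Player n) (far U (Player n) c g m) = k (Player n) e'"
      show "far U (Player n) c g m = e'"
      proof (rule gen[OF Player_valid far_in[OF Player_valid reach_tgt.hyps(1,2) gh] e' eq])
        fix c1 m1 m' g1
        assume *: "is_top c1" "m1 \<in> fob U c1" "m' \<in> fob U c1" "g1 \<in> fresh_arrows c1 (Player n)"
          "far U (Player n) c g m = far U (Player n) c1 g1 m1" "k c1 m1 = k c1 m'"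
        have "c = c1 \<and> m = m1 \<and> g = g1"
          by (rule A(8)[OF Player_valid reach_tgt.hyps(1,2) _ *(1,2,4,5)]) (simp add: reach_tgt.hyps(4))
        then have q: "c1 = c" "m1 = m" by auto
        show "m1 = m'"
          unfolding q by (rule move_inj[OF reach_tgt.hyps(1,2)]) (use * q reach_tgt.IH in auto)
      qed
    qed
  qed
  show ?thesis
  proof (rule nt_monoI)
    fix a e e' assume a: "a \<in> ob CC" and e: "e \<in> fob U a" "e' \<in> fob U a" "k a e = k a e'"
    show "e = e'"
    proof (rule gen[OF a e])
      fix c m m' g assume c: "is_top c" "m \<in> fob U c" "m' \<in> fob U c" "k c m = k c m'"
      show "m = m'"
      proof (rule move_inj[OF c])
        fix n g e' assume g: "g \<in> srcs c n" and e': "e' \<in> fob U (Player n)"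
          and eq: "k (Player n) (far U (Player n) c g m) = k (Player n) e'"
        have "g \<in> hom CC (Player n) c" using g hom_Player_top(1)[OF c(1)] by blast
        from player[OF A(10)[OF far_in[OF Player_valid c(1,2) this]]] show "far U (Player n) c g m = e'"
          using e' eq by blast
      qed
    qed
  qed
qed

text \<open>
  Slots: zigzag words that lead from an initial element to an element of the play, going down along
  restrictions and up from a player to the move it makes. In a closed-world play a word leads to at
  most one element and every element is reached by a word, so slots name the elements of all plays
  on \<open>X\<close> simultaneously, by countably many names.
\<close>

datatype instr = Dn cobj "gen list" | Up cobj nat "gen list"

instance instr :: countable by countable_datatype

text \<open>The head of the word is the instruction performed last. Letters contain paths rather
  than arrows of \<open>CC\<close>, which are sets of paths, so that the alphabet is a countable
  type.\<close>

inductive slot :: "'a cpsh \<Rightarrow> 'a cpsh \<Rightarrow> ('a, 'a) cmap \<Rightarrow> cobj \<times> 'a \<Rightarrow> instr list \<Rightarrow> cobj \<Rightarrow> 'a \<Rightarrow> bool"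
  for X U u p where
  slot_init: "\<lbrakk>p = (a, x); a \<in> ob CC; x \<in> fob X a\<rbrakk> \<Longrightarrow> slot X U u p [] a (u a x)"
| slot_dn: "\<lbrakk>slot X U u p w b e; cpath a q b\<rbrakk> \<Longrightarrow> slot X U u p (Dn a q # w) a (far U a b (arw a b q) e)"
| slot_up: "\<lbrakk>slot X U u p w (Player n) (far U (Player n) c (arw (Player n) c q) m); is_top c; m \<in> fob U c; (n, q) \<in> src_paths c\<rbrakk>
    \<Longrightarrow> slot X U u p (Up c n q # w) c m"

lemma slot_in:
  assumes conf: "cw_conf X U u" and s: "slot X U u p w a e"
  shows "a \<in> ob CC \<and> e \<in> fob U a"
  using s
proof induction
  case (slot_init a x) then show ?case using nat_trans_in[OF cw_confD(3)[OF conf]] by blast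
next
  case (slot_dn w b e a q)
  have a: "a \<in> ob CC" using path_target[OF slot_dn.hyps(2)] by (simp add: ob_CC)
  then show ?case
    using presheaf_far_in[OF cw_confD(2)[OF conf] a _ arw_in_hom[OF slot_dn.hyps(2)]] slot_dn.IH by blast
next
  case (slot_up w n c q m) then show ?case using top_valid by blast
qed

text \<open>Going down is a function, and going up is unambiguous because a player makes at most one
  move.\<close>

lemma slot_determ:
  assumes conf: "cw_conf X U u" and s: "slot X U u p w a e"
  shows "slot X U u p w a' e' \<Longrightarrow> a' = a \<and> e' = e"
  using s
proof (induction arbitrary: a' e')
  case (slot_init a x) then show ?case by (auto elim: slot.cases)
next
  case (slot_dn w b e a q)
  from slot_dn.prems obtain b' e1 where *: "slot X U u p w b' e1" "a' = a" "e' = far U a b' (arw a b' q) e1"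
    by (auto elim: slot.cases)
  then show ?case using slot_dn.IH[OF *(1)] by simp
next
  case (slot_up w n c q m)
  from slot_up.prems have *: "slot X U u p w (Player n) (far U (Player n) c (arw (Player n) c q) e')" "a' = c" "e' \<in> fob U c"
    by (auto elim: slot.cases)
  have q: "arw (Player n) c q \<in> srcs c n" using slot_up.hyps(4) by (auto simp: srcs_def)
  have "far U (Player n) c (arw (Player n) c q) e' = far U (Player n) c (arw (Player n) c q) m"
    using slot_up.IH[OF *(1)] by blast
  then show ?case using cw_confD(9)[OF conf slot_up.hyps(2) *(3) q slot_up.hyps(2,3) q] *(2) by blast
qed

text \<open>Restrictions and source players are preserved by every map under \<open>X\<close>, so
  names keep their meaning along extensions.\<close>

lemma slot_map:
  assumes conf: "cw_conf X U u" and k: "k \<in> nat_trans CC U U'"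
    and ku: "\<And>a x. a \<in> ob CC \<Longrightarrow> x \<in> fob X a \<Longrightarrow> k a (u a x) = u' a x" and s: "slot X U u p w a e"
  shows "slot X U' u' p w a (k a e)"
  using s
proof induction
  case (slot_init a x) then show ?case using slot.slot_init[of p a x X U' u'] ku by simp
next
  case (slot_dn w b e a q)
  have a: "a \<in> ob CC" using path_target[OF slot_dn.hyps(2)] by (simp add: ob_CC)
  have b: "b \<in> ob CC" "e \<in> fob U b" using slot_in[OF conf slot_dn.hyps(1)] by auto
  show ?case
    unfolding nat_trans_natural[OF k a b(1) arw_in_hom[OF slot_dn.hyps(2)] b(2)]
    by (rule slot.slot_dn[OF slot_dn.IH slot_dn.hyps(2)])
next
  case (slot_up w n c q m)
  have c: "c \<in> ob CC" by (rule top_valid[OF slot_up.hyps(2)])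
  have q: "arw (Player n) c q \<in> hom CC (Player n) c"
    by (rule arw_in_hom) (use boundary_paths(1)[OF slot_up.hyps(2,4)] in blast)
  show ?case
    by (rule slot.slot_up[OF slot_up.IH[unfolded nat_trans_natural[OF k Player_valid c q slot_up.hyps(3)]]
          slot_up.hyps(2) nat_trans_in[OF k c slot_up.hyps(3)] slot_up.hyps(4)])
qed

text \<open>A move is reached through any one of its sources, and everything else from
  \<open>X\<close> or by restricting a move; the regress ends because every player satisfies
  \<open>reach\<close>.\<close>

lemma slot_total:
  assumes conf: "cw_conf X U u" and a: "a \<in> ob CC" and e: "e \<in> fob U a"
  shows "\<exists>p w. p \<in> (SIGMA a:ob CC. fob X a) \<and> slot X U u p w a e"
proof -
  note A = cw_confD[OF conf]
  define sl where "sl a e \<longleftrightarrow> (\<exists>p w. p \<in> (SIGMA a:ob CC. fob X a) \<and> slot X U u p w a e)" for a e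
  have init: "sl a (u a x)" if "a \<in> ob CC" "x \<in> fob X a" for a x
    unfolding sl_def using that slot_init[OF refl that, of U u] by blast
  have down: "sl a (far U a c g m)" if m: "sl c m" and g: "g \<in> hom CC a c" for a c g m
  proof -
    obtain q where q: "cpath a q c" "g = arw a c q" using g by (auto simp: hom_CC)
    obtain p w where p: "p \<in> (SIGMA a:ob CC. fob X a)" "slot X U u p w c m" using m unfolding sl_def by blast
    show ?thesis unfolding sl_def q(2) using p(1) slot_dn[OF p(2) q(1)] by blast
  qed
  have up: "sl c m" if c: "is_top c" and m: "m \<in> fob U c" and src: "\<And>n g. g \<in> srcs c n \<Longrightarrow> sl (Player n) (far U (Player n) c g m)" for c m
  proof -
    obtain n q where q: "(n, q) \<in> src_paths c" using srcs_nonempty[OF c] by (auto simp: srcs_def)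
    then have "sl (Player n) (far U (Player n) c (arw (Player n) c q) m)" using src by (auto simp: srcs_def)
    then show ?thesis using slot_up[OF _ c m q] unfolding sl_def by blast
  qed
  have player: "sl (Player n) e" if "reach X U u n e" for n e
    using that
  proof induction
    case (reach_init x n) then show ?case using init by simp
  next
    case (reach_tgt c m g n)
    have "g \<in> hom CC (Player n) c" using hom_Player_top(1)[OF reach_tgt.hyps(1)] reach_tgt.hyps(4) by blast
    then show ?case using down[OF up[OF reach_tgt.hyps(1,2) reach_tgt.IH]] by blast
  qed
  have move: "sl c m" if c: "is_top c" and m: "m \<in> fob U c" for c m
  proof (rule up[OF c m])
    fix n g assume "g \<in> srcs c n"
    then have "g \<in> hom CC (Player n) c" using hom_Player_top(1)[OF c] by blast
    then show "sl (Player n) (far U (Player n) c g m)"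
      using player[OF A(10)] presheaf_far_in[OF A(2) Player_valid top_valid[OF c] _ m] by blast
  qed
  from A(6)[OF a e] have "sl a e"
  proof (elim disjE exE conjE)
    assume "e \<in> u a ` fob X a" then show ?thesis using init[OF a] by blast
  next
    fix c m g assume *: "is_top c" "m \<in> fob U c" "g \<in> fresh_arrows c a" "e = far U a c g m"
    then show ?thesis using down[OF move[OF *(1,2)]] fresh_arrows_hom[OF *(1)] by blast
  qed
  then show ?thesis unfolding sl_def .
qed

section \<open>Unions of increasing sequences of configurations\<close>

text \<open>The uniqueness conditions concern at most two moves; these lie in a common stage, and
  the monos \<phi> reflect equations back to it. The history of a player is carried forward by
  \<open>reach_map\<close>.\<close>

lemma cw_conf_union:
  fixes Us :: "nat \<Rightarrow> 'a cpsh"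
  assumes conf: "\<And>n. cw_conf X (Us n) (us n)" and V: "presheaf CC V"
    and \<phi>: "\<And>n. \<phi> n \<in> nat_trans CC (Us n) V" and mono: "\<And>n. nt_mono CC (Us n) (\<phi> n)"
    and v: "v \<in> nat_trans CC X V" and \<phi>u: "\<And>n a x. a \<in> ob CC \<Longrightarrow> x \<in> fob X a \<Longrightarrow> \<phi> n a (us n a x) = v a x"
    and cov: "\<And>a e. a \<in> ob CC \<Longrightarrow> e \<in> fob V a \<Longrightarrow> \<exists>n. e \<in> \<phi> n a ` fob (Us n) a"
    and inc: "\<And>n a. a \<in> ob CC \<Longrightarrow> \<phi> n a ` fob (Us n) a \<subseteq> \<phi> (Suc n) a ` fob (Us (Suc n)) a"
  shows "cw_conf X V v"
proof -
  note A = cw_confD[OF conf]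
  have inc': "\<phi> n a ` fob (Us n) a \<subseteq> \<phi> l a ` fob (Us l) a" if "a \<in> ob CC" "n \<le> l" for n l a
    by (rule lift_Suc_mono_le[of "\<lambda>n. \<phi> n a ` fob (Us n) a", OF inc[OF that(1)] that(2)])
  have nat: "\<phi> n a (far (Us n) a c g m) = far V a c g (\<phi> n c m)"
    if "a \<in> ob CC" "is_top c" "m \<in> fob (Us n) c" "g \<in> hom CC a c" for n a c g m
    by (rule nat_trans_natural[OF \<phi> that(1) top_valid[OF that(2)] that(4,3)])
  have far_in: "far (Us n) a c g m \<in> fob (Us n) a" if "a \<in> ob CC" "is_top c" "m \<in> fob (Us n) c" "g \<in> hom CC a c" for n a c g m
    by (rule presheaf_far_in[OF A(2) that(1) top_valid[OF that(2)] that(4,3)])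
  have fh: "g \<in> hom CC a c" if "is_top c" "g \<in> fresh_arrows c a" for a c g
    using fresh_arrows_hom[OF that(1)] that(2) by blast
  have sh: "g \<in> hom CC (Player n) c" if "is_top c" "g \<in> srcs c n" for n c g
    using hom_Player_top(1)[OF that(1)] that(2) by blast
  have two: "\<exists>n m1 m1'. m1 \<in> fob (Us n) c \<and> m1' \<in> fob (Us n) c' \<and> m = \<phi> n c m1 \<and> m' = \<phi> n c' m1'"
    if c: "is_top c" "m \<in> fob V c" and c': "is_top c'" "m' \<in> fob V c'" for c m c' m'
  proof -
    obtain n where n: "m \<in> \<phi> n c ` fob (Us n) c" using cov[OF top_valid[OF c(1)] c(2)] by blast
    obtain n' where n': "m' \<in> \<phi> n' c' ` fob (Us n') c'" using cov[OF top_valid[OF c'(1)] c'(2)] by blast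
    have "m \<in> \<phi> (max n n') c ` fob (Us (max n n')) c" using inc'[OF top_valid[OF c(1)], of n "max n n'"] n by auto
    moreover have "m' \<in> \<phi> (max n n') c' ` fob (Us (max n n')) c'" using inc'[OF top_valid[OF c'(1)], of n' "max n n'"] n' by auto
    ultimately show ?thesis by blast
  qed
  have pull: "far (Us n) a c g m1 = far (Us n) a c' g' m1'"
    if "a \<in> ob CC" "is_top c" "m1 \<in> fob (Us n) c" "g \<in> hom CC a c" "is_top c'" "m1' \<in> fob (Us n) c'" "g' \<in> hom CC a c'"
      "far V a c g (\<phi> n c m1) = far V a c' g' (\<phi> n c' m1')" for n a c g m1 c' g' m1'
    by (rule nt_mono_inj[OF mono that(1) far_in[OF that(1-4)] far_in[OF that(1,5-7)]])
      (simp only: nat[OF that(1-4)] nat[OF that(1,5-7)] that(8))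
  show ?thesis
    unfolding cw_conf_def
  proof (intro conjI ballI allI impI A(1) V v)
    show "nt_mono CC X v"
    proof (rule nt_monoI)
      fix a x y assume a: "a \<in> ob CC" and x: "x \<in> fob X a" and y: "y \<in> fob X a" and eq: "v a x = v a y"
      have "us 0 a x = us 0 a y"
        by (rule nt_mono_inj[OF mono[of 0] a nat_trans_in[OF A(3) a x] nat_trans_in[OF A(3) a y]])
          (simp only: \<phi>u[OF a x] \<phi>u[OF a y] eq)
      then show "x = y" by (rule nt_mono_inj[OF A(4) a x y])
    qed
  next
    fix a assume a: "a \<in> ob CC"
    have "fob V a \<subseteq> (\<Union>n. \<phi> n a ` fob (Us n) a)" using cov[OF a] by blast
    then show "countable (fob V a)" by (rule countable_subset) (use A(5)[OF a] in simp)
  next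
    fix a e assume a: "a \<in> ob CC" and e: "e \<in> fob V a"
    obtain n y where y: "y \<in> fob (Us n) a" "e = \<phi> n a y" using cov[OF a e] by blast
    from A(6)[OF a y(1)] show "e \<in> v a ` fob X a \<or> (\<exists>c m g. is_top c \<and> m \<in> fob V c \<and> g \<in> fresh_arrows c a \<and> e = far V a c g m)"
    proof (elim disjE exE conjE)
      assume "y \<in> us n a ` fob X a" then show ?thesis using y(2) \<phi>u[OF a] by auto
    next
      fix c m g assume *: "is_top c" "m \<in> fob (Us n) c" "g \<in> fresh_arrows c a" "y = far (Us n) a c g m"
      have "e = far V a c g (\<phi> n c m)" using nat[OF a *(1,2) fh[OF *(1,3)]] y(2) *(4) by simp
      then show ?thesis using *(1,3) nat_trans_in[OF \<phi> top_valid[OF *(1)] *(2)] by blast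
    qed
  next
    fix a c m g assume a: "a \<in> ob CC" and c: "is_top c" "m \<in> fob V c" and g: "g \<in> fresh_arrows c a"
    obtain n m1 where m1: "m1 \<in> fob (Us n) c" "m = \<phi> n c m1" using cov[OF top_valid[OF c(1)] c(2)] by blast
    note gh = fh[OF c(1) g]
    show "far V a c g m \<notin> v a ` fob X a"
    proof
      assume "far V a c g m \<in> v a ` fob X a"
      then obtain x where x: "x \<in> fob X a" "far V a c g m = v a x" by blast
      have "far (Us n) a c g m1 = us n a x"
        by (rule nt_mono_inj[OF mono a far_in[OF a c(1) m1(1) gh] nat_trans_in[OF A(3) a x(1)]])
          (simp only: nat[OF a c(1) m1(1) gh] \<phi>u[OF a x(1)] x(2)[symmetric] m1(2))
      then show False using A(7)[OF a c(1) m1(1) g] x(1) by blast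
    qed
  next
    fix a c m g c' m' g'
    assume a: "a \<in> ob CC" and c: "is_top c" "m \<in> fob V c" and g: "g \<in> fresh_arrows c a"
      and c': "is_top c'" "m' \<in> fob V c'" and g': "g' \<in> fresh_arrows c' a" and eq: "far V a c g m = far V a c' g' m'"
    obtain n m1 m1' where m: "m1 \<in> fob (Us n) c" "m1' \<in> fob (Us n) c'" "m = \<phi> n c m1" "m' = \<phi> n c' m1'"
      using two[OF c c'] by blast
    have "far (Us n) a c g m1 = far (Us n) a c' g' m1'"
      by (rule pull[OF a c(1) m(1) fh[OF c(1) g] c'(1) m(2) fh[OF c'(1) g']]) (use eq m in simp)
    from A(8)[OF a c(1) m(1) g c'(1) m(2) g' this] show "c = c'" "m = m'" "g = g'" using m by auto
  next
    fix n c m g c' m' g'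
    assume c: "is_top c" "m \<in> fob V c" and g: "g \<in> srcs c n"
      and c': "is_top c'" "m' \<in> fob V c'" and g': "g' \<in> srcs c' n" and eq: "far V (Player n) c g m = far V (Player n) c' g' m'"
    obtain l m1 m1' where m: "m1 \<in> fob (Us l) c" "m1' \<in> fob (Us l) c'" "m = \<phi> l c m1" "m' = \<phi> l c' m1'"
      using two[OF c c'] by blast
    have "far (Us l) (Player n) c g m1 = far (Us l) (Player n) c' g' m1'"
      by (rule pull[OF Player_valid c(1) m(1) sh[OF c(1) g] c'(1) m(2) sh[OF c'(1) g']]) (use eq m in simp)
    from A(9)[OF c(1) m(1) g c'(1) m(2) g' this] show "c = c'" "m = m'" "g = g'" using m by auto
  next
    fix n e assume e: "e \<in> fob V (Player n)"
    obtain l y where y: "y \<in> fob (Us l) (Player n)" "e = \<phi> l (Player n) y" using cov[OF Player_valid e] by blast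
    show "reach X V v n e" unfolding y(2) by (rule reach_map[OF \<phi> \<phi>u A(10)[OF y(1)]])
  qed
qed

subsection \<open>Gluing states\<close>

lemma pushout_Yo_finite:
  assumes po: "is_pushout CC I (Yo c) Z f g P a b" and Z: "position Z"
  shows "finite (SIGMA x:ob CC. fob P x)"
proof (rule finite_subset)
  show "(SIGMA x:ob CC. fob P x) \<subseteq> (\<lambda>(x, y). (x, a x y)) ` (SIGMA x:ob CC. hom CC x c) \<union>
      (\<lambda>(x, y). (x, b x y)) ` (SIGMA x:ob CC. fob Z x)"
    using pushout_jointly_surj[OF po] by (force simp: image_iff)
  show "finite ((\<lambda>(x, y). (x, a x y)) ` (SIGMA x:ob CC. hom CC x c) \<union>
      (\<lambda>(x, y). (x, b x y)) ` (SIGMA x:ob CC. fob Z x))"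
    using finite_hom_into[of c] Z by (simp add: position_def)
qed

lemma ext_basic_finite:
  fixes M :: "'a cpsh"
  assumes "ext_basic X s M t Y"
  shows "presheaf CC M" "presheaf CC Y" "finite (SIGMA x:ob CC. fob M x)" "finite (SIGMA x:ob CC. fob Y x)"
proof -
  from assms obtain c n n' where "pushed_out (basic_move c n n') X s M t Y" by cases
  then obtain Z :: "'a cpsh" and z pM qM pY qY where Z: "position Z"
    and M: "is_pushout CC (stars n) (Yo c) Z (nt_comp CC (stars n) (Yo_map (Player n) c [GS c]) (d_cotuple n n)) z M pM qM"
    and Y: "is_pushout CC (stars n) (Yo (Player n')) Z (d_cotuple n n') z Y pY qY"
    by (simp add: pushed_out_def basic_move_def) blast
  show "presheaf CC M" "presheaf CC Y" using is_pushoutD(4)[OF M] is_pushoutD(4)[OF Y] .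
  show "finite (SIGMA x:ob CC. fob M x)" "finite (SIGMA x:ob CC. fob Y x)"
    using pushout_Yo_finite[OF M Z] pushout_Yo_finite[OF Y Z] .
qed

text \<open>A view has finitely many basic moves, each with finitely many elements. This finiteness
  is what makes a view land in a single stage of a union.\<close>

lemma view_finite:
  assumes "view X U u"
  shows "finite (SIGMA x:ob CC. fob U x)"
proof -
  obtain N Xs ss Ms ts xs ms where X: "position X" and X0: "Xs 0 = X"
    and mv: "\<And>k. k < N \<Longrightarrow> ext_basic (Xs k) (ss k) (Ms k) (ts k) (Xs (Suc k))"
    and cl: "chain_colimit (enat N) Xs ss Ms ts U xs ms"
  proof -
    obtain N where "chain_play ext_basic (enat N) X U u" using assms unfolding view_def by blast
    then show thesis using that unfolding chain_play_def enat_ord_simps by blast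
  qed
  note B = ext_basic_finite[OF mv]
  have Xk: "presheaf CC (Xs k) \<and> finite (SIGMA x:ob CC. fob (Xs k) x)" if "k \<le> N" for k
    using that X X0 B(2,4) by (cases k) (auto simp: position_def)
  have "(SIGMA x:ob CC. fob U x) \<subseteq> (\<Union>k\<le>N. (\<lambda>(x, y). (x, xs k x y)) ` (SIGMA x:ob CC. fob (Xs k) x)) \<union>
      (\<Union>k<N. (\<lambda>(x, y). (x, ms k x y)) ` (SIGMA x:ob CC. fob (Ms k) x))" (is "_ \<subseteq> ?R")
  proof
    fix p assume "p \<in> (SIGMA x:ob CC. fob U x)"
    then obtain x e where p: "p = (x, e)" "x \<in> ob CC" "e \<in> fob U x" by blast
    have "(\<exists>k y. enat k \<le> enat N \<and> y \<in> fob (Xs k) x \<and> e = xs k x y) \<or> (\<exists>k y. enat k < enat N \<and> y \<in> fob (Ms k) x \<and> e = ms k x y)"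
      by (rule chain_colimit_surj[OF cl _ _ p(2,3)]) (use Xk B(1) in auto)
    then show "p \<in> ?R"
    proof (elim disjE exE conjE)
      fix k y assume "enat k \<le> enat N" "y \<in> fob (Xs k) x" "e = xs k x y"
      then show ?thesis using p by (intro UnI1 UN_I[of k]) (auto simp: image_iff)
    next
      fix k y assume "enat k < enat N" "y \<in> fob (Ms k) x" "e = ms k x y"
      then show ?thesis using p by (intro UnI2 UN_I[of k]) (auto simp: image_iff)
    qed
  qed
  then show ?thesis by (rule finite_subset) (use Xk B(3) in auto)
qed

text \<open>An element over \<open>L\<close> is a compatible family indexed by arrows into
  \<open>L\<close> from objects of \<open>A\<close>. Each such arrow factors through a stage, and
  two factorisations agree once moved to a common stage, so the families given at the stages
  determine one over \<open>L\<close>.\<close>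

lemma right_kan_glue:
  fixes F :: "('o1, 'm1, 'v) presheaf"
  assumes cat: "category B" and fu: "is_functor A B i"
    and Us: "\<And>n. Us n \<in> ob B" and L: "L \<in> ob B"
    and \<iota>: "\<And>n. \<iota> n \<in> hom B (Us n) (Us (Suc n))" and \<phi>: "\<And>n. \<phi> n \<in> hom B (Us n) L"
    and \<phi>\<iota>: "\<And>n. cmp B (Us n) (Us (Suc n)) L (\<phi> (Suc n)) (\<iota> n) = \<phi> n"
    and fac: "\<And>a f. a \<in> ob A \<Longrightarrow> f \<in> hom B (map_ob i a) L \<Longrightarrow>
      \<exists>n. \<exists>f'\<in>hom B (map_ob i a) (Us n). cmp B (map_ob i a) (Us n) L (\<phi> n) f' = f"
    and mon: "\<And>a n f f'. \<lbrakk>a \<in> ob A; f \<in> hom B (map_ob i a) (Us n); f' \<in> hom B (map_ob i a) (Us n);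
      cmp B (map_ob i a) (Us n) L (\<phi> n) f = cmp B (map_ob i a) (Us n) L (\<phi> n) f'\<rbrakk> \<Longrightarrow> f = f'"
    and \<sigma>: "\<And>n. \<sigma> n \<in> fob (right_kan A B i F) (Us n)"
    and \<sigma>\<iota>: "\<And>n. far (right_kan A B i F) (Us n) (Us (Suc n)) (\<iota> n) (\<sigma> (Suc n)) = \<sigma> n"
  shows "\<exists>\<tau>\<in>fob (right_kan A B i F) L. \<forall>n. far (right_kan A B i F) (Us n) L (\<phi> n) \<tau> = \<sigma> n"
proof -
  let ?i = "map_ob i" and ?R = "right_kan A B i F"
  have iob: "?i a \<in> ob B" if "a \<in> ob A" for a using fu that unfolding is_functor_def by blast
  have iarr: "map_arr i a b g \<in> hom B (?i a) (?i b)" if "a \<in> ob A" "b \<in> ob A" "g \<in> hom A a b" for a b g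
    using fu that unfolding is_functor_def by blast
  have \<sigma>_step: "\<sigma> (Suc n) (a, cmp B (?i a) (Us n) (Us (Suc n)) (\<iota> n) f) = \<sigma> n (a, f)"
    if "a \<in> ob A" "f \<in> hom B (?i a) (Us n)" for a f n
    using arg_cong[OF \<sigma>\<iota>[of n], of "\<lambda>s. s (a, f)"] that by (simp add: right_kan_def right_kan_index_def)
  \<comment> \<open>Moving a factorisation to a later stage changes neither the composite into
    \<open>L\<close> nor the value assigned to it.\<close>
  have push: "\<exists>f'\<in>hom B (?i a) (Us l). cmp B (?i a) (Us l) L (\<phi> l) f' = cmp B (?i a) (Us n) L (\<phi> n) f \<and> \<sigma> l (a, f') = \<sigma> n (a, f)"
    if a: "a \<in> ob A" and f: "f \<in> hom B (?i a) (Us n)" and nl: "n \<le> l" for a f n l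
    using nl
  proof (induction rule: dec_induct)
    case base then show ?case using f by blast
  next
    case (step l)
    then obtain f' where f': "f' \<in> hom B (?i a) (Us l)" "cmp B (?i a) (Us l) L (\<phi> l) f' = cmp B (?i a) (Us n) L (\<phi> n) f"
      "\<sigma> l (a, f') = \<sigma> n (a, f)" by blast
    show ?case
    proof (intro bexI conjI)
      show "cmp B (?i a) (Us l) (Us (Suc l)) (\<iota> l) f' \<in> hom B (?i a) (Us (Suc l))"
        by (rule category_cmp_in[OF cat iob[OF a] Us Us f'(1) \<iota>])
      show "cmp B (?i a) (Us (Suc l)) L (\<phi> (Suc l)) (cmp B (?i a) (Us l) (Us (Suc l)) (\<iota> l) f') = cmp B (?i a) (Us n) L (\<phi> n) f"
        unfolding category_assoc[OF cat iob[OF a] Us Us L f'(1) \<iota> \<phi>] \<phi>\<iota> by (rule f'(2))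
      show "\<sigma> (Suc l) (a, cmp B (?i a) (Us l) (Us (Suc l)) (\<iota> l) f') = \<sigma> n (a, f)"
        unfolding \<sigma>_step[OF a f'(1)] by (rule f'(3))
    qed
  qed
  have indep: "\<sigma> n (a, f) = \<sigma> n' (a, f')"
    if a: "a \<in> ob A" and f: "f \<in> hom B (?i a) (Us n)" and f': "f' \<in> hom B (?i a) (Us n')"
      and eq: "cmp B (?i a) (Us n) L (\<phi> n) f = cmp B (?i a) (Us n') L (\<phi> n') f'" for a n f n' f'
  proof -
    let ?l = "max n n'"
    obtain h where h: "h \<in> hom B (?i a) (Us ?l)" "cmp B (?i a) (Us ?l) L (\<phi> ?l) h = cmp B (?i a) (Us n) L (\<phi> n) f" "\<sigma> ?l (a, h) = \<sigma> n (a, f)"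
      using push[OF a f, of ?l] by auto
    obtain h' where h': "h' \<in> hom B (?i a) (Us ?l)" "cmp B (?i a) (Us ?l) L (\<phi> ?l) h' = cmp B (?i a) (Us n') L (\<phi> n') f'" "\<sigma> ?l (a, h') = \<sigma> n' (a, f')"
      using push[OF a f', of ?l] by auto
    have "h = h'" by (rule mon[OF a h(1) h'(1)]) (simp only: h(2) h'(2) eq)
    then show ?thesis using h(3) h'(3) by simp
  qed
  \<comment> \<open>The choice is harmless: by \<open>indep\<close> all factorisations of
    \<open>f\<close> give the same value.\<close>
  define \<tau> where "\<tau> = (\<lambda>(a, f)\<in>right_kan_index A B i L.
     SOME v. \<exists>n. \<exists>f'\<in>hom B (?i a) (Us n). cmp B (?i a) (Us n) L (\<phi> n) f' = f \<and> v = \<sigma> n (a, f'))"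
  have \<tau>: "\<tau> (a, cmp B (?i a) (Us n) L (\<phi> n) f') = \<sigma> n (a, f')" if a: "a \<in> ob A" and f': "f' \<in> hom B (?i a) (Us n)" for a n f'
  proof -
    let ?f = "cmp B (?i a) (Us n) L (\<phi> n) f'"
    have fL: "?f \<in> hom B (?i a) L" by (rule category_cmp_in[OF cat iob[OF a] Us L f' \<phi>])
    have "(SOME v. \<exists>n. \<exists>f'\<in>hom B (?i a) (Us n). cmp B (?i a) (Us n) L (\<phi> n) f' = ?f \<and> v = \<sigma> n (a, f')) = \<sigma> n (a, f')"
      using f' indep[OF a _ f'] by (intro some_equality) blast+
    then show ?thesis using a fL by (simp add: \<tau>_def right_kan_index_def)
  qed
  have \<sigma>v: "\<sigma> n (a, f) \<in> fob F a" if "a \<in> ob A" "f \<in> hom B (?i a) (Us n)" for n a f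
    using \<sigma>[of n] that by (fastforce simp: right_kan_def right_kan_index_def)
  have \<sigma>n: "\<sigma> n (a, cmp B (?i a) (?i a') (Us n) f (map_arr i a a' g)) = far F a a' g (\<sigma> n (a', f))"
    if "a \<in> ob A" "a' \<in> ob A" "g \<in> hom A a a'" "f \<in> hom B (?i a') (Us n)" for n a a' g f
    using \<sigma>[of n] that by (simp add: right_kan_def)
  have "\<tau> \<in> fob ?R L"
  proof -
    have "\<tau> \<in> (\<Pi>\<^sub>E p\<in>right_kan_index A B i L. fob F (fst p))"
    proof (rule PiE_I)
      fix p assume "p \<in> right_kan_index A B i L"
      then obtain a f where p: "p = (a, f)" "a \<in> ob A" "f \<in> hom B (?i a) L" by (auto simp: right_kan_index_def)
      obtain n f' where f': "f' \<in> hom B (?i a) (Us n)" "cmp B (?i a) (Us n) L (\<phi> n) f' = f" using fac[OF p(2,3)] by blast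
      show "\<tau> p \<in> fob F (fst p)" using \<tau>[OF p(2) f'(1)] \<sigma>v[OF p(2) f'(1)] f'(2) p(1) by simp
    qed (simp add: \<tau>_def)
    moreover have "\<tau> (a, cmp B (?i a) (?i a') L f (map_arr i a a' g)) = far F a a' g (\<tau> (a', f))"
      if a: "a \<in> ob A" and a': "a' \<in> ob A" and g: "g \<in> hom A a a'" and f: "f \<in> hom B (?i a') L" for a a' g f
    proof -
      obtain n f' where f': "f' \<in> hom B (?i a') (Us n)" "cmp B (?i a') (Us n) L (\<phi> n) f' = f" using fac[OF a' f] by blast
      note g' = iarr[OF a a' g]
      have "cmp B (?i a) (?i a') L f (map_arr i a a' g) = cmp B (?i a) (Us n) L (\<phi> n) (cmp B (?i a) (?i a') (Us n) f' (map_arr i a a' g))"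
        unfolding category_assoc[OF cat iob[OF a] iob[OF a'] Us L g' f'(1) \<phi>] f'(2) ..
      then show ?thesis
        using \<tau>[OF a category_cmp_in[OF cat iob[OF a] iob[OF a'] Us g' f'(1)]] \<sigma>n[OF a a' g f'(1)] \<tau>[OF a' f'(1)] f'(2)
        by simp
    qed
    ultimately show ?thesis by (simp add: right_kan_def)
  qed
  moreover have "far ?R (Us n) L (\<phi> n) \<tau> = \<sigma> n" for n
  proof
    fix p
    have "\<sigma> n \<in> extensional (right_kan_index A B i (Us n))" using \<sigma>[of n] by (simp add: right_kan_def PiE_def)
    then show "far ?R (Us n) L (\<phi> n) \<tau> p = \<sigma> n p"
      by (cases p; cases "p \<in> right_kan_index A B i (Us n)") (auto simp: right_kan_def right_kan_index_def \<tau> extensional_def)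
  qed
  ultimately show ?thesis by blast
qed

lemma closed_world_play_play: "closed_world_play X U u \<Longrightarrow> play X U u"
  unfolding closed_world_play_def play_def chain_play_def ext_move_def by blast

section \<open>Closed-world plays as objects, and extensions of states\<close>

lemma W_obD:
  fixes A :: "'a::infinite eobj"
  assumes "A \<in> ob (W_cat X)"
  shows "A \<in> ob (E_cat X)" "base A = X" "proj A = nt_id CC X" "cw_conf X (whole A) (incl A)"
  using assms closed_world_play_cw_conf by (auto simp: W_cat_def)

text \<open>Here the order of moves is recovered: it is enough to exhibit a configuration in order
  to have an object of \<open>W_cat X\<close>.\<close>

lemma W_obI:
  fixes U :: "'a::infinite cpsh"
  assumes "cw_conf X U u"
  shows "\<lparr>base = X, whole = U, incl = u, proj = nt_id CC X\<rparr> \<in> ob (W_cat X)"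
  using cw_conf_closed_world_play[OF assms] closed_world_play_play nt_id_in[of CC X] cw_confD(1)[OF assms]
  by (auto simp: W_cat_def E_cat_def position_def)

lemma W_homI:
  assumes "presheaf CC X" "base A = X" "base B = X" "proj A = nt_id CC X" "proj B = nt_id CC X"
    and k: "k \<in> nat_trans CC (whole A) (whole B)"
    and ku: "\<And>a x. a \<in> ob CC \<Longrightarrow> x \<in> fob X a \<Longrightarrow> k a (incl A a x) = incl B a x"
  shows "(nt_id CC X, k) \<in> hom (W_cat X) A B"
proof -
  have "nt_comp CC X (nt_id CC X) (nt_id CC X) = nt_id CC X"
    by (rule nt_comp_eq_ntI[OF nt_id_in[OF assms(1)]]) simp
  moreover have "nt_comp CC X k (incl A) = nt_comp CC X (incl B) (nt_id CC X)"
    by (rule nt_comp_eqI) (simp add: ku)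
  ultimately show ?thesis using assms nt_id_in[OF assms(1)] by (simp add: W_cat_def E_cat_def)
qed

lemma W_homD:
  assumes A: "base A = X" and i: "i \<in> hom (W_cat X) A B"
  shows "i \<in> hom (E_cat X) A B" "i = (nt_id CC X, snd i)" "snd i \<in> nat_trans CC (whole A) (whole B)"
    "\<And>a x. a \<in> ob CC \<Longrightarrow> x \<in> fob X a \<Longrightarrow> snd i a (incl A a x) = incl B a x"
proof -
  show 1: "i \<in> hom (E_cat X) A B" using i by (auto simp: W_cat_def)
  show 2: "i = (nt_id CC X, snd i)" using i by (auto simp: W_cat_def)
  show "snd i \<in> nat_trans CC (whole A) (whole B)" using 1 by (auto simp: E_cat_def)
  have eq: "nt_comp CC X (snd i) (incl A) = nt_comp CC X (incl B) (nt_id CC X)"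
    using 1 2 A by (auto simp: E_cat_def)
  show "snd i a (incl A a x) = incl B a x" if "a \<in> ob CC" "x \<in> fob X a" for a x
    using nt_comp_eqD[OF eq that] that by simp
qed

lemma Gl_simps:
  "fob (Gl X F) = fob (right_kan (V_cat X) (E_cat X) inclusion F)"
  "far (Gl X F) = far (right_kan (V_cat X) (E_cat X) inclusion F)"
  by (simp_all add: Gl_def restrict_along_def inclusion_def)

lemma presheaf_Gl: "presheaf (E_cat X) (Gl X F)"
proof -
  have "presheaf (E_cat X) (right_kan (V_cat X) (E_cat X) inclusion F)"
    by (rule presheaf_right_kan[OF category_E_cat is_functor_V_cat])
  then show ?thesis unfolding presheaf_def Gl_simps .
qed

lemma state_extension_refl:
  fixes U :: "'a::infinite eobj"
  assumes U: "U \<in> ob (W_cat X)" and \<sigma>: "\<sigma> \<in> fob (Gl X F) U"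
  shows "state_extension X (Gl X F) U \<sigma> U \<sigma> (idn (E_cat X) U)"
proof -
  note W = W_obD[OF U]
  have "idn (E_cat X) U \<in> hom (W_cat X) U U"
    using category_idn_in[OF category_E_cat W(1)] W(2) by (auto simp: W_cat_def E_cat_def)
  then show ?thesis
    unfolding state_extension_def using U \<sigma> presheaf_far_id[OF presheaf_Gl W(1)] by blast
qed

lemma state_extension_trans:
  fixes U :: "'a::infinite eobj"
  assumes U: "U \<in> ob (W_cat X)" and i: "state_extension X (Gl X F) U \<sigma> U' \<sigma>' i" and j: "state_extension X (Gl X F) U' \<sigma>' U'' \<sigma>'' j"
  shows "state_extension X (Gl X F) U \<sigma> U'' \<sigma>'' (cmp (E_cat X) U U' U'' j i)"
proof -
  have U': "U' \<in> ob (W_cat X)" and U'': "U'' \<in> ob (W_cat X)" and s: "\<sigma>'' \<in> fob (Gl X F) U''"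
    and ij: "i \<in> hom (W_cat X) U U'" "j \<in> hom (W_cat X) U' U''"
    and f: "far (Gl X F) U U' i \<sigma>' = \<sigma>" "far (Gl X F) U' U'' j \<sigma>'' = \<sigma>'"
    using i j unfolding state_extension_def by blast+
  note W = W_obD[OF U] and W' = W_obD[OF U'] and W'' = W_obD[OF U'']
  note I = W_homD[OF W(2) ij(1)] and J = W_homD[OF W'(2) ij(2)]
  have X: "presheaf CC X" using cw_confD(1)[OF W(4)] by (simp add: position_def)
  have "nt_comp CC X (nt_id CC X) (nt_id CC X) = nt_id CC X"
    by (rule nt_comp_eq_ntI[OF nt_id_in[OF X]]) simp
  then have "fst (cmp (E_cat X) U U' U'' j i) = nt_id CC X"
    using I(2) J(2) W(2) by (simp add: E_cat_def split_beta) (metis fst_conv)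
  moreover have "cmp (E_cat X) U U' U'' j i \<in> hom (E_cat X) U U''"
    by (rule category_cmp_in[OF category_E_cat W(1) W'(1) W''(1) I(1) J(1)])
  ultimately have "cmp (E_cat X) U U' U'' j i \<in> hom (W_cat X) U U''"
    by (auto simp: W_cat_def)
  moreover have "far (Gl X F) U U'' (cmp (E_cat X) U U' U'' j i) \<sigma>'' = \<sigma>"
    using presheaf_far_cmp[OF presheaf_Gl W(1) W'(1) W''(1) I(1) J(1) s] f by simp
  ultimately show ?thesis unfolding state_extension_def using U'' s by blast
qed

text \<open>Each transition is monic by \<open>cw_conf_morphism_mono\<close>, so the stages form an
  increasing union. Its countable components fit into \<open>'a\<close>, it is a play because
  configurations are closed under such unions, and states glue because views are finite.\<close>

lemma state_extension_colimit:
  fixes Us :: "nat \<Rightarrow> 'a::infinite eobj"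
  assumes Us: "\<And>n. Us n \<in> ob (W_cat X)" and \<sigma>: "\<And>n. \<sigma> n \<in> fob (Gl X F) (Us n)"
    and ext: "\<And>n. state_extension X (Gl X F) (Us n) (\<sigma> n) (Us (Suc n)) (\<sigma> (Suc n)) (\<iota> n)"
  shows "\<exists>L \<tau> \<phi>. \<forall>n. state_extension X (Gl X F) (Us n) (\<sigma> n) L \<tau> (\<phi> n)"
proof -
  note W = W_obD[OF Us] and A = cw_confD[OF W_obD(4)[OF Us]]
  have \<iota>: "\<iota> n \<in> hom (W_cat X) (Us n) (Us (Suc n))"
    and \<sigma>\<iota>: "far (Gl X F) (Us n) (Us (Suc n)) (\<iota> n) (\<sigma> (Suc n)) = \<sigma> n" for n
    using ext[of n] unfolding state_extension_def by blast+
  define k where "k n = snd (\<iota> n)" for n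
  note I = W_homD[OF W(2) \<iota>, folded k_def]
  define Xs where "Xs n = whole (Us n)" for n
  have X: "presheaf CC X" using A(1) by (simp add: position_def)
  have Xp: "presheaf CC (Xs n)" for n using A(2) by (simp add: Xs_def)
  have km: "nt_mono CC (Xs n) (k n)" for n
    unfolding Xs_def by (rule cw_conf_morphism_mono[OF W(4) W(4) I(3) I(4)])
  \<comment> \<open>The sequence is recast as a zigzag: the \<open>n\<close>-th middle is the next
    stage itself, with the identity as backward map, so that the colimit construction for chains
    applies unchanged.\<close>
  define ts where "ts n = nt_id CC (Xs (Suc n))" for n
  have zz: "zigzag \<infinity> Xs k (\<lambda>n. Xs (Suc n)) ts"
    unfolding zigzag_def ts_def using Xp km I(3) nt_id_in[OF Xp] by (simp add: Xs_def)
  obtain V xs ms b where cl: "chain_colimit \<infinity> Xs k (\<lambda>n. Xs (Suc n)) ts V xs ms"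
    and bm: "birth_map \<infinity> Xs k (\<lambda>n. Xs (Suc n)) xs ms b" and cov: "birth_cover \<infinity> Xs k (\<lambda>n. Xs (Suc n)) V xs ms"
    by (rule chain_colimit_exists[OF zz]) (use A(5) in \<open>auto simp: Xs_def\<close>)
  have cc: "chain_cocone \<infinity> Xs k (\<lambda>n. Xs (Suc n)) ts V xs ms" using cl unfolding chain_colimit_def by blast
  note K = chain_coconeD[OF cc]
  have xs: "xs n \<in> nat_trans CC (Xs n) V" for n using K(2) by simp
  have msx: "ms n a x = xs (Suc n) a x" if "a \<in> ob CC" "x \<in> fob (Xs (Suc n)) a" for n a x
    using K(5)[of n a x] that by (simp add: ts_def)
  have xk: "xs (Suc n) a (k n a x) = xs n a x" if "a \<in> ob CC" "x \<in> fob (Xs n) a" for n a x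
    using K(4)[of n a x] that msx[OF that(1) nat_trans_in[OF I(3)[folded Xs_def] that]] by simp
  have xm: "nt_mono CC (Xs n) (xs n)" for n
    unfolding nt_mono_def
  proof
    fix a assume "a \<in> ob CC"
    then show "inj_on (xs n a) (fob (Xs n) a)"
      by (intro stage_inj(1)[OF zz cc bm]) (auto simp: ts_def nt_mono_def inj_on_def)
  qed
  define v where "v = nt_comp CC X (xs 0) (incl (Us 0))"
  have xv: "xs n a (incl (Us n) a x) = v a x" if a: "a \<in> ob CC" and x: "x \<in> fob X a" for n a x
  proof (induction n)
    case 0 then show ?case using a x by (simp add: v_def)
  next
    case (Suc n)
    have "incl (Us n) a x \<in> fob (Xs n) a" using nat_trans_in[OF A(3) a x] by (simp add: Xs_def)
    from xk[OF a this] show ?case using Suc I(4)[OF a x] by simp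
  qed
  have v: "v \<in> nat_trans CC X V"
    unfolding v_def by (rule nt_comp_in[OF X A(3)[of 0] xs[of 0, unfolded Xs_def]])
  have inc: "xs n a ` fob (Xs n) a \<subseteq> xs (Suc n) a ` fob (Xs (Suc n)) a" if "a \<in> ob CC" for n a
    using xk[OF that] nat_trans_in[OF I(3)[folded Xs_def] that] by (metis image_subsetI image_eqI)
  have covX: "\<exists>n. e \<in> xs n a ` fob (Xs n) a" if a: "a \<in> ob CC" and e: "e \<in> fob V a" for a e
    using cov a e
  proof (cases rule: birth_coverE)
    case (1 x) then show ?thesis by blast
  next
    case (2 n y) then show ?thesis using msx[OF a, of y n] by (intro exI[of _ "Suc n"]) auto
  qed
  have conf: "cw_conf X V v"
    by (rule cw_conf_union[where Us=Xs and us="\<lambda>n. incl (Us n)" and \<phi>=xs])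
      (use W(4) K(1) xs xm v xv covX inc in \<open>simp_all add: Xs_def\<close>)
  define L where "L = \<lparr>base = X, whole = V, incl = v, proj = nt_id CC X\<rparr>"
  have Lsel: "base L = X" "whole L = V" "incl L = v" "proj L = nt_id CC X" by (simp_all add: L_def)
  have LW: "L \<in> ob (W_cat X)" unfolding L_def by (rule W_obI[OF conf])
  define \<phi> where "\<phi> n = (nt_id CC X, xs n)" for n
  have \<phi>W: "\<phi> n \<in> hom (W_cat X) (Us n) L" for n
    unfolding \<phi>_def
    by (rule W_homI[OF X W(2) Lsel(1) W(3) Lsel(4)]) (use xs xv in \<open>simp_all add: Lsel Xs_def\<close>)
  have \<phi>E: "\<phi> n \<in> hom (E_cat X) (Us n) L" for n by (rule W_homD(1)[OF W(2) \<phi>W])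
  have idX: "nt_comp CC X (nt_id CC X) (nt_id CC X) = nt_id CC X"
    by (rule nt_comp_eq_ntI[OF nt_id_in[OF X]]) simp
  have \<phi>\<iota>: "cmp (E_cat X) (Us n) (Us (Suc n)) L (\<phi> (Suc n)) (\<iota> n) = \<phi> n" for n
  proof -
    have "nt_comp CC (Xs n) (xs (Suc n)) (k n) = xs n" by (rule nt_comp_eq_ntI[OF xs]) (rule xk)
    then show ?thesis using I(2)[of n] W(2)[of n] idX by (simp add: E_cat_def \<phi>_def Xs_def split_beta)
  qed
  have Ehom: "f \<in> hom (E_cat X) B D \<longleftrightarrow> fst f \<in> nat_trans CC (base B) (base D) \<and> snd f \<in> nat_trans CC (whole B) (whole D) \<and>
      nt_comp CC (base B) (snd f) (incl B) = nt_comp CC (base B) (incl D) (fst f) \<and>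
      nt_comp CC (base B) (proj D) (fst f) = proj B" for f B D
    by (cases f) (simp add: E_cat_def)
  have comp: "cmp (E_cat X) B (Us n) L (\<phi> n) f = (nt_comp CC (base B) (nt_id CC X) (fst f), nt_comp CC (whole B) (xs n) (snd f))" for B n f
    by (simp add: E_cat_def \<phi>_def split_beta)
  have fst_id: "nt_comp CC (base B) (nt_id CC X) h = h" if "h \<in> nat_trans CC (base B) X" for B :: "'a eobj" and h
    by (rule nt_comp_eq_ntI[OF that]) (simp add: nat_trans_in[OF that])
  have Bpsh: "presheaf CC (base B)" "presheaf CC (whole B)" "incl B \<in> nat_trans CC (base B) (whole B)"
    if "B \<in> ob (E_cat X)" for B
    using play_presheaf[of "base B" "whole B" "incl B"] that by (auto simp: E_cat_def)
  have "\<exists>\<tau>\<in>fob (right_kan (V_cat X) (E_cat X) inclusion F) L. \<forall>n. far (right_kan (V_cat X) (E_cat X) inclusion F) (Us n) L (\<phi> n) \<tau> = \<sigma> n"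
  proof (rule right_kan_glue[where Us=Us and \<iota>=\<iota> and \<phi>=\<phi> and \<sigma>=\<sigma>, OF category_E_cat is_functor_V_cat W(1) W_obD(1)[OF LW] I(1) \<phi>E \<phi>\<iota>])
    show "\<sigma> n \<in> fob (right_kan (V_cat X) (E_cat X) inclusion F) (Us n)" for n using \<sigma>[of n] by (simp add: Gl_simps)
    show "far (right_kan (V_cat X) (E_cat X) inclusion F) (Us n) (Us (Suc n)) (\<iota> n) (\<sigma> (Suc n)) = \<sigma> n" for n
      using \<sigma>\<iota>[of n] by (simp add: Gl_simps)
  next
    fix B f n f'
    assume "f \<in> hom (E_cat X) (map_ob inclusion B) (Us n)" "f' \<in> hom (E_cat X) (map_ob inclusion B) (Us n)"
      and "cmp (E_cat X) (map_ob inclusion B) (Us n) L (\<phi> n) f = cmp (E_cat X) (map_ob inclusion B) (Us n) L (\<phi> n) f'"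
    then have f: "f \<in> hom (E_cat X) B (Us n)" "f' \<in> hom (E_cat X) B (Us n)"
      and eq: "cmp (E_cat X) B (Us n) L (\<phi> n) f = cmp (E_cat X) B (Us n) L (\<phi> n) f'" by (simp_all add: inclusion_def)
    have F: "fst f \<in> nat_trans CC (base B) X" "fst f' \<in> nat_trans CC (base B) X"
      "snd f \<in> nat_trans CC (whole B) (Xs n)" "snd f' \<in> nat_trans CC (whole B) (Xs n)"
      using f W(2) unfolding Ehom by (auto simp: Xs_def)
    have "fst f = fst f'" using eq unfolding comp fst_id[OF F(1)] fst_id[OF F(2)] by simp
    moreover have "snd f = snd f'"
    proof (rule nat_trans_eqI[OF F(3,4)])
      fix a x assume a: "a \<in> ob CC" and x: "x \<in> fob (whole B) a"
      have "nt_comp CC (whole B) (xs n) (snd f) = nt_comp CC (whole B) (xs n) (snd f')" using eq unfolding comp by simp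
      from nt_comp_eqD[OF this a x] show "snd f a x = snd f' a x"
        by (rule nt_mono_inj[OF xm a nat_trans_in[OF F(3) a x] nat_trans_in[OF F(4) a x]])
    qed
    ultimately show "f = f'" by (rule prod_eqI)
  next
    fix B f assume BV: "B \<in> ob (V_cat X)" and "f \<in> hom (E_cat X) (map_ob inclusion B) L"
    then have f: "f \<in> hom (E_cat X) B L" by (simp add: inclusion_def)
    have BE: "B \<in> ob (E_cat X)" and vB: "view (base B) (whole B) (incl B)"
      using BV by (auto simp: V_cat_def full_subcat_def)
    note BP = Bpsh[OF BE]
    have F: "fst f \<in> nat_trans CC (base B) X" "snd f \<in> nat_trans CC (whole B) V"
      "nt_comp CC (base B) (snd f) (incl B) = nt_comp CC (base B) v (fst f)" "nt_comp CC (base B) (nt_id CC X) (fst f) = proj B"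
      using f unfolding Ehom Lsel by auto
    have "\<forall>p\<in>(SIGMA a:ob CC. fob (whole B) a). \<exists>n. snd f (fst p) (snd p) \<in> xs n (fst p) ` fob (Xs n) (fst p)"
      using covX nat_trans_in[OF F(2)] by auto
    from bchoice[OF this] obtain st where
      "\<forall>p\<in>(SIGMA a:ob CC. fob (whole B) a). snd f (fst p) (snd p) \<in> xs (st p) (fst p) ` fob (Xs (st p)) (fst p)"
      by (elim exE)
    then have st: "snd f a x \<in> xs (st (a, x)) a ` fob (Xs (st (a, x))) a" if "a \<in> ob CC" "x \<in> fob (whole B) a" for a x
      using that by fastforce
    \<comment> \<open>The images of the stages increase, so the largest of the finitely many stages
      serves all elements of the view. Inserting 0 keeps \<open>Max\<close> well defined.\<close>
    define n where "n = Max (insert 0 (st ` (SIGMA a:ob CC. fob (whole B) a)))"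
    have im: "snd f a x \<in> xs n a ` fob (Xs n) a" if a: "a \<in> ob CC" and x: "x \<in> fob (whole B) a" for a x
    proof -
      have "st (a, x) \<le> n" unfolding n_def using view_finite[OF vB] a x by (intro Max_ge) auto
      then show ?thesis
        using st[OF a x] lift_Suc_mono_le[of "\<lambda>n. xs n a ` fob (Xs n) a", OF inc[OF a]] by blast
    qed
    obtain k' where k': "k' \<in> nat_trans CC (whole B) (Xs n)"
      and xk': "\<And>a x. a \<in> ob CC \<Longrightarrow> x \<in> fob (whole B) a \<Longrightarrow> xs n a (k' a x) = snd f a x"
      using nat_trans_lift[OF BP(2) Xp xs xm F(2) im] by metis
    \<comment> \<open>Commutation with the inclusions is checked after the mono \<open>xs n\<close>,
      where it holds because \<open>f\<close> is a morphism into \<open>L\<close>.\<close>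
    have ki: "nt_comp CC (base B) k' (incl B) = nt_comp CC (base B) (incl (Us n)) (fst f)"
    proof (rule nt_comp_eqI)
      fix a x assume a: "a \<in> ob CC" and x: "x \<in> fob (base B) a"
      have ix: "incl B a x \<in> fob (whole B) a" by (rule nat_trans_in[OF BP(3) a x])
      have hx: "fst f a x \<in> fob X a" by (rule nat_trans_in[OF F(1) a x])
      show "k' a (incl B a x) = incl (Us n) a (fst f a x)"
      proof (rule nt_mono_inj[OF xm a nat_trans_in[OF k' a ix]])
        show "incl (Us n) a (fst f a x) \<in> fob (Xs n) a" unfolding Xs_def by (rule nat_trans_in[OF A(3) a hx])
        show "xs n a (k' a (incl B a x)) = xs n a (incl (Us n) a (fst f a x))"
          unfolding xk'[OF a ix] xv[OF a hx] by (rule nt_comp_eqD[OF F(3) a x])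
      qed
    qed
    have "(fst f, k') \<in> hom (E_cat X) B (Us n)"
      unfolding Ehom using F k' ki W(2,3) by (simp add: Xs_def)
    moreover have "cmp (E_cat X) B (Us n) L (\<phi> n) (fst f, k') = f"
    proof -
      have "nt_comp CC (whole B) (xs n) k' = snd f" by (rule nt_comp_eq_ntI[OF F(2)]) (rule xk')
      then show ?thesis unfolding comp using fst_id[OF F(1)] by (simp add: prod_eq_iff)
    qed
    ultimately show "\<exists>n. \<exists>f'\<in>hom (E_cat X) (map_ob inclusion B) (Us n). cmp (E_cat X) (map_ob inclusion B) (Us n) L (\<phi> n) f' = f"
      unfolding inclusion_def by auto
  qed
  then obtain \<tau> where "\<tau> \<in> fob (Gl X F) L" "\<And>n. far (Gl X F) (Us n) L (\<phi> n) \<tau> = \<sigma> n"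
    unfolding Gl_simps by blast
  then have "\<forall>n. state_extension X (Gl X F) (Us n) (\<sigma> n) L \<tau> (\<phi> n)"
    unfolding state_extension_def using LW \<phi>W by blast
  then show ?thesis by blast
qed

section \<open>A maximal extension by greedy choice\<close>

theorem mainTheorem9:
  fixes X :: "'a::infinite cpsh"
    and F :: "('a, 'v) strategy"
    and U :: "'a eobj"
    and \<sigma> :: "('a, 'v) state"
  assumes "position X"
    and "innocent_strategy X F"
    and "U \<in> ob (W_cat X)"
    and "\<sigma> \<in> fob (Gl X F) U"
  shows "\<exists>U' \<sigma>' i. state_extension X (Gl X F) U \<sigma> U' \<sigma>' i \<and> maximal_state X (Gl X F) U' \<sigma>'"
proof -
  let ?G = "Gl X F"
  let ?S = "(SIGMA a:ob CC. fob X a) \<times> (UNIV :: instr list set)"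
  have "finite (SIGMA a:ob CC. fob X a)" using assms(1) by (simp add: position_def)
  then have "countable ?S" by (simp add: countable_finite)
  \<comment> \<open>\<open>sl\<close> is only required to cover the names: it may take further
    values, and it exists even if \<open>X\<close> is empty.\<close>
  then obtain sl :: "nat \<Rightarrow> (cobj \<times> 'a) \<times> instr list" where sl: "?S \<subseteq> range sl"
    using subset_range_from_nat_into by blast
  \<comment> \<open>Name \<open>n\<close> leads to some element of the play. By
    \<open>slot_map\<close> this is kept by all further extensions.\<close>
  define filled where "filled n A \<longleftrightarrow> (\<exists>a e. slot X (whole A) (incl A) (fst (sl n)) (snd (sl n)) a e)"
    for n and A :: "'a eobj"
  define ok where "ok p \<longleftrightarrow> fst p \<in> ob (W_cat X) \<and> snd p \<in> fob ?G (fst p)" for p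
  \<comment> \<open>The greedy step: name \<open>n\<close> has to receive a meaning now if any
    extension of the present state can give it one. Each index is treated once, at its own
    stage.\<close>
  define nxt where "nxt n p q \<longleftrightarrow> (\<exists>i. state_extension X ?G (fst p) (snd p) (fst q) (snd q) i) \<and>
      ((\<exists>A \<tau> i. state_extension X ?G (fst p) (snd p) A \<tau> i \<and> filled n A) \<longrightarrow> filled n (fst q))" for n p q
  \<comment> \<open>The clause about index 0 pins the sequence to start at the given state, since
    dependent choice by itself does not fix the first value.\<close>
  have "\<exists>f. \<forall>n. (ok (f n) \<and> (n = 0 \<longrightarrow> f n = (U, \<sigma>))) \<and> nxt n (f n) (f (Suc n))"
  proof (rule dependent_nat_choice)
    show "\<exists>x. ok x \<and> ((0 :: nat) = 0 \<longrightarrow> x = (U, \<sigma>))" using assms(3,4) by (simp add: ok_def)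
    fix p and n :: nat assume p: "ok p \<and> (n = 0 \<longrightarrow> p = (U, \<sigma>))"
    show "\<exists>q. (ok q \<and> (Suc n = 0 \<longrightarrow> q = (U, \<sigma>))) \<and> nxt n p q"
    proof (cases "\<exists>A \<tau> i. state_extension X ?G (fst p) (snd p) A \<tau> i \<and> filled n A")
      case True
      then obtain A \<tau> i where A: "state_extension X ?G (fst p) (snd p) A \<tau> i" "filled n A" by blast
      have "ok (A, \<tau>)" using A(1) by (simp add: ok_def state_extension_def)
      moreover have "nxt n p (A, \<tau>)" unfolding nxt_def fst_conv snd_conv using A by blast
      ultimately show ?thesis by blast
    next
      case False
      have "state_extension X ?G (fst p) (snd p) (fst p) (snd p) (idn (E_cat X) (fst p))"
        by (rule state_extension_refl) (use p in \<open>simp_all add: ok_def\<close>)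
      then have "nxt n p p" unfolding nxt_def using False by blast
      then show ?thesis using p by blast
    qed
  qed
  then obtain f where f: "\<And>n. ok (f n)" "f 0 = (U, \<sigma>)" "\<And>n. nxt n (f n) (f (Suc n))" by blast
  define Us where "Us n = fst (f n)" for n
  define \<sigma>s where "\<sigma>s n = snd (f n)" for n
  have Us: "Us n \<in> ob (W_cat X)" and \<sigma>s: "\<sigma>s n \<in> fob ?G (Us n)" for n
    using f(1)[of n] by (simp_all add: ok_def Us_def \<sigma>s_def)
  have "\<forall>n. \<exists>i. state_extension X ?G (Us n) (\<sigma>s n) (Us (Suc n)) (\<sigma>s (Suc n)) i"
    using f(3) by (simp add: nxt_def Us_def \<sigma>s_def)
  then obtain \<iota> where \<iota>: "\<And>n. state_extension X ?G (Us n) (\<sigma>s n) (Us (Suc n)) (\<sigma>s (Suc n)) (\<iota> n)" by metis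
  obtain L \<tau> \<phi> where L: "\<And>n. state_extension X ?G (Us n) (\<sigma>s n) L \<tau> (\<phi> n)"
    using state_extension_colimit[where Us=Us and \<sigma>=\<sigma>s and \<iota>=\<iota>, OF Us \<sigma>s \<iota>] by blast
  have LW: "L \<in> ob (W_cat X)" using L[of 0] by (simp add: state_extension_def)
  have "maximal_state X ?G L \<tau>"
    unfolding maximal_state_def
  proof (intro notI)
    assume "\<exists>U' \<sigma>' i. strict_extension X ?G L \<tau> U' \<sigma>' i"
    then obtain U' \<sigma>' j where j: "state_extension X ?G L \<tau> U' \<sigma>' j" and ns: "\<not> nt_surj CC (whole L) (whole U') (snd j)"
      unfolding strict_extension_def by blast
    have U': "U' \<in> ob (W_cat X)" and jh: "j \<in> hom (W_cat X) L U'" using j by (simp_all add: state_extension_def)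
    note J = W_homD[OF W_obD(2)[OF LW] jh]
    \<comment> \<open>An element missed by the supposed strict extension; its name has some index
      \<open>n\<close> in the enumeration.\<close>
    obtain a e where a: "a \<in> ob CC" and e: "e \<in> fob (whole U') a" and ne: "e \<notin> snd j a ` fob (whole L) a"
      using ns nat_trans_in[OF J(3)] unfolding nt_surj_def by blast
    obtain p w where p: "p \<in> (SIGMA a:ob CC. fob X a)" and s: "slot X (whole U') (incl U') p w a e"
      using slot_total[OF W_obD(4)[OF U'] a e] by blast
    have "(p, w) \<in> ?S" using p by simp
    then obtain n where n: "sl n = (p, w)" using subsetD[OF sl] by (metis rangeE)
    have "filled n U'" unfolding filled_def n using s by auto
    \<comment> \<open>By transitivity \<open>U'\<close> also extends the state at stage
      \<open>n\<close>, so the greedy step had a witness for name \<open>n\<close>.\<close>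
    then have "filled n (Us (Suc n))"
      using state_extension_trans[OF Us L[of n] j] f(3)[of n] unfolding nxt_def Us_def \<sigma>s_def by blast
    then obtain a1 e1 where s1: "slot X (whole (Us (Suc n))) (incl (Us (Suc n))) p w a1 e1"
      unfolding filled_def n by auto
    have \<phi>h: "\<phi> (Suc n) \<in> hom (W_cat X) (Us (Suc n)) L" using L[of "Suc n"] by (simp add: state_extension_def)
    note P = W_homD[OF W_obD(2)[OF Us] \<phi>h]
    have s2: "slot X (whole L) (incl L) p w a1 (snd (\<phi> (Suc n)) a1 e1)"
      by (rule slot_map[OF W_obD(4)[OF Us] P(3,4) s1])
    have "slot X (whole U') (incl U') p w a1 (snd j a1 (snd (\<phi> (Suc n)) a1 e1))"
      by (rule slot_map[OF W_obD(4)[OF LW] J(3,4) s2])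
    \<comment> \<open>Carried along both maps, the meaning of the name at stage \<open>Suc n\<close>
      becomes its meaning in \<open>U'\<close>, which is \<open>e\<close>; so \<open>e\<close> lies
      in the image of \<open>L\<close> after all.\<close>
    then have "a1 = a" "snd j a1 (snd (\<phi> (Suc n)) a1 e1) = e"
      using slot_determ[OF W_obD(4)[OF U'] s] by blast+
    moreover have "snd (\<phi> (Suc n)) a1 e1 \<in> fob (whole L) a1" using slot_in[OF W_obD(4)[OF LW] s2] by blast
    ultimately show False using ne by blast
  qed
  moreover have "state_extension X ?G U \<sigma> L \<tau> (\<phi> 0)"
    using L[of 0] f(2) by (simp add: Us_def \<sigma>s_def)
  ultimately show ?thesis by blast
qed

end
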